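(* Let $d>0$ and $\alpha\in\mathbb{R}\setminus\mathbb{Z}$. There exists $a_0>0$ such that for every $a>0$ with $0<a/d<a_0$, the operator $H$ has no discrete spectrum: $\sigma_d(H)=\emptyset$. There exists $a_1>0$ such that for every $a>0$ with $a/d>a_1$, $\sigma_d(H)\neq\emptyset$.
   Context: Let $\Omega=\{(x,y,z)\in\mathbb{R}^2\times[0,d]:\ x^2+y^2>0\}$, $\gamma(a)=\{(x,y,0):x^2+y^2\le a^2\}$ (a disc window of radius $a$ in the plane $z=0$), $\Gamma=\partial(\mathbb{R}^2\times[0,d])\setminus\gamma(a)$, and $\mathbf{A}(x,y,z)=\alpha\left(\frac{y}{x^2+y^2},\frac{-x}{x^2+y^2},0\right)$ the Aharonov–Bohm vector potential (flux $2\pi\alpha$ through the $z$-axis). For $n\ge2$ let $\Omega_n=(B(0,n)\setminus B(0,1/n))\times[0,d]$, $\Gamma_n=\partial\Omega_n\setminus\gamma(a)$, and let $q$ be the form $q[u]=\int|(i\nabla+\mathbf{A})u|^2$ on $\bigcup_n\{u\in\mathrm{H}^1(\Omega_n):u|_{\Gamma_n}=0\}$ (functions extended by zero). $H$ is the self-adjoint operator in $\mathrm{L}^2(\Omega)$ associated with the closure of $q$; formally $H=(i\nabla+\mathbf{A})^2$ with Dirichlet condition on $\Gamma$ and magnetic Neumann condition $\nu\cdot(i\nabla+\mathbf{A})u=0$ on $\gamma(a)$. Its essential spectrum is $[(\pi/d)^2,\infty)$, and $\sigma_d(H)$ denotes its discrete spectrum (isolated eigenvalues of finite multiplicity). *)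

theory Defs
  imports "HOL-Analysis.Analysis"
begin

text \<open>Points of R^3 are triples (x,y,z); functions are complex valued and
  defined on all of R^3 (extended by zero outside the region of interest).
  Vector fields are indexed by j in {0,1,2}.\<close>

type_synonym pt = "real \<times> real \<times> real"
type_synonym fn = "pt \<Rightarrow> complex"
type_synonym vfn = "nat \<Rightarrow> fn"

definition Omega :: "real \<Rightarrow> pt set" where
  "Omega d = {(x,y,z). x\<^sup>2 + y\<^sup>2 > 0 \<and> 0 \<le> z \<and> z \<le> d}"

definition window :: "real \<Rightarrow> pt set" where
  "window a = {(x,y,z). z = 0 \<and> x\<^sup>2 + y\<^sup>2 \<le> a\<^sup>2}"

definition Omega_n :: "real \<Rightarrow> nat \<Rightarrow> pt set" where
  "Omega_n d n = {(x,y,z). (1 / real n)\<^sup>2 \<le> x\<^sup>2 + y\<^sup>2 \<and> x\<^sup>2 + y\<^sup>2 < (real n)\<^sup>2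
                     \<and> 0 \<le> z \<and> z \<le> d}"

text \<open>Aharonov--Bohm vector potential, component j.\<close>
definition Apot :: "real \<Rightarrow> nat \<Rightarrow> pt \<Rightarrow> real" where
  "Apot \<alpha> j p = (case p of (x,y,z) \<Rightarrow>
     (if j = 0 then \<alpha> * y / (x\<^sup>2 + y\<^sup>2) else if j = 1 then - \<alpha> * x / (x\<^sup>2 + y\<^sup>2) else 0))"

definition L2 :: "fn \<Rightarrow> bool" where
  "L2 u \<longleftrightarrow> u \<in> borel_measurable lborel \<and> integrable lborel (\<lambda>p. (cmod (u p))\<^sup>2)"

definition L2_Omega :: "real \<Rightarrow> fn \<Rightarrow> bool" where
  "L2_Omega d u \<longleftrightarrow> L2 u \<and> (AE p in lborel. p \<notin> Omega d \<longrightarrow> u p = 0)"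

definition L2norm :: "fn \<Rightarrow> real" where
  "L2norm u = sqrt (LINT p|lborel. (cmod (u p))\<^sup>2)"

definition L2inner :: "fn \<Rightarrow> fn \<Rightarrow> complex" where
  "L2inner u v = (LINT p|lborel. u p * cnj (v p))"

definition ev :: "nat \<Rightarrow> pt" where
  "ev j = (if j = 0 then (1,0,0) else if j = 1 then (0,1,0) else (0,0,1))"

definition pd :: "(pt \<Rightarrow> real) \<Rightarrow> nat \<Rightarrow> pt \<Rightarrow> real" where
  "pd \<phi> j p = frechet_derivative \<phi> (at p) (ev j)"

definition test_fn :: "pt set \<Rightarrow> (pt \<Rightarrow> real) \<Rightarrow> bool" where
  "test_fn U \<phi> \<longleftrightarrow> (\<forall>p. \<phi> differentiable (at p)) \<and> (\<forall>j<3. continuous_on UNIV (pd \<phi> j))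
     \<and> compact (closure {p. \<phi> p \<noteq> 0}) \<and> closure {p. \<phi> p \<noteq> 0} \<subseteq> U"

definition weak_grad :: "pt set \<Rightarrow> fn \<Rightarrow> vfn \<Rightarrow> bool" where
  "weak_grad U u g \<longleftrightarrow> (\<forall>j<3. L2 (g j) \<and>
     (\<forall>\<phi>. test_fn U \<phi> \<longrightarrow>
        (LINT p|lborel. u p * complex_of_real (pd \<phi> j p)) = - (LINT p|lborel. g j p * complex_of_real (\<phi> p))))"

text \<open>Core of the form: u vanishes outside Omega_n, u in H^1(Omega_n) with zero trace on
  Gamma_n.  The latter is expressed as: the zero extension of u lies in
  H^1(R^3 minus the closed window).  g is the gradient of u.\<close>
definition core :: "real \<Rightarrow> real \<Rightarrow> fn \<Rightarrow> vfn \<Rightarrow> bool" where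
  "core d a u g \<longleftrightarrow> (\<exists>n\<ge>2. (\<forall>p. p \<notin> Omega_n d n \<longrightarrow> u p = 0) \<and> L2 u
       \<and> weak_grad (UNIV - window a) u g)"

definition mgrad :: "real \<Rightarrow> fn \<Rightarrow> vfn \<Rightarrow> vfn" where
  "mgrad \<alpha> u g j p = \<i> * g j p + complex_of_real (Apot \<alpha> j p) * u p"

text \<open>Graph of the closure of the form: (u,w) with w = (i nabla + A) u in the closed
  form domain, obtained as L^2-limits of core elements.\<close>
definition Qgraph :: "real \<Rightarrow> real \<Rightarrow> real \<Rightarrow> (fn \<times> vfn) set" where
  "Qgraph d \<alpha> a = {(u, w). L2_Omega d u \<and> (\<forall>j<3. L2 (w j)) \<and>
     (\<exists>uk gk. (\<forall>k. core d a (uk k) (gk k)) \<and>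
        ((\<lambda>k. LINT p|lborel. (cmod (uk k p - u p))\<^sup>2) \<longlonglongrightarrow> 0) \<and>
        (\<forall>j<3. (\<lambda>k. LINT p|lborel. (cmod (mgrad \<alpha> (uk k) (gk k) j p - w j p))\<^sup>2) \<longlonglongrightarrow> 0))}"

text \<open>Graph of the associated self-adjoint operator H: H u = f.\<close>
definition Hrel :: "real \<Rightarrow> real \<Rightarrow> real \<Rightarrow> fn \<Rightarrow> fn \<Rightarrow> bool" where
  "Hrel d \<alpha> a u f \<longleftrightarrow> L2_Omega d f \<and> (\<exists>w. (u, w) \<in> Qgraph d \<alpha> a \<and>
     (\<forall>v w'. (v, w') \<in> Qgraph d \<alpha> a \<longrightarrow>
        (\<Sum>j<3. L2inner (w j) (w' j)) = L2inner f v))"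

definition resolvent_set :: "real \<Rightarrow> real \<Rightarrow> real \<Rightarrow> complex set" where
  "resolvent_set d \<alpha> a = {lam.
     (\<forall>f. L2_Omega d f \<longrightarrow> (\<exists>u. Hrel d \<alpha> a u (\<lambda>p. f p + lam * u p))) \<and>
     (\<exists>C. \<forall>u h. Hrel d \<alpha> a u h \<longrightarrow> L2norm u \<le> C * L2norm (\<lambda>p. h p - lam * u p))}"

definition spectrum_H :: "real \<Rightarrow> real \<Rightarrow> real \<Rightarrow> complex set" where
  "spectrum_H d \<alpha> a = - resolvent_set d \<alpha> a"

definition is_eigenvalue :: "real \<Rightarrow> real \<Rightarrow> real \<Rightarrow> complex \<Rightarrow> bool" where
  "is_eigenvalue d \<alpha> a lam \<longleftrightarrow>
     (\<exists>u. Hrel d \<alpha> a u (\<lambda>p. lam * u p) \<and> \<not> (AE p in lborel. u p = 0))"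

definition finite_mult :: "real \<Rightarrow> real \<Rightarrow> real \<Rightarrow> complex \<Rightarrow> bool" where
  "finite_mult d \<alpha> a lam \<longleftrightarrow> (\<exists>B. finite B \<and> (\<forall>b\<in>B. L2 b) \<and>
     (\<forall>u. Hrel d \<alpha> a u (\<lambda>p. lam * u p) \<longrightarrow>
        (\<exists>c. AE p in lborel. u p = (\<Sum>b\<in>B. c b * b p))))"

definition disc_spectrum :: "real \<Rightarrow> real \<Rightarrow> real \<Rightarrow> complex set" where
  "disc_spectrum d \<alpha> a = {lam \<in> spectrum_H d \<alpha> a.
     (\<exists>\<epsilon>>0. \<forall>\<mu>\<in>spectrum_H d \<alpha> a. \<mu> \<noteq> lam \<longrightarrow> \<epsilon> \<le> cmod (\<mu> - lam)) \<and>
     is_eigenvalue d \<alpha> a lam \<and> finite_mult d \<alpha> a lam}"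

end

theory Submission
  imports Defs
begin

text \<open>The closed form is represented by the closed subspace of all limits of pairs \<open>(u, (i \<nabla> + A) u)\<close>,
  and \<open>H\<close> is read off from this graph, so that closability is never needed. Put \<open>m = (\<pi> / d)\<^sup>2\<close>.

  Over the complement of the window, \<open>u\<close> vanishes on both faces of the slab and
  \<open>m \<integral>|u|\<^sup>2 \<le> \<integral>|\<partial>\<^sub>z u|\<^sup>2\<close>. Over the window, transport once around the \<open>z\<close>-axis multiplies by
  \<open>exp (-2 \<pi> i \<alpha>) \<noteq> 1\<close>, which gives a Hardy inequality
  \<open>c \<integral>|u|\<^sup>2 \<le> \<integral> r\<^sup>2 |(i \<nabla> + A) u|\<^sup>2\<close>. So the form is bounded below by \<open>m\<close> if \<open>m a\<^sup>2 \<le> c\<close>.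
  In a half space away from the axis \<open>A\<close> is a gradient; gauging it away there, wave packets
  show that \<open>[m, \<infinity>)\<close> lies in the spectrum, hence no eigenvalue is isolated.

  For large \<open>a / d\<close> the same gauge turns \<open>d - z\<close>, localised over the window, into a trial function with
  energy close to \<open>3 / d\<^sup>2 < m\<close>. Poincare's inequality on small boxes over the window shows that the form
  is bounded below by \<open>m\<close> up to finitely many directions, so its infimum is an isolated
  eigenvalue of finite multiplicity.\<close>

section \<open>Forms with finitely many directions below a threshold\<close>

text \<open>The vector potential is unbounded near the axis, so it is not evident that the form
  controls the plain gradient, to which Poincare's inequality applies. The Hardy inequality closes
  this gap too: with weight 1 / r^2 it bounds |A|^2 |u|^2 by the horizontal energy
  (\<open>gradient_bound\<close>). So it serves both halves of the theorem. Its constant is sin^2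
  (pi alpha) / pi^2, smaller than the optimal one, but only positivity matters; it yields the
  threshold |sin (pi alpha)| / pi^2 for small windows.

  Means over boxes replace a compact embedding: finitely many bounded numbers have a convergent
  subsequence, and the eigenvalue argument needs no other compactness.

  The energy 3 / d^2 is the Rayleigh quotient d / (d^3 / 3) of d - z. It lies below the threshold
  because pi^2 > 3, and the energy of the horizontal cut-off has to fit into the difference; this is
  where the bound 500 for a / d comes from.

  All Hilbert spaces are real, with the real part of the usual inner product. Multiplication by i is
  kept as a separate isometry, and a complex spectral parameter becomes a combination of it with the
  identity.\<close>

lemma parallelogram_law:
  fixes x y :: "'a::real_inner"
  shows "(norm (x + y))\<^sup>2 + (norm (x - y))\<^sup>2 = 2 * (norm x)\<^sup>2 + 2 * (norm y)\<^sup>2"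
  by (simp add: power2_norm_eq_inner algebra_simps inner_commute)

text \<open>The first-order condition at a minimum: for small \<open>s\<close> of sign opposite to
  \<open>a\<close> the linear term would win. Riesz representation and \<open>tform_null\<close>
  both end with it.\<close>

lemma quadratic_nonneg_linear_zero:
  fixes a b :: real
  assumes "\<And>s. 0 \<le> s * a + s\<^sup>2 * b"
  shows "a = 0"
proof (rule ccontr)
  assume "a \<noteq> 0"
  define B where "B = \<bar>b\<bar> + 1"
  have B: "B > 0" "b < B" unfolding B_def by auto
  have "0 \<le> (- a / B) * a + (- a / B)\<^sup>2 * b" by (rule assms)
  also have "\<dots> = (a\<^sup>2 / B) * (b / B - 1)"
    using B by (simp add: field_simps power2_eq_square)
  also have "\<dots> < 0"
    using B \<open>a \<noteq> 0\<close> by (intro mult_pos_neg) (auto simp: field_simps)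
  finally show False by simp
qed

text \<open>The functional \<open>J u = |u|^2 - 2 f u\<close> is bounded below, and the
  parallelogram law makes its minimising sequences Cauchy; the minimiser represents
  \<open>f\<close>. \<open>S\<close> is a set and not a type, because the form domain and the
  eigenspace both occur as subspaces of an ambient space.\<close>

lemma riesz_closed_subspace:
  fixes S :: "'a::{real_inner,complete_space} set"
  assumes "closed S" "subspace S" "bounded_linear f"
  shows "\<exists>u\<in>S. \<forall>v\<in>S. inner u v = f v"
proof -
  interpret f: bounded_linear f by fact
  obtain K where K: "\<And>x. \<bar>f x\<bar> \<le> norm x * K" "K \<ge> 0"
    using f.nonneg_bounded by (auto simp: real_norm_def)
  define J where "J = (\<lambda>u. (norm u)\<^sup>2 - 2 * f u)"
  have J_lower: "J u \<ge> - K\<^sup>2" for u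
  proof -
    have "0 \<le> (norm u - K)\<^sup>2" by simp
    then have "2 * (norm u * K) \<le> (norm u)\<^sup>2 + K\<^sup>2" by (simp add: power2_diff algebra_simps)
    moreover have "f u \<le> norm u * K" using K(1)[of u] by linarith
    ultimately show ?thesis unfolding J_def by linarith
  qed
  define I where "I = Inf (J ` S)"
  have S0: "0 \<in> S" using assms(2) subspace_0 by blast
  have bdd: "bdd_below (J ` S)" using J_lower by (auto intro!: bdd_belowI)
  have I_le: "I \<le> J u" if "u \<in> S" for u unfolding I_def using that bdd by (auto intro: cInf_lower)
  have "\<exists>u\<in>S. J u < I + 1 / (real n + 1)" for n
  proof -
    have "I < I + 1 / (real n + 1)" by simp
    then obtain y where "y \<in> J ` S" "y < I + 1 / (real n + 1)"
      unfolding I_def using S0 bdd by (metis cInf_lessD image_is_empty empty_iff)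
    then show ?thesis by auto
  qed
  then obtain u where u: "\<And>n. u n \<in> S" "\<And>n. J (u n) < I + 1 / (real n + 1)" by metis
  \<comment> \<open>The parallelogram law in terms of \<open>J\<close>. Two nearly minimal points
    are close, since \<open>J\<close> at their midpoint is not below the infimum.\<close>
  have par: "(norm (x - y))\<^sup>2 = 2 * J x + 2 * J y - 4 * J ((1/2) *\<^sub>R (x + y))" for x y
  proof -
    have "(norm ((1/2) *\<^sub>R (x + y)))\<^sup>2 = (norm (x + y))\<^sup>2 / 4"
      by (simp add: power_divide del: scaleR_add_right)
    moreover have "f ((1/2) *\<^sub>R (x + y)) = (f x + f y) / 2" by (simp add: f.add f.scaleR)
    ultimately show ?thesis unfolding J_def using parallelogram_law[of x y] by simp
  qed
  have close: "(norm (u n - u k))\<^sup>2 \<le> 2 / (real n + 1) + 2 / (real k + 1)" for n k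
  proof -
    have "(1/2) *\<^sub>R (u n + u k) \<in> S" using assms(2) u(1) by (intro subspace_scale subspace_add)
    then show ?thesis using par[of "u n" "u k"] I_le u(2)[of n] u(2)[of k] by force
  qed
  have "Cauchy u"
  proof (rule metric_CauchyI)
    fix e :: real assume e: "e > 0"
    obtain M where M: "real M > 4 / e\<^sup>2" using reals_Archimedean2 by blast
    have Mp: "real M > 0" using M e by (smt (verit) zero_less_divide_iff zero_less_power)
    show "\<exists>M. \<forall>m\<ge>M. \<forall>n\<ge>M. dist (u m) (u n) < e"
    proof (intro exI allI impI)
      fix n k assume nk: "n \<ge> M" "k \<ge> M"
      have "2 / (real n + 1) \<le> 2 / real M" "2 / (real k + 1) \<le> 2 / real M"
        using nk Mp by (auto intro!: divide_left_mono)
      then have "(norm (u n - u k))\<^sup>2 \<le> 4 / real M" using close[of n k] by simp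
      also have "\<dots> < e\<^sup>2" using M e Mp by (simp add: field_simps)
      finally show "dist (u n) (u k) < e" using e by (simp add: dist_norm power_less_imp_less_base)
    qed
  qed
  then obtain x where x: "u \<longlonglongrightarrow> x" using Cauchy_convergent_iff convergent_def by blast
  have xS: "x \<in> S" using assms(1) u(1) x closed_sequentially by blast
  have "(\<lambda>n. J (u n)) \<longlonglongrightarrow> J x"
    unfolding J_def by (intro tendsto_intros x f.tendsto)
  moreover have "(\<lambda>n. I + 1 / (real n + 1)) \<longlonglongrightarrow> I + 0"
    by (intro tendsto_intros) (use LIMSEQ_inverse_real_of_nat in \<open>simp add: inverse_eq_divide add.commute\<close>)
  ultimately have "J x \<le> I + 0"
    by (rule LIMSEQ_le) (use u(2) less_imp_le in blast)
  then have Jx: "J x \<le> J y" if "y \<in> S" for y using I_le[OF that] by simp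
  have "inner x v = f v" if v: "v \<in> S" for v
  proof -
    have "0 \<le> s * (2 * (inner x v - f v)) + s\<^sup>2 * (norm v)\<^sup>2" for s
    proof -
      have "x + s *\<^sub>R v \<in> S" using assms(2) xS v by (intro subspace_scale subspace_add)
      then have "J x \<le> J (x + s *\<^sub>R v)" by (rule Jx)
      then show ?thesis
        unfolding J_def power2_norm_eq_inner
        by (simp add: f.add f.scaleR algebra_simps inner_commute power2_eq_square)
    qed
    from quadratic_nonneg_linear_zero[OF this] show ?thesis by simp
  qed
  then show ?thesis using xS by blast
qed

text \<open>The forms to be solved are shifted by a complex number, so as real forms they are not
  symmetric and Riesz alone does not apply. The equation \<open>A u = F\<close> becomes the fixed
  point equation of a contraction.\<close>

lemma lax_milgram_closed_subspace:
  fixes S :: "'a::{real_inner,complete_space} set"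
  assumes S: "closed S" "subspace S" and f: "bounded_linear f"
    and a: "bounded_bilinear a"
    and c: "c > 0" "\<And>u. u \<in> S \<Longrightarrow> c * (norm u)\<^sup>2 \<le> a u u"
  shows "\<exists>u\<in>S. \<forall>v\<in>S. a u v = f v"
proof -
  interpret a: bounded_bilinear a by fact
  obtain C0 where C0: "C0 > 0" "\<And>x y. norm (a x y) \<le> norm x * norm y * C0"
    using a.pos_bounded by blast
  \<comment> \<open>Enlarging the bound to at least \<open>c\<close> keeps the contraction factor
    \<open>1 - (c / C)^2\<close> nonnegative, so that its square root can be used.\<close>
  define C where "C = max C0 c"
  have C: "C > 0" "c \<le> C" using C0(1) by (auto simp: C_def)
  have C3: "norm (a x y) \<le> norm x * norm y * C" for x y
    by (rule order_trans[OF C0(2)]) (auto simp: C_def intro!: mult_left_mono)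
  have "\<exists>w\<in>S. \<forall>v\<in>S. inner w v = a u v" for u
    by (rule riesz_closed_subspace[OF S]) (rule a.bounded_linear_right)
  then obtain A where A: "\<And>u. A u \<in> S" "\<And>u v. v \<in> S \<Longrightarrow> inner (A u) v = a u v" by metis
  obtain F where F: "F \<in> S" "\<And>v. v \<in> S \<Longrightarrow> inner F v = f v"
    using riesz_closed_subspace[OF S f] by blast
  have uniq: "x = y" if "x \<in> S" "y \<in> S" "\<And>v. v \<in> S \<Longrightarrow> inner x v = inner y v" for x y
    using that(3)[of "x - y"] subspace_diff[OF S(2) that(1,2)]
    by (metis inner_diff_left inner_eq_zero_iff right_minus_eq)
  have A_diff: "A (u - v) = A u - A v" for u v
    by (rule uniq) (auto intro: A subspace_diff[OF S(2)] simp: A inner_diff_left a.diff_left)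
  have A_le: "norm (A u) \<le> C * norm u" for u
  proof (cases "A u = 0")
    case False
    have "(norm (A u))\<^sup>2 = a u (A u)" using A by (simp add: power2_norm_eq_inner)
    also have "\<dots> \<le> norm u * norm (A u) * C" using C3[of u "A u"] by simp
    finally show ?thesis using False by (simp add: power2_eq_square mult.commute mult.left_commute)
  qed (use C in simp)
  \<comment> \<open>This step size minimises
    \<open>1 - 2 * \<rho> * c + \<rho>^2 * C^2\<close>.\<close>
  define \<rho> where "\<rho> = c / C\<^sup>2"
  have \<rho>: "\<rho> > 0" unfolding \<rho>_def using c C(1) by simp
  define \<kappa> where "\<kappa> = 1 - 2 * \<rho> * c + \<rho>\<^sup>2 * C\<^sup>2"
  have \<kappa>_eq: "\<kappa> = 1 - (c / C)\<^sup>2"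
    unfolding \<kappa>_def \<rho>_def using C(1) by (simp add: field_simps power2_eq_square)
  have "c / C \<le> 1" "c / C > 0" using c C by auto
  then have \<kappa>1: "\<kappa> < 1" and \<kappa>0: "\<kappa> \<ge> 0"
    unfolding \<kappa>_eq using power_le_one[of "c / C" 2] by auto
  define T where "T = (\<lambda>u. u - \<rho> *\<^sub>R (A u - F))"
  have "\<exists>!x\<in>S. T x = x"
  proof (rule Banach_fix)
    show "complete S" using S(1) complete_eq_closed by blast
    show "S \<noteq> {}" using F by blast
    show "0 \<le> sqrt \<kappa>" "sqrt \<kappa> < 1" using \<kappa>0 \<kappa>1 by auto
    show "T ` S \<subseteq> S" unfolding T_def
      using A F S(2) by (auto intro!: subspace_diff subspace_scale)
    fix x y assume xy: "x \<in> S" "y \<in> S"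
    have e: "x - y \<in> S" using xy S(2) by (intro subspace_diff)
    have "(norm (T x - T y))\<^sup>2 = (norm ((x - y) - \<rho> *\<^sub>R A (x - y)))\<^sup>2"
      unfolding T_def A_diff by (simp add: algebra_simps)
    also have "\<dots> = (norm (x - y))\<^sup>2 - 2 * \<rho> * a (x - y) (x - y) + \<rho>\<^sup>2 * (norm (A (x - y)))\<^sup>2"
      unfolding power2_norm_eq_inner
      using A(2)[OF e, of "x - y"] by (simp add: inner_diff_left inner_diff_right inner_commute power2_eq_square algebra_simps)
    also have "\<dots> \<le> (norm (x - y))\<^sup>2 - 2 * \<rho> * (c * (norm (x - y))\<^sup>2) + \<rho>\<^sup>2 * (C * norm (x - y))\<^sup>2"
      using c(2)[OF e] \<rho> A_le[of "x - y"]
      by (intro add_mono diff_mono mult_left_mono power_mono) auto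
    also have "\<dots> = \<kappa> * (norm (x - y))\<^sup>2" unfolding \<kappa>_def by (simp add: algebra_simps power_mult_distrib)
    finally show "dist (T x) (T y) \<le> sqrt \<kappa> * dist x y"
      by (metis dist_norm norm_ge_zero real_le_rsqrt real_sqrt_mult real_sqrt_unique)
  qed
  then obtain u where u: "u \<in> S" "T u = u" by blast
  then have "A u = F" unfolding T_def using \<rho> by simp
  then show ?thesis using u A(2) F(2) by metis
qed

section \<open>Compactness and finite dimension from finitely many functionals\<close>

lemma Cauchy_squareI:
  fixes X :: "nat \<Rightarrow> 'a::metric_space"
  assumes "\<And>k l. (dist (X k) (X l))\<^sup>2 \<le> G (k, l)" "(G \<longlongrightarrow> 0) (sequentially \<times>\<^sub>F sequentially)"
  shows "Cauchy X"
proof (rule metric_CauchyI)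
  fix e :: real assume e: "e > 0"
  have "\<forall>\<^sub>F p in sequentially \<times>\<^sub>F sequentially. G p < e\<^sup>2"
    using order_tendstoD(2)[OF assms(2), of "e\<^sup>2"] e by simp
  then obtain N where "\<forall>m\<ge>N. \<forall>n\<ge>N. G (n, m) < e\<^sup>2"
    unfolding eventually_prod_sequentially by blast
  then have "(dist (X n) (X m))\<^sup>2 < e\<^sup>2" if "n \<ge> N" "m \<ge> N" for n m
    using that assms(1)[of n m] by force
  then show "\<exists>M. \<forall>m\<ge>M. \<forall>n\<ge>M. dist (X m) (X n) < e"
    using e by (meson less_imp_le power_less_imp_less_base)
qed

text \<open>Bolzano-Weierstrass for finitely many sequences at once, by successive thinning. It
  takes the place of a compact embedding.\<close>

lemma finite_family_convergent_subseq:
  fixes f :: "'i \<Rightarrow> nat \<Rightarrow> real"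
  assumes "finite I" "\<And>i. i \<in> I \<Longrightarrow> bounded (range (f i))"
  shows "\<exists>r. strict_mono r \<and> (\<forall>i\<in>I. convergent (\<lambda>n. f i (r n)))"
  using assms
proof (induction I)
  case empty
  then show ?case using strict_mono_id by blast
next
  case (insert i I)
  then obtain r where r: "strict_mono r" "\<forall>i\<in>I. convergent (\<lambda>n. f i (r n))" by auto
  have "bounded (range (\<lambda>n. f i (r n)))"
    using insert.prems[of i] by (auto intro: bounded_subset)
  then obtain l s where s: "strict_mono s" "((\<lambda>n. f i (r n)) \<circ> s) \<longlonglongrightarrow> l"
    using bounded_imp_convergent_subsequence by blast
  have "convergent (\<lambda>n. f i' (r (s n)))" if "i' \<in> I" for i'
    using convergent_subseq_convergent[OF bspec[OF r(2) that] s(1)] by (simp add: o_def)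
  then show ?case using s r
    by (intro exI[of _ "r \<circ> s"] conjI strict_mono_o) (auto simp: o_def convergent_def)
qed

text \<open>Passing to the kernel of one functional costs at most one dimension, and the common
  kernel is zero.\<close>

lemma finite_span_of_separating_functionals:
  fixes E :: "'a::real_vector set" and l :: "'i \<Rightarrow> 'a \<Rightarrow> real"
  assumes "finite I" "subspace E" "\<And>i. i \<in> I \<Longrightarrow> linear (l i)"
    "\<And>u. u \<in> E \<Longrightarrow> \<forall>i\<in>I. l i u = 0 \<Longrightarrow> u = 0"
  shows "\<exists>B. finite B \<and> E \<subseteq> span B"
  using assms
proof (induction I arbitrary: E)
  case empty
  then show ?case by (intro exI[of _ "{}"]) auto
next
  case (insert i I)
  define E' where "E' = {u \<in> E. l i u = 0}"
  have lin: "linear (l i)" using insert by blast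
  have "subspace E'"
    unfolding E'_def subspace_def using insert.prems(1) lin
    by (auto simp: subspace_0 subspace_add subspace_scale linear_0 linear_add linear_scale)
  then have "\<exists>B. finite B \<and> E' \<subseteq> span B"
    by (rule insert.IH) (use insert.prems in \<open>auto simp: E'_def\<close>)
  then obtain B where B: "finite B" "E' \<subseteq> span B" by blast
  show ?case
  proof (cases "E \<subseteq> E'")
    case False
    then obtain e where e: "e \<in> E" "l i e \<noteq> 0" unfolding E'_def by auto
    have "u \<in> span (insert e B)" if u: "u \<in> E" for u
    proof -
      have "u - (l i u / l i e) *\<^sub>R e \<in> E'"
        unfolding E'_def using e u insert.prems(1) lin
        by (auto simp: subspace_diff subspace_scale linear_diff linear_scale)
      then show ?thesis using B(2) unfolding span_insert by auto
    qed
    then show ?thesis using B by (intro exI[of _ "insert e B"]) auto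
  qed (use B in blast)
qed

text \<open>A closed nonnegative quadratic form is given here by the graph \<open>D\<close> of a closed linear relation
  \<open>u \<mapsto> w\<close>, with \<open>q[u] = \<parallel>w\<parallel>\<^sup>2\<close>; complex multiplication on the real Hilbert spaces is
  carried by \<open>J\<close>.\<close>

locale form_relation =
  fixes D :: "('h::{real_inner,complete_space} \<times> 'k::{real_inner,complete_space}) set"
    and J :: "'h \<Rightarrow> 'h" and J' :: "'k \<Rightarrow> 'k"
    and m K :: real and I :: "'i set" and b :: "'i \<Rightarrow> 'h"
  assumes closed_D: "closed D" and subspace_D: "subspace D"
    and linear_J: "linear J" and J_J: "\<And>x. J (J x) = - x" and inner_J: "\<And>x y. inner (J x) (J y) = inner x y"
    and norm_J': "\<And>x. norm (J' x) = norm x"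
    and D_J: "\<And>u w. (u, w) \<in> D \<Longrightarrow> (J u, J' w) \<in> D"
    and finite_I: "finite I" and K_nonneg: "K \<ge> 0"
    and semibound: "\<And>u w. (u, w) \<in> D \<Longrightarrow> m * (norm u)\<^sup>2 \<le> (norm w)\<^sup>2 + K * (\<Sum>i\<in>I. (inner u (b i))\<^sup>2)"
    and below: "\<exists>u w. (u, w) \<in> D \<and> (norm w)\<^sup>2 < m * (norm u)\<^sup>2"
begin

section \<open>Bottom of the form and its eigenspace\<close>

definition lam :: real where
  "lam = Inf {(norm w)\<^sup>2 | u w. (u, w) \<in> D \<and> norm u = 1}"

text \<open>The polarised form of \<open>H - lam\<close>. Because \<open>lam\<close> is the infimum
  of the Rayleigh quotient, it is nonnegative on the diagonal.\<close>

definition tform :: "'h \<times> 'k \<Rightarrow> 'h \<times> 'k \<Rightarrow> real" where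
  "tform z v = inner (snd z) (snd v) - lam * inner (fst z) (fst v)"

lemma D_scale: "z \<in> D \<Longrightarrow> c *\<^sub>R z \<in> D" and D_add: "z \<in> D \<Longrightarrow> v \<in> D \<Longrightarrow> z + v \<in> D"
  and D_diff: "z \<in> D \<Longrightarrow> v \<in> D \<Longrightarrow> z - v \<in> D"
  using subspace_D by (auto intro: subspace_scale subspace_add subspace_diff)

lemma tform_simps:
  "tform (z + z') v = tform z v + tform z' v" "tform (z - z') v = tform z v - tform z' v"
  "tform z (v + v') = tform z v + tform z v'" "tform z (v - v') = tform z v - tform z v'"
  "tform (c *\<^sub>R z) v = c * tform z v" "tform z (c *\<^sub>R v) = c * tform z v"
  unfolding tform_def by (simp_all add: algebra_simps inner_left_distrib inner_right_distrib)

lemma tform_commute: "tform z v = tform v z"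
  unfolding tform_def by (simp add: inner_commute)

lemma tform_self: "tform z z = (norm (snd z))\<^sup>2 - lam * (norm (fst z))\<^sup>2"
  unfolding tform_def by (simp add: power2_norm_eq_inner)

lemma lam_bounds:
  shows lam_nonneg: "lam \<ge> 0" and lam_less: "lam < m"
    and lam_le: "(u, w) \<in> D \<Longrightarrow> lam * (norm u)\<^sup>2 \<le> (norm w)\<^sup>2"
proof -
  let ?A = "{(norm w)\<^sup>2 | u w. (u, w) \<in> D \<and> norm u = 1}"
  have bdd: "bdd_below ?A" by (rule bdd_belowI[of _ 0]) auto
  have unit: "(norm w)\<^sup>2 / (norm u)\<^sup>2 \<in> ?A" if "(u, w) \<in> D" "u \<noteq> 0" for u w
    using that D_scale[OF that(1), of "1 / norm u"]
    by (intro CollectI exI[of _ "(1 / norm u) *\<^sub>R u"] exI[of _ "(1 / norm u) *\<^sub>R w"]) (auto simp: power_divide)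
  obtain u w where uw: "(u, w) \<in> D" "(norm w)\<^sup>2 < m * (norm u)\<^sup>2" using below by blast
  then have "u \<noteq> 0" by auto
  then have "lam \<le> (norm w)\<^sup>2 / (norm u)\<^sup>2"
    unfolding lam_def using unit[OF uw(1)] bdd by (intro cInf_lower)
  also have "\<dots> < m" using uw \<open>u \<noteq> 0\<close> by (simp add: field_simps)
  finally show "lam < m" .
  show "lam \<ge> 0" unfolding lam_def using unit[OF uw(1) \<open>u \<noteq> 0\<close>] by (intro cInf_greatest) auto
  show "lam * (norm u)\<^sup>2 \<le> (norm w)\<^sup>2" if "(u, w) \<in> D" for u w
  proof (cases "u = 0")
    case False
    then have "lam \<le> (norm w)\<^sup>2 / (norm u)\<^sup>2"
      unfolding lam_def using unit[OF that] bdd by (intro cInf_lower)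
    then show ?thesis using False by (simp add: field_simps)
  qed simp
qed

lemma tform_nonneg: "z \<in> D \<Longrightarrow> 0 \<le> tform z z"
  using lam_le[of "fst z" "snd z"] by (simp add: tform_self)

text \<open>A null vector of a nonnegative form minimises it, so its derivative in every direction
  \<open>v\<close> vanishes.\<close>

lemma tform_null: "z \<in> D \<Longrightarrow> tform z z = 0 \<Longrightarrow> v \<in> D \<Longrightarrow> tform z v = 0"
proof -
  assume z: "z \<in> D" "tform z z = 0" "v \<in> D"
  have "0 \<le> s * (2 * tform z v) + s\<^sup>2 * tform v v" for s
    using tform_nonneg[OF D_add[OF z(1) D_scale[OF z(3), of s]]] z(2)
    by (simp add: tform_simps tform_commute[of v z] power2_eq_square algebra_simps)
  from quadratic_nonneg_linear_zero[OF this] show ?thesis by simp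
qed

text \<open>The only compactness argument. Along a subsequence the finitely many functionals
  converge. On differences, \<open>semibound\<close> then bounds \<open>(m - lam) |u|^2\<close> by
  \<open>tform\<close> and a null sequence, and \<open>tform\<close> of a difference tends to zero
  as well. So the subsequence converges in norm, in both components.\<close>

lemma tform_compact:
  assumes z: "\<And>k. z k \<in> D" and bdd: "\<And>k. norm (fst (z k)) \<le> 1"
    and lim: "(\<lambda>k. tform (z k) (z k)) \<longlonglongrightarrow> 0"
  shows "\<exists>r x. strict_mono r \<and> (z \<circ> r) \<longlonglongrightarrow> x \<and> x \<in> D \<and> tform x x = 0"
proof -
  let ?f = "\<lambda>i k. inner (fst (z k)) (b i)"
  have "bounded (range (?f i))" for i
  proof (rule boundedI)
    fix x assume "x \<in> range (?f i)"
    then obtain k where k: "x = ?f i k" by blast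
    have "norm x \<le> norm (fst (z k)) * norm (b i)" unfolding k by (simp add: Cauchy_Schwarz_ineq2)
    also have "\<dots> \<le> 1 * norm (b i)" using bdd by (intro mult_right_mono) auto
    finally show "norm x \<le> 1 * norm (b i)" .
  qed
  then obtain r where r: "strict_mono r" "\<forall>i\<in>I. convergent (\<lambda>n. ?f i (r n))"
    using finite_family_convergent_subseq[OF finite_I, of ?f] by blast
  then obtain l where l: "\<And>i. i \<in> I \<Longrightarrow> (\<lambda>n. ?f i (r n)) \<longlonglongrightarrow> l i"
    unfolding convergent_def by metis
  define y where "y = z \<circ> r"
  have yD: "y k \<in> D" for k unfolding y_def using z by simp
  have limy: "(\<lambda>k. tform (y k) (y k)) \<longlonglongrightarrow> 0"
    using LIMSEQ_subseq_LIMSEQ[OF lim r(1)] by (simp add: y_def o_def)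
  have fst_lim: "filterlim fst sequentially (sequentially \<times>\<^sub>F sequentially)"
    and snd_lim: "filterlim snd sequentially (sequentially \<times>\<^sub>F sequentially)"
    by (rule filterlim_fst filterlim_snd)+
  define G0 where "G0 = (\<lambda>p. 2 * tform (y (fst p)) (y (fst p)) + 2 * tform (y (snd p)) (y (snd p)))"
  define G where "G = (\<lambda>p. (G0 p + K * (\<Sum>i\<in>I. (?f i (r (fst p)) - ?f i (r (snd p)))\<^sup>2)) / (m - lam))"
  have G0_lim: "(G0 \<longlongrightarrow> 2 * 0 + 2 * 0) (sequentially \<times>\<^sub>F sequentially)"
    unfolding G0_def
    by (intro tendsto_intros filterlim_compose[OF limy fst_lim] filterlim_compose[OF limy snd_lim])
  have "(G \<longlongrightarrow> (2 * 0 + 2 * 0 + K * (\<Sum>i\<in>I. (l i - l i)\<^sup>2)) / (m - lam)) (sequentially \<times>\<^sub>F sequentially)"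
    unfolding G_def using lam_less
    by (intro tendsto_intros G0_lim filterlim_compose[OF l fst_lim] filterlim_compose[OF l snd_lim]) auto
  then have G_lim: "(G \<longlongrightarrow> 0) (sequentially \<times>\<^sub>F sequentially)" by simp
  \<comment> \<open>Parallelogram identity for \<open>tform\<close>; the term of the sum is dropped
    because it is nonnegative.\<close>
  have t_diff: "tform (y k - y n) (y k - y n) \<le> G0 (k, n)" for k n
    using tform_nonneg[OF D_add[OF yD yD], of k n] unfolding G0_def
    by (simp add: tform_simps tform_commute)
  have u_diff: "(dist (fst (y k)) (fst (y n)))\<^sup>2 \<le> G (k, n)" for k n
  proof -
    have "m * (norm (fst (y k - y n)))\<^sup>2 \<le> (norm (snd (y k - y n)))\<^sup>2 + K * (\<Sum>i\<in>I. (inner (fst (y k - y n)) (b i))\<^sup>2)"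
      using D_diff[OF yD yD] by (intro semibound) (simp del: fst_diff snd_diff)
    then have "(m - lam) * (norm (fst (y k - y n)))\<^sup>2 \<le> tform (y k - y n) (y k - y n) + K * (\<Sum>i\<in>I. (inner (fst (y k - y n)) (b i))\<^sup>2)"
      by (simp add: tform_self algebra_simps)
    also have "\<dots> \<le> G0 (k, n) + K * (\<Sum>i\<in>I. (?f i (r k) - ?f i (r n))\<^sup>2)"
      using t_diff by (simp add: y_def inner_diff_left)
    finally show ?thesis unfolding G_def using lam_less by (simp add: dist_norm field_simps)
  qed
  have "Cauchy (\<lambda>k. fst (y k))" by (rule Cauchy_squareI[OF u_diff G_lim])
  then obtain u where u: "(\<lambda>k. fst (y k)) \<longlonglongrightarrow> u" using Cauchy_convergent_iff convergent_def by blast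
  \<comment> \<open>On a difference \<open>|w|^2 = tform + lam |u|^2\<close>, so the second
    components are Cauchy as well.\<close>
  have "(dist (snd (y k)) (snd (y n)))\<^sup>2 \<le> (\<lambda>p. G0 p + lam * G p) (k, n)" for k n
    using t_diff[of k n] mult_left_mono[OF u_diff[of k n] lam_nonneg] by (simp add: tform_self dist_norm)
  moreover have "((\<lambda>p. G0 p + lam * G p) \<longlongrightarrow> 2 * 0 + 2 * 0 + lam * 0) (sequentially \<times>\<^sub>F sequentially)"
    by (intro tendsto_intros G0_lim G_lim)
  ultimately have "Cauchy (\<lambda>k. snd (y k))" by (intro Cauchy_squareI) auto
  then obtain w where w: "(\<lambda>k. snd (y k)) \<longlonglongrightarrow> w" using Cauchy_convergent_iff convergent_def by blast
  have yx: "y \<longlonglongrightarrow> (u, w)" using tendsto_Pair[OF u w] by simp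
  have "(u, w) \<in> D" using closed_D yD yx closed_sequentially by blast
  moreover have "(\<lambda>k. tform (y k) (y k)) \<longlonglongrightarrow> tform (u, w) (u, w)"
    unfolding tform_def by (intro tendsto_intros yx)
  then have "tform (u, w) (u, w) = 0" using limy LIMSEQ_unique by blast
  ultimately show ?thesis using r yx unfolding y_def by blast
qed

text \<open>Eigenvectors for \<open>lam\<close> as elements of the graph. Null vectors of
  \<open>tform\<close> are the same as weak solutions (\<open>Et_iff\<close>), and the null
  condition is what \<open>tform_compact\<close> delivers.\<close>

definition Et :: "('h \<times> 'k) set" where "Et = {z \<in> D. tform z z = 0}"
definition Eig :: "'h set" where "Eig = fst ` Et"

lemma Et_iff: "z \<in> Et \<longleftrightarrow> z \<in> D \<and> (\<forall>v\<in>D. tform z v = 0)"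
  unfolding Et_def using tform_null by blast

lemma subspace_Et: "subspace Et"
proof -
  have "tform 0 v = 0" for v by (simp add: tform_def)
  then show ?thesis
    unfolding subspace_def Ball_def Et_iff
    using subspace_0[OF subspace_D] D_add D_scale by (simp add: tform_simps)
qed

lemma subspace_Eig: "subspace Eig"
  unfolding Eig_def by (intro linear_subspace_image subspace_Et linear_fst)

lemma Et_J: "(u, w) \<in> Et \<Longrightarrow> (J u, J' w) \<in> Et"
proof -
  have "norm (J u) = norm u" by (simp add: norm_eq_sqrt_inner inner_J)
  then show "(u, w) \<in> Et \<Longrightarrow> (J u, J' w) \<in> Et"
    unfolding Et_def by (auto simp: tform_self D_J norm_J')
qed

lemma Eig_J: "e \<in> Eig \<Longrightarrow> J e \<in> Eig"
  unfolding Eig_def using Et_J by force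

text \<open>A convergent sequence in \<open>Eig\<close> lifts to null vectors of
  \<open>tform\<close>, to which \<open>tform_compact\<close> applies; the factor
  \<open>1 / M\<close> brings them into the unit ball.\<close>

lemma closed_Eig: "closed Eig"
  unfolding closed_sequential_limits
proof (intro allI impI, elim conjE)
  fix x l assume x: "\<forall>n. x n \<in> Eig" and lim: "x \<longlonglongrightarrow> l"
  then have "\<forall>n. \<exists>z\<in>Et. x n = fst z" unfolding Eig_def by blast
  then obtain z where z: "\<And>n. z n \<in> Et" "\<And>n. x n = fst (z n)" by metis
  obtain M where M: "M > 0" "\<And>n. norm (x n) \<le> M"
    using convergent_imp_bounded[OF lim] by (auto simp: bounded_pos)
  define y where "y = (\<lambda>n. (1 / M) *\<^sub>R z n)"
  have y: "y n \<in> Et" for n unfolding y_def using z subspace_Et by (intro subspace_scale)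
  have "\<exists>r v. strict_mono r \<and> (y \<circ> r) \<longlonglongrightarrow> v \<and> v \<in> D \<and> tform v v = 0"
    using y z M by (intro tform_compact) (auto simp: Et_def y_def)
  then obtain r v where r: "strict_mono r" "(y \<circ> r) \<longlonglongrightarrow> v" "v \<in> Et" unfolding Et_def by blast
  have "(\<lambda>n. M *\<^sub>R fst ((y \<circ> r) n)) \<longlonglongrightarrow> M *\<^sub>R fst v" by (intro tendsto_intros r)
  moreover have "(\<lambda>n. M *\<^sub>R fst ((y \<circ> r) n)) = x \<circ> r" using M by (auto simp: y_def z o_def)
  ultimately have "l = M *\<^sub>R fst v" using LIMSEQ_subseq_LIMSEQ[OF lim r(1)] LIMSEQ_unique by metis
  moreover have "fst v \<in> Eig" using r(3) by (simp add: Eig_def)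
  ultimately show "l \<in> Eig" using subspace_Eig by (simp add: subspace_scale)
qed

text \<open>The functionals of \<open>semibound\<close> separate the eigenspace: where all of them
  vanish, an eigenvector satisfies \<open>m |u|^2 <= lam |u|^2\<close>, while
  \<open>lam < m\<close>.\<close>

lemma Eig_finite_dim: "\<exists>B. finite B \<and> Eig \<subseteq> span B"
proof (rule finite_span_of_separating_functionals[OF finite_I subspace_Eig])
  show "linear (\<lambda>u. inner u (b i))" for i
    by (auto intro!: linearI simp: inner_left_distrib)
  fix u assume u: "u \<in> Eig" "\<forall>i\<in>I. inner u (b i) = 0"
  then obtain w where w: "(u, w) \<in> Et" unfolding Eig_def by auto
  then have "m * (norm u)\<^sup>2 \<le> lam * (norm u)\<^sup>2"
    using semibound[of u w] u(2) by (auto simp: Et_def tform_self)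
  then show "u = 0" using lam_less
    by (cases "u = 0") (auto simp: mult_le_cancel_right)
qed

text \<open>A minimising sequence of unit vectors has a subsequence that converges in norm, so the
  limit is still a unit vector.\<close>

lemma Eig_nontrivial: "\<exists>u w. (u, w) \<in> Et \<and> u \<noteq> 0"
proof -
  let ?A = "{(norm w)\<^sup>2 | u w. (u, w) \<in> D \<and> norm u = 1}"
  obtain u w where uw: "(u, w) \<in> D" "(norm w)\<^sup>2 < m * (norm u)\<^sup>2" using below by blast
  then have "u \<noteq> 0" by auto
  then have "(norm ((1 / norm u) *\<^sub>R w))\<^sup>2 \<in> ?A"
    using D_scale[OF uw(1), of "1 / norm u"]
    by (intro CollectI exI[of _ "(1 / norm u) *\<^sub>R u"] exI[of _ "(1 / norm u) *\<^sub>R w"]) auto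
  then have ne: "?A \<noteq> {}" by blast
  have bdd: "bdd_below ?A" by (rule bdd_belowI[of _ 0]) auto
  have "\<exists>z\<in>D. norm (fst z) = 1 \<and> (norm (snd z))\<^sup>2 < lam + 1 / real (Suc n)" for n
  proof -
    have "Inf ?A < lam + 1 / real (Suc n)" by (simp add: lam_def)
    then obtain y where y: "y \<in> ?A" "y < lam + 1 / real (Suc n)"
      using cInf_lessD[OF ne] by blast
    then obtain u w where "(u, w) \<in> D" "norm u = 1" "y = (norm w)\<^sup>2" by blast
    then show ?thesis using y by (intro bexI[of _ "(u, w)"]) auto
  qed
  then obtain z where z: "\<And>n. z n \<in> D" "\<And>n. norm (fst (z n)) = 1"
      "\<And>n. (norm (snd (z n)))\<^sup>2 < lam + 1 / real (Suc n)" by metis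
  have "(\<lambda>n. tform (z n) (z n)) \<longlonglongrightarrow> 0"
  proof (rule tendsto_sandwich[OF _ _ tendsto_const lim_1_over_n[THEN LIMSEQ_Suc]])
    show "\<forall>\<^sub>F n in sequentially. 0 \<le> tform (z n) (z n)" using tform_nonneg[OF z(1)] by simp
    show "\<forall>\<^sub>F n in sequentially. tform (z n) (z n) \<le> 1 / of_nat (Suc n)"
      using z(2,3) less_imp_le by (auto simp: tform_self algebra_simps intro!: always_eventually)
  qed
  then obtain r x where r: "(z \<circ> r) \<longlonglongrightarrow> x" "x \<in> D" "tform x x = 0"
    using tform_compact[of z] z by auto
  have "(\<lambda>n. norm (fst ((z \<circ> r) n))) \<longlonglongrightarrow> norm (fst x)" by (intro tendsto_intros r)
  then have "norm (fst x) = 1" using z(2) by (simp add: o_def LIMSEQ_const_iff)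
  then show ?thesis using r by (intro exI[of _ "fst x"] exI[of _ "snd x"]) (auto simp: Et_def)
qed

text \<open>Otherwise unit vectors orthogonal to the eigenspace with energy tending to
  \<open>lam\<close> would accumulate at a unit eigenvector orthogonal to itself.\<close>

lemma spectral_gap:
  "\<exists>\<delta>>0. \<forall>z\<in>D. (\<forall>e\<in>Eig. inner (fst z) e = 0) \<longrightarrow> \<delta> * (norm (fst z))\<^sup>2 \<le> tform z z"
proof (rule ccontr)
  assume neg: "\<not> ?thesis"
  have "\<exists>z\<in>D. (\<forall>e\<in>Eig. inner (fst z) e = 0) \<and> norm (fst z) = 1 \<and> tform z z \<le> 1 / real (Suc n)" for n
  proof -
    obtain z where z: "z \<in> D" "\<forall>e\<in>Eig. inner (fst z) e = 0" "tform z z < 1 / real (Suc n) * (norm (fst z))\<^sup>2"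
      using neg by (auto simp: not_le dest!: spec[of _ "1 / real (Suc n)"])
    then have nz: "fst z \<noteq> 0" using tform_nonneg[of z] by auto
    let ?z = "(1 / norm (fst z)) *\<^sub>R z"
    have "tform ?z ?z = tform z z / (norm (fst z))\<^sup>2" by (simp add: tform_simps power2_eq_square)
    also have "\<dots> \<le> 1 / real (Suc n)" using z(3) nz by (simp add: field_simps)
    finally show ?thesis using z nz by (intro bexI[of _ ?z] conjI D_scale) auto
  qed
  then obtain z where z: "\<And>n. z n \<in> D" "\<And>n e. e \<in> Eig \<Longrightarrow> inner (fst (z n)) e = 0"
      "\<And>n. norm (fst (z n)) = 1" "\<And>n. tform (z n) (z n) \<le> 1 / real (Suc n)" by metis
  have "(\<lambda>n. tform (z n) (z n)) \<longlonglongrightarrow> 0"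
    by (rule tendsto_sandwich[OF _ _ tendsto_const lim_1_over_n[THEN LIMSEQ_Suc]])
      (use tform_nonneg[OF z(1)] z(4) in auto)
  then obtain r x where r: "(z \<circ> r) \<longlonglongrightarrow> x" "x \<in> D" "tform x x = 0"
    using tform_compact[of z] z by auto
  then have e: "fst x \<in> Eig" by (auto simp: Eig_def Et_def)
  have "(\<lambda>n. norm (fst ((z \<circ> r) n))) \<longlonglongrightarrow> norm (fst x)" by (intro tendsto_intros r)
  then have "norm (fst x) = 1" using z(3) by (simp add: o_def LIMSEQ_const_iff)
  moreover have "(\<lambda>n. inner (fst ((z \<circ> r) n)) (fst x)) \<longlonglongrightarrow> inner (fst x) (fst x)"
    by (intro tendsto_intros r)
  then have "inner (fst x) (fst x) = 0" using z(2)[OF e] by (simp add: o_def LIMSEQ_const_iff)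
  ultimately show False by simp
qed

section \<open>Resolvent near the lowest eigenvalue\<close>

lemma inner_J_left: "inner (J x) y = - inner x (J y)"
  using inner_J[of x "J y"] by (simp add: J_J)

lemma inner_J_self: "inner (J x) x = 0"
  using inner_J_left[of x x] by (simp add: inner_commute)

lemma norm_J: "norm (J x) = norm x"
  by (simp add: norm_eq_sqrt_inner inner_J)

lemma bounded_linear_J: "bounded_linear J"
  by (intro bounded_linear_intro[where K = 1]) (auto simp: norm_J linear_add[OF linear_J] linear_scale[OF linear_J])

lemma norm_combination_J: "(norm (s *\<^sub>R x + \<tau> *\<^sub>R J x))\<^sup>2 = (s\<^sup>2 + \<tau>\<^sup>2) * (norm x)\<^sup>2"
  using inner_J_self[of x] unfolding power2_norm_eq_inner
  by (simp add: inner_left_distrib inner_right_distrib inner_J inner_commute power2_eq_square algebra_simps)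

text \<open>The projection onto \<open>Eig\<close> stays inside the form domain because eigenvectors
  belong to it; hence the remainder lies there too.\<close>

lemma orthogonal_decomposition:
  assumes "z \<in> D"
  obtains ze zp where "ze \<in> Et" "zp \<in> D" "z = ze + zp" "\<And>e. e \<in> Eig \<Longrightarrow> inner (fst zp) e = 0"
proof -
  obtain e where e: "e \<in> Eig" "\<And>v. v \<in> Eig \<Longrightarrow> inner e v = inner (fst z) v"
    using riesz_closed_subspace[OF closed_Eig subspace_Eig bounded_linear_inner_right, of "fst z"] by blast
  then obtain ze where ze: "ze \<in> Et" "fst ze = e" unfolding Eig_def by auto
  show ?thesis
    by (rule that[of ze "z - ze"]) (use ze e assms in \<open>auto simp: Et_def D_diff inner_diff_left\<close>)
qed

text \<open>The spectral parameter s + i tau is written with \<open>J\<close> in place of i. Near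
  \<open>lam\<close> the shifted problem splits. On \<open>Eig\<close> it is multiplication by a
  nonzero number; on the orthogonal complement the gap \<open>\<delta>\<close> exceeds the distance
  to \<open>lam\<close>, and the form is coercive. The first conclusion is surjectivity, the second
  the resolvent bound.\<close>

lemma isolated:
  "\<exists>\<epsilon>>0. \<forall>s \<tau>. (s, \<tau>) \<noteq> (lam, 0) \<longrightarrow> (s - lam)\<^sup>2 + \<tau>\<^sup>2 < \<epsilon>\<^sup>2 \<longrightarrow>
     (\<forall>f. \<exists>z\<in>D. \<forall>v\<in>D. inner (snd z) (snd v) = inner (f + (s *\<^sub>R fst z + \<tau> *\<^sub>R J (fst z))) (fst v)) \<and>
     (\<exists>C. \<forall>z\<in>D. \<forall>h. (\<forall>v\<in>D. inner (snd z) (snd v) = inner h (fst v)) \<longrightarrow>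
        norm (fst z) \<le> C * norm (h - (s *\<^sub>R fst z + \<tau> *\<^sub>R J (fst z))))"
proof -
  obtain \<delta> where \<delta>: "\<delta> > 0"
    and gap: "\<And>z. z \<in> D \<Longrightarrow> (\<And>e. e \<in> Eig \<Longrightarrow> inner (fst z) e = 0) \<Longrightarrow> \<delta> * (norm (fst z))\<^sup>2 \<le> tform z z"
    using spectral_gap by blast
  show ?thesis
  proof (rule exI[of _ \<delta>], rule conjI[OF \<delta>], rule allI, rule allI, rule impI, rule impI, rule conjI)
    fix s \<tau> assume ne: "(s, \<tau>) \<noteq> (lam, 0)" and small: "(s - lam)\<^sup>2 + \<tau>\<^sup>2 < \<delta>\<^sup>2"
    define N where "N = sqrt ((s - lam)\<^sup>2 + \<tau>\<^sup>2)"
    have N: "N < \<delta>" "0 < N" "\<bar>s - lam\<bar> \<le> N"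
    proof -
      have "sqrt ((s - lam)\<^sup>2 + \<tau>\<^sup>2) < sqrt (\<delta>\<^sup>2)" using small by (rule real_sqrt_less_mono)
      then show "N < \<delta>" unfolding N_def using \<delta> by simp
      have "(s - lam)\<^sup>2 + \<tau>\<^sup>2 > 0" using ne by (simp add: sum_power2_gt_zero_iff)
      then show "0 < N" unfolding N_def by simp
      show "\<bar>s - lam\<bar> \<le> N" unfolding N_def by simp
    qed
    define M where "M = (\<lambda>x. s *\<^sub>R x + \<tau> *\<^sub>R J x)"
    \<comment> \<open>Multiplication by the difference between the spectral parameter and
      \<open>lam\<close>; \<open>N\<close> is the modulus of this number.\<close>
    define \<nu> where "\<nu> = (\<lambda>x. (s - lam) *\<^sub>R x + \<tau> *\<^sub>R J x)"
    define a :: "'h \<times> 'k \<Rightarrow> 'h \<times> 'k \<Rightarrow> real" where "a = (\<lambda>z v. inner (snd z) (snd v) - inner (M (fst z)) (fst v))"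
    define S where "S = {z \<in> D. \<forall>e\<in>Eig. inner (fst z) e = 0}"
    have M_lin: "bounded_linear M" unfolding M_def
      by (intro bounded_linear_add bounded_linear_const_scaleR bounded_linear_J bounded_linear_ident
           bounded_linear_compose[OF bounded_linear_scaleR_right])
    have a_bil: "bounded_bilinear a"
    proof -
      obtain C where C: "\<And>x. norm (M x) \<le> norm x * C" "C \<ge> 0"
        using bounded_linear.nonneg_bounded[OF M_lin] by blast
      interpret M: bounded_linear M by (fact M_lin)
      have "\<bar>a z v\<bar> \<le> norm z * norm v * (1 + C)" for z v
      proof -
        have n: "norm (snd z) \<le> norm z" "norm (fst z) \<le> norm z" "norm (snd v) \<le> norm v" "norm (fst v) \<le> norm v"
          using norm_fst_le[of "fst z" "snd z"] norm_snd_le[of "snd z" "fst z"]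
            norm_fst_le[of "fst v" "snd v"] norm_snd_le[of "snd v" "fst v"] by simp_all
        have "\<bar>inner (snd z) (snd v)\<bar> \<le> norm z * norm v"
          by (rule order_trans[OF Cauchy_Schwarz_ineq2]) (intro mult_mono n; simp)
        moreover have "\<bar>inner (M (fst z)) (fst v)\<bar> \<le> (norm z * C) * norm v"
          by (rule order_trans[OF Cauchy_Schwarz_ineq2], intro mult_mono order_trans[OF C(1)] n)
            (use C(2) n in \<open>auto intro: mult_right_mono\<close>)
        ultimately show ?thesis unfolding a_def by (simp add: algebra_simps abs_le_iff)
      qed
      then show ?thesis
        unfolding a_def
        by unfold_locales
          (auto simp: algebra_simps inner_left_distrib inner_right_distrib M.add M.scaleR intro!: exI[of _ "1 + C"])
    qed
    have a_t: "a z v = tform z v - inner (\<nu> (fst z)) (fst v)" for z v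
      unfolding a_def tform_def M_def \<nu>_def by (simp add: algebra_simps inner_left_distrib)
    have \<nu>_Eig: "\<nu> e \<in> Eig" if "e \<in> Eig" for e
      unfolding \<nu>_def using that subspace_Eig Eig_J by (intro subspace_add subspace_scale)
    have norm_\<nu>: "norm (\<nu> x) = N * norm x" for x
      using norm_combination_J[of "s - lam" x \<tau>] unfolding \<nu>_def N_def
      by (metis norm_ge_zero real_sqrt_mult real_sqrt_unique)
    have inner_\<nu>_orth: "inner (\<nu> x) e = 0" if "e \<in> Eig" "\<And>e. e \<in> Eig \<Longrightarrow> inner x e = 0" for x e
      unfolding \<nu>_def using that Eig_J[OF that(1)] by (simp add: inner_left_distrib inner_J_left)
    have a_self: "a z z = tform z z - (s - lam) * (norm (fst z))\<^sup>2" for z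
      unfolding a_t \<nu>_def by (simp add: inner_left_distrib inner_J_self power2_norm_eq_inner)
    have coer: "(\<delta> - N) * (norm (fst z))\<^sup>2 \<le> a z z" "(1 - N / \<delta>) * tform z z \<le> a z z" if "z \<in> S" for z
    proof -
      have g: "\<delta> * (norm (fst z))\<^sup>2 \<le> tform z z" using that gap unfolding S_def by blast
      have h: "(s - lam) * (norm (fst z))\<^sup>2 \<le> N * (norm (fst z))\<^sup>2"
        using N(3) by (intro mult_right_mono) auto
      show "(\<delta> - N) * (norm (fst z))\<^sup>2 \<le> a z z" unfolding a_self using g h by (simp add: algebra_simps)
      have "N * (norm (fst z))\<^sup>2 \<le> N / \<delta> * tform z z"
        using mult_left_mono[OF g, of "N / \<delta>"] N \<delta> by simp
      then show "(1 - N / \<delta>) * tform z z \<le> a z z" unfolding a_self using h by (simp add: algebra_simps)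
    qed
    \<comment> \<open>Coercivity is needed in the norm of the graph:
      \<open>|z|^2 = tform z z + (1 + lam) |fst z|^2\<close>, and the gap bounds the last term by a
      multiple of \<open>tform z z\<close>.\<close>
    define c where "c = (1 - N / \<delta>) / (1 + (1 + lam) / \<delta>)"
    have c0: "c > 0" unfolding c_def using N \<delta> lam_nonneg by (intro divide_pos_pos add_pos_nonneg) auto
    have coercive: "c * (norm z)\<^sup>2 \<le> a z z" if "z \<in> S" for z
    proof -
      have g: "\<delta> * (norm (fst z))\<^sup>2 \<le> tform z z" using that gap unfolding S_def by blast
      have "(norm z)\<^sup>2 = tform z z + (1 + lam) * (norm (fst z))\<^sup>2"
        by (simp add: tform_self norm_prod_def algebra_simps)
      also have "\<dots> \<le> tform z z + (1 + lam) * (tform z z / \<delta>)"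
        using g \<delta> lam_nonneg by (intro add_left_mono mult_left_mono) (auto simp: field_simps)
      also have "\<dots> = (1 + (1 + lam) / \<delta>) * tform z z" by (simp add: algebra_simps)
      finally have "c * (norm z)\<^sup>2 \<le> c * ((1 + (1 + lam) / \<delta>) * tform z z)" using c0 by (intro mult_left_mono) auto
      also have "\<dots> = (1 - N / \<delta>) * tform z z"
      proof -
        have "1 + (1 + lam) / \<delta> > 0" using \<delta> lam_nonneg by (intro add_pos_nonneg) auto
        then have "c * (1 + (1 + lam) / \<delta>) = 1 - N / \<delta>" unfolding c_def by simp
        then show ?thesis by (simp only: mult.assoc[symmetric])
      qed
      also note coer(2)[OF that]
      finally show ?thesis .
    qed
    have S_eq: "S = D \<inter> (\<Inter>e\<in>Eig. {z. inner (fst z) e = 0})" unfolding S_def by auto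
    have closed_S: "closed S" unfolding S_eq
      by (intro closed_Int closed_D closed_INT ballI closed_Collect_eq continuous_intros)
    have subspace_S: "subspace S"
      unfolding S_def subspace_def using subspace_D
      by (auto simp: subspace_0 D_add D_scale inner_left_distrib)
    have solve: "\<exists>z\<in>D. \<forall>v\<in>D. a z v = inner f (fst v)" for f
    proof -
      obtain fE where fE: "fE \<in> Eig" "\<And>e. e \<in> Eig \<Longrightarrow> inner fE e = inner f e"
        using riesz_closed_subspace[OF closed_Eig subspace_Eig bounded_linear_inner_right, of f] by blast
      have "bounded_linear (\<lambda>v :: 'h \<times> 'k. inner f (fst v))"
        by (intro bounded_linear_compose[OF bounded_linear_inner_right] bounded_linear_fst)
      then obtain zp where zp: "zp \<in> S" "\<And>v. v \<in> S \<Longrightarrow> a zp v = inner f (fst v)"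
        using lax_milgram_closed_subspace[OF closed_S subspace_S _ a_bil c0 coercive] by blast
      \<comment> \<open>The solution of \<open>\<nu> e = - fE\<close> inside \<open>Eig\<close>:
        multiply by the conjugate of the number and divide by its squared modulus.\<close>
      define e where "e = - ((1 / N\<^sup>2) *\<^sub>R ((s - lam) *\<^sub>R fE - \<tau> *\<^sub>R J fE))"
      have e: "e \<in> Eig" unfolding e_def
        using fE(1) subspace_Eig Eig_J by (intro subspace_neg subspace_scale subspace_diff)
      have J_e: "J e = - ((1 / N\<^sup>2) *\<^sub>R ((s - lam) *\<^sub>R J fE + \<tau> *\<^sub>R fE))"
        unfolding e_def
        by (simp add: linear_neg[OF linear_J] linear_diff[OF linear_J] linear_scale[OF linear_J] J_J)
      have "\<nu> e = - ((1 / N\<^sup>2) *\<^sub>R (((s - lam)\<^sup>2 + \<tau>\<^sup>2) *\<^sub>R fE))"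
        unfolding \<nu>_def J_e unfolding e_def
        by (simp add: scaleR_right_diff_distrib scaleR_right_distrib scaleR_left_distrib power2_eq_square
            mult.commute mult.left_commute add_ac del: scaleR_left_diff_distrib)
      also have "\<dots> = - fE" using N(2) unfolding N_def by (auto simp: sum_power2_gt_zero_iff)
      finally have \<nu>e: "\<nu> e = - fE" .
      obtain ze where ze: "ze \<in> Et" "fst ze = e" using e unfolding Eig_def by auto
      have zeD: "ze \<in> D" using ze Et_iff by blast
      have zpD: "zp \<in> D" using zp S_def by blast
      have zp_orth: "\<And>e. e \<in> Eig \<Longrightarrow> inner (fst zp) e = 0" using zp S_def by blast
      show ?thesis
      proof (intro bexI[of _ "zp + ze"] ballI)
        show "zp + ze \<in> D" using zpD zeD by (rule D_add)
        fix v assume v: "v \<in> D"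
        obtain ve vp where dec: "ve \<in> Et" "vp \<in> D" "v = ve + vp" "\<And>e. e \<in> Eig \<Longrightarrow> inner (fst vp) e = 0"
          using orthogonal_decomposition[OF v] by metis
        have vpS: "vp \<in> S" using dec unfolding S_def by blast
        have veE: "fst ve \<in> Eig" using dec unfolding Eig_def by blast
        \<comment> \<open>The mixed term vanishes: \<open>tform\<close> against an eigenvector is
          zero, and \<open>\<nu>\<close> preserves orthogonality to \<open>Eig\<close>.\<close>
        have 1: "a zp ve = 0"
          unfolding a_t using dec(1) zpD tform_commute[of zp ve] inner_\<nu>_orth[OF veE zp_orth]
          by (auto simp: Et_iff)
        have 2: "a ze v = inner fE (fst v)"
          unfolding a_t ze \<nu>e using ze v by (auto simp: Et_iff)
        interpret a: bounded_bilinear a by fact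
        have "a (zp + ze) v = a zp ve + a zp vp + a ze v"
          by (simp add: dec a.add_left a.add_right)
        also have "\<dots> = inner f (fst vp) + inner fE (fst ve) + inner fE (fst vp)"
          using 1 2 zp(2)[OF vpS] by (simp add: dec inner_right_distrib)
        also have "inner fE (fst vp) = 0" using dec(4)[OF fE(1)] by (simp add: inner_commute)
        also have "inner fE (fst ve) = inner f (fst ve)" using fE(2)[OF veE] .
        finally show "a (zp + ze) v = inner f (fst v)" by (simp add: dec inner_right_distrib)
      qed
    qed
    show "\<forall>f. \<exists>z\<in>D. \<forall>v\<in>D. inner (snd z) (snd v) = inner (f + (s *\<^sub>R fst z + \<tau> *\<^sub>R J (fst z))) (fst v)"
      using solve unfolding a_def M_def by (simp add: inner_left_distrib algebra_simps)
    show "\<exists>C. \<forall>z\<in>D. \<forall>h. (\<forall>v\<in>D. inner (snd z) (snd v) = inner h (fst v)) \<longrightarrow>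
        norm (fst z) \<le> C * norm (h - (s *\<^sub>R fst z + \<tau> *\<^sub>R J (fst z)))"
    proof (intro exI[of _ "1 / (\<delta> - N) + 1 / N"] ballI allI impI)
      fix z h assume z: "z \<in> D" and h: "\<forall>v\<in>D. inner (snd z) (snd v) = inner h (fst v)"
      define f where "f = h - M (fst z)"
      have av: "a z v = inner f (fst v)" if "v \<in> D" for v
        using h that unfolding a_def f_def by (simp add: inner_diff_left)
      obtain ze zp where dec: "ze \<in> Et" "zp \<in> D" "z = ze + zp" "\<And>e. e \<in> Eig \<Longrightarrow> inner (fst zp) e = 0"
        using orthogonal_decomposition[OF z] by metis
      have zpS: "zp \<in> S" using dec unfolding S_def by blast
      have zeE: "fst ze \<in> Eig" using dec unfolding Eig_def by blast
      interpret a: bounded_bilinear a by fact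
      have "a ze zp = 0" unfolding a_t using dec(1,2) dec(4)[OF \<nu>_Eig[OF zeE]]
        by (auto simp: Et_iff inner_commute)
      then have "(\<delta> - N) * (norm (fst zp))\<^sup>2 \<le> inner f (fst zp)"
        using coer(1)[OF zpS] av[OF dec(2)] by (simp add: dec(3) a.add_left)
      also have "\<dots> \<le> norm f * norm (fst zp)" by (rule norm_cauchy_schwarz)
      finally have "(\<delta> - N) * norm (fst zp) * norm (fst zp) \<le> norm f * norm (fst zp)"
        by (simp add: power2_eq_square mult.assoc)
      then have "(\<delta> - N) * norm (fst zp) \<le> norm f"
        by (cases "fst zp = 0") (auto dest: mult_right_le_imp_le)
      then have p: "norm (fst zp) \<le> norm f / (\<delta> - N)"
        using N(1) by (simp add: field_simps)
      \<comment> \<open>Testing against the eigenvector \<open>\<nu> (fst ze)\<close> turns the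
        eigenspace part of \<open>a\<close> into minus its squared norm.\<close>
      obtain v where v: "v \<in> Et" "fst v = \<nu> (fst ze)" using \<nu>_Eig[OF zeE] unfolding Eig_def by auto
      have vD: "v \<in> D" using v Et_iff by blast
      have "a zp v = 0" unfolding a_t
        using v(1) dec(2) tform_commute[of zp v] inner_\<nu>_orth[OF \<nu>_Eig[OF zeE] dec(4)] by (auto simp: Et_iff v(2))
      moreover have "a ze v = - (norm (\<nu> (fst ze)))\<^sup>2"
        unfolding a_t using dec(1) vD by (auto simp: Et_iff v(2) power2_norm_eq_inner)
      ultimately have "(norm (\<nu> (fst ze)))\<^sup>2 = inner (- f) (\<nu> (fst ze))"
        using av[OF vD] by (simp add: dec(3) a.add_left v(2))
      also have "\<dots> \<le> norm (- f) * norm (\<nu> (fst ze))" by (rule norm_cauchy_schwarz)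
      finally have "norm (\<nu> (fst ze)) \<le> norm f"
        by (cases "\<nu> (fst ze) = 0") (auto simp: power2_eq_square)
      then have e: "norm (fst ze) \<le> norm f / N" unfolding norm_\<nu> using N(2) by (simp add: field_simps)
      have "norm (fst z) \<le> norm (fst ze) + norm (fst zp)" unfolding dec(3) by (simp add: norm_triangle_ineq)
      also have "\<dots> \<le> norm f / N + norm f / (\<delta> - N)" using e p by simp
      finally show "norm (fst z) \<le> (1 / (\<delta> - N) + 1 / N) * norm (h - (s *\<^sub>R fst z + \<tau> *\<^sub>R J (fst z)))"
        unfolding f_def M_def by (simp add: algebra_simps)
    qed
  qed
qed

theorem lowest_eigenvalue:
  "(\<exists>z\<in>D. fst z \<noteq> 0 \<and> (\<forall>v\<in>D. inner (snd z) (snd v) = lam * inner (fst z) (fst v)))"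
  "\<exists>B. finite B \<and> (\<forall>z\<in>D. (\<forall>v\<in>D. inner (snd z) (snd v) = lam * inner (fst z) (fst v)) \<longrightarrow> fst z \<in> span B)"
proof -
  have iff: "z \<in> Et \<longleftrightarrow> z \<in> D \<and> (\<forall>v\<in>D. inner (snd z) (snd v) = lam * inner (fst z) (fst v))" for z
    by (auto simp: Et_iff tform_def)
  show "(\<exists>z\<in>D. fst z \<noteq> 0 \<and> (\<forall>v\<in>D. inner (snd z) (snd v) = lam * inner (fst z) (fst v)))"
    using Eig_nontrivial iff by (metis fst_conv)
  obtain B where "finite B" "Eig \<subseteq> span B" using Eig_finite_dim by blast
  then show "\<exists>B. finite B \<and> (\<forall>z\<in>D. (\<forall>v\<in>D. inner (snd z) (snd v) = lam * inner (fst z) (fst v)) \<longrightarrow> fst z \<in> span B)"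
    using iff unfolding Eig_def by (intro exI[of _ B]) blast
qed

end

section \<open>The Hilbert space of square-integrable functions\<close>

lemma borel_measurable_cnj [measurable (raw)]:
  "f \<in> borel_measurable M \<Longrightarrow> (\<lambda>x. cnj (f x)) \<in> borel_measurable M"
  by (rule measurable_compose[of f M borel cnj borel]) (auto intro: borel_measurable_continuous_onI continuous_intros)

lemma L2_zero: "L2 (\<lambda>_. 0)" unfolding L2_def by simp

lemma L2_measurable [measurable_dest]: "L2 u \<Longrightarrow> u \<in> borel_measurable borel"
  unfolding L2_def by simp

lemma L2_integrable: "L2 u \<Longrightarrow> integrable lborel (\<lambda>p. (cmod (u p))\<^sup>2)"
  unfolding L2_def by simp

lemma L2I_bound:
  assumes "u \<in> borel_measurable borel" "integrable lborel f" "\<And>p. (cmod (u p))\<^sup>2 \<le> f p"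
  shows "L2 u"
  unfolding L2_def
proof
  show "integrable lborel (\<lambda>p. (cmod (u p))\<^sup>2)"
    by (rule Bochner_Integration.integrable_bound[OF assms(2)])
      (use assms in \<open>auto intro!: always_eventually order_trans[OF _ abs_ge_self] simp del: split_paired_All\<close>)
qed (use assms in simp)

lemma cmod_add_square_le: "(cmod (x + y))\<^sup>2 \<le> 2 * (cmod x)\<^sup>2 + 2 * (cmod y)\<^sup>2"
  using parallelogram_law[of x y] by (smt (verit) zero_le_power2)

lemma L2_add: assumes "L2 u" "L2 v" shows "L2 (\<lambda>p. u p + v p)"
proof (rule L2I_bound)
  show "integrable lborel (\<lambda>p. 2 * (cmod (u p))\<^sup>2 + 2 * (cmod (v p))\<^sup>2)"
    using assms[THEN L2_integrable] by auto
qed (use assms[THEN L2_measurable] cmod_add_square_le in auto)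

text \<open>The bound concerns the product and not \<open>b\<close>, so that the multiplier may be
  unbounded where \<open>u\<close> vanishes. The vector potential is such a multiplier.\<close>

lemma L2_bounded_mult:
  assumes "L2 u" "b \<in> borel_measurable borel" "\<And>p. cmod (b p * u p) \<le> C * cmod (u p)"
  shows "L2 (\<lambda>p. b p * u p)"
proof (rule L2I_bound)
  show "integrable lborel (\<lambda>p. C\<^sup>2 * (cmod (u p))\<^sup>2)"
    using assms(1)[THEN L2_integrable] by auto
  show "(cmod (b p * u p))\<^sup>2 \<le> C\<^sup>2 * (cmod (u p))\<^sup>2" for p
    using power_mono[OF assms(3)[of p] norm_ge_zero, of 2] by (simp add: power_mult_distrib)
qed (use assms L2_measurable[OF assms(1)] in auto)

lemma L2_cmult: "L2 u \<Longrightarrow> L2 (\<lambda>p. c * u p)"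
  by (rule L2_bounded_mult[where C = "cmod c"]) (auto simp: norm_mult)

lemma L2_diff: "L2 u \<Longrightarrow> L2 v \<Longrightarrow> L2 (\<lambda>p. u p - v p)"
  using L2_add[of u "\<lambda>p. - 1 * v p"] L2_cmult[of v "-1"] by simp

lemma L2_sum: "finite B \<Longrightarrow> (\<And>b. b \<in> B \<Longrightarrow> L2 (f b)) \<Longrightarrow> L2 (\<lambda>p. \<Sum>b\<in>B. f b p)"
  by (induction B rule: finite_induct) (auto intro: L2_zero L2_add)

lemma L2_prod_integrable:
  assumes "L2 u" "L2 v" shows "integrable lborel (\<lambda>p. u p * cnj (v p))"
proof (rule Bochner_Integration.integrable_bound)
  show "integrable lborel (\<lambda>p. (cmod (u p))\<^sup>2 + (cmod (v p))\<^sup>2)"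
    using assms[THEN L2_integrable] by auto
  have "cmod (x * cnj y) \<le> (cmod x)\<^sup>2 + (cmod y)\<^sup>2" for x y
  proof -
    have "0 \<le> (cmod x - cmod y)\<^sup>2" by simp
    then have "2 * (cmod x * cmod y) \<le> (cmod x)\<^sup>2 + (cmod y)\<^sup>2" by (simp add: power2_diff)
    moreover have "0 \<le> cmod x * cmod y" by simp
    ultimately have "cmod x * cmod y \<le> (cmod x)\<^sup>2 + (cmod y)\<^sup>2" by linarith
    then show ?thesis by (simp add: norm_mult)
  qed
  then show "AE p in lborel. norm (u p * cnj (v p)) \<le> norm ((cmod (u p))\<^sup>2 + (cmod (v p))\<^sup>2)" by simp
qed (use assms[THEN L2_measurable] in measurable)

lemma L2_cnj: "L2 u \<Longrightarrow> L2 (\<lambda>p. cnj (u p))"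
proof -
  assume u: "L2 u"
  have "(\<lambda>p. cnj (u p)) \<in> borel_measurable borel" by (rule borel_measurable_cnj[OF L2_measurable[OF u]])
  then show ?thesis using L2_integrable[OF u] unfolding L2_def by simp
qed

lemma L2_prod_integrable': "L2 u \<Longrightarrow> L2 v \<Longrightarrow> integrable lborel (\<lambda>p. u p * v p)"
  using L2_prod_integrable[of u "\<lambda>p. cnj (v p)"] L2_cnj[of v] by simp

\<comment> \<open>The function spaces of the problem are predicates on functions, whereas the
  abstract part speaks of a type of complete inner product spaces. The quotient is partial:
  functions that are not square-integrable have no class.\<close>
quotient_type l2 = fn / partial: "\<lambda>u v. L2 u \<and> L2 v \<and> (AE p in lborel. u p = v p)"
proof (rule part_equivpI)
  show "\<exists>u. L2 u \<and> L2 u \<and> (AE p in lborel. u p = u p)" using L2_zero by auto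
  show "symp (\<lambda>u v. L2 u \<and> L2 v \<and> (AE p in lborel. u p = v p))"
    by (rule sympI) (auto elim: AE_mp)
  show "transp (\<lambda>u v. L2 u \<and> L2 v \<and> (AE p in lborel. u p = v p))"
    by (rule transpI) (auto elim: AE_mp)
qed

definition rp :: "l2 \<Rightarrow> fn" where "rp x = rep_l2 x"
definition cls :: "fn \<Rightarrow> l2" where "cls u = abs_l2 u"

lemma L2_rp [simp]: "L2 (rp x)"
  unfolding rp_def using Quotient_rep_reflp[OF Quotient_l2, of x] by simp

lemma cls_rp [simp]: "cls (rp x) = x"
  unfolding cls_def rp_def by (rule Quotient_abs_rep[OF Quotient_l2])

lemma cls_eq_iff: "L2 u \<Longrightarrow> L2 v \<Longrightarrow> cls u = cls v \<longleftrightarrow> (AE p in lborel. u p = v p)"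
  unfolding cls_def using Quotient_rel[OF Quotient_l2, of u v] by auto

lemma rp_cls: "L2 u \<Longrightarrow> AE p in lborel. rp (cls u) p = u p"
  using cls_eq_iff[of "rp (cls u)" u] by simp

lemma l2_cases: obtains u where "L2 u" "x = cls u" using that[of "rp x"] by simp

section \<open>Vector space structure, inner product and completeness\<close>

instantiation l2 :: real_vector
begin
definition "0 = cls (\<lambda>_. 0)"
definition "x + y = cls (\<lambda>p. rp x p + rp y p)"
definition "x - y = cls (\<lambda>p. rp x p - rp y p)"
definition "- x = cls (\<lambda>p. - rp x p)"
definition "scaleR r x = cls (\<lambda>p. complex_of_real r * rp x p)"

lemma cls_add: "L2 u \<Longrightarrow> L2 v \<Longrightarrow> cls u + cls v = cls (\<lambda>p. u p + v p)"
  unfolding plus_l2_def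
  using rp_cls[of u] rp_cls[of v] by (subst cls_eq_iff) (auto intro: L2_add)
lemma cls_diff: "L2 u \<Longrightarrow> L2 v \<Longrightarrow> cls u - cls v = cls (\<lambda>p. u p - v p)"
  unfolding minus_l2_def
  using rp_cls[of u] rp_cls[of v] by (subst cls_eq_iff) (auto intro: L2_diff)
lemma L2_uminus: "L2 u \<Longrightarrow> L2 (\<lambda>p. - u p)" using L2_cmult[of u "-1"] by simp
lemma cls_uminus: "L2 u \<Longrightarrow> - cls u = cls (\<lambda>p. - u p)"
  unfolding uminus_l2_def
  using rp_cls[of u] by (subst cls_eq_iff) (auto intro: L2_uminus)
lemma cls_scaleR: "L2 u \<Longrightarrow> r *\<^sub>R cls u = cls (\<lambda>p. complex_of_real r * u p)"
  unfolding scaleR_l2_def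
  using rp_cls[of u] by (subst cls_eq_iff) (auto intro: L2_cmult)

instance
proof
  fix x y z :: l2 and r s :: real
  obtain u v w where u: "L2 u" "x = cls u" and v: "L2 v" "y = cls v" and w: "L2 w" "z = cls w"
    by (metis l2_cases)
  note c = cls_add cls_diff cls_uminus cls_scaleR L2_add L2_diff L2_cmult L2_uminus L2_zero
  show "x + y + z = x + (y + z)" "x + y = y + x"
    unfolding u v w by (simp_all add: c u v w add_ac)
  show "0 + x = x" unfolding zero_l2_def u by (simp add: c u)
  show "- x + x = 0" unfolding zero_l2_def u by (simp add: c u)
  show "x - y = x + - y" unfolding u v by (simp add: c u v)
  show "r *\<^sub>R (x + y) = r *\<^sub>R x + r *\<^sub>R y" "(r + s) *\<^sub>R x = r *\<^sub>R x + s *\<^sub>R x"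
    "r *\<^sub>R s *\<^sub>R x = (r * s) *\<^sub>R x" "1 *\<^sub>R x = x"
    unfolding u v by (simp_all add: c u v algebra_simps)
qed
end

lemma cls_zero: "cls (\<lambda>_. 0) = 0" by (simp add: zero_l2_def)

lemma integral_inner_cong:
  assumes "L2 u" "L2 v"
  shows "(LINT p|lborel. rp (cls u) p * cnj (rp (cls v) p)) = (LINT p|lborel. u p * cnj (v p))"
proof (rule integral_cong_AE)
  note [measurable] = assms[THEN L2_measurable] L2_measurable[OF L2_rp]
  show "(\<lambda>p. rp (cls u) p * cnj (rp (cls v) p)) \<in> borel_measurable lborel"
    "(\<lambda>p. u p * cnj (v p)) \<in> borel_measurable lborel" by measurable
qed (use rp_cls[OF assms(1)] rp_cls[OF assms(2)] in auto)

text \<open>The inner product is the real part of the complex one, which induces the same norm. The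
  imaginary part is recovered through \<open>mult_i\<close>.\<close>

instantiation l2 :: real_inner
begin
definition "inner x y = Re (LINT p|lborel. rp x p * cnj (rp y p))"
definition "norm x = sqrt (inner x (x::l2))"
definition "dist x y = norm (x - (y::l2))"
definition "sgn x = scaleR (inverse (norm x)) (x::l2)"
definition "(uniformity :: (l2 \<times> l2) filter) = (INF e\<in>{0 <..}. principal {(x, y). dist x y < e})"
definition "open U \<longleftrightarrow> (\<forall>x\<in>U. eventually (\<lambda>(x', y). x' = x \<longrightarrow> y \<in> U) (uniformity :: (l2 \<times> l2) filter))"

lemma inner_cls: "L2 u \<Longrightarrow> L2 v \<Longrightarrow> inner (cls u) (cls v) = Re (LINT p|lborel. u p * cnj (v p))"
  unfolding inner_l2_def by (simp add: integral_inner_cong)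

lemma inner_cls_self: "L2 u \<Longrightarrow> inner (cls u) (cls u) = (LINT p|lborel. (cmod (u p))\<^sup>2)"
proof -
  assume u: "L2 u"
  have "(LINT p|lborel. u p * cnj (u p)) = (LINT p|lborel. complex_of_real ((cmod (u p))\<^sup>2))"
    by (intro Bochner_Integration.integral_cong refl) (rule complex_norm_square[symmetric])
  then show ?thesis by (simp only: inner_cls u integral_complex_of_real Re_complex_of_real)
qed

instance
proof
  fix x y z :: l2 and r :: real
  obtain u v w where u: "L2 u" "x = cls u" and v: "L2 v" "y = cls v" and w: "L2 w" "z = cls w"
    by (metis l2_cases)
  note c = cls_add cls_diff cls_uminus cls_scaleR L2_add L2_diff L2_cmult L2_uminus L2_zero
  show "inner x y = inner y x"
  proof -
    have "(LINT p|lborel. v p * cnj (u p)) = (LINT p|lborel. cnj (u p * cnj (v p)))" by (simp add: mult.commute)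
    also have "\<dots> = cnj (LINT p|lborel. u p * cnj (v p))"
      by (rule Bochner_Integration.integral_bounded_linear[OF bounded_linear_cnj L2_prod_integrable[OF u(1) v(1)]])
    finally show ?thesis unfolding u v by (simp add: inner_cls u v)
  qed
  show "inner (x + y) z = inner x z + inner y z"
    unfolding u v w
    by (simp add: c inner_cls u v w distrib_right L2_prod_integrable)
  show "inner (r *\<^sub>R x) y = r * inner x y"
    unfolding u v by (simp add: c inner_cls u v mult.assoc)
  show "0 \<le> inner x x" unfolding u by (simp add: inner_cls_self u)
  show "inner x x = 0 \<longleftrightarrow> x = 0"
    unfolding u zero_l2_def
    by (simp add: inner_cls_self u cls_eq_iff L2_zero integral_nonneg_eq_0_iff_AE L2_integrable)
qed (simp_all add: norm_l2_def dist_l2_def sgn_l2_def uniformity_l2_def open_l2_def)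
end

lemma norm_cls: "L2 u \<Longrightarrow> (norm (cls u))\<^sup>2 = (LINT p|lborel. (cmod (u p))\<^sup>2)"
  by (simp add: power2_norm_eq_inner inner_cls_self)

lemma L2norm_cls: "L2 u \<Longrightarrow> L2norm u = norm (cls u)"
  unfolding L2norm_def by (simp add: norm_eq_sqrt_inner inner_cls_self)

lemma nn_integral_cls: "L2 u \<Longrightarrow> (\<integral>\<^sup>+p. ennreal ((cmod (u p))\<^sup>2) \<partial>lborel) = ennreal ((norm (cls u))\<^sup>2)"
  by (simp add: norm_cls nn_integral_eq_integral L2_integrable)

lemma L2I_nn:
  assumes "u \<in> borel_measurable borel" "(\<integral>\<^sup>+p. ennreal ((cmod (u p))\<^sup>2) \<partial>lborel) < \<infinity>"
  shows "L2 u"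
  unfolding L2_def using assms by (auto intro!: integrableI_nonneg)

lemma norm_cls_le:
  assumes "L2 u" "(\<integral>\<^sup>+p. ennreal ((cmod (u p))\<^sup>2) \<partial>lborel) \<le> ennreal (e\<^sup>2)" "e \<ge> 0"
  shows "norm (cls u) \<le> e"
proof (rule power2_le_imp_le)
  show "(norm (cls u))\<^sup>2 \<le> e\<^sup>2" using assms(2) unfolding nn_integral_cls[OF assms(1)] by simp
qed fact

text \<open>Converts square-integrability of weighted increments into absolute convergence at almost
  every point: once \<open>2 ^ n * (a n)^2 < 1\<close>, the terms lie below a geometric
  series.\<close>

lemma summable_of_weighted_squares:
  fixes a :: "nat \<Rightarrow> real"
  assumes "summable (\<lambda>n. 2 ^ n * (a n)\<^sup>2)"
  shows "summable (\<lambda>n. \<bar>a n\<bar>)"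
proof (rule summable_comparison_test_ev[where g = "\<lambda>n. (1 / sqrt 2) ^ n"])
  have "\<forall>\<^sub>F n in sequentially. 2 ^ n * (a n)\<^sup>2 < 1"
    using order_tendstoD(2)[OF summable_LIMSEQ_zero[OF assms], of 1] by simp
  then show "\<forall>\<^sub>F n in sequentially. norm \<bar>a n\<bar> \<le> (1 / sqrt 2) ^ n"
  proof eventually_elim
    case (elim n)
    have "((1 / sqrt 2) ^ n)\<^sup>2 = ((1 / sqrt 2)\<^sup>2) ^ n" by (simp add: power_mult[symmetric] mult.commute)
    also have "\<dots> = 1 / 2 ^ n" by (simp add: power_divide)
    finally have "(\<bar>a n\<bar>)\<^sup>2 \<le> ((1 / sqrt 2) ^ n)\<^sup>2"
      using elim by (simp add: field_simps)
    from power2_le_imp_le[OF this] show ?case by simp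
  qed
  show "summable (\<lambda>n. (1 / sqrt 2) ^ n :: real)" by (rule summable_geometric) simp
qed

text \<open>Riesz-Fischer: a subsequence with rapidly decreasing increments converges almost
  everywhere, and Fatou's lemma shows that the pointwise limit is the limit in norm.\<close>

instance l2 :: complete_space
proof
  fix X :: "nat \<Rightarrow> l2" assume X: "Cauchy X"
  have "\<exists>N. \<forall>m\<ge>N. \<forall>n\<ge>N. norm (X m - X n) < 1 / 2 ^ k" for k :: nat
    using metric_CauchyD[OF X, of "1 / 2 ^ k"] by (simp add: dist_norm)
  then obtain M where M: "\<And>k m n. m \<ge> M k \<Longrightarrow> n \<ge> M k \<Longrightarrow> norm (X m - X n) < 1 / 2 ^ k" by metis
  \<comment> \<open>Summing the \<open>M i\<close> makes the index monotone although
    \<open>M\<close> need not be; the summand \<open>k\<close> makes it strictly so.\<close>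
  define r where "r = (\<lambda>k. (\<Sum>i\<le>k. M i) + k)"
  have r_ge: "r k \<ge> M k" for k
    unfolding r_def using member_le_sum[of k "{..k}" M] by auto
  have r_mono: "strict_mono r" unfolding r_def strict_mono_Suc_iff by auto
  define u where "u = (\<lambda>k. rp (X (r k)))"
  have u_L2: "L2 (u k)" for k unfolding u_def by simp
  have u_cls: "cls (u k) = X (r k)" for k unfolding u_def by simp
  note [measurable] = L2_measurable[OF u_L2]
  have close: "norm (cls (u n) - cls (u k)) \<le> 1 / 2 ^ j" if "n \<ge> j" "k \<ge> j" for n k j
  proof -
    have "r n \<ge> M j" "r k \<ge> M j"
      using r_ge[of j] strict_mono_less_eq[OF r_mono] that by (meson order_trans)+
    then show ?thesis using M[of j "r n" "r k"] unfolding u_cls by simp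
  qed
  define a where "a = (\<lambda>n p. cmod (u (Suc n) p - u n p))"
  have a_meas [measurable]: "a n \<in> borel_measurable borel" for n unfolding a_def by measurable
  have "(\<integral>\<^sup>+p. (\<Sum>n. ennreal (2 ^ n * (a n p)\<^sup>2)) \<partial>lborel) = (\<Sum>n. \<integral>\<^sup>+p. ennreal (2 ^ n * (a n p)\<^sup>2) \<partial>lborel)"
    by (rule nn_integral_suminf) measurable
  also have "\<dots> \<le> (\<Sum>n. ennreal ((1 / 2) ^ n))"
  proof (rule suminf_le)
    fix n
    have "(\<integral>\<^sup>+p. ennreal (2 ^ n * (a n p)\<^sup>2) \<partial>lborel) = ennreal (2 ^ n) * (\<integral>\<^sup>+p. ennreal ((a n p)\<^sup>2) \<partial>lborel)"
      by (simp add: ennreal_mult nn_integral_cmult)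
    also have "(\<integral>\<^sup>+p. ennreal ((a n p)\<^sup>2) \<partial>lborel) = ennreal ((norm (cls (u (Suc n)) - cls (u n)))\<^sup>2)"
      unfolding a_def by (simp add: nn_integral_cls cls_diff u_L2 L2_diff)
    \<comment> \<open>The squared increment is at most \<open>1 / 4 ^ n\<close>, so the weight
      \<open>2 ^ n\<close> still leaves a convergent geometric series.\<close>
    also have "\<dots> \<le> ennreal ((1 / 2 ^ n)\<^sup>2)"
      by (intro ennreal_leI power_mono close) auto
    also have "ennreal (2 ^ n) * ennreal ((1 / 2 ^ n)\<^sup>2) = ennreal ((1 / 2) ^ n)"
      by (subst ennreal_mult[symmetric]) (auto simp: power2_eq_square power_divide)
    finally show "(\<integral>\<^sup>+p. ennreal (2 ^ n * (a n p)\<^sup>2) \<partial>lborel) \<le> ennreal ((1 / 2) ^ n)"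
      by (simp add: mult_left_mono)
  qed auto
  also have "\<dots> < \<infinity>"
  proof -
    have "(\<Sum>n. ennreal ((1 / 2) ^ n)) = ennreal (\<Sum>n. (1 / 2) ^ n)"
      by (rule suminf_ennreal2) (auto intro: summable_geometric)
    then show ?thesis by (metis ennreal_less_top infinity_ennreal_def)
  qed
  finally have "AE p in lborel. (\<Sum>n. ennreal (2 ^ n * (a n p)\<^sup>2)) \<noteq> \<infinity>"
    by (intro nn_integral_PInf_AE) auto
  then have conv: "AE p in lborel. convergent (\<lambda>n. u n p)"
  proof eventually_elim
    case (elim p)
    have "summable (\<lambda>n. 2 ^ n * (a n p)\<^sup>2)"
      using elim by (intro summable_suminf_not_top) auto
    then have "summable (\<lambda>n. \<bar>a n p\<bar>)" by (rule summable_of_weighted_squares)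
    then have "summable (\<lambda>n. u (Suc n) p - u n p)" unfolding a_def by (auto intro: summable_norm_cancel)
    then have "convergent (\<lambda>n. u n p - u 0 p)"
      using sum_lessThan_telescope[of "\<lambda>n. u n p"] by (simp add: summable_iff_convergent)
    then have "convergent (\<lambda>n. (u n p - u 0 p) + u 0 p)" by (intro convergent_add convergent_const)
    then show ?case by simp
  qed
  define v where "v = (\<lambda>p. lim (\<lambda>n. u n p))"
  have v_meas [measurable]: "v \<in> borel_measurable borel"
    unfolding v_def by (rule borel_measurable_lim_metric) measurable
  have lim: "AE p in lborel. (\<lambda>n. u n p) \<longlonglongrightarrow> v p"
    using conv unfolding v_def by eventually_elim (simp add: convergent_LIMSEQ_iff)
  \<comment> \<open>Fatou in \<open>n\<close> with \<open>j\<close> fixed turns the Cauchy estimate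
    into a distance from the limit.\<close>
  have fatou: "(\<integral>\<^sup>+p. ennreal ((cmod (v p - u j p))\<^sup>2) \<partial>lborel) \<le> ennreal ((1 / 2 ^ j)\<^sup>2)" for j
  proof -
    have "(\<integral>\<^sup>+p. ennreal ((cmod (v p - u j p))\<^sup>2) \<partial>lborel)
        = (\<integral>\<^sup>+p. liminf (\<lambda>n. ennreal ((cmod (u n p - u j p))\<^sup>2)) \<partial>lborel)"
    proof (rule nn_integral_cong_AE, use lim in eventually_elim)
      case (elim p)
      have "(\<lambda>n. ennreal ((cmod (u n p - u j p))\<^sup>2)) \<longlonglongrightarrow> ennreal ((cmod (v p - u j p))\<^sup>2)"
        by (intro tendsto_intros tendsto_ennrealI elim)
      then show ?case by (rule lim_imp_Liminf[OF trivial_limit_sequentially, symmetric])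
    qed
    also have "\<dots> \<le> liminf (\<lambda>n. \<integral>\<^sup>+p. ennreal ((cmod (u n p - u j p))\<^sup>2) \<partial>lborel)"
      by (rule nn_integral_liminf) measurable
    also have "\<dots> \<le> liminf (\<lambda>n. ennreal ((1 / 2 ^ j)\<^sup>2))"
    proof (rule Liminf_mono, rule eventually_sequentiallyI[of j])
      fix n assume "j \<le> n"
      then show "(\<integral>\<^sup>+p. ennreal ((cmod (u n p - u j p))\<^sup>2) \<partial>lborel) \<le> ennreal ((1 / 2 ^ j)\<^sup>2)"
        unfolding nn_integral_cls[OF L2_diff[OF u_L2 u_L2]] cls_diff[OF u_L2 u_L2, symmetric]
        by (intro ennreal_leI power_mono close) auto
    qed
    finally show ?thesis by (simp add: Liminf_const)
  qed
  have vu: "L2 (\<lambda>p. v p - u j p)" for j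
    by (rule L2I_nn) (use fatou[of j] in \<open>auto intro: le_less_trans\<close>)
  have v_L2: "L2 v" using L2_add[OF vu[of 0] u_L2[of 0]] by simp
  have "norm (cls (u j) - cls v) \<le> (1 / 2) ^ j" for j
    using norm_cls_le[OF vu fatou, of j] unfolding cls_diff[OF v_L2 u_L2, symmetric]
    by (simp add: norm_minus_commute power_divide)
  then have "(\<lambda>j. X (r j)) \<longlonglongrightarrow> cls v"
  proof -
    assume le: "\<And>j. norm (cls (u j) - cls v) \<le> (1 / 2) ^ j"
    have "(\<lambda>j. X (r j) - cls v) \<longlonglongrightarrow> 0"
      using le unfolding u_cls
      by (intro Lim_null_comparison[OF always_eventually LIMSEQ_realpow_zero[of "1/2"]]) auto
    then show ?thesis by (rule LIM_zero_cancel)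
  qed
  then show "convergent X"
    using Cauchy_converges_subseq[OF X r_mono] unfolding convergent_def o_def by blast
qed

section \<open>Complex structure, and the spaces of the problem in terms of classes\<close>

definition mult_i :: "l2 \<Rightarrow> l2" where "mult_i x = cls (\<lambda>p. \<i> * rp x p)"

lemma mult_i_cls: "L2 u \<Longrightarrow> mult_i (cls u) = cls (\<lambda>p. \<i> * u p)"
  unfolding mult_i_def using rp_cls[of u] by (subst cls_eq_iff) (auto intro: L2_cmult)

lemma cls_complex_mult:
  "L2 u \<Longrightarrow> cls (\<lambda>p. c * u p) = Re c *\<^sub>R cls u + Im c *\<^sub>R mult_i (cls u)"
proof -
  assume u: "L2 u"
  have "c * z = complex_of_real (Re c) * z + complex_of_real (Im c) * (\<i> * z)" for z
    by (simp add: complex_eq_iff)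
  then have "(\<lambda>p. c * u p) = (\<lambda>p. complex_of_real (Re c) * u p + complex_of_real (Im c) * (\<i> * u p))" by blast
  then show ?thesis using u by (simp only: mult_i_cls cls_scaleR cls_add L2_cmult)
qed

lemma linear_mult_i: "linear mult_i"
proof (rule linearI)
  fix x y :: l2 and r :: real
  show "mult_i (x + y) = mult_i x + mult_i y"
    by (cases x rule: l2_cases; cases y rule: l2_cases)
      (simp add: cls_add mult_i_cls L2_add L2_cmult distrib_left)
  show "mult_i (r *\<^sub>R x) = r *\<^sub>R mult_i x"
    by (cases x rule: l2_cases) (simp add: cls_scaleR mult_i_cls L2_cmult mult.left_commute)
qed

lemma mult_i_mult_i: "mult_i (mult_i x) = - x"
  by (cases x rule: l2_cases) (simp add: mult_i_cls L2_cmult cls_uminus)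

lemma inner_mult_i: "inner (mult_i x) (mult_i y) = inner x y"
proof -
  have "\<i> * a * cnj (\<i> * b) = a * cnj b" for a b by (simp add: complex_eq_iff)
  then have "(\<lambda>p. \<i> * u p * cnj (\<i> * v p)) = (\<lambda>p. u p * cnj (v p))" for u v :: fn by blast
  then show ?thesis
    by (cases x rule: l2_cases; cases y rule: l2_cases) (simp only: mult_i_cls L2_cmult inner_cls)
qed

lemma inner_mult_i_right: "inner x (mult_i y) = - inner (mult_i x) y"
  using inner_mult_i[of "mult_i x" y] by (simp add: mult_i_mult_i)

lemma norm_mult_i: "norm (mult_i x) = norm x"
  by (simp add: norm_eq_sqrt_inner inner_mult_i)

text \<open>As the second argument is conjugated, the imaginary part of <u, v> is the real part of
  <u, i v>.\<close>

lemma L2inner_cls: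
  assumes "L2 u" "L2 v"
  shows "L2inner u v = Complex (inner (cls u) (cls v)) (inner (cls u) (mult_i (cls v)))"
proof (rule complex_eqI)
  show "Im (L2inner u v) = Im (Complex (inner (cls u) (cls v)) (inner (cls u) (mult_i (cls v))))"
    unfolding L2inner_def
    by (simp add: mult_i_cls L2_cmult inner_cls assms mult.left_commute[of _ \<i>])
qed (simp add: L2inner_def inner_cls assms)

lemma L2_dist_tendsto_iff:
  assumes "\<And>k. L2 (uk k)" "L2 u"
  shows "((\<lambda>k. LINT p|lborel. (cmod (uk k p - u p))\<^sup>2) \<longlonglongrightarrow> 0) \<longleftrightarrow> (\<lambda>k. cls (uk k)) \<longlonglongrightarrow> cls u"
proof -
  have eq: "(LINT p|lborel. (cmod (uk k p - u p))\<^sup>2) = (norm (cls (uk k) - cls u))\<^sup>2" for k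
    by (simp add: cls_diff assms norm_cls L2_diff)
  have "((\<lambda>k. (norm (cls (uk k) - cls u))\<^sup>2) \<longlonglongrightarrow> 0) \<longleftrightarrow> (\<lambda>k. norm (cls (uk k) - cls u)) \<longlonglongrightarrow> 0"
  proof
    assume "(\<lambda>k. (norm (cls (uk k) - cls u))\<^sup>2) \<longlonglongrightarrow> 0"
    then have "(\<lambda>k. sqrt ((norm (cls (uk k) - cls u))\<^sup>2)) \<longlonglongrightarrow> sqrt 0" by (intro tendsto_intros)
    then show "(\<lambda>k. norm (cls (uk k) - cls u)) \<longlonglongrightarrow> 0" by simp
  next
    assume "(\<lambda>k. norm (cls (uk k) - cls u)) \<longlonglongrightarrow> 0"
    then show "(\<lambda>k. (norm (cls (uk k) - cls u))\<^sup>2) \<longlonglongrightarrow> 0" by (rule tendsto_eq_rhs[OF tendsto_power]) simp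
  qed
  then show ?thesis unfolding eq by (simp add: tendsto_norm_zero_iff LIM_zero_iff)
qed

lemma Omega_measurable [measurable]: "Omega d \<in> sets borel"
proof -
  have "Omega d = {p \<in> space (borel \<Otimes>\<^sub>M (borel \<Otimes>\<^sub>M borel)). (fst p)\<^sup>2 + (fst (snd p))\<^sup>2 > 0 \<and> 0 \<le> snd (snd p) \<and> snd (snd p) \<le> d}"
    unfolding Omega_def by (auto simp: space_pair_measure)
  also have "\<dots> \<in> sets (borel \<Otimes>\<^sub>M (borel \<Otimes>\<^sub>M borel))" by measurable
  finally show ?thesis unfolding borel_prod .
qed

lemma L2_Omega_cong_AE:
  "L2 u \<Longrightarrow> L2 v \<Longrightarrow> AE p in lborel. u p = v p \<Longrightarrow> L2_Omega d u \<Longrightarrow> L2_Omega d v"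
  unfolding L2_Omega_def by (auto elim: AE_mp)

text \<open>The set is the kernel of a bounded operator, multiplication by the indicator of the
  complement of \<open>Omega d\<close>.\<close>

lemma closed_L2_Omega: "closed {x. L2_Omega d (rp x)}"
proof -
  define P where "P = (\<lambda>x. cls (\<lambda>p. complex_of_real (indicator (- Omega d) p) * rp x p))"
  have L2P: "L2 (\<lambda>p. complex_of_real (indicator (- Omega d) p) * u p)" if "L2 u" for u
    by (rule L2_bounded_mult[OF that, where C = 1]) (auto simp: norm_mult indicator_def)
  have P: "P (cls u) = cls (\<lambda>p. complex_of_real (indicator (- Omega d) p) * u p)" if "L2 u" for u
    unfolding P_def using rp_cls[OF that] by (subst cls_eq_iff) (auto intro: L2P that)
  have "bounded_linear P"
  proof (rule bounded_linear_intro[where K = 1])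
    fix x y :: l2 and r :: real
    obtain u v where u: "L2 u" "x = cls u" and v: "L2 v" "y = cls v" by (metis l2_cases)
    show "P (x + y) = P x + P y" unfolding u v by (simp add: cls_add P L2_add L2P u v distrib_left)
    show "P (r *\<^sub>R x) = r *\<^sub>R P x" unfolding u by (simp add: cls_scaleR P L2P L2_cmult u mult.left_commute)
    have "(norm (P x))\<^sup>2 \<le> (norm x)\<^sup>2" unfolding u P[OF u(1)]
      using u by (simp only: norm_cls L2P, intro integral_mono L2_integrable L2P)
        (auto simp: norm_mult indicator_def)
    from power2_le_imp_le[OF this] show "norm (P x) \<le> norm x * 1" by simp
  qed
  moreover have "L2_Omega d (rp x) \<longleftrightarrow> P x = 0" for x
  proof -
    have "P x = 0 \<longleftrightarrow> (AE p in lborel. complex_of_real (indicator (- Omega d) p) * rp x p = 0)"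
      unfolding P_def zero_l2_def by (subst cls_eq_iff) (auto intro: L2P L2_zero)
    also have "\<dots> \<longleftrightarrow> L2_Omega d (rp x)"
      unfolding L2_Omega_def by (auto simp: indicator_def intro!: AE_cong)
    finally show ?thesis ..
  qed
  ultimately show ?thesis
    by (simp add: closed_Collect_eq linear_continuous_on)
qed

section \<open>Test functions\<close>

declare split_paired_All [simp del] split_paired_Ex [simp del]

text \<open>Truncated powers are the source of all explicit cut-offs. The \<open>n\<close>-th power
  of the positive part has \<open>n - 1\<close> continuous derivatives; \<open>test_fn\<close> asks
  for one and the wave packets for two.\<close>

lemma max0_power_has_derivative:
  assumes "n \<ge> 2"
  shows "((\<lambda>s::real. (max 0 s) ^ n) has_real_derivative real n * (max 0 s) ^ (n - 1)) (at s)"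
proof -
  consider "s > 0" | "s < 0" | "s = 0" by linarith
  then show ?thesis
  proof cases
    case 1
    have "((\<lambda>s::real. s ^ n) has_real_derivative real n * s ^ (n - 1)) (at s)"
      by (rule derivative_eq_intros refl)+ simp
    then show ?thesis using 1
      by (rule_tac DERIV_cong[OF has_field_derivative_transform_within_open[where S = "{0<..}"]]) auto
  next
    case 2
    have "((\<lambda>s::real. 0) has_real_derivative 0) (at s)" by simp
    then have "((\<lambda>s::real. (max 0 s) ^ n) has_real_derivative 0) (at s)"
      by (rule has_field_derivative_transform_within_open[where S = "{..<0}"]) (use 2 assms in auto)
    then show ?thesis using 2 assms by (simp add: max_def power_0_left)
  next
    case 3
    have "((\<lambda>h::real. (max 0 h) ^ n / h) \<longlongrightarrow> 0) (at 0)"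
    proof (rule Lim_null_comparison)
      show "\<forall>\<^sub>F h::real in at 0. norm ((max 0 h) ^ n / h) \<le> \<bar>h\<bar> ^ (n - 1)"
      proof (rule always_eventually, rule allI)
        fix h :: real
        obtain k where k: "n = Suc k" using assms by (cases n) auto
        then show "norm ((max 0 h) ^ n / h) \<le> \<bar>h\<bar> ^ (n - 1)"
          using assms by (cases "h > 0") (auto simp: max_def)
      qed
      have "((\<lambda>h::real. \<bar>h\<bar> ^ (n - 1)) \<longlongrightarrow> \<bar>0\<bar> ^ (n - 1)) (at 0)" by (intro tendsto_intros)
      then show "((\<lambda>h::real. \<bar>h\<bar> ^ (n - 1)) \<longlongrightarrow> 0) (at 0)" using assms by (simp add: power_0_left)
    qed
    then show ?thesis unfolding 3 DERIV_def using assms by (simp add: power_0_left)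
  qed
qed

lemma test_fnI:
  assumes d: "\<And>p. (\<phi> has_derivative D p) (at p)" and c: "\<And>j. j < 3 \<Longrightarrow> continuous_on UNIV (\<lambda>p. D p (ev j))"
    and K: "compact K" "K \<subseteq> U" "\<And>p. p \<notin> K \<Longrightarrow> \<phi> p = 0"
  shows "test_fn U \<phi>"
proof -
  have pd: "pd \<phi> j = (\<lambda>p. D p (ev j))" for j
    unfolding pd_def using frechet_derivative_at[OF d] by metis
  have cl: "closure {p. \<phi> p \<noteq> 0} \<subseteq> K"
    using K compact_imp_closed by (intro closure_minimal) auto
  have "compact (K \<inter> closure {p. \<phi> p \<noteq> 0})" using K by (intro compact_Int_closed) auto
  then have "compact (closure {p. \<phi> p \<noteq> 0})" using cl by (simp add: Int_absorb1)
  then show ?thesis unfolding test_fn_def pd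
    using d c K(2) cl by (auto simp only: differentiable_def)
qed

lemma pd_eq: "(\<phi> has_derivative D) (at p) \<Longrightarrow> pd \<phi> j p = D (ev j)"
  unfolding pd_def using frechet_derivative_at by metis

lemma pt_expand: "(h :: pt) = fst h *\<^sub>R ev 0 + fst (snd h) *\<^sub>R ev 1 + snd (snd h) *\<^sub>R ev 2"
  by (cases h) (simp add: ev_def)

lemma frechet_pd:
  assumes "\<phi> differentiable (at p)"
  shows "frechet_derivative \<phi> (at p) h = fst h * pd \<phi> 0 p + fst (snd h) * pd \<phi> 1 p + snd (snd h) * pd \<phi> 2 p"
proof -
  have "linear (frechet_derivative \<phi> (at p))" using assms by (rule linear_frechet_derivative)
  then show ?thesis
    by (subst pt_expand[of h]) (simp add: linear_add linear_scale pd_def)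
qed

lemma test_fn_differentiable: "test_fn U \<phi> \<Longrightarrow> \<phi> differentiable (at p)"
  and test_fn_pd_continuous: "test_fn U \<phi> \<Longrightarrow> j < 3 \<Longrightarrow> continuous_on UNIV (pd \<phi> j)"
  unfolding test_fn_def by simp_all

lemma test_fn_continuous: "test_fn U \<phi> \<Longrightarrow> continuous_on UNIV \<phi>"
proof -
  assume t: "test_fn U \<phi>"
  have "continuous (at p) \<phi>" for p
    by (rule differentiable_imp_continuous_within[OF test_fn_differentiable[OF t]])
  then show ?thesis by (intro continuous_at_imp_continuous_on ballI)
qed

lemma test_fn_support:
  assumes "test_fn U \<phi>"
  obtains K where "compact K" "K \<subseteq> U" "\<And>p. p \<notin> K \<Longrightarrow> \<phi> p = 0" "\<And>p j. p \<notin> K \<Longrightarrow> pd \<phi> j p = 0"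
proof (rule that[of "closure {p. \<phi> p \<noteq> 0}"])
  show "compact (closure {p. \<phi> p \<noteq> 0})" "closure {p. \<phi> p \<noteq> 0} \<subseteq> U"
    using assms unfolding test_fn_def by auto
  show z: "\<phi> p = 0" if "p \<notin> closure {p. \<phi> p \<noteq> 0}" for p
  proof (rule ccontr)
    assume "\<phi> p \<noteq> 0"
    then have "p \<in> closure {p. \<phi> p \<noteq> 0}" by (intro subsetD[OF closure_subset]) simp
    then show False using that by simp
  qed
  show "pd \<phi> j p = 0" if "p \<notin> closure {p. \<phi> p \<noteq> 0}" for p j
  proof -
    have "((\<lambda>_. 0) has_derivative (\<lambda>_. 0)) (at p :: pt filter)" by simp
    then have "(\<phi> has_derivative (\<lambda>_. 0)) (at p)"
    proof (rule has_derivative_transform_within_open)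
      show "open (- closure {p. \<phi> p \<noteq> 0})" by (intro open_Compl closed_closure)
      show "p \<in> - closure {p. \<phi> p \<noteq> 0}" using that by simp
      show "0 = \<phi> q" if "q \<in> - closure {p. \<phi> p \<noteq> 0}" for q using z[OF ComplD[OF that]] by (rule sym)
    qed
    then show ?thesis by (rule pd_eq)
  qed
qed

lemma continuous_compact_support_bounded:
  fixes f :: "'a::topological_space \<Rightarrow> 'b::real_normed_vector"
  assumes "continuous_on UNIV f" "compact K" "\<And>p. p \<notin> K \<Longrightarrow> f p = 0"
  obtains C where "C \<ge> 0" "\<And>p. norm (f p) \<le> C"
proof -
  have "compact (f ` K)" using assms(1,2) by (intro compact_continuous_image) (auto intro: continuous_on_subset)
  then obtain C where C: "\<And>x. x \<in> f ` K \<Longrightarrow> norm x \<le> C" using compact_imp_bounded bounded_iff by metis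
  have "norm (f p) \<le> max C 0" for p using C[of "f p"] assms(3)[of p] by (cases "p \<in> K") (auto intro: order_trans[OF _ max.cobounded1])
  then show ?thesis by (intro that[of "max C 0"]) auto
qed

lemma L2_compact_support:
  fixes f :: fn
  assumes "f \<in> borel_measurable borel" "compact K" "\<And>p. p \<notin> K \<Longrightarrow> f p = 0" "\<And>p. cmod (f p) \<le> C"
  shows "L2 f"
proof (rule L2I_bound)
  show "integrable lborel (\<lambda>p. C\<^sup>2 * indicator K p)"
    using assms(2) emeasure_compact_finite[OF assms(2)]
    by (auto intro!: integrable_mult_right integrable_real_indicator borel_compact)
  show "(cmod (f p))\<^sup>2 \<le> C\<^sup>2 * indicator K p" for p
    using assms(3)[of p] assms(4)[of p] by (cases "p \<in> K") (auto intro: power_mono)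
qed fact

lemma L2_continuous_compact_support:
  fixes f :: fn
  assumes "continuous_on UNIV f" "compact K" "\<And>p. p \<notin> K \<Longrightarrow> f p = 0"
  shows "L2 f"
proof -
  obtain C where "\<And>p. norm (f p) \<le> C" using continuous_compact_support_bounded[OF assms] by blast
  then show ?thesis using assms
    by (intro L2_compact_support[of f K C]) (auto intro: borel_measurable_continuous_onI)
qed

lemma L2_test_fn: "test_fn U \<phi> \<Longrightarrow> L2 (\<lambda>p. complex_of_real (\<phi> p))"
proof -
  assume t: "test_fn U \<phi>"
  obtain K where K: "compact K" "\<And>p. p \<notin> K \<Longrightarrow> \<phi> p = 0" using test_fn_support[OF t] by metis
  show ?thesis
    by (rule L2_continuous_compact_support[OF _ K(1)]) (intro continuous_intros test_fn_continuous[OF t], simp add: K)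
qed

lemma L2_test_fn_pd: "test_fn U \<phi> \<Longrightarrow> j < 3 \<Longrightarrow> L2 (\<lambda>p. complex_of_real (pd \<phi> j p))"
proof -
  assume t: "test_fn U \<phi>" and j: "j < 3"
  obtain K where K: "compact K" "\<And>p. p \<notin> K \<Longrightarrow> pd \<phi> j p = 0" using test_fn_support[OF t] by metis
  show ?thesis
    by (rule L2_continuous_compact_support[OF _ K(1)]) (intro continuous_intros test_fn_pd_continuous[OF t j], simp add: K)
qed

text \<open>Local integrability is the right class because the rotation field grows linearly: its
  product with a square-integrable gradient need not be square-integrable.\<close>

definition loc_int :: "fn \<Rightarrow> bool" where
  "loc_int f \<longleftrightarrow> f \<in> borel_measurable borel \<and> (\<forall>K. compact K \<longrightarrow> integrable lborel (\<lambda>p. indicator K p *\<^sub>R f p))"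

text \<open>Boxes form an intersection-stable generator of the Borel sets. Disjoint unions follow
  from countable additivity, complements from the vanishing of the total integral.\<close>

lemma set_integral_zero_of_boxes:
  fixes F :: "'a::euclidean_space \<Rightarrow> complex"
  assumes F: "integrable lborel F" and b: "\<And>a b. (LINT p:box a b|lborel. F p) = 0"
    and univ: "(LINT p|lborel. F p) = 0" and A: "A \<in> sets borel"
  shows "(LINT p:A|lborel. F p) = 0"
proof -
  let ?G = "range (\<lambda>(a, b). box a b :: 'a set)"
  have si: "set_integrable lborel B F" if "B \<in> sets borel" for B
    using that F unfolding set_integrable_def by (intro integrable_mult_indicator) auto
  have "Int_stable ?G"
    unfolding Int_stable_def
  proof (intro ballI)
    fix X Y assume "X \<in> ?G" "Y \<in> ?G"
    then obtain a b c d where "X = box a b" "Y = box c d" by auto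
    moreover obtain e f where "box a b \<inter> box c d = box e f" using box_Int_box by blast
    ultimately show "X \<inter> Y \<in> ?G" by auto
  qed
  moreover have "?G \<subseteq> Pow UNIV" by simp
  moreover have "A \<in> sigma_sets UNIV ?G" using A unfolding borel_eq_box by simp
  ultimately show ?thesis
  proof (induction rule: sigma_sets_induct_disjoint)
    case (basic A) then show ?case using b by auto
  next
    case empty then show ?case by (simp add: set_lebesgue_integral_def)
  next
    case (compl A)
    then have "A \<in> sets borel" unfolding borel_eq_box by simp
    then have "(LINT p:(A \<union> (UNIV - A))|lborel. F p) = (LINT p:A|lborel. F p) + (LINT p:UNIV - A|lborel. F p)"
      by (intro set_integral_Un si) auto
    then show ?case using compl univ by (simp add: set_lebesgue_integral_def)
  next
    case (union A)
    then have "A i \<in> sets borel" for i unfolding borel_eq_box by auto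
    then have "(LINT p:(\<Union>i. A i)|lborel. F p) = (\<Sum>i. (LINT p:(A i)|lborel. F p))"
      using union by (intro lebesgue_integral_countable_add si) (auto simp: disjoint_family_on_def)
    then show ?case using union by simp
  qed
qed

text \<open>A continuously differentiable step from 0 on the negative axis to the limit 1 at
  infinity. Composed with \<open>k * t - 1\<close> it tends to the indicator of
  \<open>t > 0\<close>, while the shift by 1 keeps its support in \<open>t >= 1 / k\<close>, away
  from the boundary.\<close>

definition cut :: "real \<Rightarrow> real" where "cut s = (max 0 s)\<^sup>2 / (1 + (max 0 s)\<^sup>2)"
definition cut' :: "real \<Rightarrow> real" where "cut' s = 2 * max 0 s / (1 + (max 0 s)\<^sup>2)\<^sup>2"

lemma one_add_max_sq_neq: "1 + (max 0 s)\<^sup>2 \<noteq> (0::real)" by (smt (verit) zero_le_power2)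

lemma cut_deriv: "(cut has_real_derivative cut' s) (at s)"
proof -
  have m: "((\<lambda>s::real. (max 0 s)\<^sup>2) has_real_derivative 2 * max 0 s) (at s)"
    using max0_power_has_derivative[of 2 s] by simp
  have "((\<lambda>s. (max 0 s)\<^sup>2 / (1 + (max 0 s)\<^sup>2)) has_real_derivative
      ((2 * max 0 s) * (1 + (max 0 s)\<^sup>2) - (max 0 s)\<^sup>2 * (0 + 2 * max 0 s)) / ((1 + (max 0 s)\<^sup>2) * (1 + (max 0 s)\<^sup>2))) (at s)"
    by (intro DERIV_divide DERIV_add DERIV_const m one_add_max_sq_neq)
  then show ?thesis
    unfolding cut_def cut'_def by (rule DERIV_cong) (simp add: power2_eq_square algebra_simps)
qed

lemma cut_cont: "continuous_on UNIV cut'"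
  unfolding cut'_def by (intro continuous_intros ballI) (simp add: one_add_max_sq_neq)

lemma cut_bounds: "0 \<le> cut s" "cut s \<le> 1" "s \<le> 0 \<Longrightarrow> cut s = 0"
proof -
  have "1 + (max 0 s)\<^sup>2 > 0" by (rule add_pos_nonneg) simp_all
  then show "0 \<le> cut s" "cut s \<le> 1" unfolding cut_def by simp_all
  show "s \<le> 0 \<Longrightarrow> cut s = 0" unfolding cut_def by (simp add: max_def)
qed

lemma cut_lim:
  assumes "t > 0" shows "(\<lambda>k. cut (real k * t - 1)) \<longlonglongrightarrow> 1"
proof -
  have inf: "filterlim (\<lambda>s::real. 1 + s\<^sup>2) at_top at_top"
    by (intro filterlim_tendsto_add_at_top[OF tendsto_const] filterlim_pow_at_top filterlim_ident) simp
  have "((\<lambda>s. 1 - inverse (1 + s\<^sup>2)) \<longlongrightarrow> (1 - 0::real)) at_top"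
    by (intro tendsto_diff tendsto_const tendsto_inverse_0_at_top inf)
  moreover have "\<forall>\<^sub>F s in at_top. 1 - inverse (1 + s\<^sup>2) = cut s"
  proof (rule eventually_at_top_linorderI[of 0])
    fix s :: real assume "0 \<le> s"
    moreover have "1 + s\<^sup>2 \<noteq> 0" by (smt (verit) zero_le_power2)
    ultimately show "1 - inverse (1 + s\<^sup>2) = cut s" by (simp add: cut_def max_def field_simps)
  qed
  ultimately have "(cut \<longlongrightarrow> 1) at_top" using Lim_transform_eventually by fastforce
  moreover have "filterlim (\<lambda>k. - 1 + t * real k) at_top sequentially"
    by (intro filterlim_tendsto_add_at_top[OF tendsto_const] filterlim_tendsto_pos_mult_at_top[OF tendsto_const assms]
        filterlim_real_sequentially)
  then have "filterlim (\<lambda>k. real k * t - 1) at_top sequentially" by (simp add: mult.commute)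
  ultimately show ?thesis by (rule filterlim_compose)
qed

lemma prod3_has_derivative:
  fixes a b c :: "real \<Rightarrow> 'a::real_normed_field"
  assumes "(a has_vector_derivative a') (at (fst p))" "(b has_vector_derivative b') (at (fst (snd p)))"
    "(c has_vector_derivative c') (at (snd (snd p)))"
  shows "((\<lambda>p. a (fst p) * b (fst (snd p)) * c (snd (snd p))) has_derivative
     (\<lambda>h. fst h *\<^sub>R (a' * b (fst (snd p)) * c (snd (snd p))) + fst (snd h) *\<^sub>R (a (fst p) * b' * c (snd (snd p)))
        + snd (snd h) *\<^sub>R (a (fst p) * b (fst (snd p)) * c'))) (at p)"
proof -
  have 1: "((\<lambda>p. a (fst p)) has_derivative (\<lambda>h. fst h *\<^sub>R a')) (at p)"
    by (rule has_derivative_compose[of fst fst _ _ a "\<lambda>h. h *\<^sub>R a'"])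
      (use assms in \<open>auto simp: has_vector_derivative_def intro: derivative_intros\<close>)
  have 2: "((\<lambda>p. b (fst (snd p))) has_derivative (\<lambda>h. fst (snd h) *\<^sub>R b')) (at p)"
    by (rule has_derivative_compose[of "\<lambda>p. fst (snd p)" "\<lambda>p. fst (snd p)" _ _ b "\<lambda>h. h *\<^sub>R b'"])
      (use assms in \<open>auto simp: has_vector_derivative_def intro!: derivative_intros\<close>)
  have 3: "((\<lambda>p. c (snd (snd p))) has_derivative (\<lambda>h. snd (snd h) *\<^sub>R c')) (at p)"
    by (rule has_derivative_compose[of "\<lambda>p. snd (snd p)" "\<lambda>p. snd (snd p)" _ _ c "\<lambda>h. h *\<^sub>R c'"])
      (use assms in \<open>auto simp: has_vector_derivative_def intro!: derivative_intros\<close>)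
  show ?thesis
    by (rule has_derivative_eq_rhs[OF has_derivative_mult[OF has_derivative_mult[OF 1 2] 3]])
      (simp add: fun_eq_iff algebra_simps)
qed

lemma less_3_cases: "(j::nat) < 3 \<Longrightarrow> j = 0 \<or> j = 1 \<or> j = 2" by auto

lemma ev_simps [simp]: "ev 0 = (1, 0, 0)" "ev 1 = (0, 1, 0)" "ev (Suc 0) = (0, 1, 0)" "ev 2 = (0, 0, 1)"
  by (simp_all add: ev_def)

lemma test_fn_prod3:
  assumes a: "\<And>x. (a has_vector_derivative a' x) (at x)" "continuous_on UNIV a'"
    and b: "\<And>x. (b has_vector_derivative b' x) (at x)" "continuous_on UNIV b'"
    and c: "\<And>x. (c has_vector_derivative c' x) (at x)" "continuous_on UNIV c'"
    and K: "compact K" "K \<subseteq> U" "\<And>p. p \<notin> K \<Longrightarrow> a (fst p) * b (fst (snd p)) * c (snd (snd p)) = 0"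
  shows "test_fn U (\<lambda>p. a (fst p) * b (fst (snd p)) * c (snd (snd p)))"
proof (rule test_fnI[OF prod3_has_derivative[OF a(1) b(1) c(1)] _ K])
  have cont: "continuous_on UNIV a" "continuous_on UNIV b" "continuous_on UNIV c"
    using a(1) b(1) c(1) by (meson continuous_at_imp_continuous_on has_vector_derivative_continuous)+
  note [continuous_intros] = continuous_on_compose2[OF cont(1)] continuous_on_compose2[OF cont(2)]
    continuous_on_compose2[OF cont(3)] continuous_on_compose2[OF a(2)] continuous_on_compose2[OF b(2)]
    continuous_on_compose2[OF c(2)]
  fix j :: nat assume "j < 3"
  then show "continuous_on UNIV (\<lambda>p :: pt. fst (ev j) *\<^sub>R (a' (fst p) * b (fst (snd p)) * c (snd (snd p)))
      + fst (snd (ev j)) *\<^sub>R (a (fst p) * b' (fst (snd p)) * c (snd (snd p)))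
      + snd (snd (ev j)) *\<^sub>R (a (fst p) * b (fst (snd p)) * c' (snd (snd p))))"
    by (intro continuous_intros) auto
qed

lemma box_pt_mem: "p \<in> box l u \<longleftrightarrow> fst l < fst p \<and> fst p < fst u \<and> fst (snd l) < fst (snd p) \<and> fst (snd p) < fst (snd u)
    \<and> snd (snd l) < snd (snd p) \<and> snd (snd p) < snd (snd (u :: pt))"
  by (simp add: mem_box Basis_prod_def ball_Un inner_prod_def) blast

lemma cbox_pt_mem: "p \<in> cbox l u \<longleftrightarrow> fst l \<le> fst p \<and> fst p \<le> fst u \<and> fst (snd l) \<le> fst (snd p) \<and> fst (snd p) \<le> fst (snd u)
    \<and> snd (snd l) \<le> snd (snd p) \<and> snd (snd p) \<le> snd (snd (u :: pt))"
  by (simp add: mem_box Basis_prod_def ball_Un inner_prod_def) blast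

text \<open>For \<open>l < u\<close> the product \<open>(x - l) * (u - x)\<close> is positive
  exactly on the open interval, and at least \<open>1 / k\<close> on a compact part of it.\<close>

definition cut_interval :: "real \<Rightarrow> real \<Rightarrow> nat \<Rightarrow> real \<Rightarrow> real" where
  "cut_interval l u k x = cut (real k * ((x - l) * (u - x)) - 1)"

lemma cut_interval_deriv:
  "(cut_interval l u k has_vector_derivative
     cut' (real k * ((x - l) * (u - x)) - 1) * (real k * ((u - x) - (x - l)))) (at x)"
  unfolding cut_interval_def has_real_derivative_iff_has_vector_derivative[symmetric]
proof (rule DERIV_chain2[OF cut_deriv])
  show "((\<lambda>x. real k * ((x - l) * (u - x)) - 1) has_real_derivative real k * ((u - x) - (x - l))) (at x)"
    by (auto intro!: derivative_eq_intros simp: algebra_simps)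
qed

lemma cut_interval_support:
  assumes "cut_interval l u k x \<noteq> 0" shows "1 < real k * ((x - l) * (u - x))"
proof (rule ccontr)
  assume "\<not> ?thesis"
  then show False using assms cut_bounds(3) unfolding cut_interval_def by simp
qed

definition cut_box :: "pt \<Rightarrow> pt \<Rightarrow> nat \<Rightarrow> pt \<Rightarrow> real" where
  "cut_box l u k p = cut_interval (fst l) (fst u) k (fst p) * cut_interval (fst (snd l)) (fst (snd u)) k (fst (snd p))
      * cut_interval (snd (snd l)) (snd (snd u)) k (snd (snd p))"

lemma cut_box_test_fn:
  assumes "box l u \<noteq> {}" "box l u \<subseteq> U"
  shows "test_fn U (cut_box l u k)"
proof -
  define r where "r = (\<lambda>a b x. real k * ((x - a) * (b - x)))"
  \<comment> \<open>The closed box gives compactness, and the conditions \<open>1 \<le> r\<close>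
    keep the set away from its faces.\<close>
  define K where "K = cbox l u \<inter> {p. 1 \<le> r (fst l) (fst u) (fst p)} \<inter> {p. 1 \<le> r (fst (snd l)) (fst (snd u)) (fst (snd p))}
      \<inter> {p. 1 \<le> r (snd (snd l)) (snd (snd u)) (snd (snd p))}"
  have "compact K" unfolding K_def r_def
    by (intro compact_Int_closed compact_cbox closed_Collect_le continuous_intros)
  have lu: "fst l < fst u" "fst (snd l) < fst (snd u)" "snd (snd l) < snd (snd u)"
    using assms(1) box_pt_mem[of _ l u] by fastforce+
  have inside: "a < x \<and> x < b" if "1 \<le> r a b x" "a < b" for a b x
  proof -
    have "(x - a) * (b - x) > 0" using that unfolding r_def by (metis less_le_trans mult_nonneg_nonpos not_le of_nat_0_le_iff zero_less_one)
    then show ?thesis using that(2) by (auto simp: zero_less_mult_iff)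
  qed
  have "K \<subseteq> U"
  proof
    fix p assume "p \<in> K"
    then have "p \<in> box l u" unfolding K_def box_pt_mem using inside lu by auto
    then show "p \<in> U" using assms by blast
  qed
  have zero: "cut_box l u k p = 0" if "p \<notin> K" for p
  proof (rule ccontr)
    assume "cut_box l u k p \<noteq> 0"
    then have "1 \<le> r (fst l) (fst u) (fst p)" "1 \<le> r (fst (snd l)) (fst (snd u)) (fst (snd p))"
      "1 \<le> r (snd (snd l)) (snd (snd u)) (snd (snd p))"
      unfolding cut_box_def r_def by (auto dest!: cut_interval_support)
    moreover from this have "p \<in> cbox l u" unfolding cbox_pt_mem using inside lu by fastforce
    ultimately show False using that unfolding K_def by simp
  qed
  have c: "continuous_on UNIV (\<lambda>x. cut' (real k * ((x - a) * (b - x)) - 1) * (real k * ((b - x) - (x - a))))" for a b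
    by (intro continuous_intros continuous_on_compose2[OF cut_cont]) auto
  show ?thesis
    unfolding cut_box_def[abs_def]
    by (rule test_fn_prod3[OF cut_interval_deriv c cut_interval_deriv c cut_interval_deriv c
          \<open>compact K\<close> \<open>K \<subseteq> U\<close> zero[unfolded cut_box_def]])
qed

lemma cut_interval_bounds: "0 \<le> cut_interval l u k x" "cut_interval l u k x \<le> 1"
  unfolding cut_interval_def by (simp_all add: cut_bounds)

lemma cut_interval_lim: "l < x \<Longrightarrow> x < u \<Longrightarrow> (\<lambda>k. cut_interval l u k x) \<longlonglongrightarrow> 1"
  unfolding cut_interval_def by (intro cut_lim) simp

lemma cut_box_lim:
  assumes "box l u \<noteq> {}" shows "(\<lambda>k. cut_box l u k p) \<longlonglongrightarrow> indicator (box l u) p"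
proof (cases "p \<in> box l u")
  case True
  then have "(\<lambda>k. cut_box l u k p) \<longlonglongrightarrow> 1 * 1 * 1"
    unfolding cut_box_def box_pt_mem by (intro tendsto_mult cut_interval_lim) auto
  then show ?thesis using True by simp
next
  case False
  have "cut_box l u k p = 0" for k
  proof -
    have "test_fn (box l u) (cut_box l u k)" using cut_box_test_fn[OF assms order_refl] .
    then show ?thesis using False by (metis in_mono test_fn_support)
  qed
  then show ?thesis using False by simp
qed

lemma cut_box_bounds: "0 \<le> cut_box l u k p" "cut_box l u k p \<le> 1"
  unfolding cut_box_def
  by (simp_all add: cut_interval_bounds mult_le_one)

lemma integrable_cbox: "loc_int f \<Longrightarrow> integrable lborel (\<lambda>p. indicator (cbox l u) p *\<^sub>R f p)"
  unfolding loc_int_def by auto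

text \<open>The fundamental lemma of the calculus of variations. The cut-offs of a box converge to
  its indicator, so \<open>f\<close> integrates to zero over every box in \<open>U\<close> and then
  over every Borel subset of such a box; countably many boxes cover \<open>U\<close>.\<close>

lemma AE_zero_of_test_fn:
  assumes U: "open U" and f: "loc_int f"
    and zero: "\<And>\<phi>. test_fn U \<phi> \<Longrightarrow> (LINT p|lborel. f p * complex_of_real (\<phi> p)) = 0"
  shows "AE p in lborel. p \<in> U \<longrightarrow> f p = 0"
proof -
  have [measurable]: "f \<in> borel_measurable borel" using f unfolding loc_int_def by simp
  have box_zero: "(LINT p|lborel. indicator (box l u) p *\<^sub>R f p) = 0" if "box l u \<subseteq> U" for l u :: pt
  proof (cases "box l u = {}")
    case False
    have [measurable]: "cut_box l u k \<in> borel_measurable borel" for k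
      using test_fn_continuous[OF cut_box_test_fn[OF False that]] by (rule borel_measurable_continuous_onI)
    have "(\<lambda>k. LINT p|lborel. f p * complex_of_real (cut_box l u k p)) \<longlonglongrightarrow> (LINT p|lborel. indicator (box l u) p *\<^sub>R f p)"
    proof (rule integral_dominated_convergence[where w = "\<lambda>p. norm (indicator (cbox l u) p *\<^sub>R f p)"])
      show "integrable lborel (\<lambda>p. norm (indicator (cbox l u) p *\<^sub>R f p))"
        using integrable_cbox[OF f] by (rule integrable_norm)
      show "AE p in lborel. (\<lambda>k. f p * complex_of_real (cut_box l u k p)) \<longlonglongrightarrow> indicator (box l u) p *\<^sub>R f p"
      proof (rule AE_I2)
        fix p
        have "(\<lambda>k. cut_box l u k p *\<^sub>R f p) \<longlonglongrightarrow> indicator (box l u) p *\<^sub>R f p"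
          by (intro tendsto_intros cut_box_lim False)
        then show "(\<lambda>k. f p * complex_of_real (cut_box l u k p)) \<longlonglongrightarrow> indicator (box l u) p *\<^sub>R f p"
          by (simp add: scaleR_conv_of_real mult.commute)
      qed
      show "AE p in lborel. norm (f p * complex_of_real (cut_box l u k p)) \<le> norm (indicator (cbox l u) p *\<^sub>R f p)" for k
      proof (rule AE_I2)
        fix p
        obtain K where K: "K \<subseteq> box l u" "\<And>p. p \<notin> K \<Longrightarrow> cut_box l u k p = 0"
          using test_fn_support[OF cut_box_test_fn[OF False order_refl]] by metis
        show "norm (f p * complex_of_real (cut_box l u k p)) \<le> norm (indicator (cbox l u) p *\<^sub>R f p)"
        proof (cases "p \<in> K")
          case True
          then have "p \<in> cbox l u" using K box_subset_cbox by blast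
          then show ?thesis using cut_box_bounds[of l u k p]
            by (simp add: norm_mult mult_left_le)
        qed (simp add: K)
      qed
    qed measurable
    moreover have "(LINT p|lborel. f p * complex_of_real (cut_box l u k p)) = 0" for k
      by (intro zero cut_box_test_fn False that)
    ultimately show ?thesis by (simp add: LIMSEQ_const_iff)
  qed simp
  have box_AE: "AE p in lborel. p \<in> box l u \<longrightarrow> f p = 0" if lu: "box l u \<subseteq> U" for l u :: pt
  proof -
    \<comment> \<open>Restriction to the box makes \<open>f\<close> integrable, and the intersection
      with another box is again a box in \<open>U\<close>.\<close>
    define F where "F = (\<lambda>p. indicator (box l u) p *\<^sub>R f p)"
    have F: "integrable lborel F"
      unfolding F_def by (rule Bochner_Integration.integrable_bound[OF integrable_cbox[OF f, of l u]])
        (use box_subset_cbox[of l u] in \<open>auto simp: indicator_def intro!: AE_I2\<close>)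
    have "AE p in lborel. F p = 0"
    proof (rule sigma_finite_measure.density_zero[OF sigma_finite_lborel F])
      fix A :: "pt set" assume "A \<in> sets lborel"
      have "(LINT p:box a b|lborel. F p) = 0" for a b
      proof -
        obtain a' b' where ab: "box l u \<inter> box a b = box a' b'" using box_Int_box by blast
        then have "box a' b' \<subseteq> U" using lu by blast
        then have "(LINT p|lborel. indicator (box a' b') p *\<^sub>R f p) = 0" by (rule box_zero)
        then show ?thesis unfolding set_lebesgue_integral_def F_def ab[symmetric]
          by (simp add: indicator_inter_arith mult.commute)
      qed
      then show "(LINT p:A|lborel. F p) = 0"
        by (rule set_integral_zero_of_boxes[OF F])
          (use \<open>A \<in> sets lborel\<close> box_zero[OF lu] in \<open>auto simp: F_def\<close>)
    qed
    then show ?thesis by eventually_elim (auto simp: F_def)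
  qed
  obtain \<D> where \<D>: "countable \<D>" "\<D> \<subseteq> Pow U" "\<And>X. X \<in> \<D> \<Longrightarrow> \<exists>a b. X = box a b" "\<Union>\<D> = U"
    using open_countable_Union_open_box[OF U] by metis
  have "AE p in lborel. \<forall>X\<in>\<D>. p \<in> X \<longrightarrow> f p = 0"
    unfolding AE_ball_countable[OF \<D>(1)] using \<D>(2,3) box_AE by (metis PowD in_mono)
  then show ?thesis by eventually_elim (use \<D>(4) in blast)
qed

section \<open>Weak gradients along measure-preserving flows\<close>

lemma loc_int_measurable [measurable_dest]: "loc_int f \<Longrightarrow> f \<in> borel_measurable borel"
  unfolding loc_int_def by simp

lemma loc_int_integrable: "loc_int f \<Longrightarrow> compact K \<Longrightarrow> integrable lborel (\<lambda>p. indicator K p *\<^sub>R f p)"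
  unfolding loc_int_def by simp

lemma L2_loc_int:
  assumes "L2 u" shows "loc_int u"
  unfolding loc_int_def
proof (intro conjI allI impI)
  fix K :: "pt set" assume K: "compact K"
  have "K \<in> sets borel" using K by (rule borel_compact)
  then have "L2 (\<lambda>p. complex_of_real (indicator K p))"
    by (intro L2_compact_support[OF _ K, where C = 1]) (auto simp: indicator_def)
  from L2_prod_integrable'[OF this assms]
  show "integrable lborel (\<lambda>p. indicator K p *\<^sub>R u p)" by (simp add: scaleR_conv_of_real)
qed (rule L2_measurable[OF assms])

lemma loc_int_mult_continuous:
  assumes f: "loc_int f" and c: "continuous_on UNIV (c :: fn)"
  shows "loc_int (\<lambda>p. c p * f p)"
  unfolding loc_int_def
proof (intro conjI allI impI)
  have [measurable]: "c \<in> borel_measurable borel" "f \<in> borel_measurable borel"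
    using borel_measurable_continuous_onI[OF c] f unfolding loc_int_def by auto
  show "(\<lambda>p. c p * f p) \<in> borel_measurable borel" by measurable
  fix K :: "pt set" assume K: "compact K"
  have [measurable]: "K \<in> sets borel" using K by (rule borel_compact)
  have "compact (c ` K)" using K c by (intro compact_continuous_image) (auto intro: continuous_on_subset)
  then obtain C where C: "\<And>x. x \<in> c ` K \<Longrightarrow> norm x \<le> C" using compact_imp_bounded bounded_iff by metis
  show "integrable lborel (\<lambda>p. indicator K p *\<^sub>R (c p * f p))"
  proof (rule Bochner_Integration.integrable_bound)
    show "integrable lborel (\<lambda>p. C *\<^sub>R (indicator K p *\<^sub>R f p))"
      using loc_int_integrable[OF f K] by (rule integrable_scaleR_right)
    show "AE p in lborel. norm (indicator K p *\<^sub>R (c p * f p)) \<le> norm (C *\<^sub>R (indicator K p *\<^sub>R f p))"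
    proof (rule AE_I2)
      fix p
      show "norm (indicator K p *\<^sub>R (c p * f p)) \<le> norm (C *\<^sub>R (indicator K p *\<^sub>R f p))"
      proof (cases "p \<in> K")
        case True
        then have "norm (c p) \<le> \<bar>C\<bar>" using C[of "c p"] by force
        then show ?thesis using True by (simp add: norm_mult mult_right_mono)
      qed simp
    qed
  qed measurable
qed

lemma loc_int_add: "loc_int f \<Longrightarrow> loc_int h \<Longrightarrow> loc_int (\<lambda>p. f p + h p)"
  and loc_int_diff: "loc_int f \<Longrightarrow> loc_int h \<Longrightarrow> loc_int (\<lambda>p. f p - h p)"
  unfolding loc_int_def by (auto simp: scaleR_add_right scaleR_diff_right)

lemma loc_int_zero: "loc_int (\<lambda>p. 0)" unfolding loc_int_def by simp

lemma loc_int_sum: "finite I \<Longrightarrow> (\<And>i. i \<in> I \<Longrightarrow> loc_int (f i)) \<Longrightarrow> loc_int (\<lambda>p. \<Sum>i\<in>I. f i p)"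
  by (induction I rule: finite_induct) (auto intro: loc_int_zero loc_int_add)

lemma loc_int_mult_test:
  assumes f: "loc_int f" and c: "continuous_on UNIV (c :: fn)" "compact K" "\<And>p. p \<notin> K \<Longrightarrow> c p = 0"
  shows "integrable lborel (\<lambda>p. f p * c p)"
proof -
  have "(\<lambda>p. f p * c p) = (\<lambda>p. indicator K p *\<^sub>R (c p * f p))"
    using c(3) by (auto simp: indicator_def fun_eq_iff)
  then show ?thesis using loc_int_integrable[OF loc_int_mult_continuous[OF f c(1)] c(2)] by simp
qed

text \<open>\<open>\<Psi> t\<close> is the inverse of \<open>\<Phi> t\<close>. Joint continuity
  makes the set swept out by a compact set in bounded time compact, which keeps all applications of
  Fubini's theorem local.\<close>

locale mp_flow =
  fixes \<Phi> \<Psi> :: "real \<Rightarrow> pt \<Rightarrow> pt"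
  assumes cont_\<Phi>: "continuous_on UNIV (\<lambda>x. \<Phi> (fst x) (snd x))" and cont_\<Psi>: "continuous_on UNIV (\<lambda>x. \<Psi> (fst x) (snd x))"
    and \<Psi>_\<Phi>: "\<And>t p. \<Psi> t (\<Phi> t p) = p" and \<Phi>_\<Psi>: "\<And>t p. \<Phi> t (\<Psi> t p) = p"
    and distr_\<Phi>: "\<And>t. distr lborel borel (\<Phi> t) = lborel"
begin

lemma cont_\<Phi>1: "continuous_on UNIV (\<Phi> t)" and cont_\<Psi>1: "continuous_on UNIV (\<Psi> t)"
proof -
  have c: "continuous_on UNIV (\<lambda>p. (t, p))" by (intro continuous_intros)
  show "continuous_on UNIV (\<Phi> t)" "continuous_on UNIV (\<Psi> t)"
    using continuous_on_compose2[OF cont_\<Phi> c] continuous_on_compose2[OF cont_\<Psi> c] by simp_all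
qed

lemma cont_\<Phi>2: "continuous_on UNIV (\<lambda>t. \<Phi> t p)"
proof -
  have c: "continuous_on UNIV (\<lambda>t. (t, p))" by (intro continuous_intros)
  show ?thesis using continuous_on_compose2[OF cont_\<Phi> c] by simp
qed

lemma meas_\<Phi> [measurable]: "\<Phi> t \<in> borel_measurable borel" and meas_\<Psi> [measurable]: "\<Psi> t \<in> borel_measurable borel"
  using cont_\<Phi>1 cont_\<Psi>1 by (auto intro: borel_measurable_continuous_onI)

lemma nn_integral_\<Phi>:
  assumes [measurable]: "f \<in> borel_measurable borel"
  shows "(\<integral>\<^sup>+p. f (\<Phi> t p) \<partial>lborel) = (\<integral>\<^sup>+p. f p \<partial>lborel)"
  by (subst (2) distr_\<Phi>[of t, symmetric]) (simp add: nn_integral_distr)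

lemma nn_integral_\<Psi>:
  assumes [measurable]: "f \<in> borel_measurable borel"
  shows "(\<integral>\<^sup>+p. f (\<Psi> t p) \<partial>lborel) = (\<integral>\<^sup>+p. f p \<partial>lborel)"
  using nn_integral_\<Phi>[of "\<lambda>p. f (\<Psi> t p)" t] by (simp add: \<Psi>_\<Phi>)

lemma integral_\<Phi>:
  fixes f :: "pt \<Rightarrow> complex"
  assumes [measurable]: "f \<in> borel_measurable borel"
  shows "(LINT p|lborel. f (\<Phi> t p)) = (LINT p|lborel. f p)"
  by (subst (2) distr_\<Phi>[of t, symmetric]) (simp add: integral_distr)

lemma meas_joint:
  assumes "f \<in> borel_measurable borel"
  shows "(\<lambda>x. f (\<Psi> (fst x) (snd x))) \<in> borel_measurable (lborel \<Otimes>\<^sub>M lborel)"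
proof -
  have "(\<lambda>x. \<Psi> (fst x) (snd x)) \<in> borel_measurable (borel :: (real \<times> pt) measure)"
    using cont_\<Psi> by (rule borel_measurable_continuous_onI)
  from measurable_compose[OF this assms] show ?thesis by (simp add: lborel_prod)
qed

text \<open>Up to time \<open>T\<close> the compact set \<open>K\<close> sweeps out a compact set
  \<open>K'\<close>. By invariance of the measure every time slice is bounded by the integral of
  \<open>|H|\<close> over \<open>K'\<close>.\<close>

lemma integrable_product:
  assumes H: "loc_int H" and K: "compact K"
  shows "integrable (lborel \<Otimes>\<^sub>M lborel) (\<lambda>(t, p). (indicator {0..T} t * indicator K p) *\<^sub>R H (\<Psi> t p))"
proof -
  define K' where "K' = (\<lambda>x. \<Psi> (fst x) (snd x)) ` ({0..T} \<times> K)"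
  have K': "compact K'"
    unfolding K'_def using K cont_\<Psi> by (intro compact_continuous_image compact_Times) (auto intro: continuous_on_subset)
  have [measurable]: "K \<in> sets borel" "K' \<in> sets borel" using K K' by (auto intro: borel_compact)
  have [measurable]: "H \<in> borel_measurable borel" using H by (rule loc_int_measurable)
  note [measurable] = meas_joint[of H]
  have meas: "(\<lambda>x. (indicator {0..T} (fst x) * indicator K (snd x)) *\<^sub>R H (\<Psi> (fst x) (snd x))) \<in> borel_measurable (lborel \<Otimes>\<^sub>M lborel)"
    by measurable
  define I where "I = (\<integral>\<^sup>+p. ennreal (norm (indicator K' p *\<^sub>R H p)) \<partial>lborel)"
  have I: "I < \<infinity>" unfolding I_def using loc_int_integrable[OF H K'] unfolding integrable_iff_bounded by simp
  have inner: "(\<integral>\<^sup>+p. ennreal (norm ((indicator {0..T} t * indicator K p) *\<^sub>R H (\<Psi> t p))) \<partial>lborel) \<le> I * indicator {0..T} t" for t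
  proof (cases "t \<in> {0..T}")
    case True
    have "(\<integral>\<^sup>+p. ennreal (norm ((indicator {0..T} t * indicator K p) *\<^sub>R H (\<Psi> t p))) \<partial>lborel)
        \<le> (\<integral>\<^sup>+p. ennreal (norm (indicator K' (\<Psi> t p) *\<^sub>R H (\<Psi> t p))) \<partial>lborel)"
    proof (rule nn_integral_mono)
      fix p
      have "\<Psi> t p \<in> K'" if "p \<in> K" unfolding K'_def using True that by (intro image_eqI[of _ _ "(t, p)"]) auto
      then show "ennreal (norm ((indicator {0..T} t * indicator K p) *\<^sub>R H (\<Psi> t p))) \<le> ennreal (norm (indicator K' (\<Psi> t p) *\<^sub>R H (\<Psi> t p)))"
        by (auto simp: indicator_def)
    qed
    also have "\<dots> = I" unfolding I_def by (rule nn_integral_\<Psi>) measurable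
    finally show ?thesis using True by simp
  qed simp
  have "(\<integral>\<^sup>+x. ennreal (norm ((indicator {0..T} (fst x) * indicator K (snd x)) *\<^sub>R H (\<Psi> (fst x) (snd x)))) \<partial>(lborel \<Otimes>\<^sub>M lborel))
      = (\<integral>\<^sup>+t. \<integral>\<^sup>+p. ennreal (norm ((indicator {0..T} t * indicator K p) *\<^sub>R H (\<Psi> t p))) \<partial>lborel \<partial>lborel)"
    using meas by (subst lborel.nn_integral_fst[symmetric]) auto
  also have "\<dots> \<le> (\<integral>\<^sup>+t. I * indicator {0..T} t \<partial>lborel)" by (intro nn_integral_mono inner)
  also have "\<dots> = I * ennreal (max 0 T)"
    by (subst nn_integral_cmult_indicator) (auto simp: emeasure_lborel_Icc_eq max_def)
  also have "\<dots> < \<infinity>" using I by (simp add: ennreal_mult_less_top)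
  finally show ?thesis using meas by (simp add: integrable_iff_bounded case_prod_beta)
qed

end

text \<open>The constant flow, with which \<open>integrable_product\<close> also covers functions
  that are not transported.\<close>

lemma mp_flow_id: "mp_flow (\<lambda>_ p. p) (\<lambda>_ p. p)"
  by unfold_locales (auto intro!: continuous_intros simp: distr_id2 sets_lborel)

lemma weak_grad_integral:
  assumes "weak_grad U u g" "j < 3" "test_fn U \<phi>"
  shows "(LINT p|lborel. u p * complex_of_real (pd \<phi> j p)) = - (LINT p|lborel. g j p * complex_of_real (\<phi> p))"
  using assms unfolding weak_grad_def by blast

lemma weak_grad_L2: "weak_grad U u g \<Longrightarrow> j < 3 \<Longrightarrow> L2 (g j)"
  unfolding weak_grad_def by blast

lemma continuous_on_frechet_test_fn:
  assumes "test_fn V \<phi>" "continuous_on UNIV F" "continuous_on UNIV Y"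
  shows "continuous_on UNIV (\<lambda>x. frechet_derivative \<phi> (at (F x)) (Y x))"
  unfolding frechet_pd[OF test_fn_differentiable[OF assms(1)]]
  by (intro continuous_intros assms continuous_on_compose2[OF test_fn_pd_continuous[OF assms(1)]]) auto

text \<open>Both the translations and the twisted rotations about the \<open>z\<close>-axis transport the weak gradient.
  The vector field \<open>X\<close> generating the flow enters through test functions \<open>X\<^sub>j (\<phi> \<circ> \<Phi>\<^sub>t)\<close>
  with \<open>\<partial>\<^sub>j X\<^sub>j = 0\<close>; the pointwise identity follows by duality, since integrating along the
  flow moves onto the test function.\<close>

lemma (in mp_flow) flow_identity:
  fixes u :: fn and g :: vfn and X :: "nat \<Rightarrow> pt \<Rightarrow> real" and Y :: "pt \<Rightarrow> pt" and \<beta> T :: real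
  assumes u: "L2 u" and wg: "weak_grad U u g" and V: "open V" and T: "T \<ge> 0"
    and X: "\<And>j. j < 3 \<Longrightarrow> continuous_on UNIV (X j)"
    and \<Phi>0: "\<And>p. \<Phi> 0 p = p"
    and Y: "continuous_on UNIV Y" "\<And>t p. ((\<lambda>t. \<Phi> t p) has_vector_derivative Y (\<Phi> t p)) (at t)"
    and test: "\<And>\<phi> t j. test_fn V \<phi> \<Longrightarrow> 0 \<le> t \<Longrightarrow> t \<le> T \<Longrightarrow> j < 3 \<Longrightarrow> test_fn U (\<lambda>p. X j p * \<phi> (\<Phi> t p))"
    and div: "\<And>\<phi> t p. test_fn V \<phi> \<Longrightarrow> (\<Sum>j<3. pd (\<lambda>p. X j p * \<phi> (\<Phi> t p)) j p) = frechet_derivative \<phi> (at (\<Phi> t p)) (Y (\<Phi> t p))"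
  defines "H \<equiv> \<lambda>p. \<i> * \<beta> * u p - (\<Sum>j<3. complex_of_real (X j p) * g j p)"
  shows "AE p in lborel. p \<in> V \<longrightarrow>
    exp (\<i> * \<beta> * T) * u (\<Psi> T p) - u p = (LINT t|lborel. indicator {0..T} t *\<^sub>R (exp (\<i> * \<beta> * t) * H (\<Psi> t p)))"
proof -
  note gL2 = weak_grad_L2[OF wg]
  have H_loc: "loc_int H"
    unfolding H_def using X gL2 u
    by (intro loc_int_diff loc_int_sum loc_int_mult_continuous L2_loc_int continuous_intros) auto
  have [measurable]: "u \<in> borel_measurable borel" "H \<in> borel_measurable borel"
    using u H_loc by (auto dest: L2_measurable loc_int_measurable)
  define E :: "real \<Rightarrow> complex" where "E = (\<lambda>t. exp (\<i> * \<beta> * t))"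
  have E_norm: "norm (E t) = 1" for t unfolding E_def by (metis exp_Ln norm_exp_i_times mult.assoc of_real_mult)
  have E_cont: "continuous_on S (\<lambda>x. E (h x))" if "continuous_on S h" for S :: "'z::topological_space set" and h
    unfolding E_def using that by (intro continuous_intros)
  have E_meas [measurable]: "E \<in> borel_measurable borel"
    using E_cont[of UNIV "\<lambda>x. x"] by (intro borel_measurable_continuous_onI) auto
  define J where "J = (\<lambda>p. LINT t|lborel. indicator {0..T} t *\<^sub>R (E t * H (\<Psi> t p)))"
  \<comment> \<open>The defect of the identity. It is shown to vanish against every test
    function.\<close>
  define f where "f = (\<lambda>p. E T * u (\<Psi> T p) - u p - J p)"
  have prodH: "integrable (lborel \<Otimes>\<^sub>M lborel) (\<lambda>(t, p). indicator {0..T} t *\<^sub>R (E t * H (\<Psi> t p) * c p))"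
    if c: "c \<in> borel_measurable borel" "compact K" "\<And>p. p \<notin> K \<Longrightarrow> c p = 0" "\<And>p. cmod (c p) \<le> C" for c :: fn and K C
  proof (rule Bochner_Integration.integrable_bound)
    note [measurable] = meas_joint[of H] c(1)
    show "integrable (lborel \<Otimes>\<^sub>M lborel) (\<lambda>x. C *\<^sub>R (case x of (t, p) \<Rightarrow> (indicator {0..T} t * indicator K p) *\<^sub>R H (\<Psi> t p)))"
      by (rule integrable_scaleR_right[OF integrable_product[OF H_loc c(2)]])
    show "(\<lambda>(t, p). indicator {0..T} t *\<^sub>R (E t * H (\<Psi> t p) * c p)) \<in> borel_measurable (lborel \<Otimes>\<^sub>M lborel)"
      unfolding case_prod_beta by measurable
    show "AE x in lborel \<Otimes>\<^sub>M lborel. norm (case x of (t, p) \<Rightarrow> indicator {0..T} t *\<^sub>R (E t * H (\<Psi> t p) * c p))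
        \<le> norm (C *\<^sub>R (case x of (t, p) \<Rightarrow> (indicator {0..T} t * indicator K p) *\<^sub>R H (\<Psi> t p)))"
    proof (rule AE_I2)
      fix x :: "real \<times> pt"
      obtain t p where x: "x = (t, p)" by fastforce
      have "cmod (c p) \<le> \<bar>C\<bar>" using c(4)[of p] by simp
      then show "norm (case x of (t, p) \<Rightarrow> indicator {0..T} t *\<^sub>R (E t * H (\<Psi> t p) * c p))
        \<le> norm (C *\<^sub>R (case x of (t, p) \<Rightarrow> (indicator {0..T} t * indicator K p) *\<^sub>R H (\<Psi> t p)))"
        using c(3)[of p] unfolding x
        by (cases "p \<in> K") (auto simp: indicator_def norm_mult E_norm mult.commute[of "\<bar>C\<bar>"] intro: mult_left_mono)
    qed
  qed
  have J_int: "integrable lborel (\<lambda>p. J p * c p)"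
    if c: "c \<in> borel_measurable borel" "compact K" "\<And>p. p \<notin> K \<Longrightarrow> c p = 0" "\<And>p. cmod (c p) \<le> C" for c :: fn and K C
  proof -
    have "integrable lborel (\<lambda>p. LINT t|lborel. indicator {0..T} t *\<^sub>R (E t * H (\<Psi> t p) * c p))"
      using lborel_pair.integrable_snd[OF prodH[OF c]] by simp
    moreover have "(LINT t|lborel. indicator {0..T} t *\<^sub>R (E t * H (\<Psi> t p) * c p)) = J p * c p" for p
      unfolding J_def by (subst integral_mult_left_zero[symmetric]) simp
    ultimately show ?thesis by simp
  qed
  have J_meas [measurable]: "J \<in> borel_measurable borel"
  proof -
    have "continuous_on UNIV (\<lambda>x :: pt \<times> real. (snd x, fst x))" by (intro continuous_intros)
    then have "continuous_on UNIV (\<lambda>x. \<Psi> (snd x) (fst x))"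
      using continuous_on_compose2[OF cont_\<Psi>, of UNIV "\<lambda>x. (snd x, fst x)"] by simp
    then have "(\<lambda>x. \<Psi> (snd x) (fst x)) \<in> borel_measurable (borel :: (pt \<times> real) measure)"
      by (rule borel_measurable_continuous_onI)
    from measurable_compose[OF this, of H borel]
    have [measurable]: "(\<lambda>x. H (\<Psi> (snd x) (fst x))) \<in> borel_measurable (lborel \<Otimes>\<^sub>M lborel)"
      by (simp add: lborel_prod)
    have "(\<lambda>x. indicator {0..T} (snd x) *\<^sub>R (E (snd x) * H (\<Psi> (snd x) (fst x)))) \<in> borel_measurable (lborel \<Otimes>\<^sub>M lborel)"
      by measurable
    then have "J \<in> borel_measurable lborel" unfolding J_def
      by (intro lborel.borel_measurable_lebesgue_integral) (simp add: case_prod_beta)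
    then show ?thesis by simp
  qed
  have uT_loc: "loc_int (\<lambda>p. u (\<Psi> T p))"
  proof (rule L2_loc_int, rule L2I_nn)
    show "(\<integral>\<^sup>+p. ennreal ((cmod (u (\<Psi> T p)))\<^sup>2) \<partial>lborel) < \<infinity>"
      using nn_integral_\<Psi>[of "\<lambda>p. ennreal ((cmod (u p))\<^sup>2)" T] nn_integral_cls[OF u] by simp
  qed measurable
  have J_loc: "loc_int J"
    unfolding loc_int_def
  proof (intro conjI allI impI J_meas)
    fix K :: "pt set" assume K: "compact K"
    have [measurable]: "K \<in> sets borel" using K by (rule borel_compact)
    have "integrable lborel (\<lambda>p. J p * complex_of_real (indicator K p))"
      by (rule J_int[of "\<lambda>p. complex_of_real (indicator K p)" K 1]) (auto simp: indicator_def K)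
    then show "integrable lborel (\<lambda>p. indicator K p *\<^sub>R J p)" by (simp add: scaleR_conv_of_real mult.commute)
  qed
  have ETu_loc: "loc_int (\<lambda>p. E T * u (\<Psi> T p))"
    by (rule loc_int_mult_continuous[OF uT_loc continuous_on_const])
  have f_loc: "loc_int f"
    unfolding f_def by (intro loc_int_diff ETu_loc J_loc L2_loc_int u)
  have "AE p in lborel. p \<in> V \<longrightarrow> f p = 0"
  proof (rule AE_zero_of_test_fn[OF V f_loc])
    fix \<phi> assume \<phi>: "test_fn V \<phi>"
    obtain S where S: "compact S" "S \<subseteq> V" "\<And>p. p \<notin> S \<Longrightarrow> \<phi> p = 0" "\<And>p j. p \<notin> S \<Longrightarrow> pd \<phi> j p = 0"
      using test_fn_support[OF \<phi>] by metis
    have \<phi>_cont: "continuous_on UNIV \<phi>" by (rule test_fn_continuous[OF \<phi>])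
    define c where "c = (\<lambda>p. complex_of_real (\<phi> p))"
    have c_cont: "continuous_on UNIV c" unfolding c_def by (intro continuous_intros \<phi>_cont)
    have c_zero: "c p = 0" if "p \<notin> S" for p using S(3)[OF that] by (simp add: c_def)
    obtain C where C: "\<And>p. cmod (c p) \<le> C" using continuous_compact_support_bounded[OF c_cont S(1) c_zero] by blast
    have c_meas [measurable]: "c \<in> borel_measurable borel" by (rule borel_measurable_continuous_onI[OF c_cont])
    define \<psi> where "\<psi> = (\<lambda>t p. frechet_derivative \<phi> (at (\<Phi> t p)) (Y (\<Phi> t p)))"
    \<comment> \<open>The time derivative of \<open>E t * c (\<Phi> t p)\<close>.\<close>
    define L where "L = (\<lambda>t p. E t * (\<i> * \<beta> * c (\<Phi> t p) + complex_of_real (\<psi> t p)))"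
    have \<psi>_cont: "continuous_on UNIV (\<lambda>x. \<psi> (fst x) (snd x))"
      unfolding \<psi>_def by (intro continuous_on_frechet_test_fn[OF \<phi>] cont_\<Phi> continuous_on_compose2[OF Y(1) cont_\<Phi>]) auto
    have L_cont: "continuous_on UNIV (\<lambda>x. L (fst x) (snd x))"
      unfolding L_def by (intro continuous_intros E_cont \<psi>_cont continuous_on_compose2[OF c_cont cont_\<Phi>]) auto
    define S' where "S' = (\<lambda>x. \<Psi> (fst x) (snd x)) ` ({0..T} \<times> S)"
    have S': "compact S'"
      unfolding S'_def using S(1) cont_\<Psi> by (intro compact_continuous_image compact_Times) (auto intro: continuous_on_subset)
    have S'_mem: "p \<in> S'" if "\<Phi> t p \<in> S" "t \<in> {0..T}" for t p
      unfolding S'_def using that \<Psi>_\<Phi>[of t p] by (intro image_eqI[of _ _ "(t, \<Phi> t p)"]) auto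
    have S'_zero: "c (\<Phi> t p) = 0" "\<psi> t p = 0" if "p \<notin> S'" "t \<in> {0..T}" for t p
    proof -
      have "\<Phi> t p \<notin> S" using S'_mem[OF _ that(2)] that(1) by blast
      then show "c (\<Phi> t p) = 0" "\<psi> t p = 0"
        unfolding c_def \<psi>_def frechet_pd[OF test_fn_differentiable[OF \<phi>]] by (simp_all add: S(3,4))
    qed
    have FTC: "(LINT t|lborel. indicator {0..T} t *\<^sub>R L t p) = E T * c (\<Phi> T p) - c p" for p
    proof -
      have "(LINT t|lborel. indicator {0..T} t *\<^sub>R L t p) = E T * c (\<Phi> T p) - E 0 * c (\<Phi> 0 p)"
      proof (rule integral_FTC_atLeastAtMost[OF T])
        show "continuous_on {0..T} (\<lambda>t. L t p)"
        proof -
          have "continuous_on UNIV (\<lambda>t. (t, p))" by (intro continuous_intros)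
          from continuous_on_compose2[OF L_cont this] show ?thesis by (auto intro: continuous_on_subset)
        qed
        fix t :: real
        have "(\<phi> has_derivative frechet_derivative \<phi> (at (\<Phi> t p))) (at (\<Phi> t p))"
          using test_fn_differentiable[OF \<phi>] frechet_derivative_works by blast
        from vector_derivative_diff_chain_within[OF Y(2) has_derivative_at_withinI[OF this]]
        have "((\<lambda>t. \<phi> (\<Phi> t p)) has_vector_derivative \<psi> t p) (at t)"
          by (simp add: \<psi>_def o_def)
        then have 1: "((\<lambda>t. c (\<Phi> t p)) has_vector_derivative complex_of_real (\<psi> t p)) (at t)"
          unfolding c_def by (rule bounded_linear.has_vector_derivative[OF bounded_linear_of_real])
        have 2: "(E has_vector_derivative (\<i> * \<beta> * E t)) (at t)"
          unfolding E_def
          by (rule has_vector_derivative_real_field[of "\<lambda>z. exp (\<i> * \<beta> * z)"]) (auto intro!: derivative_eq_intros)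
        have "((\<lambda>t. E t * c (\<Phi> t p)) has_vector_derivative (E t * complex_of_real (\<psi> t p) + \<i> * \<beta> * E t * c (\<Phi> t p))) (at t)"
          by (rule has_vector_derivative_mult[OF 2 1])
        then show "((\<lambda>t. E t * c (\<Phi> t p)) has_vector_derivative L t p) (at t within {0..T})"
        proof (rule has_vector_derivative_at_within[OF has_vector_derivative_eq_rhs])
          show "E t * complex_of_real (\<psi> t p) + \<i> * \<beta> * E t * c (\<Phi> t p) = L t p"
            unfolding L_def by (simp only: distrib_left mult_ac add_ac)
        qed
      qed
      then show ?thesis by (simp add: E_def \<Phi>0)
    qed
    have prodL: "integrable (lborel \<Otimes>\<^sub>M lborel) (\<lambda>(t, p). indicator {0..T} t *\<^sub>R (u p * L t p))"
    proof -
      have "compact ((\<lambda>x. L (fst x) (snd x)) ` ({0..T} \<times> S'))"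
        using S' L_cont by (intro compact_continuous_image compact_Times) (auto intro: continuous_on_subset)
      then obtain B where B: "\<And>y. y \<in> (\<lambda>x. L (fst x) (snd x)) ` ({0..T} \<times> S') \<Longrightarrow> norm y \<le> B"
        using compact_imp_bounded bounded_iff by metis
      have B': "norm (L t p) \<le> \<bar>B\<bar>" if "t \<in> {0..T}" "p \<in> S'" for t p
        using B[of "L t p"] that by (force intro!: image_eqI[of _ _ "(t, p)"])
      have L0: "L t p = 0" if "t \<in> {0..T}" "p \<notin> S'" for t p
        unfolding L_def using S'_zero[OF that(2,1)] by simp
      have [measurable]: "(\<lambda>x. L (fst x) (snd x)) \<in> borel_measurable (lborel \<Otimes>\<^sub>M lborel)"
        using borel_measurable_continuous_onI[OF L_cont] by (simp add: lborel_prod)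
      show ?thesis
      proof (rule Bochner_Integration.integrable_bound)
        show "integrable (lborel \<Otimes>\<^sub>M lborel) (\<lambda>x. B *\<^sub>R (case x of (t, p) \<Rightarrow> (indicator {0..T} t * indicator S' p) *\<^sub>R u p))"
          by (rule integrable_scaleR_right[OF mp_flow.integrable_product[OF mp_flow_id L2_loc_int[OF u] S']])
        show "(\<lambda>(t, p). indicator {0..T} t *\<^sub>R (u p * L t p)) \<in> borel_measurable (lborel \<Otimes>\<^sub>M lborel)"
          unfolding case_prod_beta by measurable
        show "AE x in lborel \<Otimes>\<^sub>M lborel. norm (case x of (t, p) \<Rightarrow> indicator {0..T} t *\<^sub>R (u p * L t p))
            \<le> norm (B *\<^sub>R (case x of (t, p) \<Rightarrow> (indicator {0..T} t * indicator S' p) *\<^sub>R u p))"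
        proof (rule AE_I2)
          fix x :: "real \<times> pt"
          obtain t p where x: "x = (t, p)" by fastforce
          show "norm (case x of (t, p) \<Rightarrow> indicator {0..T} t *\<^sub>R (u p * L t p))
            \<le> norm (B *\<^sub>R (case x of (t, p) \<Rightarrow> (indicator {0..T} t * indicator S' p) *\<^sub>R u p))"
            using B'[of t p] L0[of t p] unfolding x
            by (cases "t \<in> {0..T}"; cases "p \<in> S'") (auto simp: norm_mult mult.commute[of "\<bar>B\<bar>"] intro: mult_left_mono)
        qed
      qed
    qed
    \<comment> \<open>An integration by parts at fixed \<open>t\<close>, against
      \<open>X j p * \<phi> (\<Phi> t p)\<close>, followed by the measure-preserving substitution of
      \<open>\<Psi> t p\<close> for \<open>p\<close>.\<close>
    have slice: "(LINT p|lborel. indicator {0..T} t *\<^sub>R (u p * L t p)) = (LINT p|lborel. indicator {0..T} t *\<^sub>R (E t * H (\<Psi> t p) * c p))" for t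
    proof (cases "t \<in> {0..T}")
      case True
      then have t: "0 \<le> t" "t \<le> T" by auto
      note tf = test[OF \<phi> t]
      have c\<Phi>: "integrable lborel (\<lambda>p. v p * c (\<Phi> t p))" if "loc_int v" for v
        by (rule loc_int_mult_test[OF that _ S'])
          (auto intro!: continuous_on_compose2[OF c_cont cont_\<Phi>1] S'_zero True)
      have "(LINT p|lborel. u p * (\<i> * \<beta> * c (\<Phi> t p) + complex_of_real (\<psi> t p)))
          = (LINT p|lborel. \<i> * \<beta> * u p * c (\<Phi> t p) + (\<Sum>j<3. u p * complex_of_real (pd (\<lambda>p. X j p * \<phi> (\<Phi> t p)) j p)))"
        unfolding \<psi>_def div[OF \<phi>, symmetric] by (intro Bochner_Integration.integral_cong refl) (simp add: algebra_simps sum_distrib_left)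
      also have "\<dots> = (LINT p|lborel. \<i> * \<beta> * u p * c (\<Phi> t p)) + (\<Sum>j<3. LINT p|lborel. u p * complex_of_real (pd (\<lambda>p. X j p * \<phi> (\<Phi> t p)) j p))"
      proof -
        have i1: "integrable lborel (\<lambda>p. \<i> * \<beta> * u p * c (\<Phi> t p))"
          by (rule c\<Phi>) (intro loc_int_mult_continuous L2_loc_int u continuous_intros)
        have i2: "integrable lborel (\<lambda>p. u p * complex_of_real (pd (\<lambda>p. X j p * \<phi> (\<Phi> t p)) j p))" if "j \<in> {..<3}" for j
          using that by (intro L2_prod_integrable' u L2_test_fn_pd[OF tf]) auto
        show ?thesis using i1 i2 by (subst Bochner_Integration.integral_add) (auto intro!: Bochner_Integration.integral_sum)
      qed
      also have "\<dots> = (LINT p|lborel. \<i> * \<beta> * u p * c (\<Phi> t p)) - (\<Sum>j<3. LINT p|lborel. complex_of_real (X j p) * g j p * c (\<Phi> t p))"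
      proof -
        have "(LINT p|lborel. u p * complex_of_real (pd (\<lambda>p. X j p * \<phi> (\<Phi> t p)) j p)) = - (LINT p|lborel. complex_of_real (X j p) * g j p * c (\<Phi> t p))"
          if "j < 3" for j
          using weak_grad_integral[OF wg that tf[OF that]] by (simp add: c_def mult_ac)
        then show ?thesis by (simp add: sum_negf)
      qed
      also have "\<dots> = (LINT p|lborel. H p * c (\<Phi> t p))"
      proof -
        have i1: "integrable lborel (\<lambda>p. \<i> * \<beta> * u p * c (\<Phi> t p))"
          by (rule c\<Phi>) (intro loc_int_mult_continuous L2_loc_int u continuous_intros)
        have i2: "integrable lborel (\<lambda>p. complex_of_real (X j p) * g j p * c (\<Phi> t p))" if "j < 3" for j
          by (rule c\<Phi>) (intro loc_int_mult_continuous L2_loc_int gL2 continuous_intros X that)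
        have "(LINT p|lborel. H p * c (\<Phi> t p)) = (LINT p|lborel. \<i> * \<beta> * u p * c (\<Phi> t p) - (\<Sum>j<3. complex_of_real (X j p) * g j p * c (\<Phi> t p)))"
          unfolding H_def by (simp add: left_diff_distrib sum_distrib_right)
        then show ?thesis using i1 i2
          by (subst (asm) Bochner_Integration.integral_diff) (auto simp: Bochner_Integration.integral_sum)
      qed
      also have "\<dots> = (LINT p|lborel. H (\<Psi> t p) * c p)"
        using integral_\<Phi>[of "\<lambda>p. H (\<Psi> t p) * c p" t] by (simp add: \<Psi>_\<Phi>)
      finally have "(LINT p|lborel. u p * (\<i> * \<beta> * c (\<Phi> t p) + complex_of_real (\<psi> t p))) = (LINT p|lborel. H (\<Psi> t p) * c p)" .
      then have "E t * (LINT p|lborel. u p * (\<i> * \<beta> * c (\<Phi> t p) + complex_of_real (\<psi> t p))) = E t * (LINT p|lborel. H (\<Psi> t p) * c p)" by simp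
      then show ?thesis unfolding L_def using True
        by (simp add: mult_ac flip: integral_mult_right_zero)
    qed simp
    \<comment> \<open>The order of integration is exchanged twice: \<open>prodL\<close> covers the
      integrand before the integration by parts, \<open>prodH\<close> the one after it.\<close>
    have "(LINT p|lborel. u p * (E T * c (\<Phi> T p) - c p)) = (LINT p|lborel. LINT t|lborel. indicator {0..T} t *\<^sub>R (u p * L t p))"
      unfolding FTC[symmetric] by (simp flip: integral_mult_right_zero)
    also have "\<dots> = (LINT t|lborel. LINT p|lborel. indicator {0..T} t *\<^sub>R (u p * L t p))"
      by (rule lborel_pair.Fubini_integral[OF prodL])
    also have "\<dots> = (LINT t|lborel. LINT p|lborel. indicator {0..T} t *\<^sub>R (E t * H (\<Psi> t p) * c p))"
      unfolding slice ..
    also have "\<dots> = (LINT p|lborel. LINT t|lborel. indicator {0..T} t *\<^sub>R (E t * H (\<Psi> t p) * c p))"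
      by (rule lborel_pair.Fubini_integral[OF prodH[OF c_meas S(1) c_zero C], symmetric])
    also have "\<dots> = (LINT p|lborel. J p * c p)"
      unfolding J_def by (subst integral_mult_left_zero[symmetric]) simp
    finally have main: "(LINT p|lborel. u p * (E T * c (\<Phi> T p) - c p)) = (LINT p|lborel. J p * c p)" .
    have iT: "integrable lborel (\<lambda>p. E T * u (\<Psi> T p) * c p)" by (rule loc_int_mult_test[OF ETu_loc c_cont S(1) c_zero])
    have iu: "integrable lborel (\<lambda>p. u p * c p)" by (rule loc_int_mult_test[OF L2_loc_int[OF u] c_cont S(1) c_zero])
    have iJ: "integrable lborel (\<lambda>p. J p * c p)" by (rule loc_int_mult_test[OF J_loc c_cont S(1) c_zero])
    have i\<Phi>: "integrable lborel (\<lambda>p. u p * (E T * c (\<Phi> T p)))"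
      by (rule loc_int_mult_test[OF L2_loc_int[OF u] _ S'])
        (use T in \<open>auto intro!: continuous_intros continuous_on_compose2[OF c_cont cont_\<Phi>1] S'_zero\<close>)
    have "(LINT p|lborel. u p * (E T * c (\<Phi> T p))) = (LINT p|lborel. E T * u (\<Psi> T p) * c p)"
      using integral_\<Phi>[of "\<lambda>p. E T * u (\<Psi> T p) * c p" T] by (simp add: \<Psi>_\<Phi> mult_ac)
    then have "(LINT p|lborel. E T * u (\<Psi> T p) * c p) - (LINT p|lborel. u p * c p) = (LINT p|lborel. J p * c p)"
      using main i\<Phi> iu by (simp add: right_diff_distrib)
    moreover have "(LINT p|lborel. f p * c p) = (LINT p|lborel. E T * u (\<Psi> T p) * c p) - (LINT p|lborel. u p * c p) - (LINT p|lborel. J p * c p)"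
      unfolding f_def left_diff_distrib using iT iu iJ by simp
    ultimately show "(LINT p|lborel. f p * complex_of_real (\<phi> p)) = 0" by (simp add: c_def)
  qed
  then show ?thesis
    by eventually_elim (auto simp: f_def J_def E_def)
qed

section \<open>Translations\<close>

lemma test_fn_mono: "test_fn V \<phi> \<Longrightarrow> V \<subseteq> U \<Longrightarrow> test_fn U \<phi>"
  unfolding test_fn_def by auto

lemma weak_grad_mono: "weak_grad U u g \<Longrightarrow> V \<subseteq> U \<Longrightarrow> weak_grad V u g"
  unfolding weak_grad_def using test_fn_mono by blast

lemma test_fn_has_derivative:
  "test_fn U \<phi> \<Longrightarrow> (\<phi> has_derivative frechet_derivative \<phi> (at p)) (at p)"
  using test_fn_differentiable frechet_derivative_works by blast

lemma mp_flow_translation: "mp_flow (\<lambda>t p. p + t *\<^sub>R v) (\<lambda>t p. p - t *\<^sub>R v)"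
proof
  show "distr lborel borel (\<lambda>p. p + t *\<^sub>R v) = lborel" for t
  proof -
    have "(\<lambda>p. p + t *\<^sub>R v) = (+) (t *\<^sub>R v)" by (simp add: fun_eq_iff add.commute)
    then show ?thesis using lborel_distr_plus by metis
  qed
qed (auto intro!: continuous_intros)

definition comp :: "nat \<Rightarrow> pt \<Rightarrow> real" where
  "comp j v = (if j = 0 then fst v else if j = 1 then fst (snd v) else snd (snd v))"

lemma comp_simps [simp]: "comp 0 v = fst v" "comp (Suc 0) v = fst (snd v)" "comp 2 v = snd (snd v)"
  by (simp_all add: comp_def)

lemma sum_less_3: "(\<Sum>j<3. f j) = f 0 + f 1 + f (2::nat)"
  by (simp add: eval_nat_numeral)

text \<open>The fundamental theorem of calculus for weak gradients along segments.
  \<open>flow_identity\<close> transports by the inverse flow, so the flow is given the velocity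
  \<open>- v\<close>.\<close>

lemma translation_identity:
  assumes u: "L2 u" and wg: "weak_grad U u g" and V: "open V"
    and seg: "\<And>p t. p \<in> V \<Longrightarrow> 0 \<le> t \<Longrightarrow> t \<le> 1 \<Longrightarrow> p + t *\<^sub>R v \<in> U"
  shows "AE p in lborel. p \<in> V \<longrightarrow>
    u (p + v) - u p = (LINT t|lborel. indicator {0..1} t *\<^sub>R (\<Sum>j<3. complex_of_real (comp j v) * g j (p + t *\<^sub>R v)))"
proof -
  interpret mp_flow "\<lambda>t p. p + t *\<^sub>R (- v)" "\<lambda>t p. p - t *\<^sub>R (- v)" by (rule mp_flow_translation)
  have pd_shift: "pd (\<lambda>p. c * \<phi> (p + w)) j p = c * pd \<phi> j (p + w)"
    and shift_der: "((\<lambda>p. c * \<phi> (p + w)) has_derivative (\<lambda>h. c * frechet_derivative \<phi> (at (p + w)) h)) (at p)"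
    if "test_fn V \<phi>" for \<phi> c w j p
  proof -
    have "((\<lambda>p. \<phi> (p + w)) has_derivative (\<lambda>h. frechet_derivative \<phi> (at (p + w)) h)) (at p)"
      by (rule has_derivative_compose[OF _ test_fn_has_derivative[OF that], of "\<lambda>p. p + w" "\<lambda>h. h"])
        (auto intro!: derivative_eq_intros)
    then show d: "((\<lambda>p. c * \<phi> (p + w)) has_derivative (\<lambda>h. c * frechet_derivative \<phi> (at (p + w)) h)) (at p)"
      by (rule has_derivative_mult_right)
    show "pd (\<lambda>p. c * \<phi> (p + w)) j p = c * pd \<phi> j (p + w)" using pd_eq[OF d] by (simp add: pd_def)
  qed
  have ae: "AE p in lborel. p \<in> V \<longrightarrow>
    exp (\<i> * complex_of_real 0 * complex_of_real 1) * u (p - 1 *\<^sub>R (- v)) - u p = (LINT t|lborel. indicator {0..1} t *\<^sub>R (exp (\<i> * complex_of_real 0 * complex_of_real t) *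
       (\<i> * complex_of_real 0 * u (p - t *\<^sub>R (- v)) - (\<Sum>j<3. complex_of_real (comp j (- v)) * g j (p - t *\<^sub>R (- v))))))"
  proof (rule flow_identity[OF u wg V, where \<beta> = 0 and T = 1 and X = "\<lambda>j p. comp j (- v)" and Y = "\<lambda>p. - v"])
    show "((\<lambda>t. p + t *\<^sub>R - v) has_vector_derivative - v) (at t)" for t p
      by (auto intro!: derivative_eq_intros)
    fix \<phi> assume \<phi>: "test_fn V \<phi>"
    obtain K where K: "compact K" "K \<subseteq> V" "\<And>p. p \<notin> K \<Longrightarrow> \<phi> p = 0" using test_fn_support[OF \<phi>] by metis
    show "test_fn U (\<lambda>p. comp j (- v) * \<phi> (p + t *\<^sub>R - v))" if t: "0 \<le> t" "t \<le> 1" and j: "j < 3" for t j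
    proof (rule test_fnI[OF shift_der[OF \<phi>]])
      show "continuous_on UNIV (\<lambda>p. comp j (- v) * frechet_derivative \<phi> (at (p + t *\<^sub>R - v)) (ev i))" for i
        by (intro continuous_intros continuous_on_frechet_test_fn[OF \<phi>])
      show "compact ((\<lambda>p. p + t *\<^sub>R v) ` K)" using K(1) by (intro compact_continuous_image continuous_intros)
      show "(\<lambda>p. p + t *\<^sub>R v) ` K \<subseteq> U" using seg[OF _ t] K(2) by auto
      fix p assume "p \<notin> (\<lambda>p. p + t *\<^sub>R v) ` K"
      then have "p + t *\<^sub>R - v \<notin> K" by (metis (no_types, lifting) add.commute add_diff_cancel_left' diff_conv_add_uminus image_eqI scaleR_minus_right add_diff_cancel_right' diff_add_cancel)
      from K(3)[OF this] show "comp j (- v) * \<phi> (p + t *\<^sub>R - v) = 0" by (simp only: mult_zero_right)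
    qed
    show "(\<Sum>j<3. pd (\<lambda>p. comp j (- v) * \<phi> (p + t *\<^sub>R - v)) j p) = frechet_derivative \<phi> (at (p + t *\<^sub>R - v)) (- v)" for t p
      unfolding pd_shift[OF \<phi>] frechet_pd[OF test_fn_differentiable[OF \<phi>]] sum_less_3 by simp
  qed (auto intro: continuous_intros)
  have eq: "c - (- a - b) = a + b + c" for a b c :: complex by simp
  from ae show ?thesis
    by eventually_elim (simp add: sum_less_3 eq)
qed

section \<open>Rotations about the axis\<close>

definition rot :: "real \<Rightarrow> pt \<Rightarrow> pt" where
  "rot t p = (fst p * cos t - fst (snd p) * sin t, fst p * sin t + fst (snd p) * cos t, snd (snd p))"

lemma rot_rot: "rot s (rot t p) = rot (s + t) p"
  by (simp add: rot_def cos_add sin_add algebra_simps)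

lemma rot_0 [simp]: "rot 0 p = p" by (simp add: rot_def)

lemma sets_lborel_prod: "sets (lborel \<Otimes>\<^sub>M lborel) = sets (borel :: pt measure)"
  unfolding lborel_prod by simp

lemma emeasure_distr_indicator:
  fixes F :: "pt \<Rightarrow> pt"
  assumes [measurable]: "A \<in> sets borel" "F \<in> borel_measurable borel"
  shows "emeasure (distr lborel borel F) A = (\<integral>\<^sup>+p. indicator A (F p) \<partial>(lborel \<Otimes>\<^sub>M lborel))"
proof -
  have "emeasure (distr lborel borel F) A = (\<integral>\<^sup>+p. indicator A p \<partial>distr lborel borel F)" by simp
  also have "\<dots> = (\<integral>\<^sup>+p. indicator A (F p) \<partial>lborel)" by (rule nn_integral_distr) simp_all
  finally show ?thesis by (simp only: lborel_prod)
qed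

text \<open>On every line parallel to the first axis the shear is a translation, and Tonelli's
  theorem assembles the lines.\<close>

lemma distr_shear_x:
  assumes [measurable]: "h \<in> borel_measurable borel"
  shows "distr lborel borel (\<lambda>p :: pt. (fst p + h (snd p), snd p)) = lborel"
proof (rule measure_eqI)
  have m' [measurable]: "(\<lambda>p :: pt. (fst p + h (snd p), snd p)) \<in> measurable (lborel \<Otimes>\<^sub>M lborel) (lborel \<Otimes>\<^sub>M lborel)"
    by measurable
  then have m: "(\<lambda>p :: pt. (fst p + h (snd p), snd p)) \<in> borel_measurable borel"
    by (simp add: lborel_prod)
  fix A assume "A \<in> sets (distr lborel borel (\<lambda>p :: pt. (fst p + h (snd p), snd p)))"
  then have A: "A \<in> sets (lborel \<Otimes>\<^sub>M lborel)" unfolding sets_lborel_prod by simp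
  have "emeasure (distr lborel borel (\<lambda>p :: pt. (fst p + h (snd p), snd p))) A
      = (\<integral>\<^sup>+p. indicator A (fst p + h (snd p), snd p) \<partial>(lborel \<Otimes>\<^sub>M lborel))"
    by (rule emeasure_distr_indicator) (use A m in \<open>simp_all only: sets_lborel_prod\<close>)
  also have "\<dots> = (\<integral>\<^sup>+q. \<integral>\<^sup>+x. indicator A (x + h q, q) \<partial>lborel \<partial>lborel)"
    using A by (subst lborel_pair.nn_integral_snd[symmetric]) auto
  also have "\<dots> = (\<integral>\<^sup>+q. \<integral>\<^sup>+x. indicator A (x, q) \<partial>lborel \<partial>lborel)"
  proof (rule nn_integral_cong)
    fix q
    have [measurable]: "(\<lambda>x. indicator A (x, q) :: ennreal) \<in> borel_measurable borel" using A by measurable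
    show "(\<integral>\<^sup>+x. indicator A (x + h q, q) \<partial>lborel) = (\<integral>\<^sup>+x. indicator A (x, q) \<partial>lborel)"
      using nn_integral_real_affine[of "\<lambda>x. indicator A (x, q)" 1 "h q"] by (simp add: add.commute)
  qed
  also have "\<dots> = (\<integral>\<^sup>+p. indicator A p \<partial>(lborel \<Otimes>\<^sub>M lborel))"
    using A by (subst lborel_pair.nn_integral_snd[symmetric]) auto
  finally show "emeasure (distr lborel borel (\<lambda>p :: pt. (fst p + h (snd p), snd p))) A = emeasure lborel A"
    unfolding nn_integral_indicator[OF A] unfolding lborel_prod .
qed simp

lemma distr_shear_y:
  "distr lborel borel (\<lambda>p :: pt. (fst p, fst (snd p) + s * fst p, snd (snd p))) = lborel"
proof (rule measure_eqI)
  have m: "(\<lambda>p :: pt. (fst p, fst (snd p) + s * fst p, snd (snd p))) \<in> borel_measurable borel"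
    by (intro borel_measurable_continuous_onI continuous_intros)
  then have m' [measurable]: "(\<lambda>p :: pt. (fst p, fst (snd p) + s * fst p, snd (snd p))) \<in> measurable (lborel \<Otimes>\<^sub>M lborel) (lborel \<Otimes>\<^sub>M lborel)"
    by (simp add: lborel_prod)
  fix A assume "A \<in> sets (distr lborel borel (\<lambda>p :: pt. (fst p, fst (snd p) + s * fst p, snd (snd p))))"
  then have A: "A \<in> sets (lborel \<Otimes>\<^sub>M lborel)" unfolding sets_lborel_prod by simp
  have "emeasure (distr lborel borel (\<lambda>p :: pt. (fst p, fst (snd p) + s * fst p, snd (snd p)))) A
      = (\<integral>\<^sup>+p. indicator A (fst p, fst (snd p) + s * fst p, snd (snd p)) \<partial>(lborel \<Otimes>\<^sub>M lborel))"
    by (rule emeasure_distr_indicator) (use A m in \<open>simp_all only: sets_lborel_prod\<close>)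
  also have "\<dots> = (\<integral>\<^sup>+x. \<integral>\<^sup>+q. indicator A (x, (s * x, 0) + q) \<partial>lborel \<partial>lborel)"
  proof -
    have [measurable]: "(\<lambda>p. indicator A (fst p, fst (snd p) + s * fst p, snd (snd p)) :: ennreal) \<in> borel_measurable (lborel \<Otimes>\<^sub>M lborel)"
      by (rule measurable_compose[OF m' borel_measurable_indicator[OF A]])
    show ?thesis by (subst lborel.nn_integral_fst[symmetric]) (auto simp: plus_prod_def add.commute)
  qed
  also have "\<dots> = (\<integral>\<^sup>+x. \<integral>\<^sup>+q. indicator A (x, q) \<partial>lborel \<partial>lborel)"
  proof (rule nn_integral_cong)
    fix x
    have [measurable]: "(\<lambda>q. indicator A (x, q) :: ennreal) \<in> borel_measurable borel" using A by measurable
    show "(\<integral>\<^sup>+q. indicator A (x, (s * x, 0) + q) \<partial>lborel) = (\<integral>\<^sup>+q. indicator A (x, q) \<partial>lborel)"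
      by (subst (2) lborel_distr_plus[of "(s * x, 0)", symmetric]) (simp add: nn_integral_distr)
  qed
  also have "\<dots> = (\<integral>\<^sup>+p. indicator A p \<partial>(lborel \<Otimes>\<^sub>M lborel))"
    using A by (subst lborel.nn_integral_fst[symmetric]) auto
  finally show "emeasure (distr lborel borel (\<lambda>p :: pt. (fst p, fst (snd p) + s * fst p, snd (snd p)))) A = emeasure lborel A"
    unfolding nn_integral_indicator[OF A] unfolding lborel_prod .
qed simp

lemma cont_rot: "continuous_on UNIV (rot t)"
  unfolding rot_def by (intro continuous_intros)

lemma distr_compose_lborel:
  assumes "distr lborel borel f = (lborel :: pt measure)" "distr lborel borel h = (lborel :: pt measure)"
    "f \<in> borel_measurable borel" "h \<in> borel_measurable borel"
  shows "distr lborel borel (\<lambda>p. f (h p)) = (lborel :: pt measure)"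
proof -
  have "distr (distr lborel borel h) borel f = distr lborel borel (f \<circ> h)"
    using assms by (intro distr_distr) auto
  then show ?thesis using assms by (simp add: o_def)
qed

lemma meas_rot: "rot t \<in> borel_measurable borel"
  using cont_rot by (rule borel_measurable_continuous_onI)

text \<open>A rotation is a product of three shears, except when \<open>cos (t/2) = 0\<close>; halving the angle
  avoids this case.\<close>

lemma distr_rot: "distr lborel borel (rot t) = lborel"
proof -
  have generic: "distr lborel borel (rot t) = lborel" if c: "cos (t / 2) \<noteq> 0" for t
  proof -
    \<comment> \<open>This is - tan (t / 2). The rotation by \<open>t\<close> is a shear in x by
      \<open>k\<close>, a shear in y by \<open>sin t\<close>, and again the shear in x by
      \<open>k\<close>.\<close>
    define k where "k = - (sin (t / 2) / cos (t / 2))"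
    define sx where "sx = (\<lambda>p :: pt. (fst p + k * fst (snd p), snd p))"
    define sy where "sy = (\<lambda>p :: pt. (fst p, fst (snd p) + sin t * fst p, snd (snd p)))"
    have s2: "sin t = 2 * sin (t / 2) * cos (t / 2)" using sin_double[of "t / 2"] by simp
    have c2: "cos t = 1 - 2 * (sin (t / 2))\<^sup>2" using cos_double_sin[of "t / 2"] by simp
    have e1: "1 + k * sin t = cos t" unfolding k_def s2 c2 using c by (simp add: power2_eq_square)
    have e2: "k + (k * sin t + 1) * k = - sin t"
    proof -
      have "k + (k * sin t + 1) * k = k * (1 + cos t)" using e1 by (simp add: algebra_simps)
      also have "1 + cos t = 2 * (cos (t / 2))\<^sup>2" using cos_double_cos[of "t / 2"] by simp
      also have "k * (2 * (cos (t / 2))\<^sup>2) = - sin t" unfolding k_def s2 using c by (simp add: power2_eq_square)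
      finally show ?thesis .
    qed
    have "rot t p = sx (sy (sx p))" for p
    proof -
      obtain x y z where p: "p = (x, y, z)" by (cases p)
      have "x + k * y + k * (y + sin t * (x + k * y)) = x * (1 + k * sin t) + y * (k + (k * sin t + 1) * k)"
        by (simp add: algebra_simps)
      moreover have "y + sin t * (x + k * y) = x * sin t + y * (1 + k * sin t)" by (simp add: algebra_simps)
      ultimately show ?thesis unfolding p rot_def sx_def sy_def fst_conv snd_conv e1 e2 by simp
    qed
    then have "rot t = (\<lambda>p. sx (sy (sx p)))" by blast
    moreover have "distr lborel borel (\<lambda>p. sx (sy (sx p))) = lborel"
    proof -
      have sx: "distr lborel borel sx = lborel" unfolding sx_def
        by (rule distr_shear_x[of "\<lambda>q. k * fst q"]) (intro borel_measurable_continuous_onI continuous_intros)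
      have sy: "distr lborel borel sy = lborel" unfolding sy_def by (rule distr_shear_y)
      have m: "sx \<in> borel_measurable borel" "sy \<in> borel_measurable borel"
        unfolding sx_def sy_def by (intro borel_measurable_continuous_onI continuous_intros)+
      show ?thesis
        by (rule distr_compose_lborel[OF sx distr_compose_lborel[OF sy sx m(2,1)] m(1) measurable_compose[OF m]])
    qed
    ultimately show ?thesis by simp
  qed
  show ?thesis
  proof (cases "cos (t / 2) = 0")
    case True
    have "cos (t / 2 / 2) \<noteq> 0"
      using True cos_double_cos[of "t / 2 / 2"] by auto
    note g = generic[OF this]
    have "distr lborel borel (\<lambda>p. rot (t / 2) (rot (t / 2) p)) = lborel"
      by (rule distr_compose_lborel[OF g g meas_rot meas_rot])
    then show ?thesis by (simp add: rot_rot)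
  qed (rule generic)
qed

lemma mp_flow_rot: "mp_flow rot (\<lambda>t. rot (- t))"
proof
  show "continuous_on UNIV (\<lambda>x. rot (fst x) (snd x))" "continuous_on UNIV (\<lambda>x. rot (- fst x) (snd x))"
    unfolding rot_def by (intro continuous_intros)+
qed (simp_all add: rot_rot distr_rot)

text \<open>The velocity field of the rotation. Its j-th component does not depend on the j-th
  coordinate, so the j-th derivative of its product with a test function falls on the test function
  alone.\<close>

definition rgen :: "pt \<Rightarrow> pt" where "rgen p = (- fst (snd p), fst p, 0)"

lemma rot_has_derivative: "(rot t has_derivative rot t) (at p)"
  unfolding rot_def by (auto intro!: derivative_eq_intros simp: fun_eq_iff)

lemma rot_rgen: "rot t (rgen p) = rgen (rot t p)"
  by (simp add: rot_def rgen_def)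

lemma comp_rgen_has_derivative: "((\<lambda>p. comp j (rgen p)) has_derivative (\<lambda>h. comp j (rgen h))) (at p)"
  by (cases "j = 0"; cases "j = 1") (auto simp: comp_def rgen_def intro!: derivative_eq_intros)

lemma cont_rgen: "continuous_on UNIV rgen" and cont_comp: "continuous_on UNIV (comp j)"
proof -
  show "continuous_on UNIV rgen" unfolding rgen_def by (intro continuous_intros)
  show "continuous_on UNIV (comp j)"
    by (cases "j = 0"; cases "j = 1") (auto simp: comp_def[abs_def] intro!: continuous_intros)
qed

text \<open>After a full turn the transported point is \<open>p\<close> again, so the left side
  collapses to a multiple of \<open>u p\<close>, with a nonzero factor when \<open>\<beta>\<close>
  is not an integer. The half space is invariant under rotation and misses the window.\<close>

lemma rotation_identity:
  assumes u: "L2 u" and wg: "weak_grad {p. snd (snd p) > 0} u g"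
  shows "AE p in lborel. snd (snd p) > 0 \<longrightarrow>
    (exp (\<i> * \<beta> * (2 * pi)) - 1) * u p = (LINT t|lborel. indicator {0..2 * pi} t *\<^sub>R (exp (\<i> * complex_of_real \<beta> * complex_of_real t) *
       (\<i> * \<beta> * u (rot (- t) p) - (\<Sum>j<3. complex_of_real (comp j (rgen (rot (- t) p))) * g j (rot (- t) p)))))"
proof -
  interpret mp_flow rot "\<lambda>t. rot (- t)" by (rule mp_flow_rot)
  have der: "((\<lambda>p. comp j (rgen p) * \<phi> (rot t p)) has_derivative
      (\<lambda>h. comp j (rgen p) * frechet_derivative \<phi> (at (rot t p)) (rot t h) + comp j (rgen h) * \<phi> (rot t p))) (at p)"
    if "test_fn V \<phi>" for V \<phi> j t p
    by (intro has_derivative_mult comp_rgen_has_derivative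
        has_derivative_compose[OF rot_has_derivative test_fn_has_derivative[OF that]])
  have z: "snd (snd (rot t p)) = snd (snd p)" for t p by (simp add: rot_def)
  have ae: "AE p in lborel. p \<in> {p. snd (snd p) > 0} \<longrightarrow>
    exp (\<i> * complex_of_real \<beta> * complex_of_real (2 * pi)) * u (rot (- (2 * pi)) p) - u p = (LINT t|lborel. indicator {0..2 * pi} t *\<^sub>R (exp (\<i> * complex_of_real \<beta> * complex_of_real t) *
       (\<i> * complex_of_real \<beta> * u (rot (- t) p) - (\<Sum>j<3. complex_of_real (comp j (rgen (rot (- t) p))) * g j (rot (- t) p)))))"
  proof (rule flow_identity[OF u wg, where \<beta> = \<beta> and T = "2 * pi" and X = "\<lambda>j p. comp j (rgen p)" and Y = rgen])
    show "open {p :: pt. snd (snd p) > 0}" by (intro open_Collect_less continuous_intros)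
    show "continuous_on UNIV (\<lambda>p. comp j (rgen p))" for j
      by (rule continuous_on_compose2[OF cont_comp cont_rgen]) auto
    show "((\<lambda>t. rot t p) has_vector_derivative rgen (rot t p)) (at t)" for t p
      unfolding rot_def rgen_def
      by (auto intro!: has_vector_derivative_Pair derivative_eq_intros simp: has_real_derivative_iff_has_vector_derivative[symmetric])
    fix \<phi> assume \<phi>: "test_fn {p. snd (snd p) > 0} \<phi>"
    obtain K where K: "compact K" "K \<subseteq> {p. snd (snd p) > 0}" "\<And>p. p \<notin> K \<Longrightarrow> \<phi> p = 0" using test_fn_support[OF \<phi>] by metis
    show "test_fn {p. snd (snd p) > 0} (\<lambda>p. comp j (rgen p) * \<phi> (rot t p))" for t j
    proof (rule test_fnI[OF der[OF \<phi>]])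
      show "continuous_on UNIV (\<lambda>p. comp j (rgen p) * frechet_derivative \<phi> (at (rot t p)) (rot t (ev i)) + comp j (rgen (ev i)) * \<phi> (rot t p))" for i
        by (intro continuous_intros continuous_on_frechet_test_fn[OF \<phi>] cont_rot continuous_on_compose2[OF cont_comp cont_rgen]
            continuous_on_compose2[OF test_fn_continuous[OF \<phi>] cont_rot]) auto
      show "compact (rot (- t) ` K)" using K(1) cont_rot by (intro compact_continuous_image) (auto intro: continuous_on_subset)
      show "rot (- t) ` K \<subseteq> {p. snd (snd p) > 0}" using K(2) by (auto simp: z)
      fix p assume p: "p \<notin> rot (- t) ` K"
      have "rot t p \<notin> K"
      proof
        assume "rot t p \<in> K"
        then have "rot (- t) (rot t p) \<in> rot (- t) ` K" by (rule imageI)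
        then show False using p by (simp add: rot_rot)
      qed
      from K(3)[OF this] show "comp j (rgen p) * \<phi> (rot t p) = 0" by (simp only: mult_zero_right)
    qed
    show "(\<Sum>j<3. pd (\<lambda>p. comp j (rgen p) * \<phi> (rot t p)) j p) = frechet_derivative \<phi> (at (rot t p)) (rgen (rot t p))" for t p
    proof -
      have lin: "linear (frechet_derivative \<phi> (at (rot t p)))"
        using test_fn_differentiable[OF \<phi>] by (rule linear_frechet_derivative)
      have "rgen p = (- fst (snd p)) *\<^sub>R ev 0 + fst p *\<^sub>R ev 1" by (simp add: rgen_def)
      then have "rot t (rgen p) = (- fst (snd p)) *\<^sub>R rot t (ev 0) + fst p *\<^sub>R rot t (ev 1)"
        by (simp add: rot_def)
      then have "frechet_derivative \<phi> (at (rot t p)) (rgen (rot t p)) = (- fst (snd p)) * frechet_derivative \<phi> (at (rot t p)) (rot t (ev 0))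
          + fst p * frechet_derivative \<phi> (at (rot t p)) (rot t (ev 1))"
        unfolding rot_rgen[symmetric] by (simp only: linear_add[OF lin] linear_scale[OF lin] real_scaleR_def)
      then show ?thesis
        unfolding pd_eq[OF der[OF \<phi>]] sum_less_3 by (simp add: rgen_def)
    qed
  qed (auto simp: cont_rgen)
  have "rot (- (2 * pi)) p = p" for p by (simp add: rot_def)
  with ae show ?thesis by (simp add: left_diff_distrib)
qed

section \<open>Inequalities for the core\<close>

abbreviation sq_int :: "fn \<Rightarrow> ennreal" where
  "sq_int f \<equiv> \<integral>\<^sup>+p. ennreal ((cmod (f p))\<^sup>2) \<partial>lborel"

abbreviation sq_int_on :: "pt set \<Rightarrow> fn \<Rightarrow> ennreal" where
  "sq_int_on A f \<equiv> \<integral>\<^sup>+p. indicator A p * ennreal ((cmod (f p))\<^sup>2) \<partial>lborel"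

text \<open>Holds without integrability, since the Bochner integral of a function that is not
  integrable is 0 by convention.\<close>

lemma norm_lebesgue_integral_le_nn:
  fixes f :: "'a \<Rightarrow> 'b::{banach, second_countable_topology}"
  shows "ennreal (norm (integral\<^sup>L M f)) \<le> (\<integral>\<^sup>+x. ennreal (norm (f x)) \<partial>M)"
  by (cases "integrable M f") (auto intro: integral_norm_bound_ennreal simp: not_integrable_integral_eq)

lemma nn_integral_pt:
  assumes "f \<in> borel_measurable borel"
  shows "(\<integral>\<^sup>+p. f (p::pt) \<partial>lborel) = (\<integral>\<^sup>+x. \<integral>\<^sup>+y. \<integral>\<^sup>+z. f (x, y, z) \<partial>lborel \<partial>lborel \<partial>lborel)"
proof -
  have m: "f \<in> borel_measurable (lborel \<Otimes>\<^sub>M lborel)" using assms by (simp add: lborel_prod)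
  have "(\<integral>\<^sup>+p. f p \<partial>(lborel \<Otimes>\<^sub>M lborel)) = (\<integral>\<^sup>+x. \<integral>\<^sup>+q. f (x, q) \<partial>lborel \<partial>lborel)"
    using m by (rule lborel.nn_integral_fst[symmetric])
  also have "\<dots> = (\<integral>\<^sup>+x. \<integral>\<^sup>+y. \<integral>\<^sup>+z. f (x, y, z) \<partial>lborel \<partial>lborel \<partial>lborel)"
  proof (rule nn_integral_cong)
    fix x
    have "(\<lambda>q. f (x, q)) \<in> borel_measurable lborel" using m by measurable
    then have "(\<lambda>q. f (x, q)) \<in> borel_measurable (lborel \<Otimes>\<^sub>M lborel)" by (simp only: lborel_prod)
    from lborel.nn_integral_fst[OF this]
    show "(\<integral>\<^sup>+q. f (x, q) \<partial>lborel) = (\<integral>\<^sup>+y. \<integral>\<^sup>+z. f (x, y, z) \<partial>lborel \<partial>lborel)" by (simp only: lborel_prod)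
  qed
  finally show ?thesis by (simp only: lborel_prod)
qed

text \<open>The sharp constant comes from the Schur test with the extremal function \<open>cos (\<pi> s / d)\<close> as weight.\<close>

lemma half_interval_inequality:
  fixes G :: "real \<Rightarrow> ennreal"
  assumes d: "d > 0" and [measurable]: "G \<in> borel_measurable borel"
  shows "(\<integral>\<^sup>+z. indicator {0<..<d/2} z * (\<integral>\<^sup>+s. indicator {0..<z} s * G s \<partial>lborel)\<^sup>2 \<partial>lborel)
    \<le> ennreal ((d / pi)\<^sup>2) * (\<integral>\<^sup>+s. indicator {0..<d/2} s * (G s)\<^sup>2 \<partial>lborel)"
proof -
  define \<mu> where "\<mu> = pi / d"
  have \<mu>: "\<mu> > 0" "\<mu> * (d / 2) = pi / 2" "d / pi = 1 / \<mu>" unfolding \<mu>_def using d by auto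
  have c_pos: "0 < cos (\<mu> * s)" if "0 \<le> s" "s < d / 2" for s
  proof -
    have "\<mu> * s < pi / 2" using \<mu> that mult_strict_left_mono[of s "d/2" \<mu>] by simp
    moreover have "- (pi / 2) < \<mu> * s" using \<mu> that pi_gt_zero by (smt (verit) mult_nonneg_nonneg divide_pos_pos)
    ultimately show ?thesis by (intro cos_gt_zero_pi)
  qed
  have s_nn: "0 \<le> sin (\<mu> * s)" if "0 \<le> s" "s \<le> d / 2" for s
  proof (rule sin_ge_zero)
    show "0 \<le> \<mu> * s" using \<mu> that by simp
    have "\<mu> * s \<le> \<mu> * (d / 2)" using \<mu> that by (intro mult_left_mono) auto
    then show "\<mu> * s \<le> pi" using \<mu> pi_gt_zero by linarith
  qed
  \<comment> \<open>The Schur weight. Splitting off \<open>sqrt (cos (\<mu> * s))\<close> in the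
    Cauchy-Schwarz inequality produces the factor \<open>sin (\<mu> * z) / \<mu>\<close>, the
    integral of the cosine up to \<open>z\<close>.\<close>
  define W where "W = (\<lambda>s. ennreal (1 / cos (\<mu> * s)))"
  have [measurable]: "W \<in> borel_measurable borel" unfolding W_def by measurable
  have [measurable]: "W \<in> borel_measurable lborel" "G \<in> borel_measurable lborel" by simp_all
  have cs: "(\<integral>\<^sup>+s. indicator {0..<z} s * G s \<partial>lborel)\<^sup>2
      \<le> (\<integral>\<^sup>+s. indicator {0..<z} s * ((G s)\<^sup>2 * W s) \<partial>lborel) * ennreal (sin (\<mu> * z) / \<mu>)" if z: "0 < z" "z < d / 2" for z
  proof -
    define f where "f = (\<lambda>s. indicator {0..<z} s * (G s * ennreal (1 / sqrt (cos (\<mu> * s)))))"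
    define h where "h = (\<lambda>s. indicator {0..<z} s * ennreal (sqrt (cos (\<mu> * s))))"
    have [measurable]: "f \<in> borel_measurable borel" "h \<in> borel_measurable borel" unfolding f_def h_def by measurable
    have "(\<integral>\<^sup>+s. indicator {0..<z} s * G s \<partial>lborel) = (\<integral>\<^sup>+s. f s * h s \<partial>lborel)"
    proof (rule nn_integral_cong)
      fix s
      show "indicator {0..<z} s * G s = f s * h s"
      proof (cases "s \<in> {0..<z}")
        case True
        then have "0 < cos (\<mu> * s)" using z by (intro c_pos) auto
        then have "ennreal (1 / sqrt (cos (\<mu> * s))) * ennreal (sqrt (cos (\<mu> * s))) = 1"
          by (subst ennreal_mult[symmetric]) auto
        then show ?thesis using True by (simp add: f_def h_def mult.assoc)
      qed (simp add: f_def)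
    qed
    also have "(\<integral>\<^sup>+s. f s * h s \<partial>lborel)\<^sup>2 \<le> (\<integral>\<^sup>+s. (f s)\<^sup>2 \<partial>lborel) * (\<integral>\<^sup>+s. (h s)\<^sup>2 \<partial>lborel)"
      by (rule Cauchy_Schwarz_nn_integral) measurable
    also have "(\<integral>\<^sup>+s. (f s)\<^sup>2 \<partial>lborel) = (\<integral>\<^sup>+s. indicator {0..<z} s * ((G s)\<^sup>2 * W s) \<partial>lborel)"
    proof (rule nn_integral_cong)
      fix s
      show "(f s)\<^sup>2 = indicator {0..<z} s * ((G s)\<^sup>2 * W s)"
      proof (cases "s \<in> {0..<z}")
        case True
        then have "0 < cos (\<mu> * s)" using z by (intro c_pos) auto
        then have "(ennreal (1 / sqrt (cos (\<mu> * s))))\<^sup>2 = W s"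
          unfolding W_def by (simp add: ennreal_power power_divide)
        then show ?thesis using True by (simp add: f_def power_mult_distrib)
      qed (simp add: f_def)
    qed
    also have "(\<integral>\<^sup>+s. (h s)\<^sup>2 \<partial>lborel) \<le> (\<integral>\<^sup>+s. ennreal (cos (\<mu> * s)) * indicator {0..z} s \<partial>lborel)"
    proof (rule nn_integral_mono)
      fix s
      show "(h s)\<^sup>2 \<le> ennreal (cos (\<mu> * s)) * indicator {0..z} s"
      proof (cases "s \<in> {0..<z}")
        case True
        then have "0 < cos (\<mu> * s)" using z by (intro c_pos) auto
        then show ?thesis using True by (simp add: h_def ennreal_power)
      qed (simp add: h_def)
    qed
    also have "(\<integral>\<^sup>+s. ennreal (cos (\<mu> * s)) * indicator {0..z} s \<partial>lborel) = ennreal (sin (\<mu> * z) / \<mu> - sin (\<mu> * 0) / \<mu>)"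
    proof (rule nn_integral_FTC_Icc)
      show "((\<lambda>s. sin (\<mu> * s) / \<mu>) has_real_derivative cos (\<mu> * s)) (at s)" for s
        using \<mu>(1) by (auto intro!: derivative_eq_intros)
      show "0 \<le> cos (\<mu> * s)" if "s \<in> {0..z}" for s using c_pos[of s] that z by simp
    qed (use z in auto)
    finally show ?thesis by (simp add: mult_left_mono)
  qed
  have "(\<integral>\<^sup>+z. indicator {0<..<d/2} z * (\<integral>\<^sup>+s. indicator {0..<z} s * G s \<partial>lborel)\<^sup>2 \<partial>lborel)
    \<le> (\<integral>\<^sup>+z. \<integral>\<^sup>+s. (indicator {0<..<d/2} z * ennreal (sin (\<mu> * z) / \<mu>)) * (indicator {0..<z} s * ((G s)\<^sup>2 * W s)) \<partial>lborel \<partial>lborel)"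
  proof (rule nn_integral_mono)
    fix z
    show "indicator {0<..<d/2} z * (\<integral>\<^sup>+s. indicator {0..<z} s * G s \<partial>lborel)\<^sup>2
      \<le> (\<integral>\<^sup>+s. (indicator {0<..<d/2} z * ennreal (sin (\<mu> * z) / \<mu>)) * (indicator {0..<z} s * ((G s)\<^sup>2 * W s)) \<partial>lborel)"
      using cs[of z] by (cases "z \<in> {0<..<d/2}") (auto simp: nn_integral_cmult mult.commute)
  qed
  also have "\<dots> = (\<integral>\<^sup>+s. \<integral>\<^sup>+z. (indicator {0<..<d/2} z * ennreal (sin (\<mu> * z) / \<mu>)) * (indicator {0..<z} s * ((G s)\<^sup>2 * W s)) \<partial>lborel \<partial>lborel)"
    unfolding indicator_def of_bool_def atLeastLessThan_iff greaterThanLessThan_iff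
    by (rule lborel_pair.Fubini') measurable
  also have "\<dots> \<le> (\<integral>\<^sup>+s. ennreal ((d / pi)\<^sup>2) * (indicator {0..<d/2} s * (G s)\<^sup>2) \<partial>lborel)"
  proof (rule nn_integral_mono)
    fix s
    show "(\<integral>\<^sup>+z. (indicator {0<..<d/2} z * ennreal (sin (\<mu> * z) / \<mu>)) * (indicator {0..<z} s * ((G s)\<^sup>2 * W s)) \<partial>lborel)
      \<le> ennreal ((d / pi)\<^sup>2) * (indicator {0..<d/2} s * (G s)\<^sup>2)"
    proof (cases "s \<in> {0..<d/2}")
      case True
      then have c: "0 < cos (\<mu> * s)" by (intro c_pos) auto
      have "(\<integral>\<^sup>+z. (indicator {0<..<d/2} z * ennreal (sin (\<mu> * z) / \<mu>)) * (indicator {0..<z} s * ((G s)\<^sup>2 * W s)) \<partial>lborel)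
          \<le> (\<integral>\<^sup>+z. ((G s)\<^sup>2 * W s) * (ennreal (sin (\<mu> * z) / \<mu>) * indicator {s..d/2} z) \<partial>lborel)"
        using True by (intro nn_integral_mono) (auto simp: indicator_def mult.commute)
      also have "\<dots> = ((G s)\<^sup>2 * W s) * (\<integral>\<^sup>+z. ennreal (sin (\<mu> * z) / \<mu>) * indicator {s..d/2} z \<partial>lborel)"
        by (rule nn_integral_cmult) measurable
      \<comment> \<open>Integrating the sine from \<open>s\<close> to \<open>d / 2\<close> gives
        back the cosine at \<open>s\<close>, because the cosine vanishes at \<open>d / 2\<close>. It
        cancels the weight and leaves exactly \<open>1 / \<mu>^2\<close>.\<close>
      also have "(\<integral>\<^sup>+z. ennreal (sin (\<mu> * z) / \<mu>) * indicator {s..d/2} z \<partial>lborel)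
          = ennreal (- cos (\<mu> * (d / 2)) / \<mu>\<^sup>2 - - cos (\<mu> * s) / \<mu>\<^sup>2)"
      proof (rule nn_integral_FTC_Icc)
        show "((\<lambda>z. - cos (\<mu> * z) / \<mu>\<^sup>2) has_real_derivative sin (\<mu> * z) / \<mu>) (at z)" for z
          using \<mu>(1) by (auto intro!: derivative_eq_intros simp: power2_eq_square)
        show "0 \<le> sin (\<mu> * z) / \<mu>" if "z \<in> {s..d/2}" for z using s_nn[of z] that True \<mu> by simp
      qed (use True in auto)
      also have "\<dots> = ennreal (cos (\<mu> * s) / \<mu>\<^sup>2)" unfolding \<mu>(2) by simp
      also have "((G s)\<^sup>2 * W s) * ennreal (cos (\<mu> * s) / \<mu>\<^sup>2) = (G s)\<^sup>2 * (W s * ennreal (cos (\<mu> * s) / \<mu>\<^sup>2))"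
        by (simp add: mult.assoc)
      also have "W s * ennreal (cos (\<mu> * s) / \<mu>\<^sup>2) = ennreal ((d / pi)\<^sup>2)"
        unfolding W_def \<mu>(3) using c by (subst ennreal_mult[symmetric]) (auto simp: power_divide)
      finally show ?thesis using True by (simp add: mult.commute)
    next
      case False
      then have z: "(indicator {0<..<d/2} z * ennreal (sin (\<mu> * z) / \<mu>)) * (indicator {0..<z} s * ((G s)\<^sup>2 * W s)) = 0" for z
        by (auto simp: indicator_def)
      show ?thesis unfolding z by simp
    qed
  qed
  also have "\<dots> = ennreal ((d / pi)\<^sup>2) * (\<integral>\<^sup>+s. indicator {0..<d/2} s * (G s)\<^sup>2 \<partial>lborel)"
    by (rule nn_integral_cmult) measurable
  finally show ?thesis .
qed

text \<open>For a function that vanishes at both ends and has derivative bounded by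
  \<open>G\<close>, \<open>B z\<close> bounds the square of its value from the nearer end. The upper
  half is reflected onto the lower one. Each half is an interval of length d / 2 with one free end,
  whose sharp constant equals the Dirichlet constant of length \<open>d\<close>.\<close>

lemma dirichlet_interval_inequality:
  fixes G U :: "real \<Rightarrow> ennreal"
  assumes d: "d > 0" and [measurable]: "G \<in> borel_measurable borel"
    and B: "\<And>z. B z = (if z < d / 2 then (\<integral>\<^sup>+s. indicator {0..<z} s * G s \<partial>lborel)\<^sup>2
       else (\<integral>\<^sup>+s. indicator {z<..d} s * G s \<partial>lborel)\<^sup>2)"
  shows "(\<integral>\<^sup>+z. indicator ({0<..<d} - {d/2}) z * B z \<partial>lborel) \<le> ennreal ((d / pi)\<^sup>2) * (\<integral>\<^sup>+s. indicator {0..d} s * (G s)\<^sup>2 \<partial>lborel)"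
proof -
  define G' where "G' = (\<lambda>s. G (d - s))"
  have [measurable]: "G' \<in> borel_measurable borel" unfolding G'_def by measurable
  have [measurable]: "G \<in> borel_measurable lborel" "G' \<in> borel_measurable lborel" by simp_all
  have refl: "(\<integral>\<^sup>+z. f (d - z) \<partial>lborel) = (\<integral>\<^sup>+z. f z \<partial>lborel)" if "f \<in> borel_measurable borel" for f :: "real \<Rightarrow> ennreal"
    using nn_integral_real_affine[OF that, of "-1" d] by simp
  have [measurable]: "(\<lambda>z. \<integral>\<^sup>+s. indicator {0..<z} s * G s \<partial>lborel) \<in> borel_measurable borel"
    "(\<lambda>z. \<integral>\<^sup>+s. indicator {0..<z} s * G' s \<partial>lborel) \<in> borel_measurable borel"
    "(\<lambda>z. \<integral>\<^sup>+s. indicator {z<..d} s * G s \<partial>lborel) \<in> borel_measurable borel"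
    unfolding indicator_def of_bool_def atLeastLessThan_iff greaterThanAtMost_iff by measurable
  have "(\<integral>\<^sup>+z. indicator ({0<..<d} - {d/2}) z * B z \<partial>lborel)
      = (\<integral>\<^sup>+z. indicator {0<..<d/2} z * (\<integral>\<^sup>+s. indicator {0..<z} s * G s \<partial>lborel)\<^sup>2
          + indicator {d/2<..<d} z * (\<integral>\<^sup>+s. indicator {z<..d} s * G s \<partial>lborel)\<^sup>2 \<partial>lborel)"
    by (intro nn_integral_cong) (auto simp: B indicator_def)
  also have "\<dots> = (\<integral>\<^sup>+z. indicator {0<..<d/2} z * (\<integral>\<^sup>+s. indicator {0..<z} s * G s \<partial>lborel)\<^sup>2 \<partial>lborel)
          + (\<integral>\<^sup>+z. indicator {d/2<..<d} z * (\<integral>\<^sup>+s. indicator {z<..d} s * G s \<partial>lborel)\<^sup>2 \<partial>lborel)"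
    by (rule nn_integral_add) measurable
  also have "(\<integral>\<^sup>+z. indicator {d/2<..<d} z * (\<integral>\<^sup>+s. indicator {z<..d} s * G s \<partial>lborel)\<^sup>2 \<partial>lborel)
      = (\<integral>\<^sup>+z. indicator {0<..<d/2} z * (\<integral>\<^sup>+s. indicator {0..<z} s * G' s \<partial>lborel)\<^sup>2 \<partial>lborel)"
  proof -
    have "(\<integral>\<^sup>+s. indicator {d - z<..d} s * G s \<partial>lborel) = (\<integral>\<^sup>+s. indicator {0..<z} s * G' s \<partial>lborel)" for z
      by (subst refl[symmetric]) (auto simp: G'_def indicator_def intro!: nn_integral_cong)
    then show ?thesis
      by (subst refl[symmetric]) (auto simp: indicator_def intro!: nn_integral_cong)
  qed
  also have "(\<integral>\<^sup>+z. indicator {0<..<d/2} z * (\<integral>\<^sup>+s. indicator {0..<z} s * G s \<partial>lborel)\<^sup>2 \<partial>lborel)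
     + (\<integral>\<^sup>+z. indicator {0<..<d/2} z * (\<integral>\<^sup>+s. indicator {0..<z} s * G' s \<partial>lborel)\<^sup>2 \<partial>lborel)
     \<le> ennreal ((d / pi)\<^sup>2) * (\<integral>\<^sup>+s. indicator {0..<d/2} s * (G s)\<^sup>2 \<partial>lborel)
     + ennreal ((d / pi)\<^sup>2) * (\<integral>\<^sup>+s. indicator {0..<d/2} s * (G' s)\<^sup>2 \<partial>lborel)"
    by (intro add_mono half_interval_inequality d) measurable
  also have "(\<integral>\<^sup>+s. indicator {0..<d/2} s * (G' s)\<^sup>2 \<partial>lborel) = (\<integral>\<^sup>+s. indicator {d/2<..d} s * (G s)\<^sup>2 \<partial>lborel)"
    by (subst (2) refl[symmetric]) (auto simp: G'_def indicator_def intro!: nn_integral_cong)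
  also have "ennreal ((d / pi)\<^sup>2) * (\<integral>\<^sup>+s. indicator {0..<d/2} s * (G s)\<^sup>2 \<partial>lborel) + ennreal ((d / pi)\<^sup>2) * (\<integral>\<^sup>+s. indicator {d/2<..d} s * (G s)\<^sup>2 \<partial>lborel)
      = ennreal ((d / pi)\<^sup>2) * (\<integral>\<^sup>+s. indicator {0..<d/2} s * (G s)\<^sup>2 + indicator {d/2<..d} s * (G s)\<^sup>2 \<partial>lborel)"
    by (subst nn_integral_add) (auto simp: distrib_left)
  also have "\<dots> \<le> ennreal ((d / pi)\<^sup>2) * (\<integral>\<^sup>+s. indicator {0..d} s * (G s)\<^sup>2 \<partial>lborel)"
    using d by (intro mult_left_mono nn_integral_mono) (auto simp: indicator_def)
  finally show ?thesis .
qed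

section \<open>Dirichlet and Hardy inequalities\<close>

lemma AE_inner_neq:
  fixes v :: "'a::euclidean_space"
  assumes "v \<noteq> 0" shows "AE p in lborel. v \<bullet> p \<noteq> c"
proof -
  have "{p. v \<bullet> p = c} \<in> null_sets (completion lborel)"
    using negligible_hyperplane[of v c] assms unfolding negligible_iff_null_sets by simp
  moreover have "closed {p. v \<bullet> p = c}" by (intro closed_Collect_eq continuous_intros)
  ultimately have "{p. v \<bullet> p = c} \<in> null_sets lborel"
    by (simp add: null_sets_completion_iff borel_closed)
  then show ?thesis by (rule AE_I'[where N = "{p. v \<bullet> p = c}"]) auto
qed

lemma AE_coord_neq:
  "AE p :: pt in lborel. fst p \<noteq> c" "AE p :: pt in lborel. fst (snd p) \<noteq> c" "AE p :: pt in lborel. snd (snd p) \<noteq> c"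
  using AE_inner_neq[of "(1, 0, 0) :: pt" c] AE_inner_neq[of "(0, 1, 0) :: pt" c] AE_inner_neq[of "(0, 0, 1) :: pt" c]
  by (simp_all add: inner_prod_def zero_prod_def)

definition slab :: "real \<Rightarrow> pt set" where "slab d = {p. 0 \<le> snd (snd p) \<and> snd (snd p) \<le> d}"

definition outside :: "real \<Rightarrow> pt set" where "outside a = {p. (fst p)\<^sup>2 + (fst (snd p))\<^sup>2 > a\<^sup>2}"

lemma closed_slab: "closed (slab d)"
  unfolding slab_def by (intro closed_Collect_conj closed_Collect_le continuous_intros)

lemma open_outside: "open (outside a)"
  unfolding outside_def by (intro open_Collect_less continuous_intros)

lemma slab_measurable [measurable]: "slab d \<in> sets borel" and outside_measurable [measurable]: "outside a \<in> sets borel"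
  using closed_slab open_outside by (auto intro: borel_closed borel_open)

lemma outside_window: "outside a \<subseteq> UNIV - window a"
  unfolding outside_def window_def by auto

lemma core_L2: "core d a u g \<Longrightarrow> L2 u" and core_weak_grad: "core d a u g \<Longrightarrow> weak_grad (UNIV - window a) u g"
  and core_zero: "core d a u g \<Longrightarrow> p \<notin> slab d \<Longrightarrow> u p = 0"
proof -
  assume "core d a u g"
  then obtain n where n: "\<And>p. p \<notin> Omega_n d n \<Longrightarrow> u p = 0" "L2 u" "weak_grad (UNIV - window a) u g"
    unfolding core_def by blast
  show "L2 u" "weak_grad (UNIV - window a) u g" by fact+
  have "Omega_n d n \<subseteq> slab d" unfolding Omega_n_def slab_def by auto
  then show "p \<notin> slab d \<Longrightarrow> u p = 0" using n(1) by blast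
qed

lemma core_grad_zero:
  assumes c: "core d a u g" and d: "d > 0" and j: "j < 3"
  shows "AE p in lborel. p \<notin> slab d \<longrightarrow> g j p = 0"
proof -
  have sub: "- slab d \<subseteq> UNIV - window a" unfolding slab_def window_def using d by auto
  have "AE p in lborel. p \<in> - slab d \<longrightarrow> g j p = 0"
  proof (rule AE_zero_of_test_fn)
    show "open (- slab d)" using closed_slab by auto
    show "loc_int (g j)" by (rule L2_loc_int[OF weak_grad_L2[OF core_weak_grad[OF c] j]])
    fix \<phi> assume t: "test_fn (- slab d) \<phi>"
    obtain K where K: "K \<subseteq> - slab d" "\<And>p j. p \<notin> K \<Longrightarrow> pd \<phi> j p = 0" using test_fn_support[OF t] by metis
    have z: "u p * complex_of_real (pd \<phi> j p) = 0" for p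
    proof (cases "p \<in> slab d")
      case True
      then have "p \<notin> K" using K(1) by blast
      from K(2)[OF this] show ?thesis by simp
    qed (simp add: core_zero[OF c])
    have "(LINT p|lborel. u p * complex_of_real (pd \<phi> j p)) = 0" unfolding z by simp
    then show "(LINT p|lborel. g j p * complex_of_real (\<phi> p)) = 0"
      using weak_grad_integral[OF core_weak_grad[OF c] j test_fn_mono[OF t sub]] by simp
  qed
  then show ?thesis by eventually_elim simp
qed

lemma weak_grad_cong_AE:
  assumes "weak_grad U u g" "\<And>j. j < 3 \<Longrightarrow> AE p in lborel. g j p = h j p" "\<And>j. j < 3 \<Longrightarrow> L2 (h j)"
  shows "weak_grad U u h"
  unfolding weak_grad_def
proof (intro allI impI conjI assms(3))
  fix j :: nat and \<phi> assume j: "j < 3" and t: "test_fn U \<phi>"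
  have [measurable]: "g j \<in> borel_measurable borel" "h j \<in> borel_measurable borel" "\<phi> \<in> borel_measurable borel"
    using weak_grad_L2[OF assms(1) j] assms(3)[OF j] borel_measurable_continuous_onI[OF test_fn_continuous[OF t]]
    by (auto dest: L2_measurable)
  have "(LINT p|lborel. g j p * complex_of_real (\<phi> p)) = (LINT p|lborel. h j p * complex_of_real (\<phi> p))"
    using assms(2)[OF j] by (intro integral_cong_AE) auto
  then show "(LINT p|lborel. u p * complex_of_real (pd \<phi> j p)) = - (LINT p|lborel. h j p * complex_of_real (\<phi> p))"
    using weak_grad_integral[OF assms(1) j t] by simp
qed

text \<open>The gradient now vanishes everywhere off the slab, not just almost everywhere, so it can
  be integrated along individual vertical lines.\<close>

lemma core_truncate:
  assumes c: "core d a u g" and d: "d > 0"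
  shows "core d a u (\<lambda>j p. complex_of_real (indicator (slab d) p) * g j p)"
proof -
  have "weak_grad (UNIV - window a) u (\<lambda>j p. complex_of_real (indicator (slab d) p) * g j p)"
  proof (rule weak_grad_cong_AE[OF core_weak_grad[OF c]])
    fix j :: nat assume j: "j < 3"
    show "AE p in lborel. g j p = complex_of_real (indicator (slab d) p) * g j p"
      using core_grad_zero[OF c d j] by eventually_elim (auto simp: indicator_def)
    show "L2 (\<lambda>p. complex_of_real (indicator (slab d) p) * g j p)"
      by (rule L2_bounded_mult[where C = 1]) (use weak_grad_L2[OF core_weak_grad[OF c] j] in \<open>auto simp: indicator_def\<close>)
  qed
  then show ?thesis using c unfolding core_def by auto
qed

text \<open>Outside the disc a vertical move by \<open>2 * d\<close>, up or down, leaves the slab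
  without meeting the window, and \<open>u\<close> vanishes at its end. Hence \<open>|u|\<close> is
  bounded by the integral of \<open>|g 2|\<close> from either face, and the interval inequality
  applies on every vertical line; \<open>cyl\<close> says that \<open>S\<close> is a union of such
  lines.\<close>

lemma dirichlet_outside:
  assumes c: "core d a u g" and d: "d > 0" and S: "S \<in> sets borel" "S \<subseteq> outside a"
    and cyl: "\<And>x y z z'. (x, y, z) \<in> S \<Longrightarrow> (x, y, z') \<in> S"
  shows "sq_int_on S u
    \<le> ennreal ((d / pi)\<^sup>2) * sq_int_on S (g 2)"
proof -
  define h where "h = (\<lambda>j p. complex_of_real (indicator (slab d) p) * g j p)"
  have ch: "core d a u h" unfolding h_def by (rule core_truncate[OF c d])
  have [measurable]: "S \<in> sets borel" by fact
  have [measurable]: "u \<in> borel_measurable borel" "h 2 \<in> borel_measurable borel" "g 2 \<in> borel_measurable borel"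
    using core_L2[OF c] weak_grad_L2[OF core_weak_grad[OF ch], of 2] weak_grad_L2[OF core_weak_grad[OF c], of 2]
    by (auto dest: L2_measurable)
  define F where "F = (\<lambda>x y s. ennreal (cmod (h 2 (x, y, s))))"
  have Fp_meas [measurable]: "(\<lambda>p. ennreal (cmod (h 2 p))) \<in> borel_measurable borel" by measurable
  have "(\<lambda>p :: pt \<times> real. (fst (fst p), fst (snd (fst p)), snd p)) \<in> borel_measurable borel"
    by (intro borel_measurable_continuous_onI continuous_intros)
  from measurable_compose[OF this Fp_meas]
  have "(\<lambda>p :: pt \<times> real. F (fst (fst p)) (fst (snd (fst p))) (snd p)) \<in> borel_measurable (borel :: (pt \<times> real) measure)"
    unfolding F_def .
  then have "(\<lambda>p :: pt \<times> real. F (fst (fst p)) (fst (snd (fst p))) (snd p)) \<in> borel_measurable (borel \<Otimes>\<^sub>M borel)"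
    unfolding borel_prod .
  then have [measurable]: "(\<lambda>p :: pt \<times> real. F (fst (fst p)) (fst (snd (fst p))) (snd p)) \<in> borel_measurable (borel \<Otimes>\<^sub>M lborel)"
    by (subst measurable_cong_sets[OF sets_pair_measure_cong[OF refl sets_lborel] refl])
  have F_meas1 [measurable]: "F x y \<in> borel_measurable borel" for x y
  proof -
    have "(\<lambda>s. (x, y, s)) \<in> borel_measurable borel" by (intro borel_measurable_continuous_onI continuous_intros)
    from measurable_compose[OF this Fp_meas] show ?thesis unfolding F_def .
  qed
  have F_zero: "F x y s = 0" if "s \<notin> {0..d}" for x y s
    using that by (auto simp: F_def h_def slab_def indicator_def)
  define B where "B = (\<lambda>x y z. if z < d / 2 then (\<integral>\<^sup>+s. indicator {0..<z} s * F x y s \<partial>lborel)\<^sup>2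
       else (\<integral>\<^sup>+s. indicator {z<..d} s * F x y s \<partial>lborel)\<^sup>2)"
  define Bp where "Bp = (\<lambda>p. B (fst p) (fst (snd p)) (snd (snd p)))"
  have Bp_meas [measurable]: "Bp \<in> borel_measurable borel"
  proof -
    have [measurable]: "(\<lambda>p :: pt. fst (snd p)) \<in> borel_measurable borel" "(\<lambda>p :: pt. snd (snd p)) \<in> borel_measurable borel"
      by (intro borel_measurable_continuous_onI continuous_intros)+
    show ?thesis
      unfolding Bp_def B_def indicator_def of_bool_def atLeastLessThan_iff greaterThanAtMost_iff by measurable
  qed
  have trans: "AE p in lborel. p \<in> outside a \<longrightarrow> ennreal (cmod (u (p + (0, 0, k)) - u p))
      \<le> (\<integral>\<^sup>+t. indicator {0..1} t * (ennreal \<bar>k\<bar> * F (fst p) (fst (snd p)) (snd (snd p) + k * t)) \<partial>lborel)" for k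
  proof -
    have "AE p in lborel. p \<in> outside a \<longrightarrow> u (p + (0, 0, k)) - u p
        = (LINT t|lborel. indicator {0..1} t *\<^sub>R (\<Sum>j<3. complex_of_real (comp j (0, 0, k)) * h j (p + t *\<^sub>R (0, 0, k))))"
    proof (rule translation_identity[OF core_L2[OF c] core_weak_grad[OF ch] open_outside])
      show "p + t *\<^sub>R (0, 0, k) \<in> UNIV - window a" if "p \<in> outside a" for p t
      proof -
        have "p + t *\<^sub>R (0, 0, k) \<in> outside a" using that unfolding outside_def by (cases p) simp
        then show ?thesis using outside_window by blast
      qed
    qed
    then show ?thesis
    proof eventually_elim
      case (elim p)
      show ?case
      proof
        assume "p \<in> outside a"
        then have eq: "u (p + (0, 0, k)) - u p = (LINT t|lborel. indicator {0..1} t *\<^sub>R (complex_of_real k * h 2 (p + (0, 0, t * k))))"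
          using elim by (simp add: sum_less_3)
        have "ennreal (cmod (u (p + (0, 0, k)) - u p)) \<le> (\<integral>\<^sup>+t. ennreal (norm (indicator {0..1} t *\<^sub>R (complex_of_real k * h 2 (p + (0, 0, t * k))))) \<partial>lborel)"
          unfolding eq by (rule norm_lebesgue_integral_le_nn)
        also have "\<dots> = (\<integral>\<^sup>+t. indicator {0..1} t * (ennreal \<bar>k\<bar> * F (fst p) (fst (snd p)) (snd (snd p) + k * t)) \<partial>lborel)"
          by (cases p) (auto intro!: nn_integral_cong simp: F_def norm_mult indicator_def ennreal_mult mult.commute)
        finally show "ennreal (cmod (u (p + (0, 0, k)) - u p)) \<le> (\<integral>\<^sup>+t. indicator {0..1} t * (ennreal \<bar>k\<bar> * F (fst p) (fst (snd p)) (snd (snd p) + k * t)) \<partial>lborel)" .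
      qed
    qed
  qed
  \<comment> \<open>The substitution \<open>s = z + k * t\<close>, with \<open>k\<close> equal to
    minus or plus \<open>2 * d\<close>, turns the parametrised segment into an integral over
    \<open>s\<close>, to which only the slab contributes.\<close>
  have down: "(\<integral>\<^sup>+t. indicator {0..1} t * (ennreal \<bar>- 2 * d\<bar> * F x y (z + (- 2 * d) * t)) \<partial>lborel) \<le> (\<integral>\<^sup>+s. indicator {0..<z} s * F x y s \<partial>lborel)"
    and up: "(\<integral>\<^sup>+t. indicator {0..1} t * (ennreal \<bar>2 * d\<bar> * F x y (z + (2 * d) * t)) \<partial>lborel) \<le> (\<integral>\<^sup>+s. indicator {z<..d} s * F x y s \<partial>lborel)" for x y z
  proof -
    define f where "f = (\<lambda>s. indicator {z - 2 * d..z} s * F x y s)"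
    define f' where "f' = (\<lambda>s. indicator {z..z + 2 * d} s * F x y s)"
    have [measurable]: "f \<in> borel_measurable borel" "f' \<in> borel_measurable borel" unfolding f_def f'_def by measurable
    have "(\<integral>\<^sup>+t. indicator {0..1} t * (ennreal \<bar>- 2 * d\<bar> * F x y (z + (- 2 * d) * t)) \<partial>lborel)
        = (\<integral>\<^sup>+t. ennreal \<bar>- 2 * d\<bar> * f (z + (- 2 * d) * t) \<partial>lborel)"
      using d by (intro nn_integral_cong) (auto simp: f_def indicator_def zero_le_mult_iff)
    also have "\<dots> = ennreal \<bar>- 2 * d\<bar> * (\<integral>\<^sup>+t. f (z + (- 2 * d) * t) \<partial>lborel)" by (rule nn_integral_cmult) measurable
    also have "\<dots> = (\<integral>\<^sup>+s. f s \<partial>lborel)"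
      using d by (intro nn_integral_real_affine[symmetric]) auto
    also have "\<dots> \<le> (\<integral>\<^sup>+s. indicator {0..<z} s * F x y s \<partial>lborel)"
    proof (rule nn_integral_mono_AE, use AE_lborel_singleton[of z] in eventually_elim)
      case (elim s)
      then show ?case using F_zero[of s x y] by (auto simp: f_def indicator_def)
    qed
    finally show "(\<integral>\<^sup>+t. indicator {0..1} t * (ennreal \<bar>- 2 * d\<bar> * F x y (z + (- 2 * d) * t)) \<partial>lborel) \<le> (\<integral>\<^sup>+s. indicator {0..<z} s * F x y s \<partial>lborel)" .
    have "(\<integral>\<^sup>+t. indicator {0..1} t * (ennreal \<bar>2 * d\<bar> * F x y (z + (2 * d) * t)) \<partial>lborel)
        = (\<integral>\<^sup>+t. ennreal \<bar>2 * d\<bar> * f' (z + (2 * d) * t) \<partial>lborel)"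
      using d by (intro nn_integral_cong) (auto simp: f'_def indicator_def zero_le_mult_iff)
    also have "\<dots> = ennreal \<bar>2 * d\<bar> * (\<integral>\<^sup>+t. f' (z + (2 * d) * t) \<partial>lborel)" by (rule nn_integral_cmult) measurable
    also have "\<dots> = (\<integral>\<^sup>+s. f' s \<partial>lborel)"
      using d by (intro nn_integral_real_affine[symmetric]) auto
    also have "\<dots> \<le> (\<integral>\<^sup>+s. indicator {z<..d} s * F x y s \<partial>lborel)"
    proof (rule nn_integral_mono_AE, use AE_lborel_singleton[of z] in eventually_elim)
      case (elim s)
      then show ?case using F_zero[of s x y] by (auto simp: f'_def indicator_def)
    qed
    finally show "(\<integral>\<^sup>+t. indicator {0..1} t * (ennreal \<bar>2 * d\<bar> * F x y (z + (2 * d) * t)) \<partial>lborel) \<le> (\<integral>\<^sup>+s. indicator {z<..d} s * F x y s \<partial>lborel)" .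
  qed
  have bound: "AE p in lborel. p \<in> outside a \<and> snd (snd p) \<in> {0<..<d} - {d/2} \<longrightarrow> ennreal ((cmod (u p))\<^sup>2) \<le> Bp p"
    using trans[of "- 2 * d"] trans[of "2 * d"]
  proof eventually_elim
    case (elim p)
    show ?case
    proof (intro impI, elim conjE)
      assume p: "p \<in> outside a" "snd (snd p) \<in> {0<..<d} - {d/2}"
      have "u (p + (0, 0, - 2 * d)) = 0" "u (p + (0, 0, 2 * d)) = 0"
        using p(2) d by (auto intro!: core_zero[OF c] simp: slab_def)
      then have "ennreal (cmod (u p)) \<le> (\<integral>\<^sup>+s. indicator {0..<snd (snd p)} s * F (fst p) (fst (snd p)) s \<partial>lborel)"
        "ennreal (cmod (u p)) \<le> (\<integral>\<^sup>+s. indicator {snd (snd p)<..d} s * F (fst p) (fst (snd p)) s \<partial>lborel)"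
        using order_trans[OF mp[OF elim(1) p(1)] down] order_trans[OF mp[OF elim(2) p(1)] up] by simp_all
      then show "ennreal ((cmod (u p))\<^sup>2) \<le> Bp p"
        unfolding Bp_def B_def ennreal_power[OF norm_ge_zero, symmetric] by (auto intro: power_mono)
    qed
  qed
  have "sq_int_on S u
      \<le> (\<integral>\<^sup>+p. indicator S p * (indicator ({0<..<d} - {d/2}) (snd (snd p)) * Bp p) \<partial>lborel)"
  proof (rule nn_integral_mono_AE)
    show "AE p in lborel. indicator S p * ennreal ((cmod (u p))\<^sup>2) \<le> indicator S p * (indicator ({0<..<d} - {d/2}) (snd (snd p)) * Bp p)"
      using bound AE_coord_neq(3)[of 0] AE_coord_neq(3)[of d] AE_coord_neq(3)[of "d/2"]
    proof eventually_elim
      case (elim p)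
      show ?case
      proof (cases "p \<in> S \<and> snd (snd p) \<in> {0<..<d} - {d/2}")
        case True
        then show ?thesis using elim S(2) by auto
      next
        case False
        then have "p \<notin> S \<or> u p = 0" using elim core_zero[OF c, of p] by (auto simp: slab_def)
        then show ?thesis by auto
      qed
    qed
  qed
  also have "\<dots> = (\<integral>\<^sup>+x. \<integral>\<^sup>+y. indicator S (x, y, 0) * (\<integral>\<^sup>+z. indicator ({0<..<d} - {d/2}) z * B x y z \<partial>lborel) \<partial>lborel \<partial>lborel)"
  proof -
    have 1: "indicator S (x, y, z) = (indicator S (x, y, 0) :: ennreal)" for x y z
      using cyl[of x y z 0] cyl[of x y 0 z] by (auto simp: indicator_def)
    have 2: "(\<lambda>z. indicator ({0<..<d} - {d/2}) z * B x y z) \<in> borel_measurable lborel" for x y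
    proof -
      have c: "(\<lambda>z. (x, y, z)) \<in> borel_measurable borel" by (intro borel_measurable_continuous_onI continuous_intros)
      have [measurable]: "(\<lambda>p :: pt. snd (snd p)) \<in> borel_measurable borel"
        by (intro borel_measurable_continuous_onI continuous_intros)
      have "(\<lambda>p :: pt. indicator ({0<..<d} - {d/2}) (snd (snd p)) * Bp p) \<in> borel_measurable borel" by measurable
      from measurable_compose[OF c this]
      have "(\<lambda>z. indicator ({0<..<d} - {d/2}) (snd (snd (x, y, z))) * Bp (x, y, z)) \<in> borel_measurable borel" .
      then show ?thesis by (simp add: Bp_def)
    qed
    have [measurable]: "(\<lambda>p :: pt. snd (snd p)) \<in> borel_measurable borel"
      by (intro borel_measurable_continuous_onI continuous_intros)
    have "(\<integral>\<^sup>+p. indicator S p * (indicator ({0<..<d} - {d/2}) (snd (snd p)) * Bp p) \<partial>lborel)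
        = (\<integral>\<^sup>+x. \<integral>\<^sup>+y. \<integral>\<^sup>+z. indicator S (x, y, z) * (indicator ({0<..<d} - {d/2}) z * B x y z) \<partial>lborel \<partial>lborel \<partial>lborel)"
      by (subst nn_integral_pt) (simp_all add: Bp_def[symmetric], simp add: Bp_def)
    also have "\<dots> = (\<integral>\<^sup>+x. \<integral>\<^sup>+y. indicator S (x, y, 0) * (\<integral>\<^sup>+z. indicator ({0<..<d} - {d/2}) z * B x y z \<partial>lborel) \<partial>lborel \<partial>lborel)"
      by (subst 1) (simp only: nn_integral_cmult[OF 2])
    finally show ?thesis .
  qed
  also have "\<dots> \<le> (\<integral>\<^sup>+x. \<integral>\<^sup>+y. indicator S (x, y, 0) * (ennreal ((d / pi)\<^sup>2) * (\<integral>\<^sup>+s. indicator {0..d} s * (F x y s)\<^sup>2 \<partial>lborel)) \<partial>lborel \<partial>lborel)"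
    by (intro nn_integral_mono mult_left_mono dirichlet_interval_inequality[OF d F_meas1]) (auto simp: B_def)
  also have "\<dots> = ennreal ((d / pi)\<^sup>2) * sq_int_on S (h 2)"
  proof -
    have 1: "indicator S (x, y, z) = (indicator S (x, y, 0) :: ennreal)" for x y z
      using cyl[of x y z 0] cyl[of x y 0 z] by (auto simp: indicator_def)
    have "ennreal ((d / pi)\<^sup>2) * sq_int_on S (h 2)
        = (\<integral>\<^sup>+p. ennreal ((d / pi)\<^sup>2) * (indicator S p * ennreal ((cmod (h 2 p))\<^sup>2)) \<partial>lborel)"
      by (rule nn_integral_cmult[symmetric]) measurable
    also have "\<dots> = (\<integral>\<^sup>+x. \<integral>\<^sup>+y. \<integral>\<^sup>+z. ennreal ((d / pi)\<^sup>2) * (indicator S (x, y, z) * (F x y z)\<^sup>2) \<partial>lborel \<partial>lborel \<partial>lborel)"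
      by (subst nn_integral_pt) (simp_all add: F_def ennreal_power)
    also have "\<dots> = (\<integral>\<^sup>+x. \<integral>\<^sup>+y. \<integral>\<^sup>+z. (indicator S (x, y, 0) * ennreal ((d / pi)\<^sup>2)) * (indicator {0..d} z * (F x y z)\<^sup>2) \<partial>lborel \<partial>lborel \<partial>lborel)"
    proof (intro nn_integral_cong)
      fix x y z
      show "ennreal ((d / pi)\<^sup>2) * (indicator S (x, y, z) * (F x y z)\<^sup>2) = (indicator S (x, y, 0) * ennreal ((d / pi)\<^sup>2)) * (indicator {0..d} z * (F x y z)\<^sup>2)"
        using F_zero[of z x y] unfolding 1[of x y z] by (cases "z \<in> {0..d}") (simp_all add: mult_ac)
    qed
    also have "\<dots> = (\<integral>\<^sup>+x. \<integral>\<^sup>+y. indicator S (x, y, 0) * (ennreal ((d / pi)\<^sup>2) * (\<integral>\<^sup>+s. indicator {0..d} s * (F x y s)\<^sup>2 \<partial>lborel)) \<partial>lborel \<partial>lborel)"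
      by (subst nn_integral_cmult) (auto simp: mult.assoc)
    finally show ?thesis ..
  qed
  also have "\<dots> \<le> ennreal ((d / pi)\<^sup>2) * sq_int_on S (g 2)"
    by (intro mult_left_mono nn_integral_mono) (auto simp: h_def norm_mult indicator_def)
  finally show ?thesis .
qed

text \<open>Equals \<open>(sin (pi * \<alpha>))^2 / pi^2\<close>. The denominator is the square of
  the duration 2 pi of one turn: one factor comes from Cauchy-Schwarz and one from averaging over
  the turn.\<close>

definition hardy_const :: "real \<Rightarrow> real" where
  "hardy_const \<alpha> = (cmod (exp (\<i> * complex_of_real (- \<alpha>) * (2 * pi)) - 1))\<^sup>2 / (4 * pi\<^sup>2)"

lemma hardy_const_pos:
  assumes "\<alpha> \<notin> \<int>" shows "hardy_const \<alpha> > 0"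
proof -
  have "exp (\<i> * complex_of_real (- \<alpha>) * (2 * pi)) \<noteq> 1"
  proof
    assume "exp (\<i> * complex_of_real (- \<alpha>) * (2 * pi)) = 1"
    then obtain n :: int where "- \<alpha> * (2 * pi) = of_int (2 * n) * pi" unfolding exp_eq_1 by auto
    then have "pi * (\<alpha> + of_int n) = 0" by (simp add: algebra_simps)
    then have "\<alpha> = of_int (- n)" by simp
    then show False using assms by (metis Ints_of_int)
  qed
  then show ?thesis unfolding hardy_const_def by simp
qed

lemma cauchy_schwarz_interval:
  fixes f :: "real \<Rightarrow> ennreal"
  assumes [measurable]: "f \<in> borel_measurable borel" and T: "T \<ge> 0"
  shows "(\<integral>\<^sup>+t. indicator {0..T} t * f t \<partial>lborel)\<^sup>2 \<le> ennreal T * (\<integral>\<^sup>+t. indicator {0..T} t * (f t)\<^sup>2 \<partial>lborel)"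
proof -
  have "(\<integral>\<^sup>+t. indicator {0..T} t * f t \<partial>lborel) = (\<integral>\<^sup>+t. indicator {0..T} t * (indicator {0..T} t * f t) \<partial>lborel)"
    by (intro nn_integral_cong) (auto simp: indicator_def)
  also have "(\<integral>\<^sup>+t. indicator {0..T} t * (indicator {0..T} t * f t) \<partial>lborel)\<^sup>2
     \<le> (\<integral>\<^sup>+t. (indicator {0..T} t)\<^sup>2 \<partial>lborel) * (\<integral>\<^sup>+t. (indicator {0..T} t * f t)\<^sup>2 \<partial>lborel)"
    by (rule Cauchy_Schwarz_nn_integral) measurable
  also have "(\<integral>\<^sup>+t. (indicator {0..T} t :: ennreal)\<^sup>2 \<partial>lborel) = (\<integral>\<^sup>+t. indicator {0..T} t \<partial>lborel)"
    by (intro nn_integral_cong) (auto simp: indicator_def)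
  also have "\<dots> = ennreal T" using T by simp
  also have "(\<integral>\<^sup>+t. (indicator {0..T} t * f t)\<^sup>2 \<partial>lborel) = (\<integral>\<^sup>+t. indicator {0..T} t * (f t)\<^sup>2 \<partial>lborel)"
    by (intro nn_integral_cong) (auto simp: indicator_def)
  finally show ?thesis .
qed

lemma (in mp_flow) meas_flow_line:
  assumes "f \<in> borel_measurable borel"
  shows "(\<lambda>t. f (\<Psi> t p)) \<in> borel_measurable borel"
proof -
  have c: "continuous_on UNIV (\<lambda>t. (t, p))" by (intro continuous_intros)
  have "continuous_on UNIV (\<lambda>t. \<Psi> t p)" using continuous_on_compose2[OF cont_\<Psi> c] by simp
  from measurable_compose[OF borel_measurable_continuous_onI[OF this] assms] show ?thesis .
qed

text \<open>Tonelli's theorem, with all time slices having the same integral.\<close>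

lemma (in mp_flow) nn_integral_flow_average:
  assumes [measurable]: "f \<in> borel_measurable borel" and T: "T \<ge> 0"
  shows "(\<integral>\<^sup>+p. \<integral>\<^sup>+t. indicator {0..T} t * f (\<Psi> t p) \<partial>lborel \<partial>lborel) = ennreal T * (\<integral>\<^sup>+p. f p \<partial>lborel)"
proof -
  note [measurable] = meas_joint[OF assms(1)]
  have "(\<integral>\<^sup>+p. \<integral>\<^sup>+t. indicator {0..T} t * f (\<Psi> t p) \<partial>lborel \<partial>lborel) = (\<integral>\<^sup>+t. \<integral>\<^sup>+p. indicator {0..T} t * f (\<Psi> t p) \<partial>lborel \<partial>lborel)"
    by (rule lborel_pair.Fubini') (simp add: case_prod_beta, measurable)
  also have "\<dots> = (\<integral>\<^sup>+t. (\<integral>\<^sup>+p. f p \<partial>lborel) * indicator {0..T} t \<partial>lborel)"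
  proof (rule nn_integral_cong)
    fix t
    have "(\<integral>\<^sup>+p. indicator {0..T} t * f (\<Psi> t p) \<partial>lborel) = indicator {0..T} t * (\<integral>\<^sup>+p. f (\<Psi> t p) \<partial>lborel)"
      using meas_\<Psi>[of t] by (intro nn_integral_cmult) measurable
    then show "(\<integral>\<^sup>+p. indicator {0..T} t * f (\<Psi> t p) \<partial>lborel) = (\<integral>\<^sup>+p. f p \<partial>lborel) * indicator {0..T} t"
      using nn_integral_\<Psi>[OF assms(1), of t] by (simp add: mult.commute)
  qed
  also have "\<dots> = ennreal T * (\<integral>\<^sup>+p. f p \<partial>lborel)"
    using T by (simp add: nn_integral_cmult_indicator mult.commute)
  finally show ?thesis .
qed

lemma core_zero_axis: "core d a u g \<Longrightarrow> (fst p)\<^sup>2 + (fst (snd p))\<^sup>2 = 0 \<Longrightarrow> u p = 0"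
proof -
  assume "core d a u g" and r: "(fst p)\<^sup>2 + (fst (snd p))\<^sup>2 = 0"
  then obtain n where n: "n \<ge> 2" "\<And>p. p \<notin> Omega_n d n \<Longrightarrow> u p = 0" unfolding core_def by blast
  have "(1 / real n)\<^sup>2 > 0" using n by simp
  then have "p \<notin> Omega_n d n" using r unfolding Omega_n_def by (auto simp: case_prod_beta)
  then show ?thesis by (rule n(2))
qed

text \<open>Let w = (i nabla + A) u. For \<open>\<beta> = - \<alpha>\<close> the integrand of
  \<open>rotation_identity\<close> is, up to a factor of modulus one, y w_0 - x w_1, because y A_0 -
  x A_1 is the constant alpha off the axis. Its square is therefore at most r^2 times the horizontal
  energy density. The weight is constant along circles and passes through the average.\<close>

lemma hardy_inequality:
  assumes c: "core d a u g" and \<rho> [measurable]: "\<rho> \<in> borel_measurable borel" and inv: "\<And>t p. \<rho> (rot t p) = \<rho> p"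
  shows "ennreal (hardy_const \<alpha>) * (\<integral>\<^sup>+p. \<rho> p * ennreal ((cmod (u p))\<^sup>2) \<partial>lborel)
    \<le> (\<integral>\<^sup>+p. \<rho> p * ennreal (((fst p)\<^sup>2 + (fst (snd p))\<^sup>2) * ((cmod (mgrad \<alpha> u g 0 p))\<^sup>2 + (cmod (mgrad \<alpha> u g 1 p))\<^sup>2)) \<partial>lborel)"
proof -
  interpret mp_flow rot "\<lambda>t. rot (- t)" by (rule mp_flow_rot)
  note u = core_L2[OF c] and wg = core_weak_grad[OF c]
  note [measurable] = L2_measurable[OF u] L2_measurable[OF weak_grad_L2[OF wg]]
  have gm [measurable]: "g 0 \<in> borel_measurable borel" "g (Suc 0) \<in> borel_measurable borel" "g 2 \<in> borel_measurable borel"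
    using L2_measurable[OF weak_grad_L2[OF wg]] by auto
  define H where "H = (\<lambda>p. \<i> * complex_of_real (- \<alpha>) * u p - (\<Sum>j<3. complex_of_real (comp j (rgen p)) * g j p))"
  have [measurable]: "(\<lambda>p. comp j (rgen p)) \<in> borel_measurable borel" for j
    by (rule borel_measurable_continuous_onI[OF continuous_on_compose2[OF cont_comp cont_rgen]]) auto
  have H_meas [measurable]: "H \<in> borel_measurable borel"
  proof (rule loc_int_measurable)
    show "loc_int H"
      unfolding H_def using weak_grad_L2[OF wg] u
      by (intro loc_int_diff loc_int_sum loc_int_mult_continuous L2_loc_int continuous_intros
          continuous_on_compose2[OF cont_comp cont_rgen]) auto
  qed
  have H_le: "(cmod (H p))\<^sup>2 \<le> ((fst p)\<^sup>2 + (fst (snd p))\<^sup>2) * ((cmod (mgrad \<alpha> u g 0 p))\<^sup>2 + (cmod (mgrad \<alpha> u g 1 p))\<^sup>2)" for p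
  proof -
    obtain x y z where p: "p = (x, y, z)" by (cases p)
    have H: "H p = - \<i> * \<alpha> * u p + y * g 0 p - x * g 1 p"
      unfolding H_def sum_less_3 p by (simp add: rgen_def algebra_simps)
    show ?thesis
    proof (cases "x\<^sup>2 + y\<^sup>2 = 0")
      case True
      then have "x = 0" "y = 0" by (auto simp: sum_power2_eq_zero_iff)
      moreover have "u p = 0" by (rule core_zero_axis[OF c]) (simp add: p True)
      ultimately have "H p = 0" unfolding H by simp
      then show ?thesis by simp
    next
      case False
      have "y * Apot \<alpha> 0 p - x * Apot \<alpha> 1 p = (\<alpha> * (x\<^sup>2 + y\<^sup>2)) / (x\<^sup>2 + y\<^sup>2)"
        unfolding Apot_def p by (simp add: power2_eq_square add_divide_distrib algebra_simps)
      also have "\<dots> = \<alpha>" using False by simp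
      finally have A: "complex_of_real y * complex_of_real (Apot \<alpha> 0 p) - complex_of_real x * complex_of_real (Apot \<alpha> 1 p) = complex_of_real \<alpha>"
        by (metis of_real_diff of_real_mult)
      have "y * mgrad \<alpha> u g 0 p - x * mgrad \<alpha> u g 1 p
          = \<i> * (y * g 0 p - x * g 1 p) + (complex_of_real y * complex_of_real (Apot \<alpha> 0 p) - complex_of_real x * complex_of_real (Apot \<alpha> 1 p)) * u p"
        unfolding mgrad_def by (simp add: algebra_simps)
      also have "\<dots> = \<i> * H p" unfolding A H by (simp add: algebra_simps)
      finally have iH: "\<i> * H p = y * mgrad \<alpha> u g 0 p - x * mgrad \<alpha> u g 1 p" ..
      have "cmod (H p) = cmod (y * mgrad \<alpha> u g 0 p - x * mgrad \<alpha> u g 1 p)"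
        unfolding iH[symmetric] by (simp add: norm_mult)
      also have "\<dots> \<le> \<bar>y\<bar> * cmod (mgrad \<alpha> u g 0 p) + \<bar>x\<bar> * cmod (mgrad \<alpha> u g 1 p)"
        by (rule order_trans[OF norm_triangle_ineq4]) (simp add: norm_mult)
      finally have "(cmod (H p))\<^sup>2 \<le> (\<bar>y\<bar> * cmod (mgrad \<alpha> u g 0 p) + \<bar>x\<bar> * cmod (mgrad \<alpha> u g 1 p))\<^sup>2"
        by (rule power_mono) simp
      also have "\<dots> \<le> (y\<^sup>2 + x\<^sup>2) * ((cmod (mgrad \<alpha> u g 0 p))\<^sup>2 + (cmod (mgrad \<alpha> u g 1 p))\<^sup>2)"
      proof -
        have "(b * A + e * B)\<^sup>2 \<le> (b\<^sup>2 + e\<^sup>2) * (A\<^sup>2 + B\<^sup>2)" for b e A B :: real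
        proof -
          have "(b\<^sup>2 + e\<^sup>2) * (A\<^sup>2 + B\<^sup>2) - (b * A + e * B)\<^sup>2 = (b * B - e * A)\<^sup>2"
            by (simp add: power2_eq_square algebra_simps)
          then show ?thesis by (smt (verit) zero_le_power2)
        qed
        from this[of "\<bar>y\<bar>" _ "\<bar>x\<bar>"] show ?thesis by simp
      qed
      finally show ?thesis unfolding p by (simp add: add.commute)
    qed
  qed
  define e where "e = exp (\<i> * complex_of_real (- \<alpha>) * (2 * pi)) - 1"
  have "AE p in lborel. snd (snd p) > 0 \<longrightarrow> ennreal ((cmod (e * u p))\<^sup>2)
      \<le> ennreal (2 * pi) * (\<integral>\<^sup>+t. indicator {0..2 * pi} t * ennreal ((cmod (H (rot (- t) p)))\<^sup>2) \<partial>lborel)"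
    using rotation_identity[OF u weak_grad_mono[OF wg], where \<beta> = "- \<alpha>"]
  proof (rule AE_mp[OF _ AE_I2[OF impI]])
    show "{p. snd (snd p) > 0} \<subseteq> UNIV - window a" unfolding window_def by auto
    fix p assume id: "snd (snd p) > 0 \<longrightarrow> (exp (\<i> * complex_of_real (- \<alpha>) * complex_of_real (2 * pi)) - 1) * u p
        = (LINT t|lborel. indicator {0..2 * pi} t *\<^sub>R (exp (\<i> * complex_of_real (- \<alpha>) * complex_of_real t) *
       (\<i> * complex_of_real (- \<alpha>) * u (rot (- t) p) - (\<Sum>j<3. complex_of_real (comp j (rgen (rot (- t) p))) * g j (rot (- t) p)))))"
    show "snd (snd p) > 0 \<longrightarrow> ennreal ((cmod (e * u p))\<^sup>2)
      \<le> ennreal (2 * pi) * (\<integral>\<^sup>+t. indicator {0..2 * pi} t * ennreal ((cmod (H (rot (- t) p)))\<^sup>2) \<partial>lborel)"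
    proof
      assume "snd (snd p) > 0"
      then have eu: "e * u p = (LINT t|lborel. indicator {0..2 * pi} t *\<^sub>R (exp (\<i> * complex_of_real (- \<alpha>) * complex_of_real t) * H (rot (- t) p)))"
        using id unfolding e_def H_def by simp
      have ex: "cmod (exp (\<i> * complex_of_real (- \<alpha>) * complex_of_real t)) = 1" for t
        by (simp add: norm_exp_eq_Re)
      have "ennreal (cmod (e * u p)) \<le> (\<integral>\<^sup>+t. ennreal (norm (indicator {0..2 * pi} t *\<^sub>R (exp (\<i> * complex_of_real (- \<alpha>) * complex_of_real t) * H (rot (- t) p)))) \<partial>lborel)"
        unfolding eu by (rule norm_lebesgue_integral_le_nn)
      also have "\<dots> = (\<integral>\<^sup>+t. indicator {0..2 * pi} t * ennreal (cmod (H (rot (- t) p))) \<partial>lborel)"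
        by (intro nn_integral_cong) (simp add: norm_mult ex indicator_def)
      finally have "(ennreal (cmod (e * u p)))\<^sup>2 \<le> (\<integral>\<^sup>+t. indicator {0..2 * pi} t * ennreal (cmod (H (rot (- t) p))) \<partial>lborel)\<^sup>2"
        by (rule power_mono) simp
      also have "\<dots> \<le> ennreal (2 * pi) * (\<integral>\<^sup>+t. indicator {0..2 * pi} t * (ennreal (cmod (H (rot (- t) p))))\<^sup>2 \<partial>lborel)"
        by (rule cauchy_schwarz_interval[OF meas_flow_line[of "\<lambda>p. ennreal (cmod (H p))"]]) auto
      finally show "ennreal ((cmod (e * u p))\<^sup>2)
        \<le> ennreal (2 * pi) * (\<integral>\<^sup>+t. indicator {0..2 * pi} t * ennreal ((cmod (H (rot (- t) p)))\<^sup>2) \<partial>lborel)"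
        by (simp add: ennreal_power)
    qed
  qed
  then have "(\<integral>\<^sup>+p. \<rho> p * ennreal ((cmod (e * u p))\<^sup>2) \<partial>lborel)
      \<le> (\<integral>\<^sup>+p. \<rho> p * (ennreal (2 * pi) * (\<integral>\<^sup>+t. indicator {0..2 * pi} t * ennreal ((cmod (H (rot (- t) p)))\<^sup>2) \<partial>lborel)) \<partial>lborel)"
    using AE_coord_neq(3)[of 0]
  proof (intro nn_integral_mono_AE, eventually_elim)
    case (elim p)
    \<comment> \<open>The rotation identity covers \<open>z > 0\<close>, \<open>u\<close> vanishes
      for \<open>z < 0\<close>, and the plane \<open>z = 0\<close> is a null set.\<close>
    then have "snd (snd p) > 0 \<or> p \<notin> slab d" by (auto simp: slab_def)
    then show ?case using elim core_zero[OF c, of p] by (auto intro: mult_left_mono)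
  qed
  also have "\<dots> = (\<integral>\<^sup>+p. \<integral>\<^sup>+t. indicator {0..2 * pi} t * (ennreal (2 * pi) * (\<rho> (rot (- t) p) * ennreal ((cmod (H (rot (- t) p)))\<^sup>2))) \<partial>lborel \<partial>lborel)"
  proof (rule nn_integral_cong)
    fix p
    have m: "(\<lambda>t. indicator {0..2 * pi} t * ennreal ((cmod (H (rot (- t) p)))\<^sup>2)) \<in> borel_measurable lborel"
      using meas_flow_line[of "\<lambda>p. ennreal ((cmod (H p))\<^sup>2)" p] by simp
    show "\<rho> p * (ennreal (2 * pi) * (\<integral>\<^sup>+t. indicator {0..2 * pi} t * ennreal ((cmod (H (rot (- t) p)))\<^sup>2) \<partial>lborel))
      = (\<integral>\<^sup>+t. indicator {0..2 * pi} t * (ennreal (2 * pi) * (\<rho> (rot (- t) p) * ennreal ((cmod (H (rot (- t) p)))\<^sup>2))) \<partial>lborel)"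
    proof -
      have m2: "(\<lambda>t. ennreal (2 * pi) * (indicator {0..2 * pi} t * ennreal ((cmod (H (rot (- t) p)))\<^sup>2))) \<in> borel_measurable lborel"
        using m by measurable
      show ?thesis
        unfolding inv nn_integral_cmult[OF m, symmetric] nn_integral_cmult[OF m2, symmetric]
        by (intro nn_integral_cong) (simp only: mult_ac)
    qed
  qed
  also have "\<dots> = ennreal (2 * pi) * (\<integral>\<^sup>+p. ennreal (2 * pi) * (\<rho> p * ennreal ((cmod (H p))\<^sup>2)) \<partial>lborel)"
    by (rule nn_integral_flow_average[of "\<lambda>p. ennreal (2 * pi) * (\<rho> p * ennreal ((cmod (H p))\<^sup>2))"]) auto
  also have "\<dots> = ennreal (4 * pi\<^sup>2) * (\<integral>\<^sup>+p. \<rho> p * ennreal ((cmod (H p))\<^sup>2) \<partial>lborel)"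
    by (subst nn_integral_cmult) (auto simp: ennreal_mult[symmetric] power2_eq_square mult.assoc[symmetric])
  also have "\<dots> \<le> ennreal (4 * pi\<^sup>2) * (\<integral>\<^sup>+p. \<rho> p * ennreal (((fst p)\<^sup>2 + (fst (snd p))\<^sup>2) * ((cmod (mgrad \<alpha> u g 0 p))\<^sup>2 + (cmod (mgrad \<alpha> u g 1 p))\<^sup>2)) \<partial>lborel)"
    by (intro mult_left_mono nn_integral_mono ennreal_leI H_le) auto
  finally have main: "(\<integral>\<^sup>+p. \<rho> p * ennreal ((cmod (e * u p))\<^sup>2) \<partial>lborel) \<le> ennreal (4 * pi\<^sup>2) * (\<integral>\<^sup>+p. \<rho> p * ennreal (((fst p)\<^sup>2 + (fst (snd p))\<^sup>2) * ((cmod (mgrad \<alpha> u g 0 p))\<^sup>2 + (cmod (mgrad \<alpha> u g 1 p))\<^sup>2)) \<partial>lborel)" .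
  have he: "4 * pi\<^sup>2 * hardy_const \<alpha> = (cmod e)\<^sup>2" unfolding hardy_const_def e_def by simp
  have "(\<integral>\<^sup>+p. \<rho> p * ennreal ((cmod (e * u p))\<^sup>2) \<partial>lborel) = (\<integral>\<^sup>+p. ennreal (4 * pi\<^sup>2 * hardy_const \<alpha>) * (\<rho> p * ennreal ((cmod (u p))\<^sup>2)) \<partial>lborel)"
    unfolding he by (intro nn_integral_cong) (simp add: norm_mult power_mult_distrib ennreal_mult mult.left_commute)
  also have "\<dots> = ennreal (4 * pi\<^sup>2 * hardy_const \<alpha>) * (\<integral>\<^sup>+p. \<rho> p * ennreal ((cmod (u p))\<^sup>2) \<partial>lborel)"
    by (rule nn_integral_cmult) measurable
  also have "\<dots> = ennreal (4 * pi\<^sup>2) * (ennreal (hardy_const \<alpha>) * (\<integral>\<^sup>+p. \<rho> p * ennreal ((cmod (u p))\<^sup>2) \<partial>lborel))"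
  proof -
    have "ennreal (4 * pi\<^sup>2 * hardy_const \<alpha>) = ennreal (4 * pi\<^sup>2) * ennreal (hardy_const \<alpha>)"
      by (rule ennreal_mult) (auto simp: hardy_const_def)
    then show ?thesis by (simp only: mult.assoc)
  qed
  finally show ?thesis using main by (simp add: ennreal_mult_le_mult_iff)
qed

section \<open>Poincare's inequality on a box\<close>

lemma convex_combination_box:
  assumes "p \<in> box l m" "p + v \<in> box l m" "0 \<le> t" "t \<le> 1"
  shows "p + t *\<^sub>R v \<in> box l (m :: pt)"
proof -
  have "(1 - t) *\<^sub>R p + t *\<^sub>R (p + v) \<in> box l m"
    using convex_box(2)[of l m] assms by (auto simp: convex_alt)
  then show ?thesis by (simp add: algebra_simps)
qed

definition grad_sq :: "vfn \<Rightarrow> pt \<Rightarrow> real" where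
  "grad_sq g p = (\<Sum>j<3. (cmod (g j p))\<^sup>2)"

lemma comp_sum_le: "(cmod (\<Sum>j<3. complex_of_real (comp j v) * a j))\<^sup>2 \<le> (norm v)\<^sup>2 * (\<Sum>j<3. (cmod (a j))\<^sup>2)"
proof -
  have nv: "(norm v)\<^sup>2 = (\<Sum>j<3. \<bar>comp j v\<bar>\<^sup>2)"
    by (cases v) (simp add: sum_less_3 norm_prod_def)
  have "cmod (\<Sum>j<3. complex_of_real (comp j v) * a j) \<le> (\<Sum>j<3. \<bar>comp j v\<bar> * cmod (a j))"
    by (rule order_trans[OF norm_sum]) (simp add: norm_mult)
  then have "(cmod (\<Sum>j<3. complex_of_real (comp j v) * a j))\<^sup>2 \<le> (\<Sum>j<3. \<bar>comp j v\<bar> * cmod (a j))\<^sup>2"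
    by (rule power_mono) simp
  also have "\<dots> \<le> (\<Sum>j<3. \<bar>comp j v\<bar>\<^sup>2) * (\<Sum>j<3. (cmod (a j))\<^sup>2)" by (rule Cauchy_Schwarz_ineq_sum)
  finally show ?thesis unfolding nv .
qed

lemma grad_sq_measurable:
  assumes "weak_grad U u g" shows "grad_sq g \<in> borel_measurable borel"
proof -
  have "(\<lambda>p. (cmod (g j p))\<^sup>2) \<in> borel_measurable borel" if "j \<in> {..<3}" for j
    using L2_measurable[OF weak_grad_L2[OF assms]] that by simp
  then show ?thesis unfolding grad_sq_def by (rule borel_measurable_sum)
qed

text \<open>By convexity the segment from \<open>p\<close> to \<open>p + v\<close> stays in the box
  when its end points do. The average over the segment is absorbed by translation
  invariance.\<close>

lemma translation_estimate:
  assumes u: "L2 u" and wg: "weak_grad U u g" and Q: "box l m \<subseteq> U"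
  shows "(\<integral>\<^sup>+p. indicator (box l m) p * indicator (box l m) (p + v) * ennreal ((cmod (u (p + v) - u p))\<^sup>2) \<partial>lborel)
     \<le> ennreal ((norm v)\<^sup>2) * (\<integral>\<^sup>+p. indicator (box l m) p * ennreal (grad_sq g p) \<partial>lborel)"
proof -
  interpret mp_flow "\<lambda>t p. p + t *\<^sub>R (- v)" "\<lambda>t p. p - t *\<^sub>R (- v)" by (rule mp_flow_translation)
  note [measurable] = grad_sq_measurable[OF wg]
  define V where "V = box l m \<inter> (\<lambda>p. p + v) -` box l m"
  have V: "open V" unfolding V_def
    by (intro open_Int open_box continuous_open_vimage continuous_intros)
  define f where "f = (\<lambda>p. ennreal ((norm v)\<^sup>2) * (indicator (box l m) p * ennreal (grad_sq g p)))"
  have f_meas [measurable]: "f \<in> borel_measurable borel" unfolding f_def by measurable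
  have "AE p in lborel. p \<in> V \<longrightarrow> u (p + v) - u p = (LINT t|lborel. indicator {0..1} t *\<^sub>R (\<Sum>j<3. complex_of_real (comp j v) * g j (p + t *\<^sub>R v)))"
  proof (rule translation_identity[OF u wg V])
    show "p + t *\<^sub>R v \<in> U" if "p \<in> V" "0 \<le> t" "t \<le> 1" for p t
      using that(1) unfolding V_def by (intro subsetD[OF Q convex_combination_box[OF _ _ that(2,3)]]) simp_all
  qed
  then have "AE p in lborel. indicator (box l m) p * indicator (box l m) (p + v) * ennreal ((cmod (u (p + v) - u p))\<^sup>2)
      \<le> (\<integral>\<^sup>+t. indicator {0..1} t * f (p - t *\<^sub>R (- v)) \<partial>lborel)"
  proof eventually_elim
    case (elim p)
    show ?case
    proof (cases "p \<in> V")
      case True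
      define k where "k = (\<lambda>t. \<Sum>j<3. complex_of_real (comp j v) * g j (p + t *\<^sub>R v))"
      have k_meas: "(\<lambda>t. ennreal (cmod (k t))) \<in> borel_measurable borel"
      proof -
        have "(\<lambda>p. ennreal (cmod (\<Sum>j<3. complex_of_real (comp j v) * g j p))) \<in> borel_measurable borel"
        proof -
          have "(\<lambda>p. \<Sum>j<3. complex_of_real (comp j v) * g j p) \<in> borel_measurable borel"
            using L2_measurable[OF weak_grad_L2[OF wg]] by (intro borel_measurable_sum borel_measurable_times borel_measurable_const) auto
          then show ?thesis by simp
        qed
        from meas_flow_line[OF this, of p] show ?thesis unfolding k_def by simp
      qed
      have eq: "u (p + v) - u p = (LINT t|lborel. indicator {0..1} t *\<^sub>R k t)" using elim True unfolding k_def by blast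
      have "ennreal (cmod (u (p + v) - u p)) \<le> (\<integral>\<^sup>+t. ennreal (norm (indicator {0..1} t *\<^sub>R k t)) \<partial>lborel)"
        unfolding eq by (rule norm_lebesgue_integral_le_nn)
      also have "\<dots> = (\<integral>\<^sup>+t. indicator {0..1} t * ennreal (cmod (k t)) \<partial>lborel)"
        by (intro nn_integral_cong) (simp add: indicator_def)
      finally have "(ennreal (cmod (u (p + v) - u p)))\<^sup>2 \<le> (\<integral>\<^sup>+t. indicator {0..1} t * ennreal (cmod (k t)) \<partial>lborel)\<^sup>2"
        by (rule power_mono) simp
      also have "\<dots> \<le> ennreal 1 * (\<integral>\<^sup>+t. indicator {0..1} t * (ennreal (cmod (k t)))\<^sup>2 \<partial>lborel)"
        by (rule cauchy_schwarz_interval[OF k_meas]) simp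
      also have "\<dots> \<le> (\<integral>\<^sup>+t. indicator {0..1} t * f (p - t *\<^sub>R (- v)) \<partial>lborel)"
        unfolding ennreal_1 mult_1
      proof (rule nn_integral_mono)
        fix t :: real
        show "indicator {0..1} t * (ennreal (cmod (k t)))\<^sup>2 \<le> indicator {0..1} t * f (p - t *\<^sub>R (- v))"
        proof (cases "t \<in> {0..1}")
          case t: True
          then have "p + t *\<^sub>R v \<in> box l m" using True unfolding V_def by (intro convex_combination_box) auto
          moreover have "(cmod (k t))\<^sup>2 \<le> (norm v)\<^sup>2 * grad_sq g (p + t *\<^sub>R v)"
            unfolding k_def grad_sq_def by (rule comp_sum_le)
          then have "ennreal ((cmod (k t))\<^sup>2) \<le> ennreal ((norm v)\<^sup>2) * ennreal (grad_sq g (p + t *\<^sub>R v))"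
            by (simp add: ennreal_mult[symmetric] grad_sq_def sum_nonneg ennreal_leI)
          ultimately show ?thesis using t by (simp add: f_def ennreal_power)
        qed simp
      qed
      finally show ?thesis using True by (simp add: V_def ennreal_power)
    qed (auto simp: V_def indicator_def)
  qed
  then have "(\<integral>\<^sup>+p. indicator (box l m) p * indicator (box l m) (p + v) * ennreal ((cmod (u (p + v) - u p))\<^sup>2) \<partial>lborel)
     \<le> (\<integral>\<^sup>+p. \<integral>\<^sup>+t. indicator {0..1} t * f (p - t *\<^sub>R (- v)) \<partial>lborel \<partial>lborel)"
    by (rule nn_integral_mono_AE)
  also have "\<dots> = ennreal 1 * (\<integral>\<^sup>+p. f p \<partial>lborel)" by (rule nn_integral_flow_average) auto
  also have "\<dots> = ennreal ((norm v)\<^sup>2) * (\<integral>\<^sup>+p. indicator (box l m) p * ennreal (grad_sq g p) \<partial>lborel)"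
    unfolding f_def by (simp add: nn_integral_cmult)
  finally show ?thesis .
qed

definition vol :: "pt \<Rightarrow> pt \<Rightarrow> real" where
  "vol l m = (fst m - fst l) * (fst (snd m) - fst (snd l)) * (snd (snd m) - snd (snd l))"

lemma emeasure_box_pt:
  assumes "fst l < fst m" "fst (snd l) < fst (snd m)" "snd (snd l) < snd (snd m)"
  shows "emeasure lborel (box l m) = ennreal (vol l m)" "vol l m > 0"
proof -
  have B: "(Basis :: pt set) = {(1, 0, 0), (0, 1, 0), (0, 0, 1)}" by (auto simp: Basis_prod_def zero_prod_def)
  show "emeasure lborel (box l m) = ennreal (vol l m)"
    using assms by (subst emeasure_lborel_box) (auto simp: B inner_prod_def vol_def mult.assoc less_imp_le)
  show "vol l m > 0" unfolding vol_def using assms by simp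
qed

text \<open>With \<open>q = p + v\<close> the translation estimate is integrated over all
  displacements. They fill the box from \<open>l - m\<close> to \<open>m - l\<close>, whose volume
  is eight times that of the original box.\<close>

lemma poincare_pairs:
  assumes u: "L2 u" and wg: "weak_grad U u g" and Q: "box l m \<subseteq> U"
    and lm: "fst l < fst m" "fst (snd l) < fst (snd m)" "snd (snd l) < snd (snd m)"
  shows "(\<integral>\<^sup>+p. indicator (box l m) p * (\<integral>\<^sup>+q. indicator (box l m) q * ennreal ((cmod (u q - u p))\<^sup>2) \<partial>lborel) \<partial>lborel)
     \<le> ennreal (8 * vol l m * (norm (m - l))\<^sup>2) * (\<integral>\<^sup>+p. indicator (box l m) p * ennreal (grad_sq g p) \<partial>lborel)"
proof -
  define I where "I = (\<integral>\<^sup>+p. indicator (box l m) p * ennreal (grad_sq g p) \<partial>lborel)"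
  note [measurable] = L2_measurable[OF u]
  have add_meas [measurable]: "(\<lambda>x :: pt \<times> pt. fst x + snd x) \<in> borel_measurable (lborel \<Otimes>\<^sub>M lborel)"
    unfolding lborel_prod by (simp add: borel_measurable_continuous_onI continuous_intros)
  have fst_meas [measurable]: "(fst :: pt \<times> pt \<Rightarrow> pt) \<in> borel_measurable (lborel \<Otimes>\<^sub>M lborel)"
    unfolding lborel_prod by (simp add: borel_measurable_continuous_onI continuous_intros)
  define K where "K = (\<lambda>p v. indicator (box l m) p * indicator (box l m) (p + v) * ennreal ((cmod (u (p + v) - u p))\<^sup>2))"
  have K_meas: "(\<lambda>(p, v). K p v) \<in> borel_measurable (lborel \<Otimes>\<^sub>M lborel)"
    unfolding K_def case_prod_beta by measurable
  have "(\<integral>\<^sup>+p. indicator (box l m) p * (\<integral>\<^sup>+q. indicator (box l m) q * ennreal ((cmod (u q - u p))\<^sup>2) \<partial>lborel) \<partial>lborel)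
      = (\<integral>\<^sup>+p. \<integral>\<^sup>+v. K p v \<partial>lborel \<partial>lborel)"
  proof (rule nn_integral_cong)
    fix p
    define f where "f = (\<lambda>q. indicator (box l m) p * (indicator (box l m) q * ennreal ((cmod (u q - u p))\<^sup>2)))"
    have [measurable]: "f \<in> borel_measurable borel" unfolding f_def by measurable
    have "indicator (box l m) p * (\<integral>\<^sup>+q. indicator (box l m) q * ennreal ((cmod (u q - u p))\<^sup>2) \<partial>lborel) = (\<integral>\<^sup>+q. f q \<partial>lborel)"
      unfolding f_def by (rule nn_integral_cmult[symmetric]) measurable
    also have "\<dots> = (\<integral>\<^sup>+v. f (p + v) \<partial>lborel)"
      by (subst lborel_distr_plus[of p, symmetric]) (simp add: nn_integral_distr)
    also have "\<dots> = (\<integral>\<^sup>+v. K p v \<partial>lborel)" unfolding f_def K_def by (simp only: mult.assoc)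
    finally show "indicator (box l m) p * (\<integral>\<^sup>+q. indicator (box l m) q * ennreal ((cmod (u q - u p))\<^sup>2) \<partial>lborel) = (\<integral>\<^sup>+v. K p v \<partial>lborel)" .
  qed
  also have "\<dots> = (\<integral>\<^sup>+v. \<integral>\<^sup>+p. K p v \<partial>lborel \<partial>lborel)"
    by (rule lborel_pair.Fubini'[symmetric]) (use K_meas in \<open>simp add: case_prod_beta\<close>)
  also have "\<dots> \<le> (\<integral>\<^sup>+v. (ennreal ((norm (m - l))\<^sup>2) * I) * indicator (box (l - m) (m - l)) v \<partial>lborel)"
  proof (rule nn_integral_mono)
    fix v
    show "(\<integral>\<^sup>+p. K p v \<partial>lborel) \<le> (ennreal ((norm (m - l))\<^sup>2) * I) * indicator (box (l - m) (m - l)) v"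
    proof (cases "v \<in> box (l - m) (m - l)")
      case True
      then have "norm v \<le> norm (m - l)"
        by (intro norm_le_componentwise) (auto simp: mem_box inner_diff_left abs_if)
      then have "ennreal ((norm v)\<^sup>2) \<le> ennreal ((norm (m - l))\<^sup>2)" by (intro ennreal_leI power_mono) auto
      then show ?thesis
        using order_trans[OF translation_estimate[OF u wg Q, of v, folded I_def] mult_right_mono[of _ _ I]] True
        unfolding K_def by simp
    next
      case False
      have "K p v = 0" for p
      proof (rule ccontr)
        assume "K p v \<noteq> 0"
        then have "p \<in> box l m" "p + v \<in> box l m" unfolding K_def by (auto simp: indicator_def split: if_splits)
        then have "v \<in> box (l - m) (m - l)" unfolding box_pt_mem by simp
        then show False using False by simp
      qed
      then show ?thesis by simp
    qed
  qed
  also have "\<dots> = (ennreal ((norm (m - l))\<^sup>2) * I) * emeasure lborel (box (l - m) (m - l))"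
    by (rule nn_integral_cmult_indicator) simp
  also have "emeasure lborel (box (l - m) (m - l)) = ennreal (vol (l - m) (m - l))"
    using lm by (intro emeasure_box_pt) auto
  also have "vol (l - m) (m - l) = 8 * vol l m" by (simp add: vol_def algebra_simps)
  finally show ?thesis unfolding I_def[symmetric]
    using emeasure_box_pt(2)[OF lm] by (simp add: ennreal_mult mult_ac)
qed

text \<open>The volume times \<open>u p\<close> is the integral of \<open>u\<close> over the box
  minus that of \<open>u q - u p\<close> over \<open>q\<close>; squaring the sum costs factors 2.
  What matters in the second term is the squared diameter, which shrinks with the box.\<close>

lemma poincare_box:
  assumes u: "L2 u" and wg: "weak_grad U u g" and Q: "box l m \<subseteq> U"
    and lm: "fst l < fst m" "fst (snd l) < fst (snd m)" "snd (snd l) < snd (snd m)"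
  shows "sq_int_on (box l m) u
     \<le> ennreal (2 / vol l m * (cmod (LINT p|lborel. indicator (box l m) p *\<^sub>R u p))\<^sup>2)
       + ennreal (16 * (norm (m - l))\<^sup>2) * (\<integral>\<^sup>+p. indicator (box l m) p * ennreal (grad_sq g p) \<partial>lborel)"
proof -
  note [measurable] = L2_measurable[OF u]
  define I where "I = (\<integral>\<^sup>+p. indicator (box l m) p * ennreal (grad_sq g p) \<partial>lborel)"
  define w where "w = vol l m"
  define A where "A = (LINT p|lborel. indicator (box l m) p *\<^sub>R u p)"
  have w: "w > 0" "emeasure lborel (box l m) = ennreal w" unfolding w_def using emeasure_box_pt[OF lm] by auto
  have meas_w: "measure lborel (box l m) = w" using w by (simp add: measure_def)
  have int_box: "integrable lborel (\<lambda>p. indicator (box l m) p :: real)" using w by (simp add: integrable_indicator_iff)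
  have int_u: "integrable lborel (\<lambda>p. indicator (box l m) p *\<^sub>R u p)"
  proof (rule Bochner_Integration.integrable_bound[OF loc_int_integrable[OF L2_loc_int[OF u] compact_cbox[of l m]]])
    show "AE p in lborel. norm (indicator (box l m) p *\<^sub>R u p) \<le> norm (indicator (cbox l m) p *\<^sub>R u p)"
      using box_subset_cbox[of l m] by (intro AE_I2) (auto simp: indicator_def)
  qed measurable
  define J where "J = (\<lambda>p. \<integral>\<^sup>+q. indicator (box l m) q * ennreal ((cmod (u q - u p))\<^sup>2) \<partial>lborel)"
  have J_meas [measurable]: "J \<in> borel_measurable borel"
  proof -
    have [measurable]: "(fst :: pt \<times> pt \<Rightarrow> pt) \<in> borel_measurable (lborel \<Otimes>\<^sub>M lborel)"
      "(snd :: pt \<times> pt \<Rightarrow> pt) \<in> borel_measurable (lborel \<Otimes>\<^sub>M lborel)"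
      unfolding lborel_prod by (simp_all add: borel_measurable_continuous_onI continuous_intros)
    have "(\<lambda>(p, q). indicator (box l m) q * ennreal ((cmod (u q - u p))\<^sup>2)) \<in> borel_measurable (lborel \<Otimes>\<^sub>M lborel)"
      unfolding case_prod_beta by measurable
    then show ?thesis unfolding J_def using lborel.borel_measurable_nn_integral by simp
  qed
  have pt: "ennreal (w\<^sup>2) * ennreal ((cmod (u p))\<^sup>2) \<le> ennreal (2 * (cmod A)\<^sup>2) + ennreal (2 * w) * J p" for p
  proof -
    have "(LINT q|lborel. indicator (box l m) q *\<^sub>R (u q - u p)) = A - w *\<^sub>R u p"
    proof -
      have "(LINT q|lborel. indicator (box l m) q *\<^sub>R (u q - u p)) = (LINT q|lborel. indicator (box l m) q *\<^sub>R u q - indicator (box l m) q *\<^sub>R u p)"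
        by (simp add: scaleR_diff_right)
      also have "\<dots> = A - (LINT q|lborel. indicator (box l m) q *\<^sub>R u p)"
        unfolding A_def by (rule Bochner_Integration.integral_diff[OF int_u integrable_scaleR_left[OF int_box]])
      finally show ?thesis using int_box by (simp add: meas_w)
    qed
    then have "w *\<^sub>R u p = A + (- (LINT q|lborel. indicator (box l m) q *\<^sub>R (u q - u p)))" by simp
    then have "(cmod (w *\<^sub>R u p))\<^sup>2 \<le> 2 * (cmod A)\<^sup>2 + 2 * (cmod (LINT q|lborel. indicator (box l m) q *\<^sub>R (u q - u p)))\<^sup>2"
      using cmod_add_square_le[of A "- (LINT q|lborel. indicator (box l m) q *\<^sub>R (u q - u p))"] by simp
    then have "ennreal (w\<^sup>2 * (cmod (u p))\<^sup>2) \<le> ennreal (2 * (cmod A)\<^sup>2 + 2 * (cmod (LINT q|lborel. indicator (box l m) q *\<^sub>R (u q - u p)))\<^sup>2)"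
      using w by (intro ennreal_leI) (simp add: power_mult_distrib)
    also have "\<dots> = ennreal (2 * (cmod A)\<^sup>2) + ennreal (2 * (cmod (LINT q|lborel. indicator (box l m) q *\<^sub>R (u q - u p)))\<^sup>2)"
      by (rule ennreal_plus) simp_all
    also have "ennreal (2 * (cmod (LINT q|lborel. indicator (box l m) q *\<^sub>R (u q - u p)))\<^sup>2)
        = ennreal 2 * (ennreal (cmod (LINT q|lborel. indicator (box l m) q *\<^sub>R (u q - u p))))\<^sup>2"
      by (subst ennreal_mult) (simp_all add: ennreal_power)
    also have "(ennreal (cmod (LINT q|lborel. indicator (box l m) q *\<^sub>R (u q - u p))))\<^sup>2 \<le> ennreal w * J p"
    proof -
      have "ennreal (cmod (LINT q|lborel. indicator (box l m) q *\<^sub>R (u q - u p))) \<le> (\<integral>\<^sup>+q. ennreal (norm (indicator (box l m) q *\<^sub>R (u q - u p))) \<partial>lborel)"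
        by (rule norm_lebesgue_integral_le_nn)
      also have "\<dots> = (\<integral>\<^sup>+q. indicator (box l m) q * (indicator (box l m) q * ennreal (cmod (u q - u p))) \<partial>lborel)"
        by (intro nn_integral_cong) (simp add: indicator_def)
      finally have "(ennreal (cmod (LINT q|lborel. indicator (box l m) q *\<^sub>R (u q - u p))))\<^sup>2 \<le> (\<integral>\<^sup>+q. indicator (box l m) q * (indicator (box l m) q * ennreal (cmod (u q - u p))) \<partial>lborel)\<^sup>2"
        by (rule power_mono) simp
      also have "\<dots> \<le> (\<integral>\<^sup>+q. (indicator (box l m) q)\<^sup>2 \<partial>lborel) * (\<integral>\<^sup>+q. (indicator (box l m) q * ennreal (cmod (u q - u p)))\<^sup>2 \<partial>lborel)"
        by (rule Cauchy_Schwarz_nn_integral) measurable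
      also have "(\<integral>\<^sup>+q. (indicator (box l m) q :: ennreal)\<^sup>2 \<partial>lborel) = (\<integral>\<^sup>+q. indicator (box l m) q \<partial>lborel)"
        by (intro nn_integral_cong) (auto simp: indicator_def)
      also have "\<dots> = ennreal w" using w by simp
      also have "(\<integral>\<^sup>+q. (indicator (box l m) q * ennreal (cmod (u q - u p)))\<^sup>2 \<partial>lborel) = J p"
        unfolding J_def by (intro nn_integral_cong) (auto simp: indicator_def ennreal_power)
      finally show ?thesis .
    qed
    finally show ?thesis using w by (simp add: ennreal_mult mult_left_mono mult.assoc)
  qed
  have "ennreal (w\<^sup>2) * sq_int_on (box l m) u
      = (\<integral>\<^sup>+p. indicator (box l m) p * (ennreal (w\<^sup>2) * ennreal ((cmod (u p))\<^sup>2)) \<partial>lborel)"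
    by (subst nn_integral_cmult[symmetric]) (auto simp: mult.left_commute)
  also have "\<dots> \<le> (\<integral>\<^sup>+p. ennreal (2 * (cmod A)\<^sup>2) * indicator (box l m) p + ennreal (2 * w) * (indicator (box l m) p * J p) \<partial>lborel)"
  proof (rule nn_integral_mono)
    fix p
    show "indicator (box l m) p * (ennreal (w\<^sup>2) * ennreal ((cmod (u p))\<^sup>2))
       \<le> ennreal (2 * (cmod A)\<^sup>2) * indicator (box l m) p + ennreal (2 * w) * (indicator (box l m) p * J p)"
      using pt[of p] by (simp add: indicator_def)
  qed
  also have "\<dots> = ennreal (2 * (cmod A)\<^sup>2) * ennreal w + ennreal (2 * w) * (\<integral>\<^sup>+p. indicator (box l m) p * J p \<partial>lborel)"
    by (subst nn_integral_add) (auto simp: nn_integral_cmult nn_integral_cmult_indicator w)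
  also have "\<dots> \<le> ennreal (2 * (cmod A)\<^sup>2) * ennreal w + ennreal (2 * w) * (ennreal (8 * w * (norm (m - l))\<^sup>2) * I)"
    using poincare_pairs[OF u wg Q lm] unfolding J_def I_def w_def by (intro add_left_mono mult_left_mono) auto
  also have "\<dots> = ennreal (w\<^sup>2) * (ennreal (2 / w * (cmod A)\<^sup>2) + ennreal (16 * (norm (m - l))\<^sup>2) * I)"
  proof -
    have 1: "ennreal (2 * (cmod A)\<^sup>2) * ennreal w = ennreal (w\<^sup>2) * ennreal (2 / w * (cmod A)\<^sup>2)"
      using w by (simp add: ennreal_mult[symmetric] power2_eq_square)
    have 2: "ennreal (2 * w) * ennreal (8 * w * (norm (m - l))\<^sup>2) = ennreal (w\<^sup>2) * ennreal (16 * (norm (m - l))\<^sup>2)"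
      using w by (simp add: ennreal_mult[symmetric] power2_eq_square mult_ac)
    show ?thesis by (simp only: distrib_left mult.assoc[symmetric] 1 2)
  qed
  finally show ?thesis
    using w unfolding I_def[symmetric] A_def[symmetric] w_def[symmetric] by (subst (asm) ennreal_mult_le_mult_iff) auto
qed

section \<open>The closed form\<close>

definition emb :: "fn \<Rightarrow> vfn \<Rightarrow> l2 \<times> (l2 \<times> l2 \<times> l2)" where
  "emb u w = (cls u, (cls (w 0), cls (w 1), cls (w 2)))"

definition form_core :: "real \<Rightarrow> real \<Rightarrow> real \<Rightarrow> (l2 \<times> (l2 \<times> l2 \<times> l2)) set" where
  "form_core d \<alpha> a = {emb u (mgrad \<alpha> u g) | u g. core d a u g}"

text \<open>\<open>Qgraph\<close> after passage to classes: its sequential limits become the closure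
  in a product Hilbert space.\<close>

definition form_dom :: "real \<Rightarrow> real \<Rightarrow> real \<Rightarrow> (l2 \<times> (l2 \<times> l2 \<times> l2)) set" where
  "form_dom d \<alpha> a = closure (form_core d \<alpha> a)"

definition mult_i3 :: "l2 \<times> l2 \<times> l2 \<Rightarrow> l2 \<times> l2 \<times> l2" where
  "mult_i3 w = (mult_i (fst w), mult_i (fst (snd w)), mult_i (snd (snd w)))"

lemma Apot_measurable: "Apot \<alpha> j \<in> borel_measurable borel"
proof -
  have [measurable]: "(\<lambda>p :: pt. fst p) \<in> borel_measurable borel" "(\<lambda>p :: pt. fst (snd p)) \<in> borel_measurable borel"
    by (intro borel_measurable_continuous_onI continuous_intros)+
  have "Apot \<alpha> j = (\<lambda>p. if j = 0 then \<alpha> * fst (snd p) / ((fst p)\<^sup>2 + (fst (snd p))\<^sup>2)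
      else if j = 1 then - \<alpha> * fst p / ((fst p)\<^sup>2 + (fst (snd p))\<^sup>2) else 0)"
    by (simp add: fun_eq_iff Apot_def case_prod_beta)
  then show ?thesis by simp
qed

text \<open>On the axis both sides are 0, as division by zero yields 0.\<close>

lemma Apot_sq: "(Apot \<alpha> 0 p)\<^sup>2 + (Apot \<alpha> 1 p)\<^sup>2 = \<alpha>\<^sup>2 / ((fst p)\<^sup>2 + (fst (snd p))\<^sup>2)"
proof -
  obtain x y z where p: "p = (x, y, z)" by (cases p)
  have "(\<alpha> * y / (x\<^sup>2 + y\<^sup>2))\<^sup>2 + (- \<alpha> * x / (x\<^sup>2 + y\<^sup>2))\<^sup>2 = \<alpha>\<^sup>2 * (x\<^sup>2 + y\<^sup>2) / (x\<^sup>2 + y\<^sup>2)\<^sup>2"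
    by (simp add: power_divide power_mult_distrib add_divide_distrib algebra_simps)
  also have "\<dots> = \<alpha>\<^sup>2 / (x\<^sup>2 + y\<^sup>2)" by (cases "x\<^sup>2 + y\<^sup>2 = 0") (auto simp: power2_eq_square)
  finally show ?thesis unfolding p Apot_def by simp
qed

lemma Apot_2 [simp]: "Apot \<alpha> 2 p = 0" by (simp add: Apot_def case_prod_beta)

lemma mgrad_L2:
  assumes c: "core d a u g" and j: "j < 3"
  shows "L2 (mgrad \<alpha> u g j)"
proof -
  obtain n where n: "n \<ge> 2" "\<And>p. p \<notin> Omega_n d n \<Longrightarrow> u p = 0" using c unfolding core_def by blast
  \<comment> \<open>Where \<open>u\<close> does not vanish the radius is at least
    \<open>1 / n\<close>, and the potential is bounded there by |alpha| n.\<close>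
  have "L2 (\<lambda>p. complex_of_real (Apot \<alpha> j p) * u p)"
  proof (rule L2_bounded_mult[OF core_L2[OF c], where C = "\<bar>\<alpha>\<bar> * real n"])
    show "(\<lambda>p. complex_of_real (Apot \<alpha> j p)) \<in> borel_measurable borel"
      using Apot_measurable[of \<alpha> j] by simp
    fix p
    show "cmod (complex_of_real (Apot \<alpha> j p) * u p) \<le> \<bar>\<alpha>\<bar> * real n * cmod (u p)"
    proof (cases "p \<in> Omega_n d n")
      case True
      then have r: "(1 / real n)\<^sup>2 \<le> (fst p)\<^sup>2 + (fst (snd p))\<^sup>2" unfolding Omega_n_def by (auto simp: case_prod_beta)
      have "(Apot \<alpha> j p)\<^sup>2 \<le> (Apot \<alpha> 0 p)\<^sup>2 + (Apot \<alpha> 1 p)\<^sup>2" using less_3_cases[OF j] by auto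
      also have "\<dots> \<le> \<alpha>\<^sup>2 / (1 / real n)\<^sup>2"
      proof -
        have "(1 / real n)\<^sup>2 > 0" using n(1) by simp
        then show ?thesis unfolding Apot_sq using r by (intro divide_left_mono mult_pos_pos) (auto intro: less_le_trans[OF _ r])
      qed
      also have "\<dots> = (\<bar>\<alpha>\<bar> * real n)\<^sup>2" by (simp add: power_divide power_mult_distrib)
      finally have "\<bar>Apot \<alpha> j p\<bar> \<le> \<bar>\<alpha>\<bar> * real n" by (metis abs_ge_zero abs_le_square_iff abs_mult abs_of_nat abs_idempotent)
      then show ?thesis by (simp add: norm_mult mult_right_mono)
    qed (simp add: n(2))
  qed
  then show ?thesis
    unfolding mgrad_def using weak_grad_L2[OF core_weak_grad[OF c] j] by (intro L2_add L2_cmult)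
qed

lemma weak_grad_cmult:
  assumes "weak_grad U u g" shows "weak_grad U (\<lambda>p. c * u p) (\<lambda>j p. c * g j p)"
  using assms unfolding weak_grad_def by (simp add: L2_cmult mult.assoc)

lemma weak_grad_add:
  assumes "L2 u" "L2 v" "weak_grad U u g" "weak_grad U v h"
  shows "weak_grad U (\<lambda>p. u p + v p) (\<lambda>j p. g j p + h j p)"
  unfolding weak_grad_def
proof (intro allI impI conjI)
  fix j :: nat assume j: "j < 3"
  note gh = weak_grad_L2[OF assms(3) j] weak_grad_L2[OF assms(4) j]
  then show "L2 (\<lambda>p. g j p + h j p)" by (rule L2_add)
  fix \<phi> assume t: "test_fn U \<phi>"
  have "(LINT p|lborel. (u p + v p) * complex_of_real (pd \<phi> j p)) = (LINT p|lborel. u p * complex_of_real (pd \<phi> j p)) + (LINT p|lborel. v p * complex_of_real (pd \<phi> j p))"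
    using assms(1,2) L2_test_fn_pd[OF t j] by (simp add: distrib_right L2_prod_integrable')
  moreover have "(LINT p|lborel. (g j p + h j p) * complex_of_real (\<phi> p)) = (LINT p|lborel. g j p * complex_of_real (\<phi> p)) + (LINT p|lborel. h j p * complex_of_real (\<phi> p))"
    using gh L2_test_fn[OF t] by (simp add: distrib_right L2_prod_integrable')
  ultimately show "(LINT p|lborel. (u p + v p) * complex_of_real (pd \<phi> j p)) = - (LINT p|lborel. (g j p + h j p) * complex_of_real (\<phi> p))"
    using weak_grad_integral[OF assms(3) j t] weak_grad_integral[OF assms(4) j t] by simp
qed

lemma Omega_n_mono: "1 \<le> n \<Longrightarrow> n \<le> k \<Longrightarrow> Omega_n d n \<subseteq> Omega_n d k"
proof
  fix p assume n: "1 \<le> n" "n \<le> k" and p: "p \<in> Omega_n d n"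
  have 1: "(1 / real k)\<^sup>2 \<le> (1 / real n)\<^sup>2" using n by (intro power_mono divide_left_mono) auto
  have 2: "(real n)\<^sup>2 \<le> (real k)\<^sup>2" using n by (intro power_mono) auto
  obtain x y z where xyz: "p = (x, y, z)" by (cases p)
  then have "(1 / real n)\<^sup>2 \<le> x\<^sup>2 + y\<^sup>2" "x\<^sup>2 + y\<^sup>2 < (real n)\<^sup>2" "0 \<le> z" "z \<le> d"
    using p unfolding Omega_n_def by auto
  then show "p \<in> Omega_n d k"
    unfolding xyz Omega_n_def using order_trans[OF 1] less_le_trans[OF _ 2] by simp
qed

text \<open>The two functions may live on different \<open>Omega_n\<close>; these sets increase with
  \<open>n\<close>, so the larger index serves both.\<close>

lemma core_add:
  assumes "core d a u g" "core d a v h" shows "core d a (\<lambda>p. u p + v p) (\<lambda>j p. g j p + h j p)"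
proof -
  obtain n where n: "n \<ge> 2" "\<And>p. p \<notin> Omega_n d n \<Longrightarrow> u p = 0" using assms(1) unfolding core_def by blast
  obtain k where k: "k \<ge> 2" "\<And>p. p \<notin> Omega_n d k \<Longrightarrow> v p = 0" using assms(2) unfolding core_def by blast
  have "p \<notin> Omega_n d n \<and> p \<notin> Omega_n d k" if "p \<notin> Omega_n d (max n k)" for p
    using that n(1) k(1) Omega_n_mono[of n "max n k" d] Omega_n_mono[of k "max n k" d] by auto
  then show ?thesis unfolding core_def
    using n k core_L2[OF assms(1)] core_L2[OF assms(2)] core_weak_grad[OF assms(1)] core_weak_grad[OF assms(2)]
    by (intro exI[of _ "max n k"]) (auto intro: L2_add weak_grad_add)
qed

lemma core_cmult: "core d a u g \<Longrightarrow> core d a (\<lambda>p. c * u p) (\<lambda>j p. c * g j p)"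
  unfolding core_def using L2_cmult weak_grad_cmult by fastforce

lemma mgrad_add: "mgrad \<alpha> (\<lambda>p. u p + v p) (\<lambda>j p. g j p + h j p) j = (\<lambda>p. mgrad \<alpha> u g j p + mgrad \<alpha> v h j p)"
  and mgrad_cmult: "mgrad \<alpha> (\<lambda>p. c * u p) (\<lambda>j p. c * g j p) j = (\<lambda>p. c * mgrad \<alpha> u g j p)"
  unfolding mgrad_def by (simp_all add: fun_eq_iff algebra_simps)

lemma mgrad_zero: "mgrad \<alpha> (\<lambda>p. 0) (\<lambda>j p. 0) j = (\<lambda>p. 0)"
  by (simp add: mgrad_def fun_eq_iff)

lemma form_core_cmult:
  assumes "core d a u g"
  shows "emb (\<lambda>p. c * u p) (\<lambda>j p. c * mgrad \<alpha> u g j p) \<in> form_core d \<alpha> a"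
  unfolding form_core_def
  by (intro CollectI exI[of _ "\<lambda>p. c * u p"] exI[of _ "\<lambda>j p. c * g j p"] conjI core_cmult[OF assms]) (simp add: emb_def mgrad_cmult)

lemma zero_core: "core d a (\<lambda>p. 0) (\<lambda>j p. 0)"
  unfolding core_def weak_grad_def by (auto intro!: exI[of _ 2] L2_zero)

lemma subspace_form_core: "subspace (form_core d \<alpha> a)"
  unfolding subspace_def
proof (intro conjI ballI allI)
  have "(0 :: l2 \<times> l2 \<times> l2 \<times> l2) = emb (\<lambda>p. 0) (mgrad \<alpha> (\<lambda>p. 0) (\<lambda>j p. 0))"
    by (simp add: emb_def mgrad_zero cls_zero zero_prod_def)
  then show "0 \<in> form_core d \<alpha> a" unfolding form_core_def using zero_core by blast
next
  fix x y assume "x \<in> form_core d \<alpha> a" "y \<in> form_core d \<alpha> a"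
  then obtain u g v h where c: "core d a u g" "core d a v h" "x = emb u (mgrad \<alpha> u g)" "y = emb v (mgrad \<alpha> v h)"
    unfolding form_core_def by blast
  have "x + y = emb (\<lambda>p. u p + v p) (mgrad \<alpha> (\<lambda>p. u p + v p) (\<lambda>j p. g j p + h j p))"
    unfolding c emb_def mgrad_add using c(1,2)
    by (simp add: cls_add core_L2 mgrad_L2)
  then show "x + y \<in> form_core d \<alpha> a" unfolding form_core_def using core_add[OF c(1,2)] by blast
next
  fix r :: real and x assume "x \<in> form_core d \<alpha> a"
  then obtain u g where c: "core d a u g" "x = emb u (mgrad \<alpha> u g)"
    unfolding form_core_def by blast
  have "r *\<^sub>R x = emb (\<lambda>p. complex_of_real r * u p) (\<lambda>j p. complex_of_real r * mgrad \<alpha> u g j p)"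
    unfolding c emb_def using c(1) by (simp add: cls_scaleR core_L2 mgrad_L2)
  then show "r *\<^sub>R x \<in> form_core d \<alpha> a" using form_core_cmult[OF c(1)] by simp
qed

lemma subspace_closure_normed:
  fixes S :: "'a::real_normed_vector set"
  assumes "subspace S" shows "subspace (closure S)"
proof (rule subspaceI)
  show "0 \<in> closure S" using assms subspace_0 closure_subset by blast
next
  fix x y assume "x \<in> closure S" "y \<in> closure S"
  then obtain f h where "\<And>n. f n \<in> S" "f \<longlonglongrightarrow> x" "\<And>n. h n \<in> S" "h \<longlonglongrightarrow> y"
    unfolding closure_sequential by blast
  then show "x + y \<in> closure S" unfolding closure_sequential
    using assms by (intro exI[of _ "\<lambda>n. f n + h n"]) (auto intro: tendsto_add subspace_add)
next
  fix x and c :: real assume "x \<in> closure S"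
  then obtain f where "\<And>n. f n \<in> S" "f \<longlonglongrightarrow> x" unfolding closure_sequential by blast
  then show "c *\<^sub>R x \<in> closure S" unfolding closure_sequential
    using assms by (intro exI[of _ "\<lambda>n. c *\<^sub>R f n"]) (auto intro: tendsto_scaleR subspace_scale)
qed

lemma subspace_form_dom: "subspace (form_dom d \<alpha> a)"
  unfolding form_dom_def by (rule subspace_closure_normed[OF subspace_form_core])

lemma closed_form_dom: "closed (form_dom d \<alpha> a)"
  unfolding form_dom_def by simp

text \<open>The route by which every estimate reaches the closed form: it is proved on the core and
  survives limits.\<close>

lemma form_dom_induct:
  assumes z: "z \<in> form_dom d \<alpha> a" and "closed {z. P z}" and "\<And>u g. core d a u g \<Longrightarrow> P (emb u (mgrad \<alpha> u g))"
  shows "P z"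
proof -
  have "form_core d \<alpha> a \<subseteq> {z. P z}" using assms(3) unfolding form_core_def by auto
  then have "form_dom d \<alpha> a \<subseteq> {z. P z}" unfolding form_dom_def using assms(2) by (rule closure_minimal)
  then show ?thesis using z by blast
qed

lemma continuous_mult_i: "continuous_on S mult_i"
proof -
  have "bounded_linear mult_i"
    by (rule bounded_linear_intro[where K = 1])
      (auto simp: norm_mult_i linear_add[OF linear_mult_i] linear_scale[OF linear_mult_i])
  then show ?thesis by (rule linear_continuous_on)
qed

text \<open>Complex linearity of the form domain. It allows a real identity to be tested with
  \<open>i v\<close> as well and so to yield a complex one.\<close>

lemma form_dom_mult_i: 
  assumes "(u, w) \<in> form_dom d \<alpha> a" shows "(mult_i u, mult_i3 w) \<in> form_dom d \<alpha> a"
proof -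
  define F :: "l2 \<times> l2 \<times> l2 \<times> l2 \<Rightarrow> l2 \<times> l2 \<times> l2 \<times> l2" where "F = (\<lambda>z. (mult_i (fst z), mult_i3 (snd z)))"
  have F: "continuous_on UNIV F" unfolding F_def mult_i3_def
    by (intro continuous_intros continuous_on_compose2[OF continuous_mult_i[of UNIV]]) auto
  have "F (u, w) \<in> form_dom d \<alpha> a"
  proof (rule form_dom_induct[OF assms])
    show "closed {z. F z \<in> form_dom d \<alpha> a}"
      using continuous_closed_vimage[OF closed_form_dom, of F] F continuous_on_eq_continuous_at[of UNIV F] by (simp add: vimage_def)
    fix u g assume c: "core d a u g"
    have "F (emb u (mgrad \<alpha> u g)) = emb (\<lambda>p. \<i> * u p) (\<lambda>j p. \<i> * mgrad \<alpha> u g j p)"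
      unfolding F_def emb_def mult_i3_def using c by (simp add: mult_i_cls core_L2 mgrad_L2)
    then have "F (emb u (mgrad \<alpha> u g)) \<in> form_core d \<alpha> a" using form_core_cmult[OF c] by simp
    then show "F (emb u (mgrad \<alpha> u g)) \<in> form_dom d \<alpha> a" unfolding form_dom_def using closure_subset by blast
  qed
  then show ?thesis by (simp add: F_def)
qed

lemma norm_mult_i3: "norm (mult_i3 w) = norm w"
  unfolding mult_i3_def norm_prod_def by (simp add: norm_mult_i)

lemma Omega_n_subset_Omega: "n \<ge> 1 \<Longrightarrow> Omega_n d n \<subseteq> Omega d"
proof -
  assume "n \<ge> 1"
  then have "0 < (1 / real n)\<^sup>2" by simp
  from less_le_trans[OF this] show ?thesis unfolding Omega_n_def Omega_def by auto
qed

lemma form_dom_Omega: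
  assumes "z \<in> form_dom d \<alpha> a" shows "L2_Omega d (rp (fst z))"
proof (rule form_dom_induct[OF assms])
  have "closed (fst -` {x. L2_Omega d (rp x)} :: (l2 \<times> l2 \<times> l2 \<times> l2) set)"
    by (intro continuous_closed_vimage closed_L2_Omega) (auto intro: continuous_intros)
  then show "closed {z :: l2 \<times> l2 \<times> l2 \<times> l2. L2_Omega d (rp (fst z))}" by (simp add: vimage_def)
  fix u g assume c: "core d a u g"
  obtain n where n: "n \<ge> 2" "\<And>p. p \<notin> Omega_n d n \<Longrightarrow> u p = 0" using c unfolding core_def by blast
  have "L2_Omega d u" unfolding L2_Omega_def
    using core_L2[OF c] n Omega_n_subset_Omega[of n d] by (intro conjI AE_I2) auto
  moreover have "AE p in lborel. u p = rp (cls u) p"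
    using rp_cls[OF core_L2[OF c]] by eventually_elim simp
  ultimately show "L2_Omega d (rp (fst (emb u (mgrad \<alpha> u g))))"
    using L2_Omega_cong_AE[OF core_L2[OF c] L2_rp] by (simp add: emb_def)
qed

text \<open>The integrals in \<open>Qgraph\<close> are squared distances of classes, and the support
  condition follows from \<open>form_dom_Omega\<close>.\<close>

lemma Qgraph_iff:
  assumes u: "L2 u" and w: "\<And>j. j < 3 \<Longrightarrow> L2 (w j)"
  shows "(u, w) \<in> Qgraph d \<alpha> a \<longleftrightarrow> emb u w \<in> form_dom d \<alpha> a"
proof
  have w': "L2 (w 0)" "L2 (w 1)" "L2 (w 2)" using w by auto
  assume "(u, w) \<in> Qgraph d \<alpha> a"
  then obtain uk gk where k: "\<And>k. core d a (uk k) (gk k)"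
    "(\<lambda>k. LINT p|lborel. (cmod (uk k p - u p))\<^sup>2) \<longlonglongrightarrow> 0"
    "\<And>j. j < 3 \<Longrightarrow> (\<lambda>k. LINT p|lborel. (cmod (mgrad \<alpha> (uk k) (gk k) j p - w j p))\<^sup>2) \<longlonglongrightarrow> 0"
    unfolding Qgraph_def by blast
  have "(\<lambda>k. cls (uk k)) \<longlonglongrightarrow> cls u" using k(2) L2_dist_tendsto_iff[of uk u, OF core_L2[OF k(1)] u] by blast
  moreover have "(\<lambda>k. cls (mgrad \<alpha> (uk k) (gk k) j)) \<longlonglongrightarrow> cls (w j)" if "j < 3" for j
    using k(3)[OF that] L2_dist_tendsto_iff[of "\<lambda>k. mgrad \<alpha> (uk k) (gk k) j" "w j", OF mgrad_L2[OF k(1) that] w[OF that]] by blast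
  ultimately have "(\<lambda>k. emb (uk k) (mgrad \<alpha> (uk k) (gk k))) \<longlonglongrightarrow> emb u w"
    unfolding emb_def by (intro tendsto_Pair) auto
  moreover have "emb (uk k) (mgrad \<alpha> (uk k) (gk k)) \<in> form_core d \<alpha> a" for k using k(1) unfolding form_core_def by blast
  ultimately show "emb u w \<in> form_dom d \<alpha> a" unfolding form_dom_def closure_sequential
    by (intro CollectI exI[of _ "\<lambda>k. emb (uk k) (mgrad \<alpha> (uk k) (gk k))"]) simp
next
  have w': "L2 (w 0)" "L2 (w 1)" "L2 (w 2)" using w by auto
  assume D: "emb u w \<in> form_dom d \<alpha> a"
  have "L2_Omega d u"
    by (rule L2_Omega_cong_AE[OF L2_rp u rp_cls[OF u]]) (use form_dom_Omega[OF D] in \<open>simp add: emb_def\<close>)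
  obtain x where x: "\<And>k. x k \<in> form_core d \<alpha> a" "x \<longlonglongrightarrow> emb u w"
    using D unfolding form_dom_def closure_sequential by blast
  have "\<exists>ug. core d a (fst ug) (snd ug) \<and> x k = emb (fst ug) (mgrad \<alpha> (fst ug) (snd ug))" for k
  proof -
    obtain u' g' where "core d a u' g'" "x k = emb u' (mgrad \<alpha> u' g')" using x(1)[of k] unfolding form_core_def by blast
    then show ?thesis by (intro exI[of _ "(u', g')"]) simp
  qed
  then obtain ug where ug: "\<And>k. core d a (fst (ug k)) (snd (ug k))" "\<And>k. x k = emb (fst (ug k)) (mgrad \<alpha> (fst (ug k)) (snd (ug k)))"
    by metis
  note t1 = tendsto_fst[OF x(2)] and t2 = tendsto_snd[OF x(2)]
  have "(\<lambda>k. cls (fst (ug k))) \<longlonglongrightarrow> cls u" using t1 unfolding ug(2) emb_def by simp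
  then have c1: "(\<lambda>k. LINT p|lborel. (cmod (fst (ug k) p - u p))\<^sup>2) \<longlonglongrightarrow> 0"
    using L2_dist_tendsto_iff[of "\<lambda>k. fst (ug k)" u, OF core_L2[OF ug(1)] u] by blast
  have "(\<lambda>k. cls (mgrad \<alpha> (fst (ug k)) (snd (ug k)) j)) \<longlonglongrightarrow> cls (w j)" if "j < 3" for j
    using less_3_cases[OF that] tendsto_fst[OF t2] tendsto_fst[OF tendsto_snd[OF t2]] tendsto_snd[OF tendsto_snd[OF t2]]
    unfolding ug(2) emb_def by auto
  then have c2: "(\<lambda>k. LINT p|lborel. (cmod (mgrad \<alpha> (fst (ug k)) (snd (ug k)) j p - w j p))\<^sup>2) \<longlonglongrightarrow> 0" if "j < 3" for j
    using L2_dist_tendsto_iff[of "\<lambda>k. mgrad \<alpha> (fst (ug k)) (snd (ug k)) j" "w j", OF mgrad_L2[OF ug(1) that] w[OF that]] that by blast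
  show "(u, w) \<in> Qgraph d \<alpha> a"
    unfolding Qgraph_def using \<open>L2_Omega d u\<close> w ug(1) c1 c2
    by (intro CollectI case_prodI conjI exI[of _ "\<lambda>k. fst (ug k)"] exI[of _ "\<lambda>k. snd (ug k)"]) auto
qed

definition comps :: "l2 \<times> l2 \<times> l2 \<Rightarrow> vfn" where
  "comps W j = (if j = 0 then rp (fst W) else if j = 1 then rp (fst (snd W)) else rp (snd (snd W)))"

lemma L2_comps: "L2 (comps W j)" by (simp add: comps_def)

lemma emb_comps: "L2 u \<Longrightarrow> emb u (comps W) = (cls u, W)"
  by (simp add: emb_def comps_def)

lemma sum_L2inner:
  assumes "\<And>j. j < 3 \<Longrightarrow> L2 (w j)" "\<And>j. j < 3 \<Longrightarrow> L2 (w' j)"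
  shows "(\<Sum>j<3. L2inner (w j) (w' j)) = Complex (inner (snd (emb u w)) (snd (emb v w'))) (inner (snd (emb u w)) (mult_i3 (snd (emb v w'))))"
  using assms by (simp add: sum_less_3 L2inner_cls emb_def inner_prod_def mult_i3_def complex_eq_iff)

lemma Qgraph_L2:
  assumes "(u, w) \<in> Qgraph d \<alpha> a" shows "L2 u" "\<And>j. j < 3 \<Longrightarrow> L2 (w j)"
  using assms unfolding Qgraph_def L2_Omega_def by auto

text \<open>Only the real part of the weak equation is kept. As the form domain is invariant under
  multiplication by i, testing with \<open>i v\<close> restores the imaginary part.\<close>

lemma Hrel_iff:
  "Hrel d \<alpha> a u f \<longleftrightarrow> L2 u \<and> L2_Omega d f \<and>
     (\<exists>W. (cls u, W) \<in> form_dom d \<alpha> a \<and> (\<forall>z\<in>form_dom d \<alpha> a. inner W (snd z) = inner (cls f) (fst z)))"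
proof
  assume H: "Hrel d \<alpha> a u f"
  then obtain w where f: "L2_Omega d f" and w: "(u, w) \<in> Qgraph d \<alpha> a"
    and eq: "\<And>v w'. (v, w') \<in> Qgraph d \<alpha> a \<Longrightarrow> (\<Sum>j<3. L2inner (w j) (w' j)) = L2inner f v"
    unfolding Hrel_def by blast
  have L: "L2 u" "\<And>j. j < 3 \<Longrightarrow> L2 (w j)" using Qgraph_L2[OF w] by auto
  have fL: "L2 f" using f unfolding L2_Omega_def by simp
  have "inner (snd (emb u w)) (snd z) = inner (cls f) (fst z)" if z: "z \<in> form_dom d \<alpha> a" for z
  proof -
    have e: "emb (rp (fst z)) (comps (snd z)) = z" by (simp add: emb_comps)
    then have "(rp (fst z), comps (snd z)) \<in> Qgraph d \<alpha> a" using z by (subst Qgraph_iff) (auto simp: L2_comps)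
    from eq[OF this] show ?thesis
      using sum_L2inner[where w = w and w' = "comps (snd z)" and u = u and v = "rp (fst z)", OF L(2) L2_comps] e L2inner_cls[OF fL L2_rp, of "fst z"]
      by simp
  qed
  moreover have "(cls u, snd (emb u w)) \<in> form_dom d \<alpha> a" using w Qgraph_iff[OF L] by (simp add: emb_def)
  ultimately show "L2 u \<and> L2_Omega d f \<and>
     (\<exists>W. (cls u, W) \<in> form_dom d \<alpha> a \<and> (\<forall>z\<in>form_dom d \<alpha> a. inner W (snd z) = inner (cls f) (fst z)))"
    using L(1) f by blast
next
  assume "L2 u \<and> L2_Omega d f \<and>
     (\<exists>W. (cls u, W) \<in> form_dom d \<alpha> a \<and> (\<forall>z\<in>form_dom d \<alpha> a. inner W (snd z) = inner (cls f) (fst z)))"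
  then obtain W where u: "L2 u" and f: "L2_Omega d f" and W: "(cls u, W) \<in> form_dom d \<alpha> a"
    and eq: "\<And>z. z \<in> form_dom d \<alpha> a \<Longrightarrow> inner W (snd z) = inner (cls f) (fst z)" by blast
  have fL: "L2 f" using f unfolding L2_Omega_def by simp
  have "(u, comps W) \<in> Qgraph d \<alpha> a"
    using W by (subst Qgraph_iff) (auto simp: u L2_comps emb_comps)
  moreover have "(\<Sum>j<3. L2inner (comps W j) (w' j)) = L2inner f v" if q: "(v, w') \<in> Qgraph d \<alpha> a" for v w'
  proof -
    note L = Qgraph_L2[OF q]
    have D: "emb v w' \<in> form_dom d \<alpha> a" using q Qgraph_iff[OF L] by simp
    then have D': "(mult_i (cls v), mult_i3 (snd (emb v w'))) \<in> form_dom d \<alpha> a"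
      by (intro form_dom_mult_i) (simp add: emb_def)
    show ?thesis
      using sum_L2inner[where w = "comps W" and w' = w' and u = u and v = v, OF L2_comps L(2)] eq[OF D] eq[OF D'] L2inner_cls[OF fL L(1)] u
      by (simp add: emb_comps) (simp add: emb_def)
  qed
  ultimately show "Hrel d \<alpha> a u f" unfolding Hrel_def using f by blast
qed

section \<open>Lower bounds for the form\<close>

text \<open>The inequality is multiplied by \<open>m / c\<close>, which is legitimate although
  \<open>A\<close> and \<open>B\<close> may be infinite.\<close>

lemma ennreal_rescale:
  assumes c: "c > 0" and m: "m \<ge> 0" and k: "k \<ge> 0" and le: "ennreal c * A \<le> ennreal k * B" and small: "m * k \<le> c * s"
  shows "ennreal m * A \<le> ennreal s * B"
proof -
  have "ennreal m * A = ennreal (m / c) * (ennreal c * A)"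
    using c m by (simp add: mult.assoc[symmetric] ennreal_mult[symmetric])
  also have "\<dots> \<le> ennreal (m / c) * (ennreal k * B)" by (intro mult_left_mono le) simp
  also have "\<dots> = ennreal (m / c * k) * B" using c m k by (simp add: mult.assoc[symmetric] ennreal_mult[symmetric])
  also have "\<dots> \<le> ennreal s * B"
    using small c by (intro mult_right_mono ennreal_leI) (auto simp: field_simps)
  finally show ?thesis .
qed

lemma cmod_mgrad_2: "cmod (mgrad \<alpha> u g 2 p) = cmod (g 2 p)"
  unfolding mgrad_def by (simp add: norm_mult)

definition horiz :: "real \<Rightarrow> fn \<Rightarrow> vfn \<Rightarrow> pt \<Rightarrow> real" where
  "horiz \<alpha> u g p = (cmod (mgrad \<alpha> u g 0 p))\<^sup>2 + (cmod (mgrad \<alpha> u g 1 p))\<^sup>2"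

lemma horiz_nonneg: "horiz \<alpha> u g p \<ge> 0"
  unfolding horiz_def by simp

lemma core_measurable:
  assumes "core d a u g"
  shows "u \<in> borel_measurable borel" "g 0 \<in> borel_measurable borel" "g 1 \<in> borel_measurable borel"
    "g 2 \<in> borel_measurable borel" "horiz \<alpha> u g \<in> borel_measurable borel"
proof -
  show "u \<in> borel_measurable borel" "g 0 \<in> borel_measurable borel" "g 1 \<in> borel_measurable borel" "g 2 \<in> borel_measurable borel"
    using L2_measurable[OF core_L2[OF assms]] L2_measurable[OF weak_grad_L2[OF core_weak_grad[OF assms]]] by auto
  have [measurable]: "mgrad \<alpha> u g 0 \<in> borel_measurable borel" "mgrad \<alpha> u g 1 \<in> borel_measurable borel"
    using L2_measurable[OF mgrad_L2[OF assms]] by auto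
  show "horiz \<alpha> u g \<in> borel_measurable borel" unfolding horiz_def by measurable
qed

lemma norm_emb:
  assumes c: "core d a u g"
  shows "ennreal ((norm (fst (emb u (mgrad \<alpha> u g))))\<^sup>2) = sq_int u"
    and "ennreal ((norm (snd (emb u (mgrad \<alpha> u g))))\<^sup>2) = (\<integral>\<^sup>+p. ennreal (horiz \<alpha> u g p) \<partial>lborel) + sq_int (g 2)"
proof -
  show "ennreal ((norm (fst (emb u (mgrad \<alpha> u g))))\<^sup>2) = sq_int u"
    by (simp add: emb_def nn_integral_cls core_L2[OF c])
  have [measurable]: "mgrad \<alpha> u g 0 \<in> borel_measurable borel" "mgrad \<alpha> u g (Suc 0) \<in> borel_measurable borel"
    using L2_measurable[OF mgrad_L2[OF c]] by auto
  have "(norm (snd (emb u (mgrad \<alpha> u g))))\<^sup>2 = (norm (cls (mgrad \<alpha> u g 0)))\<^sup>2 + ((norm (cls (mgrad \<alpha> u g 1)))\<^sup>2 + (norm (cls (mgrad \<alpha> u g 2)))\<^sup>2)"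
    by (simp add: emb_def norm_prod_def)
  then have "ennreal ((norm (snd (emb u (mgrad \<alpha> u g))))\<^sup>2)
      = ennreal ((norm (cls (mgrad \<alpha> u g 0)))\<^sup>2) + (ennreal ((norm (cls (mgrad \<alpha> u g 1)))\<^sup>2) + ennreal ((norm (cls (mgrad \<alpha> u g 2)))\<^sup>2))"
    by simp
  also have "\<dots> = (\<integral>\<^sup>+p. ennreal ((cmod (mgrad \<alpha> u g 0 p))\<^sup>2) \<partial>lborel) + (\<integral>\<^sup>+p. ennreal ((cmod (mgrad \<alpha> u g 1 p))\<^sup>2) \<partial>lborel)
      + sq_int (g 2)"
    by (simp add: nn_integral_cls[symmetric] mgrad_L2[OF c] cmod_mgrad_2 add.assoc)
  also have "(\<integral>\<^sup>+p. ennreal ((cmod (mgrad \<alpha> u g 0 p))\<^sup>2) \<partial>lborel) + (\<integral>\<^sup>+p. ennreal ((cmod (mgrad \<alpha> u g 1 p))\<^sup>2) \<partial>lborel)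
      = (\<integral>\<^sup>+p. ennreal (horiz \<alpha> u g p) \<partial>lborel)"
    unfolding horiz_def by (subst nn_integral_add[symmetric]) auto
  finally show "ennreal ((norm (snd (emb u (mgrad \<alpha> u g))))\<^sup>2) = (\<integral>\<^sup>+p. ennreal (horiz \<alpha> u g p) \<partial>lborel) + sq_int (g 2)" .
qed

lemma rot_radius: "(fst (rot t p))\<^sup>2 + (fst (snd (rot t p)))\<^sup>2 = (fst p)\<^sup>2 + (fst (snd p))\<^sup>2"
proof -
  have *: "(x * c - y * s)\<^sup>2 + (x * s + y * c)\<^sup>2 = (x\<^sup>2 + y\<^sup>2) * (s\<^sup>2 + c\<^sup>2)"
    "(c * x - s * y)\<^sup>2 + (s * x + c * y)\<^sup>2 = (x\<^sup>2 + y\<^sup>2) * (s\<^sup>2 + c\<^sup>2)"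
     "(x * c + y * s)\<^sup>2 + (y * c - x * s)\<^sup>2 = (x\<^sup>2 + y\<^sup>2) * (s\<^sup>2 + c\<^sup>2)" for x y s c :: real
    by (simp_all add: power2_eq_square algebra_simps)
  show ?thesis unfolding rot_def by (simp add: case_prod_beta *)
qed

text \<open>Outside the disc the Dirichlet inequality spends vertical energy, over the disc the
  Hardy inequality spends horizontal energy. The two bounds therefore add up without counting any
  energy twice.\<close>

lemma form_bound_small_window:
  assumes d: "d > 0" and \<alpha>: "\<alpha> \<notin> \<int>" and small: "(pi / d)\<^sup>2 * a\<^sup>2 \<le> hardy_const \<alpha>" and z: "z \<in> form_dom d \<alpha> a"
  shows "(pi / d)\<^sup>2 * (norm (fst z))\<^sup>2 \<le> (norm (snd z))\<^sup>2"
proof (rule form_dom_induct[OF z])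
  show "closed {z :: l2 \<times> l2 \<times> l2 \<times> l2. (pi / d)\<^sup>2 * (norm (fst z))\<^sup>2 \<le> (norm (snd z))\<^sup>2}"
    by (intro closed_Collect_le continuous_intros)
  fix u g assume c: "core d a u g"
  note [measurable] = core_measurable[OF c] core_measurable(5)[OF c, of \<alpha>]
  define Os where "Os = outside a"
  have Os_meas [measurable]: "Os \<in> sets borel" unfolding Os_def by simp
  define m where "m = (pi / d)\<^sup>2"
  have m: "m > 0" unfolding m_def using d by simp
  have md: "m * (d / pi)\<^sup>2 = 1" unfolding m_def using d by (simp add: power_divide)
  have out: "ennreal m * sq_int_on Os u \<le> sq_int_on Os (g 2)"
  proof -
    have "sq_int_on Os u \<le> ennreal ((d / pi)\<^sup>2) * sq_int_on Os (g 2)"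
      by (rule dirichlet_outside[OF c d Os_meas]) (auto simp: Os_def outside_def)
    then have "ennreal m * sq_int_on Os u \<le> ennreal 1 * sq_int_on Os (g 2)"
      using m md by (intro ennreal_rescale[of 1 m "(d / pi)\<^sup>2"]) auto
    then show ?thesis by simp
  qed
  have "ennreal (hardy_const \<alpha>) * sq_int_on (- Os) u
      \<le> (\<integral>\<^sup>+p. indicator (- Os) p * ennreal (((fst p)\<^sup>2 + (fst (snd p))\<^sup>2) * ((cmod (mgrad \<alpha> u g 0 p))\<^sup>2 + (cmod (mgrad \<alpha> u g 1 p))\<^sup>2)) \<partial>lborel)"
  proof (rule hardy_inequality[OF c])
    show "(indicator (- Os) :: pt \<Rightarrow> ennreal) \<in> borel_measurable borel" by measurable
    fix t p
    have "rot t p \<in> Os \<longleftrightarrow> p \<in> Os" unfolding Os_def outside_def by (simp add: rot_radius)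
    then show "indicator (- Os) (rot t p) = (indicator (- Os) p :: ennreal)" by (simp add: indicator_def)
  qed
  also have "\<dots> \<le> (\<integral>\<^sup>+p. ennreal (a\<^sup>2) * ennreal (horiz \<alpha> u g p) \<partial>lborel)"
  proof (rule nn_integral_mono)
    fix p
    show "indicator (- Os) p * ennreal (((fst p)\<^sup>2 + (fst (snd p))\<^sup>2) * ((cmod (mgrad \<alpha> u g 0 p))\<^sup>2 + (cmod (mgrad \<alpha> u g 1 p))\<^sup>2))
        \<le> ennreal (a\<^sup>2) * ennreal (horiz \<alpha> u g p)"
    proof (cases "p \<in> Os")
      case False
      then have "(fst p)\<^sup>2 + (fst (snd p))\<^sup>2 \<le> a\<^sup>2" unfolding Os_def outside_def by simp
      then show ?thesis using False
        unfolding horiz_def[symmetric]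
        by (simp add: ennreal_mult[symmetric] horiz_nonneg) (intro ennreal_leI mult_right_mono horiz_nonneg; simp)
    qed simp
  qed
  also have "\<dots> = ennreal (a\<^sup>2) * (\<integral>\<^sup>+p. ennreal (horiz \<alpha> u g p) \<partial>lborel)" by (rule nn_integral_cmult) measurable
  finally have h0: "ennreal (hardy_const \<alpha>) * sq_int_on (- Os) u \<le> ennreal (a\<^sup>2) * (\<integral>\<^sup>+p. ennreal (horiz \<alpha> u g p) \<partial>lborel)" .
  have "ennreal m * sq_int_on (- Os) u \<le> ennreal 1 * (\<integral>\<^sup>+p. ennreal (horiz \<alpha> u g p) \<partial>lborel)"
    by (rule ennreal_rescale[OF hardy_const_pos[OF \<alpha>] _ _ h0]) (use small m in \<open>simp_all add: m_def\<close>)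
  then have ins: "ennreal m * sq_int_on (- Os) u \<le> (\<integral>\<^sup>+p. ennreal (horiz \<alpha> u g p) \<partial>lborel)" by simp
  have "sq_int u = (\<integral>\<^sup>+p. indicator Os p * ennreal ((cmod (u p))\<^sup>2) + indicator (- Os) p * ennreal ((cmod (u p))\<^sup>2) \<partial>lborel)"
    by (intro nn_integral_cong) (simp add: indicator_def)
  also have "\<dots> = sq_int_on Os u + sq_int_on (- Os) u"
    by (rule nn_integral_add) measurable
  finally have "ennreal m * sq_int u
      \<le> sq_int_on Os (g 2) + (\<integral>\<^sup>+p. ennreal (horiz \<alpha> u g p) \<partial>lborel)"
    using add_mono[OF out ins] by (simp add: distrib_left)
  also have "\<dots> \<le> sq_int (g 2) + (\<integral>\<^sup>+p. ennreal (horiz \<alpha> u g p) \<partial>lborel)"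
    by (intro add_right_mono nn_integral_mono) (simp add: indicator_def)
  finally have "ennreal (m * (norm (fst (emb u (mgrad \<alpha> u g))))\<^sup>2) \<le> ennreal ((norm (snd (emb u (mgrad \<alpha> u g))))\<^sup>2)"
    using m by (simp add: ennreal_mult norm_emb[OF c] add.commute)
  then show "(pi / d)\<^sup>2 * (norm (fst (emb u (mgrad \<alpha> u g))))\<^sup>2 \<le> (norm (snd (emb u (mgrad \<alpha> u g))))\<^sup>2"
    by (simp add: m_def)
qed

text \<open>The magnetic and the plain gradient differ by A u, and |A|^2 = alpha^2 / r^2. The Hardy
  inequality with weight 1 / r^2 bounds exactly this difference.\<close>

lemma gradient_bound:
  assumes c: "core d a u g" and \<alpha>: "\<alpha> \<notin> \<int>"
  shows "(\<integral>\<^sup>+p. ennreal ((cmod (g 0 p))\<^sup>2 + (cmod (g 1 p))\<^sup>2) \<partial>lborel)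
    \<le> ennreal (2 + 2 * \<alpha>\<^sup>2 / hardy_const \<alpha>) * (\<integral>\<^sup>+p. ennreal (horiz \<alpha> u g p) \<partial>lborel)"
proof -
  note [measurable] = core_measurable[OF c] core_measurable(5)[OF c, of \<alpha>]
  define \<rho> where "\<rho> = (\<lambda>p :: pt. ennreal (1 / ((fst p)\<^sup>2 + (fst (snd p))\<^sup>2)))"
  have [measurable]: "(\<lambda>p :: pt. fst p) \<in> borel_measurable borel" "(\<lambda>p :: pt. fst (snd p)) \<in> borel_measurable borel"
    by (intro borel_measurable_continuous_onI continuous_intros)+
  have [measurable]: "\<rho> \<in> borel_measurable borel" unfolding \<rho>_def by measurable
  have "ennreal (hardy_const \<alpha>) * (\<integral>\<^sup>+p. \<rho> p * ennreal ((cmod (u p))\<^sup>2) \<partial>lborel)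
      \<le> (\<integral>\<^sup>+p. \<rho> p * ennreal (((fst p)\<^sup>2 + (fst (snd p))\<^sup>2) * ((cmod (mgrad \<alpha> u g 0 p))\<^sup>2 + (cmod (mgrad \<alpha> u g 1 p))\<^sup>2)) \<partial>lborel)"
  proof (rule hardy_inequality[OF c])
    fix t p
    show "\<rho> (rot t p) = \<rho> p" unfolding \<rho>_def by (simp add: rot_radius)
  qed measurable
  also have "\<dots> \<le> (\<integral>\<^sup>+p. ennreal (horiz \<alpha> u g p) \<partial>lborel)"
  proof (rule nn_integral_mono)
    fix p :: pt
    define r where "r = (fst p)\<^sup>2 + (fst (snd p))\<^sup>2"
    have "r \<ge> 0" unfolding r_def by simp
    then have "1 / r * (r * horiz \<alpha> u g p) \<le> horiz \<alpha> u g p" by (cases "r = 0") (auto simp: horiz_def)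
    then show "\<rho> p * ennreal (((fst p)\<^sup>2 + (fst (snd p))\<^sup>2) * ((cmod (mgrad \<alpha> u g 0 p))\<^sup>2 + (cmod (mgrad \<alpha> u g 1 p))\<^sup>2)) \<le> ennreal (horiz \<alpha> u g p)"
      using \<open>r \<ge> 0\<close> unfolding \<rho>_def horiz_def[symmetric] r_def[symmetric]
      by (subst ennreal_mult[symmetric]) (auto simp: horiz_def intro!: ennreal_leI)
  qed
  finally have h0: "ennreal (hardy_const \<alpha>) * (\<integral>\<^sup>+p. \<rho> p * ennreal ((cmod (u p))\<^sup>2) \<partial>lborel) \<le> (\<integral>\<^sup>+p. ennreal (horiz \<alpha> u g p) \<partial>lborel)" .
  have h: "ennreal (2 * \<alpha>\<^sup>2) * (\<integral>\<^sup>+p. \<rho> p * ennreal ((cmod (u p))\<^sup>2) \<partial>lborel) \<le> ennreal (2 * \<alpha>\<^sup>2 / hardy_const \<alpha>) * (\<integral>\<^sup>+p. ennreal (horiz \<alpha> u g p) \<partial>lborel)"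
  proof (rule ennreal_rescale[of "hardy_const \<alpha>" "2 * \<alpha>\<^sup>2" 1])
    show "2 * \<alpha>\<^sup>2 * 1 \<le> hardy_const \<alpha> * (2 * \<alpha>\<^sup>2 / hardy_const \<alpha>)" using hardy_const_pos[OF \<alpha>] by simp
  qed (use hardy_const_pos[OF \<alpha>] h0 in simp_all)
  have pt: "(cmod (g 0 p))\<^sup>2 + (cmod (g 1 p))\<^sup>2 \<le> 2 * horiz \<alpha> u g p + 2 * \<alpha>\<^sup>2 * (1 / ((fst p)\<^sup>2 + (fst (snd p))\<^sup>2) * (cmod (u p))\<^sup>2)" for p
  proof -
    have 1: "(cmod (g j p))\<^sup>2 \<le> 2 * (cmod (mgrad \<alpha> u g j p))\<^sup>2 + 2 * (Apot \<alpha> j p)\<^sup>2 * (cmod (u p))\<^sup>2" for j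
    proof -
      have "\<i> * g j p = mgrad \<alpha> u g j p + (- complex_of_real (Apot \<alpha> j p) * u p)" unfolding mgrad_def by simp
      then have "(cmod (\<i> * g j p))\<^sup>2 \<le> 2 * (cmod (mgrad \<alpha> u g j p))\<^sup>2 + 2 * (cmod (- complex_of_real (Apot \<alpha> j p) * u p))\<^sup>2"
        using cmod_add_square_le by metis
      then show ?thesis by (simp add: norm_mult power_mult_distrib)
    qed
    have "(cmod (g 0 p))\<^sup>2 + (cmod (g 1 p))\<^sup>2 \<le> 2 * horiz \<alpha> u g p + 2 * ((Apot \<alpha> 0 p)\<^sup>2 + (Apot \<alpha> 1 p)\<^sup>2) * (cmod (u p))\<^sup>2"
      using 1[of 0] 1[of 1] unfolding horiz_def by (simp add: algebra_simps)
    then show ?thesis unfolding Apot_sq by simp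
  qed
  have "(\<integral>\<^sup>+p. ennreal ((cmod (g 0 p))\<^sup>2 + (cmod (g 1 p))\<^sup>2) \<partial>lborel)
      \<le> (\<integral>\<^sup>+p. ennreal 2 * ennreal (horiz \<alpha> u g p) + ennreal (2 * \<alpha>\<^sup>2) * (\<rho> p * ennreal ((cmod (u p))\<^sup>2)) \<partial>lborel)"
  proof (rule nn_integral_mono)
    fix p
    have hn: "0 \<le> horiz \<alpha> u g p" unfolding horiz_def by simp
    have "ennreal (2 * horiz \<alpha> u g p + 2 * \<alpha>\<^sup>2 * (1 / ((fst p)\<^sup>2 + (fst (snd p))\<^sup>2) * (cmod (u p))\<^sup>2))
      = ennreal (2 * horiz \<alpha> u g p) + ennreal (2 * \<alpha>\<^sup>2 * (1 / ((fst p)\<^sup>2 + (fst (snd p))\<^sup>2) * (cmod (u p))\<^sup>2))"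
      using hn by (intro ennreal_plus) auto
    also have "ennreal (2 * \<alpha>\<^sup>2 * (1 / ((fst p)\<^sup>2 + (fst (snd p))\<^sup>2) * (cmod (u p))\<^sup>2)) = ennreal (2 * \<alpha>\<^sup>2) * (\<rho> p * ennreal ((cmod (u p))\<^sup>2))"
      unfolding \<rho>_def by (subst ennreal_mult[symmetric], simp, simp, rule ennreal_mult) auto
    also have "ennreal (2 * horiz \<alpha> u g p) = ennreal 2 * ennreal (horiz \<alpha> u g p)" using hn by (intro ennreal_mult) auto
    finally show "ennreal ((cmod (g 0 p))\<^sup>2 + (cmod (g 1 p))\<^sup>2) \<le> ennreal 2 * ennreal (horiz \<alpha> u g p) + ennreal (2 * \<alpha>\<^sup>2) * (\<rho> p * ennreal ((cmod (u p))\<^sup>2))"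
      using ennreal_leI[OF pt[of p]] by simp
  qed
  also have "\<dots> = ennreal 2 * (\<integral>\<^sup>+p. ennreal (horiz \<alpha> u g p) \<partial>lborel) + ennreal (2 * \<alpha>\<^sup>2) * (\<integral>\<^sup>+p. \<rho> p * ennreal ((cmod (u p))\<^sup>2) \<partial>lborel)"
    by (subst nn_integral_add) (auto simp: nn_integral_cmult)
  also have "\<dots> \<le> ennreal 2 * (\<integral>\<^sup>+p. ennreal (horiz \<alpha> u g p) \<partial>lborel) + ennreal (2 * \<alpha>\<^sup>2 / hardy_const \<alpha>) * (\<integral>\<^sup>+p. ennreal (horiz \<alpha> u g p) \<partial>lborel)"
    by (intro add_left_mono h)
  also have "\<dots> = ennreal (2 + 2 * \<alpha>\<^sup>2 / hardy_const \<alpha>) * (\<integral>\<^sup>+p. ennreal (horiz \<alpha> u g p) \<partial>lborel)"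
    using hardy_const_pos[OF \<alpha>] by (subst ennreal_plus) (auto simp: distrib_right)
  finally show ?thesis .
qed

section \<open>Tiling a cuboid over the window\<close>

lemma indicator_split_le:
  fixes s t r x :: real
  assumes "s \<le> t" "t \<le> r"
  shows "indicator {s<..<t} x + indicator {t<..<r} x \<le> (indicator {s<..<r} x :: real)"
proof (cases "x < t")
  case True then show ?thesis using assms by (simp add: indicator_def)
next
  case False then show ?thesis using assms by (simp add: indicator_def)
qed

lemma indicator_split_ge:
  fixes s t r x :: real
  assumes "x \<noteq> t"
  shows "(indicator {s<..<r} x :: real) \<le> indicator {s<..<t} x + indicator {t<..<r} x"
proof (cases "x < t")
  case True then show ?thesis by (simp add: indicator_def)
next
  case False then show ?thesis using assms by (simp add: indicator_def)
qed

lemma tile_sum_le: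
  assumes "h > 0"
  shows "(\<Sum>i<N. indicator {s + real i * h<..<s + real (Suc i) * h} x) \<le> (indicator {s<..<s + real N * h} x :: real)"
proof (induction N)
  case (Suc N)
  have "(\<Sum>i<Suc N. indicator {s + real i * h<..<s + real (Suc i) * h} x)
      \<le> (indicator {s<..<s + real N * h} x + indicator {s + real N * h<..<s + real (Suc N) * h} x :: real)"
    using Suc by simp
  also have "\<dots> \<le> indicator {s<..<s + real (Suc N) * h} x"
    using assms by (intro indicator_split_le add_left_mono mult_right_mono) auto
  finally show ?case .
qed simp

lemma tile_sum_ge:
  assumes "\<And>i. i \<le> N \<Longrightarrow> x \<noteq> s + real i * h"
  shows "(indicator {s<..<s + real N * h} x :: real) \<le> (\<Sum>i<N. indicator {s + real i * h<..<s + real (Suc i) * h} x)"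
  using assms
proof (induction N)
  case (Suc N)
  have "x \<noteq> s + real N * h" using Suc.prems[of N] by simp
  then have "(indicator {s<..<s + real (Suc N) * h} x :: real) \<le> indicator {s<..<s + real N * h} x + indicator {s + real N * h<..<s + real (Suc N) * h} x"
    by (rule indicator_split_ge)
  also have "\<dots> \<le> (\<Sum>i<N. indicator {s + real i * h<..<s + real (Suc i) * h} x) + indicator {s + real N * h<..<s + real (Suc N) * h} x"
    using Suc by simp
  finally show ?case by simp
qed simp

text \<open>Lower corner of a tile; \<open>N^3\<close> congruent boxes subdivide the cuboid with
  base [-a, a]^2 and height \<open>d\<close>. A square base is taken so that boxes fill it
  exactly.\<close>

definition tile_lo :: "real \<Rightarrow> real \<Rightarrow> nat \<Rightarrow> nat \<times> nat \<times> nat \<Rightarrow> pt" where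
  "tile_lo a d N t = (- a + real (fst t) * (2 * a / real N), - a + real (fst (snd t)) * (2 * a / real N), real (snd (snd t)) * (d / real N))"

definition tile_hi :: "real \<Rightarrow> real \<Rightarrow> nat \<Rightarrow> nat \<times> nat \<times> nat \<Rightarrow> pt" where
  "tile_hi a d N t = tile_lo a d N (Suc (fst t), Suc (fst (snd t)), Suc (snd (snd t)))"

definition tile :: "real \<Rightarrow> real \<Rightarrow> nat \<Rightarrow> nat \<times> nat \<times> nat \<Rightarrow> pt set" where
  "tile a d N t = box (tile_lo a d N t) (tile_hi a d N t)"

definition tiles :: "nat \<Rightarrow> (nat \<times> nat \<times> nat) set" where
  "tiles N = {..<N} \<times> {..<N} \<times> {..<N}"

definition square :: "real \<Rightarrow> real \<Rightarrow> pt set" where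
  "square a d = {p. - a < fst p \<and> fst p < a \<and> - a < fst (snd p) \<and> fst (snd p) < a \<and> 0 < snd (snd p) \<and> snd (snd p) < d}"

lemma finite_tiles: "finite (tiles N)" unfolding tiles_def by simp

lemma sum_tiles: "(\<Sum>t\<in>tiles N. f (fst t) * (g (fst (snd t)) * h (snd (snd t)))) = (\<Sum>i<N. f i) * ((\<Sum>i<N. g i) * (\<Sum>i<N. h i) :: real)"
proof -
  have 2: "(\<Sum>i<N. g i) * (\<Sum>i<N. h i) = (\<Sum>t\<in>{..<N} \<times> {..<N}. g (fst t) * h (snd t))"
    by (simp add: sum_product sum.cartesian_product case_prod_beta)
  show ?thesis unfolding 2 sum_product sum.cartesian_product tiles_def by (simp add: case_prod_beta)
qed

lemma indicator_tile:
  fixes a d :: real and N :: nat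
  defines "h \<equiv> 2 * a / real N" and "e \<equiv> d / real N"
  shows "(indicator (tile a d N t) p :: real) = indicator {- a + real (fst t) * h<..<- a + real (Suc (fst t)) * h} (fst p) *
    (indicator {- a + real (fst (snd t)) * h<..<- a + real (Suc (fst (snd t))) * h} (fst (snd p)) *
     indicator {0 + real (snd (snd t)) * e<..<0 + real (Suc (snd (snd t))) * e} (snd (snd p)))"
  by (cases p) (simp add: tile_def tile_lo_def tile_hi_def box_pt_mem indicator_def h_def e_def)

lemma sum_tile_le:
  assumes "a > 0" "d > 0" "N > 0"
  shows "(\<Sum>t\<in>tiles N. indicator (tile a d N t) p) \<le> (indicator (square a d) p :: real)"
proof -
  let ?h = "2 * a / real N" and ?e = "d / real N"
  have "(\<Sum>t\<in>tiles N. indicator (tile a d N t) p :: real) = (\<Sum>i<N. indicator {- a + real i * ?h<..<- a + real (Suc i) * ?h} (fst p)) *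
    ((\<Sum>i<N. indicator {- a + real i * ?h<..<- a + real (Suc i) * ?h} (fst (snd p))) *
     (\<Sum>i<N. indicator {0 + real i * ?e<..<0 + real (Suc i) * ?e} (snd (snd p))))"
    unfolding indicator_tile by (rule sum_tiles)
  also have "\<dots> \<le> indicator {- a<..<- a + real N * ?h} (fst p) *
    (indicator {- a<..<- a + real N * ?h} (fst (snd p)) * indicator {0<..<0 + real N * ?e} (snd (snd p)))"
    using assms by (intro mult_mono tile_sum_le sum_nonneg mult_nonneg_nonneg) (auto simp del: of_nat_Suc)
  also have "\<dots> = indicator (square a d) p"
    using assms by (simp add: square_def indicator_def)
  finally show ?thesis .
qed

lemma sum_tile_ge:
  assumes "a > 0" "d > 0" "N > 0"
  shows "AE p in lborel. indicator {p. \<bar>fst p\<bar> \<le> a \<and> \<bar>fst (snd p)\<bar> \<le> a \<and> 0 \<le> snd (snd p) \<and> snd (snd p) \<le> d} p \<le> (\<Sum>t\<in>tiles N. indicator (tile a d N t) p :: real)"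
proof -
  let ?h = "2 * a / real N" and ?e = "d / real N"
  \<comment> \<open>The open tiles miss only points on the grid planes, which are finitely many null
    sets.\<close>
  have "AE p :: pt in lborel. \<forall>i\<in>{..N}. fst p \<noteq> - a + real i * ?h \<and> fst (snd p) \<noteq> - a + real i * ?h \<and> snd (snd p) \<noteq> 0 + real i * ?e"
    by (rule AE_finite_allI) (auto intro: AE_coord_neq AE_conjI)
  then show ?thesis
  proof eventually_elim
    fix p :: pt
    assume *: "\<forall>i\<in>{..N}. fst p \<noteq> - a + real i * ?h \<and> fst (snd p) \<noteq> - a + real i * ?h \<and> snd (snd p) \<noteq> 0 + real i * ?e"
    have "fst p \<noteq> - a" "fst p \<noteq> a" "fst (snd p) \<noteq> - a" "fst (snd p) \<noteq> a" "snd (snd p) \<noteq> 0" "snd (snd p) \<noteq> d"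
      using bspec[OF *, of 0] bspec[OF *, of N] assms by auto
    then have "indicator {p. \<bar>fst p\<bar> \<le> a \<and> \<bar>fst (snd p)\<bar> \<le> a \<and> 0 \<le> snd (snd p) \<and> snd (snd p) \<le> d} p
      \<le> indicator {- a<..<- a + real N * ?h} (fst p) *
    (indicator {- a<..<- a + real N * ?h} (fst (snd p)) * indicator {0<..<0 + real N * ?e} (snd (snd p)) :: real)"
      using assms by (simp add: indicator_def abs_le_iff)
    also have "\<dots> \<le> (\<Sum>i<N. indicator {- a + real i * ?h<..<- a + real (Suc i) * ?h} (fst p)) *
    ((\<Sum>i<N. indicator {- a + real i * ?h<..<- a + real (Suc i) * ?h} (fst (snd p))) *
     (\<Sum>i<N. indicator {0 + real i * ?e<..<0 + real (Suc i) * ?e} (snd (snd p))))"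
      using * by (intro mult_mono tile_sum_ge sum_nonneg mult_nonneg_nonneg) auto
    also have "\<dots> = (\<Sum>t\<in>tiles N. indicator (tile a d N t) p)" unfolding indicator_tile by (rule sum_tiles[symmetric])
    finally show "indicator {p. \<bar>fst p\<bar> \<le> a \<and> \<bar>fst (snd p)\<bar> \<le> a \<and> 0 \<le> snd (snd p) \<and> snd (snd p) \<le> d} p \<le> (\<Sum>t\<in>tiles N. indicator (tile a d N t) p :: real)" .
  qed
qed

lemma tile_geometry:
  assumes "a > 0" "d > 0" "N > 0"
  shows "vol (tile_lo a d N t) (tile_hi a d N t) = (2 * a / N)\<^sup>2 * (d / N)"
    and "(norm (tile_hi a d N t - tile_lo a d N t))\<^sup>2 = (8 * a\<^sup>2 + d\<^sup>2) / (real N)\<^sup>2"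
    and "tile a d N t \<subseteq> UNIV - window a"
    and "fst (tile_lo a d N t) < fst (tile_hi a d N t)" "fst (snd (tile_lo a d N t)) < fst (snd (tile_hi a d N t))"
      "snd (snd (tile_lo a d N t)) < snd (snd (tile_hi a d N t))"
proof -
  have diff: "tile_hi a d N t - tile_lo a d N t = (2 * a / N, 2 * a / N, d / N)"
    unfolding tile_hi_def tile_lo_def by (simp add: distrib_right add_divide_distrib)
  then show lt: "fst (tile_lo a d N t) < fst (tile_hi a d N t)" "fst (snd (tile_lo a d N t)) < fst (snd (tile_hi a d N t))"
      "snd (snd (tile_lo a d N t)) < snd (snd (tile_hi a d N t))"
    unfolding tile_hi_def tile_lo_def using assms by (auto simp: distrib_right add_divide_distrib)
  show "vol (tile_lo a d N t) (tile_hi a d N t) = (2 * a / N)\<^sup>2 * (d / N)"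
    unfolding vol_def tile_hi_def tile_lo_def by (simp add: distrib_right add_divide_distrib power2_eq_square)
  show "(norm (tile_hi a d N t - tile_lo a d N t))\<^sup>2 = (8 * a\<^sup>2 + d\<^sup>2) / (real N)\<^sup>2"
    unfolding diff by (simp add: norm_prod_def power_divide power_mult_distrib add_divide_distrib)
  have "snd (snd (tile_lo a d N t)) \<ge> 0" unfolding tile_lo_def using assms by simp
  then show "tile a d N t \<subseteq> UNIV - window a"
    unfolding tile_def window_def by (auto simp: box_pt_mem)
qed

lemma nn_integral_sum_tile:
  assumes [measurable]: "f \<in> borel_measurable borel" and f: "\<And>p. f p \<ge> 0"
  shows "(\<Sum>t\<in>tiles N. \<integral>\<^sup>+p. indicator (tile a d N t) p * ennreal (f p) \<partial>lborel) = (\<integral>\<^sup>+p. ennreal ((\<Sum>t\<in>tiles N. indicator (tile a d N t) p) * f p) \<partial>lborel)"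
proof -
  have [measurable]: "tile a d N t \<in> sets borel" for t unfolding tile_def by simp
  have "(\<Sum>t\<in>tiles N. \<integral>\<^sup>+p. indicator (tile a d N t) p * ennreal (f p) \<partial>lborel) = (\<integral>\<^sup>+p. (\<Sum>t\<in>tiles N. indicator (tile a d N t) p * ennreal (f p)) \<partial>lborel)"
    by (rule nn_integral_sum[symmetric]) measurable
  also have "\<dots> = (\<integral>\<^sup>+p. ennreal ((\<Sum>t\<in>tiles N. indicator (tile a d N t) p) * f p) \<partial>lborel)"
  proof (rule nn_integral_cong)
    fix p
    have "(\<Sum>t\<in>tiles N. indicator (tile a d N t) p * ennreal (f p)) = (\<Sum>t\<in>tiles N. ennreal (indicator (tile a d N t) p * f p))"
      by (intro sum.cong) (auto simp: indicator_def)
    then show "(\<Sum>t\<in>tiles N. indicator (tile a d N t) p * ennreal (f p)) = ennreal ((\<Sum>t\<in>tiles N. indicator (tile a d N t) p) * f p)"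
      using f by (simp add: sum_ennreal sum_distrib_right)
  qed
  finally show ?thesis .
qed

lemma square_measurable [measurable]: "square a d \<in> sets borel"
  unfolding square_def by (intro borel_open open_Collect_conj open_Collect_less continuous_intros)

text \<open>Outside the square column the Dirichlet inequality is paid for by the vertical energy
  there. On a tile, Poincare's inequality leaves the mean of \<open>u\<close> and
  \<open>\<epsilon>\<close> times the gradient. The mesh is so fine that, after
  \<open>gradient_bound\<close>, the latter costs at most the vertical energy over the square and
  the horizontal energy. Only the means remain as a correction.\<close>

lemma core_semibound:
  assumes c: "core d a u g" and d: "d > 0" and a: "a > 0" and \<alpha>: "\<alpha> \<notin> \<int>" and N: "N > 0"
    and fine: "16 * (pi / d)\<^sup>2 * ((8 * a\<^sup>2 + d\<^sup>2) / (real N)\<^sup>2) \<le> 1"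
      "16 * (pi / d)\<^sup>2 * ((8 * a\<^sup>2 + d\<^sup>2) / (real N)\<^sup>2) * (2 + 2 * \<alpha>\<^sup>2 / hardy_const \<alpha>) \<le> 1"
  defines "K \<equiv> 2 * (pi / d)\<^sup>2 / ((2 * a / N)\<^sup>2 * (d / N))"
  shows "(pi / d)\<^sup>2 * (norm (fst (emb u (mgrad \<alpha> u g))))\<^sup>2 \<le> (norm (snd (emb u (mgrad \<alpha> u g))))\<^sup>2
    + K * (\<Sum>t\<in>tiles N. (cmod (LINT p|lborel. indicator (tile a d N t) p *\<^sub>R u p))\<^sup>2)"
proof -
  note [measurable] = core_measurable[OF c] core_measurable(5)[OF c, of \<alpha>]
  have g1 [measurable]: "g (Suc 0) \<in> borel_measurable borel" using core_measurable(3)[OF c] by simp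
  define m where "m = (pi / d)\<^sup>2"
  define \<epsilon> where "\<epsilon> = 16 * ((8 * a\<^sup>2 + d\<^sup>2) / (real N)\<^sup>2)"
  define C where "C = 2 + 2 * \<alpha>\<^sup>2 / hardy_const \<alpha>"
  have m: "m > 0" unfolding m_def using d by simp
  have \<epsilon>: "\<epsilon> \<ge> 0" unfolding \<epsilon>_def by simp
  have C: "C \<ge> 0" unfolding C_def using hardy_const_pos[OF \<alpha>] by simp
  have m\<epsilon>: "m * \<epsilon> \<le> 1" "m * \<epsilon> * C \<le> 1" using fine unfolding m_def \<epsilon>_def C_def by (simp_all only: mult_ac)
  define V where "V = (2 * a / N)\<^sup>2 * (d / N)"
  have V: "V > 0" unfolding V_def using a d N by simp
  \<comment> \<open>The complement of the closed square column. It lies outside the disc; the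
    corners of the square beyond the disc are left to the tiles.\<close>
  define S where "S = {p :: pt. \<bar>fst p\<bar> > a \<or> \<bar>fst (snd p)\<bar> > a}"
  have S_open: "open S" unfolding S_def by (intro open_Collect_disj open_Collect_less continuous_intros)
  then have S_meas [measurable]: "S \<in> sets borel" by simp
  have md: "m * (d / pi)\<^sup>2 = 1" unfolding m_def using d by (simp add: power_divide)
  have out: "ennreal m * sq_int_on S u \<le> sq_int_on S (g 2)"
  proof -
    have sq: "a\<^sup>2 < x\<^sup>2" if "a < \<bar>x\<bar>" for x using power_strict_mono[OF that, of 2] a by simp
    have sq2: "a\<^sup>2 < x\<^sup>2 + y\<^sup>2" if "a < \<bar>x\<bar> \<or> a < \<bar>y\<bar>" for x y
      using that sq[of x] sq[of y] zero_le_power2[of x] zero_le_power2[of y] by linarith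
    have "S \<subseteq> outside a" unfolding S_def outside_def using sq2 by auto
    then have "sq_int_on S u \<le> ennreal ((d / pi)\<^sup>2) * sq_int_on S (g 2)"
      by (rule dirichlet_outside[OF c d S_meas]) (auto simp: S_def)
    then have "ennreal m * sq_int_on S u \<le> ennreal 1 * sq_int_on S (g 2)"
      using m md by (intro ennreal_rescale[of 1 m "(d / pi)\<^sup>2"]) auto
    then show ?thesis by simp
  qed
  define I where "I t = (cmod (LINT p|lborel. indicator (tile a d N t) p *\<^sub>R u p))\<^sup>2" for t
  have G: "(\<integral>\<^sup>+p. ennreal ((\<Sum>t\<in>tiles N. indicator (tile a d N t) p) * grad_sq g p) \<partial>lborel)
      \<le> sq_int_on (square a d) (g 2) + ennreal C * (\<integral>\<^sup>+p. ennreal (horiz \<alpha> u g p) \<partial>lborel)"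
  proof -
    have "(\<integral>\<^sup>+p. ennreal ((\<Sum>t\<in>tiles N. indicator (tile a d N t) p) * grad_sq g p) \<partial>lborel)
      \<le> (\<integral>\<^sup>+p. indicator (square a d) p * ennreal ((cmod (g 2 p))\<^sup>2) + ennreal ((cmod (g 0 p))\<^sup>2 + (cmod (g 1 p))\<^sup>2) \<partial>lborel)"
    proof (rule nn_integral_mono)
      fix p
      have "(\<Sum>t\<in>tiles N. indicator (tile a d N t) p) * grad_sq g p \<le> indicator (square a d) p * grad_sq g p"
        by (intro mult_right_mono sum_tile_le a d N) (auto simp: grad_sq_def sum_nonneg)
      also have "\<dots> \<le> indicator (square a d) p * (cmod (g 2 p))\<^sup>2 + ((cmod (g 0 p))\<^sup>2 + (cmod (g 1 p))\<^sup>2)"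
        by (simp add: grad_sq_def sum_less_3 indicator_def)
      finally have "ennreal ((\<Sum>t\<in>tiles N. indicator (tile a d N t) p) * grad_sq g p)
         \<le> ennreal (indicator (square a d) p * (cmod (g 2 p))\<^sup>2 + ((cmod (g 0 p))\<^sup>2 + (cmod (g 1 p))\<^sup>2))" by (rule ennreal_leI)
      also have "\<dots> = indicator (square a d) p * ennreal ((cmod (g 2 p))\<^sup>2) + ennreal ((cmod (g 0 p))\<^sup>2 + (cmod (g 1 p))\<^sup>2)"
        by (subst ennreal_plus) (auto simp: indicator_def simp del: ennreal_plus)
      finally show "ennreal ((\<Sum>t\<in>tiles N. indicator (tile a d N t) p) * grad_sq g p)
         \<le> indicator (square a d) p * ennreal ((cmod (g 2 p))\<^sup>2) + ennreal ((cmod (g 0 p))\<^sup>2 + (cmod (g 1 p))\<^sup>2)" .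
    qed
    also have "\<dots> = sq_int_on (square a d) (g 2) + (\<integral>\<^sup>+p. ennreal ((cmod (g 0 p))\<^sup>2 + (cmod (g 1 p))\<^sup>2) \<partial>lborel)"
      using g1 by (intro nn_integral_add) measurable
    also have "\<dots> \<le> sq_int_on (square a d) (g 2) + ennreal C * (\<integral>\<^sup>+p. ennreal (horiz \<alpha> u g p) \<partial>lborel)"
      unfolding C_def by (intro add_left_mono gradient_bound[OF c \<alpha>])
    finally show ?thesis .
  qed
  have gsm: "grad_sq g \<in> borel_measurable borel"
    using g1 unfolding grad_sq_def sum_less_3 by simp
  have box: "(\<Sum>t\<in>tiles N. \<integral>\<^sup>+p. indicator (tile a d N t) p * ennreal ((cmod (u p))\<^sup>2) \<partial>lborel)
     \<le> ennreal (2 / V * (\<Sum>t\<in>tiles N. I t)) + ennreal \<epsilon> * (\<integral>\<^sup>+p. ennreal ((\<Sum>t\<in>tiles N. indicator (tile a d N t) p) * grad_sq g p) \<partial>lborel)"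
  proof -
    have "sq_int_on (tile a d N t) u
       \<le> ennreal (2 / V * I t) + ennreal \<epsilon> * (\<integral>\<^sup>+p. indicator (tile a d N t) p * ennreal (grad_sq g p) \<partial>lborel)" for t
      using poincare_box[OF core_L2[OF c] core_weak_grad[OF c] tile_geometry(3)[OF a d N, of t, unfolded tile_def] tile_geometry(4-6)[OF a d N, of t]]
      unfolding tile_geometry(1,2)[OF a d N] tile_def[symmetric] V_def I_def \<epsilon>_def .
    then have "(\<Sum>t\<in>tiles N. \<integral>\<^sup>+p. indicator (tile a d N t) p * ennreal ((cmod (u p))\<^sup>2) \<partial>lborel)
      \<le> (\<Sum>t\<in>tiles N. ennreal (2 / V * I t) + ennreal \<epsilon> * (\<integral>\<^sup>+p. indicator (tile a d N t) p * ennreal (grad_sq g p) \<partial>lborel))"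
      by (rule sum_mono)
    also have "\<dots> = (\<Sum>t\<in>tiles N. ennreal (2 / V * I t)) + ennreal \<epsilon> * (\<Sum>t\<in>tiles N. \<integral>\<^sup>+p. indicator (tile a d N t) p * ennreal (grad_sq g p) \<partial>lborel)"
      by (simp add: sum.distrib sum_distrib_left)
    also have "(\<Sum>t\<in>tiles N. ennreal (2 / V * I t)) = ennreal (2 / V * (\<Sum>t\<in>tiles N. I t))"
      using V by (subst sum_ennreal) (auto simp: I_def sum_distrib_left)
    also have "(\<Sum>t\<in>tiles N. \<integral>\<^sup>+p. indicator (tile a d N t) p * ennreal (grad_sq g p) \<partial>lborel) = (\<integral>\<^sup>+p. ennreal ((\<Sum>t\<in>tiles N. indicator (tile a d N t) p) * grad_sq g p) \<partial>lborel)"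
      by (rule nn_integral_sum_tile[OF gsm]) (simp add: grad_sq_def sum_nonneg)
    finally show ?thesis .
  qed
  have total: "sq_int u \<le> sq_int_on S u
      + (\<Sum>t\<in>tiles N. \<integral>\<^sup>+p. indicator (tile a d N t) p * ennreal ((cmod (u p))\<^sup>2) \<partial>lborel)"
  proof -
    have um: "(\<lambda>p. (cmod (u p))\<^sup>2) \<in> borel_measurable borel" by measurable
    have [measurable]: "tile a d N t \<in> sets borel" for t unfolding tile_def by simp
    have "sq_int u \<le> (\<integral>\<^sup>+p. indicator S p * ennreal ((cmod (u p))\<^sup>2)
       + ennreal ((\<Sum>t\<in>tiles N. indicator (tile a d N t) p) * (cmod (u p))\<^sup>2) \<partial>lborel)"
    proof (rule nn_integral_mono_AE)
      show "AE p in lborel. ennreal ((cmod (u p))\<^sup>2) \<le> indicator S p * ennreal ((cmod (u p))\<^sup>2)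
       + ennreal ((\<Sum>t\<in>tiles N. indicator (tile a d N t) p) * (cmod (u p))\<^sup>2)"
        using sum_tile_ge[OF a d N]
      proof eventually_elim
        fix p
        assume le: "indicator {p. \<bar>fst p\<bar> \<le> a \<and> \<bar>fst (snd p)\<bar> \<le> a \<and> 0 \<le> snd (snd p) \<and> snd (snd p) \<le> d} p \<le> (\<Sum>t\<in>tiles N. indicator (tile a d N t) p :: real)"
        consider "p \<in> S" | "p \<notin> slab d" | "p \<notin> S" "p \<in> slab d" by blast
        then show "ennreal ((cmod (u p))\<^sup>2) \<le> indicator S p * ennreal ((cmod (u p))\<^sup>2)
           + ennreal ((\<Sum>t\<in>tiles N. indicator (tile a d N t) p) * (cmod (u p))\<^sup>2)"
        proof cases
          case 2
          then show ?thesis using core_zero[OF c, of p] by simp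
        next
          case 3
          then have "1 \<le> (\<Sum>t\<in>tiles N. indicator (tile a d N t) p :: real)" using le by (auto simp: S_def slab_def indicator_def not_less)
          then have "1 * (cmod (u p))\<^sup>2 \<le> (\<Sum>t\<in>tiles N. indicator (tile a d N t) p :: real) * (cmod (u p))\<^sup>2"
            by (rule mult_right_mono) simp
          then show ?thesis using 3 by (auto intro: ennreal_leI)
        qed (simp add: add_increasing2)
      qed
    qed
    also have "\<dots> = sq_int_on S u
       + (\<integral>\<^sup>+p. ennreal ((\<Sum>t\<in>tiles N. indicator (tile a d N t) p) * (cmod (u p))\<^sup>2) \<partial>lborel)"
      by (rule nn_integral_add) measurable
    finally show ?thesis unfolding nn_integral_sum_tile[OF um zero_le_power2] .
  qed
  have disj: "sq_int_on S (g 2) + sq_int_on (square a d) (g 2)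
      \<le> sq_int (g 2)"
  proof -
    have "sq_int_on S (g 2) + sq_int_on (square a d) (g 2)
      = (\<integral>\<^sup>+p. indicator S p * ennreal ((cmod (g 2 p))\<^sup>2) + indicator (square a d) p * ennreal ((cmod (g 2 p))\<^sup>2) \<partial>lborel)"
      by (rule nn_integral_add[symmetric]) measurable
    also have "\<dots> \<le> sq_int (g 2)"
      by (intro nn_integral_mono) (auto simp: indicator_def S_def square_def)
    finally show ?thesis .
  qed
  let ?H = "\<integral>\<^sup>+p. ennreal (horiz \<alpha> u g p) \<partial>lborel"
  let ?Z = "\<integral>\<^sup>+p. indicator (square a d) p * ennreal ((cmod (g 2 p))\<^sup>2) \<partial>lborel"
  let ?Y = "\<integral>\<^sup>+p. indicator S p * ennreal ((cmod (g 2 p))\<^sup>2) \<partial>lborel"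
  let ?U = "\<integral>\<^sup>+p. indicator S p * ennreal ((cmod (u p))\<^sup>2) \<partial>lborel"
  let ?W = "\<integral>\<^sup>+p. ennreal ((cmod (u p))\<^sup>2) \<partial>lborel"
  have Ip: "0 \<le> 2 / V * (\<Sum>t\<in>tiles N. I t)" using V by (simp add: I_def sum_nonneg)
  have mIp: "0 \<le> m * (2 / V * (\<Sum>t\<in>tiles N. I t))" by (rule mult_nonneg_nonneg[OF less_imp_le[OF m] Ip])
  have "ennreal m * ?W \<le> ennreal m * (?U + (ennreal (2 / V * (\<Sum>t\<in>tiles N. I t)) + ennreal \<epsilon> * (?Z + ennreal C * ?H)))"
    by (intro mult_left_mono order_trans[OF total] add_left_mono order_trans[OF box] G) auto
  also have "\<dots> = ennreal m * ?U + ennreal (m * (2 / V * (\<Sum>t\<in>tiles N. I t))) + ennreal (m * \<epsilon>) * ?Z + ennreal (m * \<epsilon> * C) * ?H"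
    unfolding ennreal_mult[OF less_imp_le[OF m] Ip] using m \<epsilon> C
    by (simp add: distrib_left mult.assoc[symmetric] ennreal_mult add.assoc del: times_divide_eq_left times_divide_eq_right)
  also have "\<dots> \<le> ?Y + ennreal (m * (2 / V * (\<Sum>t\<in>tiles N. I t))) + 1 * ?Z + 1 * ?H"
    by (intro add_mono out mult_right_mono order_refl) (use m\<epsilon> in auto)
  also have "\<dots> = (?Y + ?Z) + ?H + ennreal (m * (2 / V * (\<Sum>t\<in>tiles N. I t)))" by (simp add: ac_simps)
  also have "\<dots> \<le> sq_int (g 2) + ?H + ennreal (m * (2 / V * (\<Sum>t\<in>tiles N. I t)))"
    by (intro add_right_mono disj)
  also have "\<dots> = ennreal ((norm (snd (emb u (mgrad \<alpha> u g))))\<^sup>2 + m * (2 / V * (\<Sum>t\<in>tiles N. I t)))"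
    by (subst ennreal_plus[OF zero_le_power2 mIp]) (simp add: norm_emb[OF c] add.commute)
  finally have "ennreal (m * (norm (fst (emb u (mgrad \<alpha> u g))))\<^sup>2) \<le> ennreal ((norm (snd (emb u (mgrad \<alpha> u g))))\<^sup>2 + m * (2 / V * (\<Sum>t\<in>tiles N. I t)))"
    using m by (simp only: ennreal_mult[OF less_imp_le[OF m] zero_le_power2] norm_emb(1)[OF c])
  then have "m * (norm (fst (emb u (mgrad \<alpha> u g))))\<^sup>2 \<le> (norm (snd (emb u (mgrad \<alpha> u g))))\<^sup>2 + m * (2 / V * (\<Sum>t\<in>tiles N. I t))"
    by (subst (asm) ennreal_le_iff[OF add_nonneg_nonneg[OF zero_le_power2 mIp]])
  then show ?thesis unfolding K_def m_def[symmetric] V_def[symmetric] I_def by (simp add: mult_ac)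
qed

lemma L2_indicator_tile: "L2 (\<lambda>p. complex_of_real (indicator (tile a d N t) p))"
proof (rule L2I_nn)
  have [measurable]: "tile a d N t \<in> sets borel" unfolding tile_def by simp
  show "(\<lambda>p. complex_of_real (indicator (tile a d N t) p)) \<in> borel_measurable borel" by measurable
  have "(\<integral>\<^sup>+p. ennreal ((cmod (complex_of_real (indicator (tile a d N t) p)))\<^sup>2) \<partial>lborel) = emeasure lborel (tile a d N t)"
    by (subst nn_integral_indicator[symmetric], simp, rule nn_integral_cong) (simp add: indicator_def)
  then show "(\<integral>\<^sup>+p. ennreal ((cmod (complex_of_real (indicator (tile a d N t) p)))\<^sup>2) \<partial>lborel) < \<infinity>"
    using emeasure_lborel_box_finite[of "tile_lo a d N t" "tile_hi a d N t"] by (simp add: tile_def less_top)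
qed

text \<open>One complex mean amounts to two real functionals, which is why the index set of
  \<open>semibound\<close> carries a \<open>bool\<close>.\<close>

lemma tile_mean:
  assumes u: "L2 u"
  shows "(cmod (LINT p|lborel. indicator (tile a d N t) p *\<^sub>R u p))\<^sup>2
    = (inner (cls u) (cls (\<lambda>p. complex_of_real (indicator (tile a d N t) p))))\<^sup>2
    + (inner (cls u) (mult_i (cls (\<lambda>p. complex_of_real (indicator (tile a d N t) p)))))\<^sup>2"
proof -
  let ?b = "\<lambda>p. complex_of_real (indicator (tile a d N t) p)"
  have "(LINT p|lborel. indicator (tile a d N t) p *\<^sub>R u p) = L2inner u ?b"
    unfolding L2inner_def by (intro Bochner_Integration.integral_cong) (auto simp: scaleR_conv_of_real mult.commute)
  then show ?thesis by (simp add: L2inner_cls[OF u L2_indicator_tile] cmod_power2)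
qed

theorem semibound:
  assumes d: "d > 0" and a: "a > 0" and \<alpha>: "\<alpha> \<notin> \<int>"
  obtains I :: "((nat \<times> nat \<times> nat) \<times> bool) set" and b :: "(nat \<times> nat \<times> nat) \<times> bool \<Rightarrow> l2" and K :: real
  where "finite I" "K \<ge> 0"
    "\<And>z. z \<in> form_dom d \<alpha> a \<Longrightarrow> (pi / d)\<^sup>2 * (norm (fst z))\<^sup>2 \<le> (norm (snd z))\<^sup>2 + K * (\<Sum>i\<in>I. (inner (fst z) (b i))\<^sup>2)"
proof -
  define C where "C = 2 + 2 * \<alpha>\<^sup>2 / hardy_const \<alpha>"
  have C: "C \<ge> 0" unfolding C_def using hardy_const_pos[OF \<alpha>] by simp
  define B where "B = 16 * (pi / d)\<^sup>2 * (8 * a\<^sup>2 + d\<^sup>2)"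
  have B: "B \<ge> 0" unfolding B_def by simp
  \<comment> \<open>The bound \<open>B * (1 + C) \<le> N^2\<close> implies both conditions on the
    mesh, and \<open>N \<le> N^2\<close> lets a linear choice suffice.\<close>
  obtain N0 :: nat where N0: "B * (1 + C) < real N0" using reals_Archimedean2 by blast
  define N where "N = Suc N0"
  have N: "N > 0" unfolding N_def by simp
  have "B * (1 + C) \<le> real N" using N0 unfolding N_def by simp
  also have "\<dots> \<le> (real N)\<^sup>2" using N by (simp add: power2_eq_square)
  finally have BN: "B * (1 + C) \<le> (real N)\<^sup>2" .
  have BC: "B * C \<ge> 0" using B C by simp
  have "B / (real N)\<^sup>2 \<le> 1" "B * C / (real N)\<^sup>2 \<le> 1" using BN N B BC by (simp_all add: distrib_left)
  then have fine: "16 * (pi / d)\<^sup>2 * ((8 * a\<^sup>2 + d\<^sup>2) / (real N)\<^sup>2) \<le> 1"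
      "16 * (pi / d)\<^sup>2 * ((8 * a\<^sup>2 + d\<^sup>2) / (real N)\<^sup>2) * (2 + 2 * \<alpha>\<^sup>2 / hardy_const \<alpha>) \<le> 1"
    unfolding B_def C_def by (simp_all add: mult_ac)
  define K where "K = 2 * (pi / d)\<^sup>2 / ((2 * a / N)\<^sup>2 * (d / N))"
  define b0 where "b0 t = cls (\<lambda>p. complex_of_real (indicator (tile a d N t) p))" for t
  define b where "b i = (if snd i then b0 (fst i) else mult_i (b0 (fst i)))" for i
  define I where "I = tiles N \<times> (UNIV :: bool set)"
  have sum: "(\<Sum>i\<in>I. (inner x (b i))\<^sup>2) = (\<Sum>t\<in>tiles N. (inner x (b0 t))\<^sup>2 + (inner x (mult_i (b0 t)))\<^sup>2)" for x
    using sum.cartesian_product[of "\<lambda>t s. (inner x (if s then b0 t else mult_i (b0 t)))\<^sup>2" "UNIV :: bool set" "tiles N"]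
    unfolding I_def b_def by (simp add: UNIV_bool add.commute case_prod_beta)
  show thesis
  proof (rule that[of I K b])
    show "finite I" unfolding I_def by (simp add: finite_tiles)
    show "K \<ge> 0" unfolding K_def using d by simp
    fix z assume z: "z \<in> form_dom d \<alpha> a"
    show "(pi / d)\<^sup>2 * (norm (fst z))\<^sup>2 \<le> (norm (snd z))\<^sup>2 + K * (\<Sum>i\<in>I. (inner (fst z) (b i))\<^sup>2)"
    proof (rule form_dom_induct[OF z])
      show "closed {z :: l2 \<times> l2 \<times> l2 \<times> l2. (pi / d)\<^sup>2 * (norm (fst z))\<^sup>2 \<le> (norm (snd z))\<^sup>2 + K * (\<Sum>i\<in>I. (inner (fst z) (b i))\<^sup>2)}"
        by (intro closed_Collect_le continuous_intros)
      fix u g assume c: "core d a u g"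
      have "(\<Sum>i\<in>I. (inner (fst (emb u (mgrad \<alpha> u g))) (b i))\<^sup>2) = (\<Sum>t\<in>tiles N. (cmod (LINT p|lborel. indicator (tile a d N t) p *\<^sub>R u p))\<^sup>2)"
        unfolding sum tile_mean[OF core_L2[OF c]] b0_def emb_def by simp
      then show "(pi / d)\<^sup>2 * (norm (fst (emb u (mgrad \<alpha> u g))))\<^sup>2 \<le> (norm (snd (emb u (mgrad \<alpha> u g))))\<^sup>2
          + K * (\<Sum>i\<in>I. (inner (fst (emb u (mgrad \<alpha> u g))) (b i))\<^sup>2)"
        using core_semibound[OF c d a \<alpha> N fine] unfolding K_def by simp
    qed
  qed
qed

section \<open>Continuously differentiable functions cut off to the slab\<close>

definition C1 :: "fn \<Rightarrow> vfn \<Rightarrow> bool" where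
  "C1 F G \<longleftrightarrow> (\<forall>p. (F has_derivative (\<lambda>h. \<Sum>j<3. comp j h *\<^sub>R G j p)) (at p)) \<and> (\<forall>j<3. continuous_on UNIV (G j))"

lemma C1_has_derivative: "C1 F G \<Longrightarrow> (F has_derivative (\<lambda>h. \<Sum>j<3. comp j h *\<^sub>R G j p)) (at p)"
  and C1_continuous_grad: "C1 F G \<Longrightarrow> j < 3 \<Longrightarrow> continuous_on UNIV (G j)"
  unfolding C1_def by simp_all

lemma C1_continuous: "C1 F G \<Longrightarrow> continuous_on UNIV F"
  by (intro continuous_at_imp_continuous_on ballI has_derivative_continuous[OF C1_has_derivative])

lemma C1_mult:
  assumes "C1 F G" "C1 F' G'" shows "C1 (\<lambda>p. F p * F' p) (\<lambda>j p. G j p * F' p + F p * G' j p)"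
  unfolding C1_def
proof (intro conjI allI impI)
  fix p
  show "((\<lambda>p. F p * F' p) has_derivative (\<lambda>h. \<Sum>j<3. comp j h *\<^sub>R (G j p * F' p + F p * G' j p))) (at p)"
    by (rule has_derivative_eq_rhs[OF has_derivative_mult[OF C1_has_derivative[OF assms(1)] C1_has_derivative[OF assms(2)]]])
      (simp add: fun_eq_iff sum_distrib_left sum_distrib_right sum.distrib scaleR_add_right)
next
  fix j :: nat assume "j < 3"
  then show "continuous_on UNIV (\<lambda>p. G j p * F' p + F p * G' j p)"
    using assms by (intro continuous_intros C1_continuous[of F] C1_continuous[of F']) (auto intro: C1_continuous_grad)
qed

lemma C1_test_fn: "test_fn U \<phi> \<Longrightarrow> C1 (\<lambda>p. complex_of_real (\<phi> p)) (\<lambda>j p. complex_of_real (pd \<phi> j p))"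
  unfolding C1_def
proof (intro conjI allI impI)
  fix p assume t: "test_fn U \<phi>"
  have "(\<phi> has_derivative (\<lambda>h. \<Sum>j<3. comp j h * pd \<phi> j p)) (at p)"
    by (rule has_derivative_eq_rhs[OF test_fn_has_derivative[OF t]])
      (simp add: fun_eq_iff frechet_pd[OF test_fn_differentiable[OF t]] sum_less_3)
  from has_derivative_of_real[OF this]
  show "((\<lambda>p. complex_of_real (\<phi> p)) has_derivative (\<lambda>h. \<Sum>j<3. comp j h *\<^sub>R complex_of_real (pd \<phi> j p))) (at p)"
    by (simp add: scaleR_conv_of_real)
next
  fix j :: nat assume "test_fn U \<phi>" "j < 3"
  then show "continuous_on UNIV (\<lambda>p. complex_of_real (pd \<phi> j p))"
    by (intro continuous_intros test_fn_pd_continuous)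
qed

lemma comp_ev: "j < 3 \<Longrightarrow> (\<Sum>i<3. comp i (ev j) *\<^sub>R (f i :: 'a::real_vector)) = f j"
  using less_3_cases[of j] by (auto simp: sum_less_3)

text \<open>Extends the defining identity of the weak gradient from real to complex test functions,
  through real and imaginary parts.\<close>

lemma C1_weak_grad:
  assumes v: "L2 v" and wg: "weak_grad U v k" and F: "C1 F G" and K: "compact K" "K \<subseteq> U" "\<And>p. p \<notin> K \<Longrightarrow> F p = 0"
    and j: "j < 3"
  shows "(LINT p|lborel. v p * G j p) = - (LINT p|lborel. k j p * F p)"
proof -
  have re: "((\<lambda>p. Re (F p)) has_derivative (\<lambda>h. Re (\<Sum>j<3. comp j h *\<^sub>R G j p))) (at p)"
    and im: "((\<lambda>p. Im (F p)) has_derivative (\<lambda>h. Im (\<Sum>j<3. comp j h *\<^sub>R G j p))) (at p)" for p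
    using bounded_linear.has_derivative[OF bounded_linear_Re C1_has_derivative[OF F]]
      bounded_linear.has_derivative[OF bounded_linear_Im C1_has_derivative[OF F]] by auto
  have t: "test_fn U (\<lambda>p. Re (F p))" "test_fn U (\<lambda>p. Im (F p))"
    by (rule test_fnI[OF re _ K(1,2)]; use K(3) C1_continuous_grad[OF F] in \<open>auto simp: comp_ev intro!: continuous_intros\<close>)
      (rule test_fnI[OF im _ K(1,2)]; use K(3) C1_continuous_grad[OF F] in \<open>auto simp: comp_ev intro!: continuous_intros\<close>)
  have pd: "pd (\<lambda>p. Re (F p)) j p = Re (G j p)" "pd (\<lambda>p. Im (F p)) j p = Im (G j p)" for p
    using pd_eq[OF re, of j p] pd_eq[OF im, of j p] j by (simp_all add: comp_ev)
  have e: "w p * z p = w p * complex_of_real (Re (z p)) + \<i> * (w p * complex_of_real (Im (z p)))" for w z :: fn and p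
    by (simp add: complex_eq_iff)
  have int: "L2 (\<lambda>p. complex_of_real (Re (F p)))" "L2 (\<lambda>p. complex_of_real (Im (F p)))"
     "L2 (\<lambda>p. complex_of_real (Re (G j p)))" "L2 (\<lambda>p. complex_of_real (Im (G j p)))"
    using L2_test_fn[OF t(1)] L2_test_fn[OF t(2)] L2_test_fn_pd[OF t(1) j] L2_test_fn_pd[OF t(2) j] by (simp_all add: pd)
  have "(LINT p|lborel. v p * G j p) = (LINT p|lborel. v p * complex_of_real (Re (G j p))) + \<i> * (LINT p|lborel. v p * complex_of_real (Im (G j p)))"
    unfolding e[where w = v and z = "G j"] using v int by (subst Bochner_Integration.integral_add) (auto intro: L2_prod_integrable')
  also have "\<dots> = - ((LINT p|lborel. k j p * complex_of_real (Re (F p))) + \<i> * (LINT p|lborel. k j p * complex_of_real (Im (F p))))"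
    using wg j t unfolding weak_grad_def by (simp add: pd[symmetric])
  also have "(LINT p|lborel. k j p * complex_of_real (Re (F p))) + \<i> * (LINT p|lborel. k j p * complex_of_real (Im (F p))) = (LINT p|lborel. k j p * F p)"
    unfolding e[where w = "k j" and z = F] using weak_grad_L2[OF wg j] int by (subst Bochner_Integration.integral_add) (auto intro: L2_prod_integrable')
  finally show ?thesis .
qed

lemma C1_grad_unique:
  assumes "C1 F G" "(F has_derivative D) (at p)" "j < 3" shows "G j p = D (ev j)"
  using has_derivative_unique[OF assms(2) C1_has_derivative[OF assms(1)]] assms(3) by (simp add: comp_ev)

lemma C1_grad_support:
  assumes F: "C1 F G" and K: "closed K" "\<And>p. p \<notin> K \<Longrightarrow> F p = 0" and p: "p \<notin> K" and j: "j < 3"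
  shows "G j p = 0"
proof -
  have "((\<lambda>_. 0) has_derivative (\<lambda>_. 0)) (at p)" by simp
  then have "(F has_derivative (\<lambda>_. 0)) (at p)"
    by (rule has_derivative_transform_within_open[where s = "- K"]) (use K p in auto)
  from C1_grad_unique[OF F this j] show ?thesis .
qed

lemma comp_le_norm: "\<bar>comp j h\<bar> \<le> norm h"
proof -
  have 1: "\<bar>fst h\<bar> \<le> norm h" using norm_fst_le[of "fst h" "snd h"] by simp
  have 2: "norm (snd h) \<le> norm h" using norm_snd_le[of "snd h" "fst h"] by simp
  have "\<bar>fst (snd h)\<bar> \<le> norm (snd h)" "\<bar>snd (snd h)\<bar> \<le> norm (snd h)"
    using norm_fst_le[of "fst (snd h)" "snd (snd h)"] norm_snd_le[of "snd (snd h)" "fst (snd h)"] by simp_all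
  then show ?thesis using 1 2 unfolding comp_def by auto
qed

lemma C1_lipschitz:
  assumes F: "C1 F G" and K: "compact K" "\<And>p. p \<notin> K \<Longrightarrow> F p = 0"
  obtains L where "L \<ge> 0" "\<And>p q. cmod (F p - F q) \<le> L * norm (p - q)"
proof -
  have "\<exists>C\<ge>0. \<forall>p. norm (G j p) \<le> C" if "j < 3" for j
    using continuous_compact_support_bounded[OF C1_continuous_grad[OF F that] K(1) C1_grad_support[OF F compact_imp_closed[OF K(1)] K(2) _ that]]
    by metis
  then obtain C where C: "\<And>j. j < 3 \<Longrightarrow> C j \<ge> 0" "\<And>j p. j < 3 \<Longrightarrow> norm (G j p) \<le> C j" by metis
  show thesis
  proof (rule that)
    show "(\<Sum>j<3. C j) \<ge> 0" using C(1) by (auto intro: sum_nonneg)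
    fix p q
    show "cmod (F p - F q) \<le> (\<Sum>j<3. C j) * norm (p - q)"
    proof (rule differentiable_bound[of UNIV])
      fix x :: pt
      show "(F has_derivative (\<lambda>h. \<Sum>j<3. comp j h *\<^sub>R G j x)) (at x)" by (rule C1_has_derivative[OF F])
      show "onorm (\<lambda>h. \<Sum>j<3. comp j h *\<^sub>R G j x) \<le> (\<Sum>j<3. C j)"
      proof (rule onorm_le)
        fix h
        have "norm (\<Sum>j<3. comp j h *\<^sub>R G j x) \<le> (\<Sum>j<3. C j * norm h)"
          using C by (intro sum_norm_le) (simp add: mult.commute[of "C _"] mult_mono comp_le_norm)
        then show "norm (\<Sum>j<3. comp j h *\<^sub>R G j x) \<le> (\<Sum>j<3. C j) * norm h" by (simp add: sum_distrib_right)
      qed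
    qed auto
  qed
qed

text \<open>Difference quotients integrate to zero by translation invariance. The Lipschitz bound
  and the compact support dominate them, so a derivative almost everywhere is enough for the
  limit.\<close>

lemma integral_directional_derivative_zero:
  fixes \<psi> D :: fn
  assumes \<psi>: "integrable lborel \<psi>" and K: "compact K" "\<And>p. p \<notin> K \<Longrightarrow> \<psi> p = 0"
    and [measurable]: "D \<in> borel_measurable borel"
    and lip: "\<And>p t. cmod (\<psi> (p + t *\<^sub>R v) - \<psi> p) \<le> L * \<bar>t\<bar>"
    and der: "AE p in lborel. ((\<lambda>t. \<psi> (p + t *\<^sub>R v)) has_vector_derivative D p) (at 0)"
  shows "(LINT p|lborel. D p) = 0"
proof -
  have [measurable]: "\<psi> \<in> borel_measurable borel" using \<psi> by simp
  obtain M where M: "\<And>p. p \<in> K \<Longrightarrow> norm p \<le> M" using compact_imp_bounded[OF K(1)] bounded_iff by metis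
  define s where "s n = 1 / real (Suc n)" for n
  have s: "s n > 0" "s n \<le> 1" for n unfolding s_def by auto
  have s0: "s \<longlonglongrightarrow> 0" unfolding s_def by (rule LIMSEQ_Suc[OF lim_1_over_n])
  define f where "f n p = (\<psi> (p + s n *\<^sub>R v) - \<psi> p) /\<^sub>R s n" for n p
  have tr: "integrable lborel (\<lambda>p. \<psi> (p + c))" "(LINT p|lborel. \<psi> (p + c)) = (LINT p|lborel. \<psi> p)" for c
  proof -
    have d: "distr lborel borel (\<lambda>p :: pt. p + c) = lborel" using lborel_distr_plus[of c] unfolding add.commute[of _ c] .
    show "integrable lborel (\<lambda>p. \<psi> (p + c))" using integrable_distr_eq[of "\<lambda>p. p + c" lborel borel \<psi>] \<psi> by (simp add: d)
    show "(LINT p|lborel. \<psi> (p + c)) = (LINT p|lborel. \<psi> p)" using integral_distr[of "\<lambda>p. p + c" lborel borel \<psi>] by (simp add: d)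
  qed
  have "(LINT p|lborel. f n p) = 0" for n
    unfolding f_def using tr[of "s n *\<^sub>R v"] \<psi> by simp
  \<comment> \<open>Outside the dominating ball neither \<open>p\<close> nor
    \<open>p + s n *\<^sub>R v\<close> lies in \<open>K\<close>, because
    \<open>s n \<le> 1\<close>.\<close>
  moreover have "(\<lambda>n. LINT p|lborel. f n p) \<longlonglongrightarrow> (LINT p|lborel. D p)"
  proof (rule integral_dominated_convergence[where w = "\<lambda>p. L * indicator (cball 0 (M + norm v)) p"])
    show "f n \<in> borel_measurable lborel" for n unfolding f_def by measurable
    show "integrable lborel (\<lambda>p :: pt. L * indicator (cball 0 (M + norm v)) p :: real)"
      using emeasure_compact_finite[of "cball (0::pt) (M + norm v)"] by (intro integrable_mult_right integrable_real_indicator) auto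
    show "AE p in lborel. (\<lambda>n. f n p) \<longlonglongrightarrow> D p" using der
    proof eventually_elim
      fix p assume "((\<lambda>t. \<psi> (p + t *\<^sub>R v)) has_vector_derivative D p) (at 0)"
      then have "((\<lambda>h. norm (\<psi> (p + h *\<^sub>R v) - \<psi> p - h *\<^sub>R D p) / norm h) \<longlongrightarrow> 0) (at 0)"
        by (simp add: has_vector_derivative_def has_derivative_at)
      then have "((\<lambda>h. norm ((\<psi> (p + h *\<^sub>R v) - \<psi> p) /\<^sub>R h - D p)) \<longlongrightarrow> 0) (at 0)"
      proof (rule Lim_transform_eventually)
        have "norm (x - h *\<^sub>R y) / norm h = norm (x /\<^sub>R h - y)" if "h \<noteq> 0" for x y :: complex and h :: real
        proof -
          have "x /\<^sub>R h - y = (x - h *\<^sub>R y) /\<^sub>R h" using that by (simp add: scaleR_diff_right)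
          then show ?thesis by (simp add: divide_inverse mult.commute)
        qed
        then show "\<forall>\<^sub>F h in at 0. norm (\<psi> (p + h *\<^sub>R v) - \<psi> p - h *\<^sub>R D p) / norm h = norm ((\<psi> (p + h *\<^sub>R v) - \<psi> p) /\<^sub>R h - D p)"
          unfolding eventually_at by (intro exI[of _ 1]) simp
      qed
      then have "((\<lambda>t. (\<psi> (p + t *\<^sub>R v) - \<psi> p) /\<^sub>R t) \<longlongrightarrow> D p) (at 0)"
        unfolding tendsto_norm_zero_iff by (rule LIM_zero_cancel)
      then show "(\<lambda>n. f n p) \<longlonglongrightarrow> D p" unfolding f_def
        by (rule filterlim_compose) (use s s0 in \<open>auto simp: filterlim_at less_imp_neq[THEN not_sym]\<close>)
    qed
    show "AE p in lborel. norm (f n p) \<le> L * indicator (cball 0 (M + norm v)) p" for n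
    proof (rule AE_I2)
      fix p
      show "norm (f n p) \<le> L * indicator (cball 0 (M + norm v)) p"
      proof (cases "norm p \<le> M + norm v")
        case True
        have "norm (f n p) = cmod (\<psi> (p + s n *\<^sub>R v) - \<psi> p) / s n" unfolding f_def using s(1)[of n] by (simp add: divide_inverse mult.commute)
        also have "\<dots> \<le> L" using lip[of p "s n"] s(1)[of n] by (simp add: field_simps)
        finally show ?thesis using True by simp
      next
        case False
        have "norm (p + s n *\<^sub>R v) \<ge> norm p - norm (s n *\<^sub>R v)" by (rule norm_diff_ineq)
        moreover have "norm (s n *\<^sub>R v) \<le> norm v" using s[of n] by (simp add: mult_left_le_one_le)
        ultimately have "norm (p + s n *\<^sub>R v) > M" "norm p > M" using False norm_ge_zero[of v] by linarith+
        then have "p + s n *\<^sub>R v \<notin> K" "p \<notin> K" using M not_le by metis+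
        then have "\<psi> (p + s n *\<^sub>R v) = 0" "\<psi> p = 0" using K(2) by auto
        then show ?thesis using False by (simp add: f_def)
      qed
    qed
  qed simp
  ultimately show ?thesis using LIMSEQ_unique[of "\<lambda>_. 0" _ 0] by simp
qed

text \<open>Moves a point vertically to the nearest point of the slab. If a function vanishes on
  both faces, its cut-off to the slab equals the function composed with this contraction, and so
  stays Lipschitz across the faces.\<close>

definition clamp_z :: "real \<Rightarrow> pt \<Rightarrow> pt" where
  "clamp_z d p = (fst p, fst (snd p), max 0 (min d (snd (snd p))))"

text \<open>Zero boundary values are imposed on the part of the faces inside \<open>U\<close>.
  Elsewhere the test function vanishes, so its product with \<open>F\<close> is zero on both faces,
  and cutting off to the slab creates no jump. This is how the window stays free of any
  condition.\<close>

lemma weak_grad_slab: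
  assumes F: "C1 F G" and d: "d > 0"
    and L2: "L2 (\<lambda>p. indicator (slab d) p * F p)" "\<And>j. j < 3 \<Longrightarrow> L2 (\<lambda>p. indicator (slab d) p * G j p)"
    and bd: "\<And>p. p \<in> U \<Longrightarrow> snd (snd p) = 0 \<or> snd (snd p) = d \<Longrightarrow> F p = 0"
  shows "weak_grad U (\<lambda>p. indicator (slab d) p * F p) (\<lambda>j p. indicator (slab d) p * G j p)"
  unfolding weak_grad_def
proof (intro conjI allI impI)
  fix j :: nat assume j: "j < 3"
  show "L2 (\<lambda>p. indicator (slab d) p * G j p)" by (rule L2(2)[OF j])
  fix \<phi> assume t: "test_fn U \<phi>"
  obtain K where K: "compact K" "K \<subseteq> U" "\<And>p. p \<notin> K \<Longrightarrow> \<phi> p = 0" using test_fn_support[OF t] by metis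
  define \<eta> where "\<eta> p = F p * complex_of_real (\<phi> p)" for p
  define E where "E j p = G j p * complex_of_real (\<phi> p) + F p * complex_of_real (pd \<phi> j p)" for j p
  have \<eta>: "C1 \<eta> E" unfolding \<eta>_def E_def by (rule C1_mult[OF F C1_test_fn[OF t]])
  have \<eta>K: "p \<notin> K \<Longrightarrow> \<eta> p = 0" for p unfolding \<eta>_def using K by simp
  have bd': "\<eta> p = 0" if "snd (snd p) = 0 \<or> snd (snd p) = d" for p
    using bd[OF _ that] K(2) K(3)[of p] unfolding \<eta>_def by (cases "p \<in> U") auto
  obtain L where L: "L \<ge> 0" "\<And>p q. cmod (\<eta> p - \<eta> q) \<le> L * norm (p - q)" using C1_lipschitz[OF \<eta> K(1) \<eta>K] by metis
  define \<psi> where "\<psi> p = indicator (slab d) p * \<eta> p" for p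
  have cont: "continuous_on UNIV \<eta>" "continuous_on UNIV (E j)" using C1_continuous[OF \<eta>] C1_continuous_grad[OF \<eta> j] by auto
  have [measurable]: "\<eta> \<in> borel_measurable borel" "E j \<in> borel_measurable borel"
    using cont by (auto intro: borel_measurable_continuous_onI)
  have nev: "norm (ev j) = 1" using less_3_cases[OF j] by (auto simp: norm_prod_def)
  have "(LINT p|lborel. indicator (slab d) p * E j p) = 0"
  proof (rule integral_directional_derivative_zero[of \<psi> K _ "ev j" L])
    show "integrable lborel \<psi>"
    proof (rule Bochner_Integration.integrable_bound)
      show "integrable lborel \<eta>" using loc_int_integrable[OF L2_loc_int[OF L2_continuous_compact_support[OF cont(1) K(1) \<eta>K]] K(1)]
        by (rule Bochner_Integration.integrable_cong[THEN iffD1, rotated 2]) (auto simp: indicator_def \<eta>K)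
      show "\<psi> \<in> borel_measurable lborel" unfolding \<psi>_def by measurable
      show "AE p in lborel. norm (\<psi> p) \<le> norm (\<eta> p)" unfolding \<psi>_def by (simp add: indicator_def)
    qed
    show "compact K" "\<And>p. p \<notin> K \<Longrightarrow> \<psi> p = 0" using K \<eta>K unfolding \<psi>_def by auto
    show "(\<lambda>p. indicator (slab d) p * E j p) \<in> borel_measurable borel" by measurable
    fix p :: pt and t :: real
    show "cmod (\<psi> (p + t *\<^sub>R ev j) - \<psi> p) \<le> L * \<bar>t\<bar>"
    proof (cases "j = 2")
      case False
      then have "snd (snd (p + t *\<^sub>R ev j)) = snd (snd p)" using less_3_cases[OF j] by auto
      then have "p + t *\<^sub>R ev j \<in> slab d \<longleftrightarrow> p \<in> slab d" unfolding slab_def mem_Collect_eq by (simp only:)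
      then have "\<psi> (p + t *\<^sub>R ev j) - \<psi> p = indicator (slab d) p * (\<eta> (p + t *\<^sub>R ev j) - \<eta> p)"
        unfolding \<psi>_def by (simp add: indicator_def)
      then have "cmod (\<psi> (p + t *\<^sub>R ev j) - \<psi> p) \<le> cmod (\<eta> (p + t *\<^sub>R ev j) - \<eta> p)"
        by (simp add: indicator_def)
      also have "\<dots> \<le> L * \<bar>t\<bar>" using L(2)[of "p + t *\<^sub>R ev j" p] by (simp add: nev)
      finally show ?thesis .
    next
      case True
      have cl: "\<psi> q = \<eta> (clamp_z d q)" for q
      proof (cases "q \<in> slab d")
        case True
        then have "clamp_z d q = q" unfolding clamp_z_def slab_def by (simp add: prod_eq_iff)
        then show ?thesis using True by (simp add: \<psi>_def)
      next
        case False
        then have "\<eta> (clamp_z d q) = 0" unfolding clamp_z_def slab_def using d by (intro bd') auto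
        then show ?thesis using False by (simp add: \<psi>_def)
      qed
      have "norm (clamp_z d (p + t *\<^sub>R ev j) - clamp_z d p) = \<bar>max 0 (min d (snd (snd p) + t)) - max 0 (min d (snd (snd p)))\<bar>"
        unfolding True clamp_z_def by (simp add: norm_prod_def)
      also have "\<dots> \<le> \<bar>t\<bar>" by (auto simp: max_def min_def)
      finally have "L * norm (clamp_z d (p + t *\<^sub>R ev j) - clamp_z d p) \<le> L * \<bar>t\<bar>" using L(1) by (rule mult_left_mono)
      then show ?thesis unfolding cl using L(2) order_trans by blast
    qed
  next
    have "AE p :: pt in lborel. snd (snd p) \<noteq> 0 \<and> snd (snd p) \<noteq> d" using AE_coord_neq(3)[of 0] AE_coord_neq(3)[of d] by eventually_elim simp
    then show "AE p in lborel. ((\<lambda>t. \<psi> (p + t *\<^sub>R ev j)) has_vector_derivative indicator (slab d) p * E j p) (at 0)"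
    proof eventually_elim
      fix p :: pt assume p: "snd (snd p) \<noteq> 0 \<and> snd (snd p) \<noteq> d"
      have "((\<lambda>t. p + t *\<^sub>R ev j) has_derivative (\<lambda>t. t *\<^sub>R ev j)) (at 0)" by (auto intro!: derivative_eq_intros)
      moreover have "(\<eta> has_derivative (\<lambda>h. \<Sum>i<3. comp i h *\<^sub>R E i p)) (at (p + 0 *\<^sub>R ev j))" using C1_has_derivative[OF \<eta>] by simp
      ultimately have "((\<lambda>t. \<eta> (p + t *\<^sub>R ev j)) has_derivative (\<lambda>t. \<Sum>i<3. comp i (t *\<^sub>R ev j) *\<^sub>R E i p)) (at 0)"
        by (rule has_derivative_compose)
      moreover have "(\<Sum>i<3. comp i (t *\<^sub>R ev j) *\<^sub>R E i p) = t *\<^sub>R E j p" for t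
        using comp_ev[OF j, of "\<lambda>i. t *\<^sub>R E i p"] less_3_cases[OF j] by (auto simp: sum_less_3)
      ultimately have der: "((\<lambda>t. \<eta> (p + t *\<^sub>R ev j)) has_vector_derivative E j p) (at 0)" by (simp add: has_vector_derivative_def)
      have cont: "continuous_on UNIV (\<lambda>t. snd (snd (p + t *\<^sub>R ev j)))" by (intro continuous_intros)
      show "((\<lambda>t. \<psi> (p + t *\<^sub>R ev j)) has_vector_derivative indicator (slab d) p * E j p) (at 0)"
      proof (cases "p \<in> slab d")
        case True
        have "open {t. 0 < snd (snd (p + t *\<^sub>R ev j)) \<and> snd (snd (p + t *\<^sub>R ev j)) < d}"
          by (intro open_Collect_conj open_Collect_less cont continuous_on_const)
        then have "((\<lambda>t. \<psi> (p + t *\<^sub>R ev j)) has_vector_derivative E j p) (at 0)"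
          by (rule has_vector_derivative_transform_within_open[OF der]) (use p True in \<open>auto simp: \<psi>_def slab_def\<close>)
        then show ?thesis using True by simp
      next
        case False
        have "((\<lambda>t :: real. 0 :: complex) has_vector_derivative 0) (at 0)" by simp
        moreover have "open {t. snd (snd (p + t *\<^sub>R ev j)) < 0 \<or> d < snd (snd (p + t *\<^sub>R ev j))}"
          by (intro open_Collect_disj open_Collect_less cont continuous_on_const)
        ultimately have "((\<lambda>t. \<psi> (p + t *\<^sub>R ev j)) has_vector_derivative 0) (at 0)"
          by (rule has_vector_derivative_transform_within_open) (use p False in \<open>auto simp: \<psi>_def slab_def\<close>)
        then show ?thesis using False by simp
      qed
    qed
  qed
  moreover have "(LINT p|lborel. indicator (slab d) p * E j p) = (LINT p|lborel. indicator (slab d) p * F p * complex_of_real (pd \<phi> j p))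
      + (LINT p|lborel. indicator (slab d) p * G j p * complex_of_real (\<phi> p))"
    unfolding E_def using L2_prod_integrable'[OF L2(1) L2_test_fn_pd[OF t j]] L2_prod_integrable'[OF L2(2)[OF j] L2_test_fn[OF t]]
    by (simp add: distrib_left mult.assoc)
  ultimately show "(LINT p|lborel. indicator (slab d) p * F p * complex_of_real (pd \<phi> j p))
      = - (LINT p|lborel. indicator (slab d) p * G j p * complex_of_real (\<phi> p))"
    by (simp add: add_eq_0_iff)
qed

section \<open>Gauging away the potential in a half space\<close>

definition C1_real :: "(real \<Rightarrow> complex) \<Rightarrow> (real \<Rightarrow> complex) \<Rightarrow> bool" where
  "C1_real f f' \<longleftrightarrow> (\<forall>x. (f has_vector_derivative f' x) (at x)) \<and> continuous_on UNIV f'"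

lemma C1_real_derivative: "C1_real f f' \<Longrightarrow> (f has_vector_derivative f' x) (at x)"
  and C1_real_continuous_derivative: "C1_real f f' \<Longrightarrow> continuous_on UNIV f'"
  unfolding C1_real_def by simp_all

lemma C1_real_continuous: "C1_real f f' \<Longrightarrow> continuous_on UNIV f"
  by (intro continuous_at_imp_continuous_on ballI has_vector_derivative_continuous[OF C1_real_derivative])

lemma C1_real_zero:
  assumes "C1_real f f'" "open S" "\<And>x. x \<in> S \<Longrightarrow> f x = 0" "x \<in> S" shows "f' x = 0"
proof -
  have "((\<lambda>_. 0) has_vector_derivative 0) (at x)" by simp
  then have "(f has_vector_derivative 0) (at x)"
    by (rule has_vector_derivative_transform_within_open[of _ _ _ S]) (use assms in auto)
  then show ?thesis using vector_derivative_unique_at C1_real_derivative[OF assms(1)] by blast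
qed

lemma C1_real_zero_outside:
  assumes "C1_real f f'" "\<And>x. x \<notin> {l..r} \<Longrightarrow> f x = 0" "x \<notin> {l..r}" shows "f' x = 0"
  by (rule C1_real_zero[OF assms(1), of "- {l..r}"]) (use assms in auto)

text \<open>On the half space \<open>x > 0\<close> the vector potential is the gradient of \<open>-\<alpha> arctan (y / x)\<close>, so
  there it can be gauged away.\<close>

definition phase :: "real \<Rightarrow> fn" where
  "phase \<alpha> p = exp (\<i> * complex_of_real (- \<alpha> * arctan (fst (snd p) / fst p)))"

definition gauged :: "real \<Rightarrow> (real \<Rightarrow> complex) \<Rightarrow> (real \<Rightarrow> complex) \<Rightarrow> (real \<Rightarrow> complex) \<Rightarrow> fn" where
  "gauged \<alpha> P Q S p = phase \<alpha> p * (P (fst p) * Q (fst (snd p)) * S (snd (snd p)))"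

lemma norm_phase [simp]: "cmod (phase \<alpha> p) = 1"
  unfolding phase_def by simp

lemma arctan_quotient_derivative:
  assumes x: "fst p > 0"
  shows "((\<lambda>p :: pt. - \<alpha> * arctan (fst (snd p) / fst p)) has_derivative
     (\<lambda>h. fst h * Apot \<alpha> 0 p + fst (snd h) * Apot \<alpha> 1 p)) (at p)"
proof -
  obtain x y z where p: "p = (x, y, z)" by (cases p)
  have x0: "x > 0" using x p by simp
  have pos: "x\<^sup>2 + y\<^sup>2 > 0" using x0 by (simp add: add_pos_nonneg)
  have i: "inverse (1 + (y / x)\<^sup>2) = x\<^sup>2 / (x\<^sup>2 + y\<^sup>2)" using x0 by (simp add: power_divide field_simps)
  have "- \<alpha> * ((k * x - y * h) / (x * x) * (x\<^sup>2 / (x\<^sup>2 + y\<^sup>2))) = h * (\<alpha> * y / (x\<^sup>2 + y\<^sup>2)) + k * (- \<alpha> * x / (x\<^sup>2 + y\<^sup>2))" for h k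
  proof -
    have "(k * x - y * h) / (x * x) * (x\<^sup>2 / (x\<^sup>2 + y\<^sup>2)) = (k * x - y * h) / (x\<^sup>2 + y\<^sup>2)" using x0 by (simp add: power2_eq_square)
    moreover have "- \<alpha> * ((k * x - y * h) / D) = h * (\<alpha> * y / D) + k * (- \<alpha> * x / D)" for D
      by (simp add: algebra_simps diff_divide_distrib)
    ultimately show ?thesis by (simp only:)
  qed
  note e = this
  have "((\<lambda>p :: pt. - \<alpha> * arctan (fst (snd p) / fst p)) has_derivative
     (\<lambda>h. - \<alpha> * ((fst (snd h) * x - y * fst h) / (x * x) * inverse (1 + (y / x)\<^sup>2)))) (at p)"
    unfolding p using x0 by (auto intro!: derivative_eq_intros has_derivative_divide')
  then show ?thesis unfolding i e by (simp add: p Apot_def)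
qed

lemma phase_has_derivative:
  assumes x: "fst p > 0"
  shows "(phase \<alpha> has_derivative (\<lambda>h. (\<i> * complex_of_real (fst h * Apot \<alpha> 0 p + fst (snd h) * Apot \<alpha> 1 p)) * phase \<alpha> p)) (at p)"
  unfolding phase_def[abs_def]
  by (rule has_derivative_eq_rhs[OF has_derivative_compose[OF has_derivative_mult_right[OF has_derivative_of_real[OF arctan_quotient_derivative[OF x]]]
    DERIV_exp[unfolded has_field_derivative_def]]]) (simp add: fun_eq_iff mult.commute)

lemma continuous_on_phase: "continuous_on {p. fst p > 0} (phase \<alpha>)"
  unfolding phase_def by (intro continuous_intros) auto

lemma continuous_on_Apot: "continuous_on {p. fst p > 0} (Apot \<alpha> j)"
proof -
  have "Apot \<alpha> j = (\<lambda>p. if j = 0 then \<alpha> * fst (snd p) / ((fst p)\<^sup>2 + (fst (snd p))\<^sup>2)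
      else if j = 1 then - \<alpha> * fst p / ((fst p)\<^sup>2 + (fst (snd p))\<^sup>2) else 0)"
    by (simp add: fun_eq_iff Apot_def case_prod_beta)
  moreover have "(fst p)\<^sup>2 + (fst (snd p))\<^sup>2 \<noteq> 0" if "fst p > 0" for p :: pt
    using add_pos_nonneg[of "(fst p)\<^sup>2" "(fst (snd p))\<^sup>2"] that by simp
  ultimately show ?thesis by (cases "j = 0"; cases "j = 1") (auto intro!: continuous_intros)
qed

text \<open>The factor \<open>w\<close> may be discontinuous at \<open>x = 0\<close>, as the phase
  is; but \<open>f\<close> vanishes to the left of \<open>R\<close>, and the product continues by
  zero.\<close>

lemma continuous_half_space:
  assumes w: "continuous_on {p :: pt. fst p > 0} w" and R: "R > 0" and f: "continuous_on UNIV f" "\<And>p. fst p < R \<Longrightarrow> f p = (0 :: complex)"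
  shows "continuous_on UNIV (\<lambda>p. w p * f p)"
proof -
  have o: "open {p :: pt. fst p > 0}" "open {p :: pt. fst p < R}" by (intro open_Collect_less continuous_intros)+
  have "continuous_on {p :: pt. fst p > 0} (\<lambda>p. w p * f p)" by (intro continuous_intros w continuous_on_subset[OF f(1)]) auto
  moreover have "continuous_on {p :: pt. fst p < R} (\<lambda>p. w p * f p)"
    by (rule continuous_on_eq[of _ "\<lambda>_. 0"]) (auto simp: f(2))
  ultimately have "continuous_on ({p. fst p > 0} \<union> {p. fst p < R}) (\<lambda>p. w p * f p)"
    by (rule continuous_on_open_Un[OF o])
  moreover have "{p :: pt. fst p > 0} \<union> {p. fst p < R} = UNIV" using R by auto
  ultimately show ?thesis by simp
qed

lemma continuous_product3:
  fixes P Q S :: "real \<Rightarrow> complex"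
  assumes "continuous_on UNIV P" "continuous_on UNIV Q" "continuous_on UNIV S"
  shows "continuous_on UNIV (\<lambda>p :: pt. P (fst p) * Q (fst (snd p)) * S (snd (snd p)))"
  by (intro continuous_intros continuous_on_compose2[OF assms(1)] continuous_on_compose2[OF assms(2)] continuous_on_compose2[OF assms(3)]) auto

lemma continuous_gauged:
  assumes "continuous_on UNIV P" "continuous_on UNIV Q" "continuous_on UNIV S" "R > 0" "\<And>x. x < R \<Longrightarrow> P x = 0"
  shows "continuous_on UNIV (gauged \<alpha> P Q S)" "continuous_on UNIV (\<lambda>p. \<i> * complex_of_real (Apot \<alpha> j p) * gauged \<alpha> P Q S p)"
proof -
  show "continuous_on UNIV (gauged \<alpha> P Q S)"
    unfolding gauged_def by (rule continuous_half_space[OF continuous_on_phase assms(4) continuous_product3]) (use assms in auto)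
  have "continuous_on UNIV (\<lambda>p. (\<i> * complex_of_real (Apot \<alpha> j p) * phase \<alpha> p) * (P (fst p) * Q (fst (snd p)) * S (snd (snd p))))"
    by (rule continuous_half_space[OF _ assms(4) continuous_product3])
      (use assms in \<open>auto intro!: continuous_intros continuous_on_phase continuous_on_Apot\<close>)
  then show "continuous_on UNIV (\<lambda>p. \<i> * complex_of_real (Apot \<alpha> j p) * gauged \<alpha> P Q S p)"
    unfolding gauged_def by (simp add: mult.assoc)
qed

text \<open>The phase times the plain partial derivatives of the product. The full gradient arises
  by adding i A times the function, as the phase has logarithmic gradient i A.\<close>

definition gauged_part :: "real \<Rightarrow> (real \<Rightarrow> complex) \<Rightarrow> (real \<Rightarrow> complex) \<Rightarrow> (real \<Rightarrow> complex) \<Rightarrow>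
    (real \<Rightarrow> complex) \<Rightarrow> (real \<Rightarrow> complex) \<Rightarrow> (real \<Rightarrow> complex) \<Rightarrow> vfn" where
  "gauged_part \<alpha> P P' Q Q' S S' j = (if j = 0 then gauged \<alpha> P' Q S else if j = 1 then gauged \<alpha> P Q' S else gauged \<alpha> P Q S')"

definition gauged_grad :: "real \<Rightarrow> (real \<Rightarrow> complex) \<Rightarrow> (real \<Rightarrow> complex) \<Rightarrow> (real \<Rightarrow> complex) \<Rightarrow>
    (real \<Rightarrow> complex) \<Rightarrow> (real \<Rightarrow> complex) \<Rightarrow> (real \<Rightarrow> complex) \<Rightarrow> vfn" where
  "gauged_grad \<alpha> P P' Q Q' S S' j p = gauged_part \<alpha> P P' Q Q' S S' j p + \<i> * complex_of_real (Apot \<alpha> j p) * gauged \<alpha> P Q S p"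

lemma gauged_C1:
  assumes P: "C1_real P P'" and Q: "C1_real Q Q'" and S: "C1_real S S'" and R: "R > 0" and supp: "\<And>x. x < R \<Longrightarrow> P x = 0"
  shows "C1 (gauged \<alpha> P Q S) (gauged_grad \<alpha> P P' Q Q' S S')"
proof -
  have supp': "P' x = 0" if "x < R" for x
    by (rule C1_real_zero[OF P, of "{..<R}"]) (use supp that in auto)
  note cont = C1_real_continuous[OF P] C1_real_continuous[OF Q] C1_real_continuous[OF S]
    C1_real_continuous_derivative[OF P] C1_real_continuous_derivative[OF Q] C1_real_continuous_derivative[OF S]
  show ?thesis unfolding C1_def
  proof (intro conjI allI impI)
    fix p :: pt
    let ?f = "\<lambda>p :: pt. P (fst p) * Q (fst (snd p)) * S (snd (snd p))"
    have e: "gauged \<alpha> P Q S = (\<lambda>p. phase \<alpha> p * (P (fst p) * Q (fst (snd p)) * S (snd (snd p))))"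
      by (simp add: fun_eq_iff gauged_def)
    show "(gauged \<alpha> P Q S has_derivative (\<lambda>h. \<Sum>j<3. comp j h *\<^sub>R gauged_grad \<alpha> P P' Q Q' S S' j p)) (at p)"
    proof (cases "fst p > 0")
      case True
      show ?thesis
        unfolding e
        by (rule has_derivative_eq_rhs[OF has_derivative_mult[OF phase_has_derivative[OF True] prod3_has_derivative[OF C1_real_derivative[OF P] C1_real_derivative[OF Q] C1_real_derivative[OF S]]]])
          (simp add: fun_eq_iff sum_less_3 gauged_grad_def gauged_part_def gauged_def scaleR_conv_of_real algebra_simps)
    next
      case False
      have "((\<lambda>_. 0) has_derivative (\<lambda>_. 0)) (at p)" by simp
      moreover have "open {p :: pt. fst p < R}" by (intro open_Collect_less continuous_intros)
      ultimately have "(gauged \<alpha> P Q S has_derivative (\<lambda>_. 0)) (at p)"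
        by (rule has_derivative_transform_within_open) (use False R supp in \<open>auto simp: gauged_def\<close>)
      moreover have "gauged_grad \<alpha> P P' Q Q' S S' j p = 0" for j
        using False R supp[of "fst p"] supp'[of "fst p"] unfolding gauged_grad_def gauged_part_def gauged_def by auto
      ultimately show ?thesis by simp
    qed
  next
    fix j :: nat
    have "continuous_on UNIV (gauged_part \<alpha> P P' Q Q' S S' j)"
      unfolding gauged_part_def using continuous_gauged(1)[of _ _ _ R] cont R supp supp' by simp
    then show "continuous_on UNIV (gauged_grad \<alpha> P P' Q Q' S S' j)"
      unfolding gauged_grad_def[abs_def] using continuous_gauged(2)[of P Q S R] cont R supp by (intro continuous_on_add) auto
  qed
qed

lemma L2_slab:
  assumes f: "continuous_on UNIV f" and z: "\<And>p. \<not> (\<bar>fst p\<bar> \<le> M \<and> \<bar>fst (snd p)\<bar> \<le> M) \<Longrightarrow> f p = 0"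
  shows "L2 (\<lambda>p. indicator (slab d) p * f p)"
proof -
  define K where "K = cbox (- M, - M, 0) (M, M, d)"
  have K: "compact K" unfolding K_def by simp
  have "compact (f ` K)" using K f by (intro compact_continuous_image) (auto intro: continuous_on_subset)
  then obtain C where C: "\<And>x. x \<in> f ` K \<Longrightarrow> norm x \<le> C" using compact_imp_bounded bounded_iff by metis
  have KI: "p \<in> slab d \<Longrightarrow> p \<notin> K \<Longrightarrow> f p = 0" for p 
  proof -
    assume p: "p \<in> slab d" "p \<notin> K"
    then have "\<not> (\<bar>fst p\<bar> \<le> M \<and> \<bar>fst (snd p)\<bar> \<le> M)" unfolding K_def slab_def cbox_pt_mem by (auto simp: abs_le_iff)
    then show "f p = 0" by (rule z)
  qed
  have [measurable]: "f \<in> borel_measurable borel" using f by (rule borel_measurable_continuous_onI)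
  show ?thesis
  proof (rule L2_compact_support[OF _ K, where C = "max C 0"])
    show "(\<lambda>p. indicator (slab d) p * f p) \<in> borel_measurable borel" by measurable
    show "indicator (slab d) p * f p = 0" if "p \<notin> K" for p using KI[of p] that by (auto simp: indicator_def)
    show "cmod (indicator (slab d) p * f p) \<le> max C 0" for p
      using KI[of p] C[of "f p"] by (auto simp: indicator_def le_max_iff_disj)
  qed
qed

abbreviation slab_gauged :: "real \<Rightarrow> real \<Rightarrow> (real \<Rightarrow> complex) \<Rightarrow> (real \<Rightarrow> complex) \<Rightarrow> (real \<Rightarrow> complex) \<Rightarrow> fn" where
  "slab_gauged d \<alpha> P Q S \<equiv> \<lambda>p. indicator (slab d) p * gauged \<alpha> P Q S p"

text \<open>The two alternatives for \<open>S 0\<close> serve the two applications: the wave packets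
  vanish on the lower face, while the trial function does not and is supported over the window. The
  support of \<open>P\<close> starts at \<open>R > 0\<close>, which keeps the product off the
  axis.\<close>

lemma gauged_core:
  assumes P: "C1_real P P'" and Q: "C1_real Q Q'" and S: "C1_real S S'" and R: "R > 0" and d: "d > 0"
    and supp: "\<And>x. x \<notin> {R..M} \<Longrightarrow> P x = 0" "\<And>y. y \<notin> {- M..M} \<Longrightarrow> Q y = 0"
    and Sd: "S d = 0" and S0: "S 0 = 0 \<or> (\<forall>x y. P x * Q y \<noteq> 0 \<longrightarrow> x\<^sup>2 + y\<^sup>2 \<le> a\<^sup>2)"
  shows "core d a (slab_gauged d \<alpha> P Q S) (\<lambda>j p. indicator (slab d) p * gauged_grad \<alpha> P P' Q Q' S S' j p)"
proof -
  have F: "C1 (gauged \<alpha> P Q S) (gauged_grad \<alpha> P P' Q Q' S S')"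
    using gauged_C1[OF P Q S R] supp by auto
  have z: "gauged \<alpha> P Q S p = 0" if "\<not> (R \<le> fst p \<and> fst p \<le> M \<and> \<bar>fst (snd p)\<bar> \<le> M)" for p
    using that supp(1)[of "fst p"] supp(2)[of "fst (snd p)"] unfolding gauged_def by (auto simp: abs_le_iff minus_le_iff)
  define K where "K = {p :: pt. \<bar>fst p\<bar> \<le> M \<and> \<bar>fst (snd p)\<bar> \<le> M}"
  have K: "closed K" unfolding K_def by (intro closed_Collect_conj closed_Collect_le continuous_intros)
  have zK: "p \<notin> K \<Longrightarrow> gauged \<alpha> P Q S p = 0" for p using z[of p] R unfolding K_def by auto
  have L: "L2 (slab_gauged d \<alpha> P Q S)"
    using zK by (intro L2_slab[OF C1_continuous[OF F], of M]) (auto simp: K_def)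
  have Lg: "L2 (\<lambda>p. indicator (slab d) p * gauged_grad \<alpha> P P' Q Q' S S' j p)" if "j < 3" for j
    using C1_grad_support[OF F K zK _ that] by (intro L2_slab[OF C1_continuous_grad[OF F that], of M]) (auto simp: K_def)
  have wg: "weak_grad (UNIV - window a) (slab_gauged d \<alpha> P Q S) (\<lambda>j p. indicator (slab d) p * gauged_grad \<alpha> P P' Q Q' S S' j p)"
  proof (rule weak_grad_slab[OF F d L Lg])
    fix p assume p: "p \<in> UNIV - window a" "snd (snd p) = 0 \<or> snd (snd p) = d"
    show "gauged \<alpha> P Q S p = 0"
    proof (rule ccontr)
      assume nz: "gauged \<alpha> P Q S p \<noteq> 0"
      then have "snd (snd p) = 0" "S 0 \<noteq> 0" "P (fst p) * Q (fst (snd p)) \<noteq> 0" using p(2) Sd unfolding gauged_def by auto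
      then have "p \<in> window a" using S0 unfolding window_def by (auto simp: case_prod_beta)
      then show False using p(1) by simp
    qed
  qed
  \<comment> \<open>Exceeding \<open>1 / R\<close> makes the hole around the axis small enough,
    exceeding \<open>2 * M^2\<close> makes the outer radius large enough, and the summand 2 ensures
    \<open>n \<ge> 2\<close>.\<close>
  obtain n :: nat where n: "max (1 / R) (2 + 2 * M\<^sup>2) < real n" using reals_Archimedean2 by blast
  have nR: "1 / R < real n" and nM: "2 + 2 * M\<^sup>2 < real n" using n by simp_all
  have "2 \<le> 2 + 2 * M\<^sup>2" by simp
  then have n2: "n \<ge> 2" using nM by linarith
  have "p \<in> Omega_n d n" if "indicator (slab d) p * gauged \<alpha> P Q S p \<noteq> 0" for p
  proof -
    have p: "p \<in> slab d" "R \<le> fst p" "fst p \<le> M" "\<bar>fst (snd p)\<bar> \<le> M" using that z[of p] by (auto simp: indicator_def split: if_splits)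
    have "1 / real n \<le> R" using nR n2 R by (simp add: field_simps)
    then have "(1 / real n)\<^sup>2 \<le> (fst p)\<^sup>2" using p(2) by (intro power_mono) auto
    moreover have "(fst p)\<^sup>2 \<le> M\<^sup>2" using p R by (intro power_mono) auto
    moreover have "(fst (snd p))\<^sup>2 \<le> M\<^sup>2" using power_mono[OF p(4), of 2] by simp
    moreover have "real n \<le> (real n)\<^sup>2" using n2 by (simp add: power2_eq_square)
    ultimately have "(1 / real n)\<^sup>2 \<le> (fst p)\<^sup>2 + (fst (snd p))\<^sup>2" "(fst p)\<^sup>2 + (fst (snd p))\<^sup>2 < (real n)\<^sup>2"
      using nM zero_le_power2[of "fst (snd p)"] by linarith+
    then show ?thesis using p(1) unfolding Omega_n_def slab_def by (auto simp: case_prod_beta)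
  qed
  then show ?thesis unfolding core_def using n2 L wg by (intro exI[of _ n]) blast
qed

text \<open>Gauge invariance: the term with A in the gradient is multiplied by i and cancels the one
  in \<open>mgrad\<close>.\<close>

lemma mgrad_gauged:
  "mgrad \<alpha> (slab_gauged d \<alpha> P Q S) (\<lambda>j p. indicator (slab d) p * gauged_grad \<alpha> P P' Q Q' S S' j p) j
    = (\<lambda>p. \<i> * (indicator (slab d) p * gauged_part \<alpha> P P' Q Q' S S' j p))"
  unfolding mgrad_def gauged_grad_def by (simp add: fun_eq_iff algebra_simps)

lemma C1_cnj: "C1 F G \<Longrightarrow> C1 (\<lambda>p. cnj (F p)) (\<lambda>j p. cnj (G j p))"
  unfolding C1_def using bounded_linear.has_derivative[OF bounded_linear_cnj]
  by (fastforce intro: continuous_intros)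

text \<open>\<open>V\<close> has compact support away from the window, so its conjugate can be used
  as a test function for \<open>v\<close>. Its cut-off to the slab produces no boundary term,
  because \<open>v\<close> vanishes outside the slab and its gradient does so almost
  everywhere.\<close>

lemma gauged_integration_by_parts:
  assumes c: "core d a v k" and d: "d > 0" and V: "C1 V G" and K: "compact K" "K \<subseteq> UNIV - window a" "\<And>p. p \<notin> K \<Longrightarrow> V p = 0"
    and E: "continuous_on UNIV E" "\<And>p. E p = G j p - \<i> * complex_of_real (Apot \<alpha> j p) * V p" and j: "j < 3"
  shows "(LINT p|lborel. \<i> * (indicator (slab d) p * V p) * cnj (mgrad \<alpha> v k j p)) = - (LINT p|lborel. indicator (slab d) p * E p * cnj (v p))"
proof -
  have G0: "p \<notin> K \<Longrightarrow> G j p = 0" for p by (rule C1_grad_support[OF V compact_imp_closed[OF K(1)] K(3) _ j])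
  have "E p = 0" if "p \<notin> K" for p unfolding E(2) using K(3)[OF that] G0[OF that] by simp
  then have L: "L2 V" "L2 (G j)" "L2 E"
    using K(3) G0 by (auto intro!: L2_continuous_compact_support[OF _ K(1)] C1_continuous[OF V] C1_continuous_grad[OF V j] E(1))
  have LA: "L2 (\<lambda>p. \<i> * complex_of_real (Apot \<alpha> j p) * V p)" using L2_diff[OF L(2,3)] by (simp add: E(2))
  note v = core_L2[OF c] and k = weak_grad_L2[OF core_weak_grad[OF c] j]
  note [measurable] = L2_measurable[OF L(1)] L2_measurable[OF L(2)] L2_measurable[OF L(3)] L2_measurable[OF v] L2_measurable[OF k]
    L2_measurable[OF mgrad_L2[OF c j, of \<alpha>]] L2_measurable[OF LA]
  have "(LINT p|lborel. cnj (V p) * k j p) = - (LINT p|lborel. v p * cnj (G j p))"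
    using C1_weak_grad[OF v core_weak_grad[OF c] C1_cnj[OF V] K(1,2) _ j] K(3) by (simp add: mult.commute)
  from arg_cong[OF this, of cnj]
  have "(LINT p|lborel. cnj (cnj (V p) * k j p)) = - (LINT p|lborel. cnj (v p * cnj (G j p)))"
    by (simp only: Bochner_Integration.integral_cnj complex_cnj_minus)
  then have ibp: "(LINT p|lborel. V p * cnj (k j p)) = - (LINT p|lborel. G j p * cnj (v p))" by (simp add: mult.commute)
  have "(LINT p|lborel. \<i> * (indicator (slab d) p * V p) * cnj (mgrad \<alpha> v k j p))
      = (LINT p|lborel. V p * cnj (k j p) + \<i> * complex_of_real (Apot \<alpha> j p) * V p * cnj (v p))"
  proof (rule integral_cong_AE)
    show "AE p in lborel. \<i> * (indicator (slab d) p * V p) * cnj (mgrad \<alpha> v k j p)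
        = V p * cnj (k j p) + \<i> * complex_of_real (Apot \<alpha> j p) * V p * cnj (v p)"
      using core_grad_zero[OF c d j]
    proof eventually_elim
      fix p assume *: "p \<notin> slab d \<longrightarrow> k j p = 0"
      show "\<i> * (indicator (slab d) p * V p) * cnj (mgrad \<alpha> v k j p)
        = V p * cnj (k j p) + \<i> * complex_of_real (Apot \<alpha> j p) * V p * cnj (v p)"
      proof (cases "p \<in> slab d")
        case True
        have "\<i> * W * cnj (\<i> * X + complex_of_real A * B) = W * cnj X + \<i> * complex_of_real A * W * cnj B" for W X B and A :: real
          by (simp add: complex_eq_iff algebra_simps)
        then show ?thesis using True by (simp add: mgrad_def)
      next
        case False then show ?thesis using * core_zero[OF c False] by simp
      qed
    qed
  qed measurable
  also have "\<dots> = (LINT p|lborel. V p * cnj (k j p)) + (LINT p|lborel. \<i> * complex_of_real (Apot \<alpha> j p) * V p * cnj (v p))"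
    by (intro Bochner_Integration.integral_add L2_prod_integrable L L2_prod_integrable[OF LA] v k)
  also have "\<dots> = - ((LINT p|lborel. G j p * cnj (v p)) - (LINT p|lborel. \<i> * complex_of_real (Apot \<alpha> j p) * V p * cnj (v p)))"
    unfolding ibp by simp
  also have "(LINT p|lborel. G j p * cnj (v p)) - (LINT p|lborel. \<i> * complex_of_real (Apot \<alpha> j p) * V p * cnj (v p)) = (LINT p|lborel. E p * cnj (v p))"
    unfolding E(2) left_diff_distrib
    by (intro Bochner_Integration.integral_diff[symmetric] L2_prod_integrable L L2_prod_integrable[OF LA] v)
  also have "(LINT p|lborel. E p * cnj (v p)) = (LINT p|lborel. indicator (slab d) p * E p * cnj (v p))"
    by (intro Bochner_Integration.integral_cong refl) (use core_zero[OF c] in \<open>auto simp: indicator_def\<close>)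
  finally show ?thesis .
qed

lemma inner_emb:
  assumes "core d a u g" "core d a v k"
  shows "inner (snd (emb u (mgrad \<alpha> u g))) (snd (emb v (mgrad \<alpha> v k)))
    = Re (\<Sum>j<3. LINT p|lborel. mgrad \<alpha> u g j p * cnj (mgrad \<alpha> v k j p))"
  using mgrad_L2[OF assms(1), of _ \<alpha>] mgrad_L2[OF assms(2), of _ \<alpha>]
  by (simp add: emb_def inner_prod_def inner_cls sum_less_3)

text \<open>In the gauge H acts as minus the Laplacian, and each first derivative is integrated by
  parts once more. The support lies at \<open>x \<ge> R > a\<close>, hence away from the window, so
  the only boundary condition met is the Dirichlet one.\<close>

lemma gauged_Hrel:
  assumes P: "C1_real P P'" "C1_real P' P''" and Q: "C1_real Q Q'" "C1_real Q' Q''" and S: "C1_real S S'" "C1_real S' S''"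
    and a: "0 < a" "a < R" and d: "d > 0"
    and supp: "\<And>x. x \<notin> {R..M} \<Longrightarrow> P x = 0" "\<And>y. y \<notin> {- M..M} \<Longrightarrow> Q y = 0" "\<And>z. z \<notin> {- M..M} \<Longrightarrow> S z = 0"
    and bd: "S 0 = 0" "S d = 0"
  shows "Hrel d \<alpha> a (slab_gauged d \<alpha> P Q S)
     (\<lambda>p. - (indicator (slab d) p * (gauged \<alpha> P'' Q S p + gauged \<alpha> P Q'' S p + gauged \<alpha> P Q S'' p)))"
proof -
  have R: "R > 0" using a by simp
  define u where "u = (slab_gauged d \<alpha> P Q S)"
  define g where "g = (\<lambda>j p. indicator (slab d) p * gauged_grad \<alpha> P P' Q Q' S S' j p)"
  define E where "E = gauged_part \<alpha> P P'' Q Q'' S S''"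
  define h where "h = (\<lambda>p. - (indicator (slab d) p * (E 0 p + E 1 p + E 2 p)))"
  have u: "core d a u g" unfolding u_def g_def
    by (rule gauged_core[OF P(1) Q(1) S(1) R d, where M = M]) (use supp bd in auto)
  have supp': "x \<notin> {R..M} \<Longrightarrow> P' x = 0" "x \<notin> {- M..M} \<Longrightarrow> Q' x = 0" "x \<notin> {- M..M} \<Longrightarrow> S' x = 0" for x
    using C1_real_zero_outside[OF P(1) supp(1)] C1_real_zero_outside[OF Q(1) supp(2)] C1_real_zero_outside[OF S(1) supp(3)] by auto
  have supp'': "x \<notin> {R..M} \<Longrightarrow> P'' x = 0" "x \<notin> {- M..M} \<Longrightarrow> Q'' x = 0" "x \<notin> {- M..M} \<Longrightarrow> S'' x = 0" for x
    using C1_real_zero_outside[OF P(2) supp'(1)] C1_real_zero_outside[OF Q(2) supp'(2)] C1_real_zero_outside[OF S(2) supp'(3)] by auto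
  define K where "K = cbox (R, - M, - M) (M, M, M)"
  have K: "compact K" unfolding K_def by simp
  have KU: "K \<subseteq> UNIV - window a"
  proof
    fix p assume "p \<in> K"
    then have "R \<le> fst p" unfolding K_def cbox_pt_mem by simp
    then have "a\<^sup>2 < (fst p)\<^sup>2" using a by (intro power_strict_mono) auto
    then have "a\<^sup>2 < (fst p)\<^sup>2 + (fst (snd p))\<^sup>2" using zero_le_power2[of "fst (snd p)"] by linarith
    then show "p \<in> UNIV - window a" unfolding window_def by (auto simp: case_prod_beta)
  qed
  have gz: "gauged \<alpha> P1 Q1 S1 p = 0"
    if "p \<notin> K" "\<And>x. x \<notin> {R..M} \<Longrightarrow> P1 x = 0" "\<And>x. x \<notin> {- M..M} \<Longrightarrow> Q1 x = 0" "\<And>x. x \<notin> {- M..M} \<Longrightarrow> S1 x = 0" for P1 Q1 S1 p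
    using that(1) that(2)[of "fst p"] that(3)[of "fst (snd p)"] that(4)[of "snd (snd p)"]
    unfolding K_def cbox_pt_mem gauged_def by (auto simp: mult_eq_0_iff)
  note cont = C1_real_continuous[OF P(1)] C1_real_continuous[OF Q(1)] C1_real_continuous[OF S(1)]
    C1_real_continuous[OF P(2)] C1_real_continuous[OF Q(2)] C1_real_continuous[OF S(2)]
    C1_real_continuous_derivative[OF P(2)] C1_real_continuous_derivative[OF Q(2)] C1_real_continuous_derivative[OF S(2)]
  have Ec: "continuous_on UNIV (E j)" for j
    unfolding E_def gauged_part_def using continuous_gauged(1)[of _ _ _ R] cont R supp supp'' by simp
  have EK: "E j p = 0" if "p \<notin> K" for j p
    unfolding E_def gauged_part_def using gz[OF that] supp supp'' by simp
  have Lh: "L2 h"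
  proof -
    have "L2 (\<lambda>p. indicator (slab d) p * (E 0 p + E 1 p + E 2 p))"
    proof (rule L2_slab[of _ M])
      show "continuous_on UNIV (\<lambda>p. E 0 p + E 1 p + E 2 p)" by (intro continuous_on_add Ec)
      fix p :: pt assume "\<not> (\<bar>fst p\<bar> \<le> M \<and> \<bar>fst (snd p)\<bar> \<le> M)"
      then have "p \<notin> K" using R unfolding K_def cbox_pt_mem by auto
      then show "E 0 p + E 1 p + E 2 p = 0" by (simp add: EK)
    qed
    then show ?thesis unfolding h_def by (rule L2_uminus)
  qed
  have V: "C1 (gauged_part \<alpha> P P' Q Q' S S' j)
     (if j = 0 then gauged_grad \<alpha> P' P'' Q Q' S S' else if j = 1 then gauged_grad \<alpha> P P' Q' Q'' S S' else gauged_grad \<alpha> P P' Q Q' S' S'')" for j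
    using gauged_C1[OF P(2) Q(1) S(1) R] gauged_C1[OF P(1) Q(2) S(1) R] gauged_C1[OF P(1) Q(1) S(2) R] supp supp'
    unfolding gauged_part_def by auto
  have VK: "gauged_part \<alpha> P P' Q Q' S S' j p = 0" if "p \<notin> K" for j p
    unfolding gauged_part_def using gz[OF that] supp supp' by simp
  have key: "(LINT p|lborel. mgrad \<alpha> u g j p * cnj (mgrad \<alpha> v k j p)) = - (LINT p|lborel. indicator (slab d) p * E j p * cnj (v p))"
    if c: "core d a v k" and j: "j < 3" for v k j
    unfolding u_def g_def mgrad_gauged
    by (rule gauged_integration_by_parts[OF c d V K KU VK Ec _ j])
      (use less_3_cases[OF j] in \<open>auto simp: E_def gauged_part_def gauged_grad_def\<close>)
  have "emb u (mgrad \<alpha> u g) \<in> form_core d \<alpha> a"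
    unfolding form_core_def by (intro CollectI exI[of _ u] exI[of _ g] conjI refl u)
  then have emb_u: "emb u (mgrad \<alpha> u g) \<in> form_dom d \<alpha> a"
    unfolding form_dom_def by (rule closure_subset[THEN subsetD])
  have "inner (snd (emb u (mgrad \<alpha> u g))) (snd z) = inner (cls h) (fst z)" if z: "z \<in> form_dom d \<alpha> a" for z
  proof (rule form_dom_induct[OF z])
    show "closed {z :: l2 \<times> l2 \<times> l2 \<times> l2. inner (snd (emb u (mgrad \<alpha> u g))) (snd z) = inner (cls h) (fst z)}"
      by (intro closed_Collect_eq continuous_intros)
    fix v k assume c: "core d a v k"
    note v = core_L2[OF c]
    have LE: "L2 (\<lambda>p. indicator (slab d) p * E j p)" for j
    proof (rule L2_slab[OF Ec, of M])
      fix p :: pt assume "\<not> (\<bar>fst p\<bar> \<le> M \<and> \<bar>fst (snd p)\<bar> \<le> M)"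
      then have "p \<notin> K" using R unfolding K_def cbox_pt_mem by auto
      then show "E j p = 0" by (rule EK)
    qed
    have "(\<Sum>j<3. LINT p|lborel. mgrad \<alpha> u g j p * cnj (mgrad \<alpha> v k j p)) = - (\<Sum>j<3. LINT p|lborel. indicator (slab d) p * E j p * cnj (v p))"
      unfolding sum_negf[symmetric] by (intro sum.cong refl key[OF c]) simp
    also have "(\<Sum>j<3. LINT p|lborel. indicator (slab d) p * E j p * cnj (v p)) = (LINT p|lborel. (\<Sum>j<3. indicator (slab d) p * E j p * cnj (v p)))"
      by (intro Bochner_Integration.integral_sum[symmetric] L2_prod_integrable LE v)
    also have "- \<dots> = (LINT p|lborel. h p * cnj (v p))"
      unfolding integral_minus[symmetric] h_def by (intro Bochner_Integration.integral_cong refl) (simp add: sum_less_3 algebra_simps)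
    finally show "inner (snd (emb u (mgrad \<alpha> u g))) (snd (emb v (mgrad \<alpha> v k))) = inner (cls h) (fst (emb v (mgrad \<alpha> v k)))"
      unfolding inner_emb[OF u c] by (simp add: emb_def inner_cls Lh v)
  qed
  moreover have "L2_Omega d h"
  proof -
    have "h p = 0" if "p \<notin> Omega d" for p
    proof (cases "p \<in> slab d \<and> p \<in> K")
      case True
      then have "0 < (fst p)\<^sup>2" using R unfolding K_def cbox_pt_mem by auto
      then have "p \<in> Omega d" using True unfolding Omega_def slab_def by (auto simp: case_prod_beta add_pos_nonneg)
      then show ?thesis using that by simp
    qed (auto simp: h_def EK)
    then show ?thesis using Lh unfolding L2_Omega_def by auto
  qed
  ultimately have "Hrel d \<alpha> a u h"
    unfolding Hrel_iff using core_L2[OF u] emb_u by (auto simp: emb_def)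
  then show ?thesis unfolding u_def h_def E_def gauged_part_def by simp
qed

section \<open>Trial functions and Weyl sequences\<close>

lemma max0_cube_derivative:
  assumes "(g has_real_derivative g') (at x)"
  shows "((\<lambda>x. (max 0 (g x)) ^ 3) has_real_derivative 3 * (max 0 (g x))\<^sup>2 * g') (at x)"
  using DERIV_chain2[OF max0_power_has_derivative[of 3] assms] by simp

lemma max0_square_derivative:
  assumes "(g has_real_derivative g') (at x)"
  shows "((\<lambda>x. (max 0 (g x))\<^sup>2) has_real_derivative 2 * max 0 (g x) * g') (at x)"
  using DERIV_chain2[OF max0_power_has_derivative[of 2] assms] by simp

text \<open>The third power provides the two continuous derivatives that \<open>gauged_Hrel\<close>
  asks for.\<close>

definition hump :: "real \<Rightarrow> real" where "hump t = (max 0 (1 - t\<^sup>2)) ^ 3"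
definition hump' :: "real \<Rightarrow> real" where "hump' t = - 6 * t * (max 0 (1 - t\<^sup>2))\<^sup>2"
definition hump'' :: "real \<Rightarrow> real" where "hump'' t = - 6 * (max 0 (1 - t\<^sup>2))\<^sup>2 + 24 * t\<^sup>2 * max 0 (1 - t\<^sup>2)"

lemma one_minus_sq_derivative: "((\<lambda>t. 1 - t\<^sup>2) has_real_derivative - 2 * t) (at (t :: real))"
  by (auto intro!: derivative_eq_intros)

lemma hump_derivative: "(hump has_real_derivative hump' t) (at t)"
  unfolding hump_def[abs_def] hump'_def
  using max0_cube_derivative[OF one_minus_sq_derivative[of t]] by (simp add: mult_ac)

lemma hump'_derivative: "(hump' has_real_derivative hump'' t) (at t)"
proof -
  have "((\<lambda>t. - 6 * t * (max 0 (1 - t\<^sup>2))\<^sup>2) has_real_derivative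
      - 6 * (max 0 (1 - t\<^sup>2))\<^sup>2 + (2 * max 0 (1 - t\<^sup>2) * (- 2 * t)) * (- 6 * t)) (at t)"
    by (rule DERIV_mult[OF _ max0_square_derivative[OF one_minus_sq_derivative]]) (auto intro!: derivative_eq_intros)
  then show ?thesis unfolding hump'_def[abs_def] hump''_def by (simp add: power2_eq_square mult_ac)
qed

lemma hump''_continuous: "continuous_on UNIV hump''"
  unfolding hump''_def by (intro continuous_intros)

lemma hump_zero: "\<bar>t\<bar> > 1 \<Longrightarrow> hump t = 0 \<and> hump' t = 0 \<and> hump'' t = 0"
proof -
  assume "\<bar>t\<bar> > 1"
  then have "t\<^sup>2 > 1" using power_strict_mono[of 1 "\<bar>t\<bar>" 2] by simp
  then show ?thesis unfolding hump_def hump'_def hump''_def by (simp add: max_def)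
qed

lemma hump_bounds: "\<bar>hump t\<bar> \<le> 1" "\<bar>hump' t\<bar> \<le> 6" "\<bar>hump'' t\<bar> \<le> 30"
proof -
  define m where "m = max 0 (1 - t\<^sup>2)"
  have m: "0 \<le> m" "m \<le> 1" unfolding m_def by auto
  have mk: "0 \<le> m ^ k" "m ^ k \<le> 1" for k using m by (auto intro: power_le_one)
  have *: "\<bar>hump t\<bar> \<le> 1 \<and> \<bar>hump' t\<bar> \<le> 6 \<and> \<bar>hump'' t\<bar> \<le> 30"
  proof (cases "\<bar>t\<bar> > 1")
    case False
    then have t: "\<bar>t\<bar> \<le> 1" by simp
    then have t2: "t\<^sup>2 \<le> 1" by (simp add: abs_square_le_1)
    have "\<bar>t\<bar> * m\<^sup>2 \<le> 1 * 1" using t mk by (intro mult_mono) auto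
    moreover have "t\<^sup>2 * m \<le> 1 * 1" using t2 m by (intro mult_mono) auto
    moreover have "0 \<le> t\<^sup>2 * m" using m by simp
    moreover have "0 \<le> m\<^sup>2" "m\<^sup>2 \<le> 1" using mk[of 2] by auto
    ultimately have "\<bar>- 6 * m\<^sup>2 + 24 * (t\<^sup>2 * m)\<bar> \<le> 30" "\<bar>t\<bar> * m\<^sup>2 \<le> 1" by linarith+
    then show ?thesis unfolding hump_def hump'_def hump''_def m_def[symmetric]
      using mk[of 3] m(1) by (simp add: abs_mult mult.assoc)
  qed (simp add: hump_zero)
  show "\<bar>hump t\<bar> \<le> 1" "\<bar>hump' t\<bar> \<le> 6" "\<bar>hump'' t\<bar> \<le> 30" using * by auto
qed

lemma hump_lower: "\<bar>t\<bar> \<le> 1 / 2 \<Longrightarrow> 1 / 4 \<le> hump t"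
proof -
  assume "\<bar>t\<bar> \<le> 1 / 2"
  then have "t\<^sup>2 \<le> 1 / 4" using power_mono[of "\<bar>t\<bar>" "1 / 2" 2] by (simp add: power2_eq_square)
  then have "(3 / 4) ^ 3 \<le> (max 0 (1 - t\<^sup>2)) ^ 3" by (intro power_mono) auto
  then show ?thesis unfolding hump_def by (simp add: power3_eq_cube)
qed

definition packet :: "real \<Rightarrow> real \<Rightarrow> real \<Rightarrow> real \<Rightarrow> complex" where
  "packet k c R x = exp (\<i> * complex_of_real (k * x)) * complex_of_real (hump ((x - c) / R))"
definition packet' :: "real \<Rightarrow> real \<Rightarrow> real \<Rightarrow> real \<Rightarrow> complex" where
  "packet' k c R x = exp (\<i> * complex_of_real (k * x)) * (\<i> * complex_of_real k * complex_of_real (hump ((x - c) / R)) + complex_of_real (hump' ((x - c) / R) / R))"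
text \<open>What the second derivative contains besides \<open>- k^2\<close> times the packet. Every
  term carries a derivative of the envelope, so for fixed \<open>k\<close> it is of order
  \<open>1 / R\<close>.\<close>

definition packet_rest :: "real \<Rightarrow> real \<Rightarrow> real \<Rightarrow> real \<Rightarrow> complex" where
  "packet_rest k c R x = exp (\<i> * complex_of_real (k * x)) *
     (2 * \<i> * complex_of_real k * complex_of_real (hump' ((x - c) / R) / R) + complex_of_real (hump'' ((x - c) / R) / R / R))"
definition packet'' :: "real \<Rightarrow> real \<Rightarrow> real \<Rightarrow> real \<Rightarrow> complex" where
  "packet'' k c R x = packet_rest k c R x - complex_of_real (k\<^sup>2) * packet k c R x"

lemma wave_derivative: "((\<lambda>x. exp (\<i> * complex_of_real (k * x))) has_vector_derivative \<i> * complex_of_real k * exp (\<i> * complex_of_real (k * x))) (at x)"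
proof -
  have "((\<lambda>x. \<i> * complex_of_real (k * x)) has_vector_derivative \<i> * complex_of_real k) (at x)"
    by (intro has_vector_derivative_mult_right has_vector_derivative_of_real) (auto intro!: derivative_eq_intros)
  from field_vector_diff_chain_at[OF this, of exp "exp (\<i> * complex_of_real (k * x))"]
  show ?thesis using DERIV_exp by (simp add: o_def)
qed

lemma scaled_derivative:
  assumes "\<And>t. (f has_real_derivative f' t) (at t)"
  shows "((\<lambda>x. complex_of_real (f ((x - c) / R))) has_vector_derivative complex_of_real (f' ((x - c) / R) / R)) (at x)"
proof -
  have "((\<lambda>x. f ((x - c) / R)) has_real_derivative f' ((x - c) / R) / R) (at x)"
    using DERIV_chain2[OF assms DERIV_cdivide[OF DERIV_diff[OF DERIV_ident DERIV_const]], of c R x] by simp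
  then show ?thesis by (rule has_vector_derivative_of_real)
qed

lemma packet_C1: "C1_real (packet k c R) (packet' k c R)"
  unfolding C1_real_def
proof (intro conjI allI)
  fix x
  show "(packet k c R has_vector_derivative packet' k c R x) (at x)"
    unfolding packet_def[abs_def]
    by (rule has_vector_derivative_eq_rhs[OF has_vector_derivative_mult[OF wave_derivative scaled_derivative[OF hump_derivative]]])
      (simp add: packet'_def algebra_simps)
next
  have [continuous_intros]: "continuous_on UNIV hump" "continuous_on UNIV hump'"
    using DERIV_isCont[OF hump_derivative] DERIV_isCont[OF hump'_derivative] by (auto intro: continuous_at_imp_continuous_on)
  show "continuous_on UNIV (packet' k c R)" unfolding packet'_def divide_inverse
    by (intro continuous_intros continuous_on_compose2[of UNIV hump] continuous_on_compose2[of UNIV hump']) auto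
qed

lemma packet'_C1: "C1_real (packet' k c R) (packet'' k c R)"
  unfolding C1_real_def
proof (intro conjI allI)
  fix x
  have 1: "((\<lambda>x. complex_of_real (hump' ((x - c) / R) / R)) has_vector_derivative complex_of_real (hump'' ((x - c) / R) / R / R)) (at x)"
    using has_vector_derivative_divide[OF scaled_derivative[OF hump'_derivative, of c R x], of "complex_of_real R"] by simp
  have e: "exp (\<i> * complex_of_real (k * x)) = w \<Longrightarrow> hump ((x - c) / R) = h \<Longrightarrow> hump' ((x - c) / R) / R = h1 \<Longrightarrow> hump'' ((x - c) / R) / R / R = h2 \<Longrightarrow>
     exp (\<i> * complex_of_real (k * x)) * (\<i> * complex_of_real k * complex_of_real (hump' ((x - c) / R) / R) + complex_of_real (hump'' ((x - c) / R) / R / R))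
     + \<i> * complex_of_real k * exp (\<i> * complex_of_real (k * x)) * (\<i> * complex_of_real k * complex_of_real (hump ((x - c) / R)) + complex_of_real (hump' ((x - c) / R) / R))
     = packet'' k c R x" for w h h1 h2
    unfolding packet''_def packet_rest_def packet_def
    by (simp add: complex_eq_iff power2_eq_square algebra_simps)
  show "(packet' k c R has_vector_derivative packet'' k c R x) (at x)"
    unfolding packet'_def[abs_def]
    by (rule has_vector_derivative_eq_rhs[OF has_vector_derivative_mult[OF wave_derivative
       has_vector_derivative_add[OF has_vector_derivative_mult_right[OF scaled_derivative[OF hump_derivative]] 1]]]) (rule e[OF refl refl refl refl])
next
  have [continuous_intros]: "continuous_on UNIV hump" "continuous_on UNIV hump'" "continuous_on UNIV hump''"
    using DERIV_isCont[OF hump_derivative] DERIV_isCont[OF hump'_derivative] hump''_continuous by (auto intro: continuous_at_imp_continuous_on)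
  show "continuous_on UNIV (packet'' k c R)" unfolding packet''_def packet_rest_def packet_def divide_inverse
    by (intro continuous_intros continuous_on_compose2[of UNIV hump] continuous_on_compose2[of UNIV hump'] continuous_on_compose2[of UNIV hump'']) auto
qed

lemma packet_support:
  assumes "R > 0" "x \<notin> {c - R..c + R}"
  shows "packet k c R x = 0" "packet' k c R x = 0" "packet_rest k c R x = 0" "packet'' k c R x = 0"
proof -
  have "\<bar>(x - c) / R\<bar> > 1" using assms by (auto simp: abs_if field_simps not_le)
  from hump_zero[OF this] show "packet k c R x = 0" "packet' k c R x = 0" "packet_rest k c R x = 0" "packet'' k c R x = 0"
    by (simp_all add: packet_def packet'_def packet_rest_def packet''_def)
qed

lemma packet_bounds:
  assumes "R > 0"
  shows "cmod (packet k c R x) \<le> 1" "cmod (packet' 0 c R x) \<le> 6 / R" "R \<ge> 1 \<Longrightarrow> cmod (packet_rest k c R x) \<le> (12 * \<bar>k\<bar> + 30) / R"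
    "\<bar>x - c\<bar> \<le> R / 2 \<Longrightarrow> 1 / 4 \<le> cmod (packet k c R x)"
proof -
  let ?t = "(x - c) / R"
  show "cmod (packet k c R x) \<le> 1" "cmod (packet' 0 c R x) \<le> 6 / R"
    using hump_bounds[of ?t] assms by (simp_all add: packet_def packet'_def norm_mult norm_divide divide_right_mono)
  show "1 / 4 \<le> cmod (packet k c R x)" if "\<bar>x - c\<bar> \<le> R / 2"
    using hump_lower[of ?t] that assms by (simp add: packet_def norm_mult field_simps)
  assume R: "R \<ge> 1"
  have "cmod (packet_rest k c R x) \<le> cmod (2 * \<i> * complex_of_real k * complex_of_real (hump' ?t / R)) + cmod (complex_of_real (hump'' ?t / R / R))"
    unfolding packet_rest_def norm_mult[of "exp (\<i> * complex_of_real (k * x))"] norm_exp_i_times mult_1 by (rule norm_triangle_ineq)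
  also have "\<dots> = (2 * \<bar>k\<bar> * \<bar>hump' ?t\<bar>) / R + (\<bar>hump'' ?t\<bar> / R) / R" using assms by (simp add: norm_mult norm_divide)
  also have "\<dots> \<le> (2 * \<bar>k\<bar> * 6) / R + 30 / R"
  proof (intro add_mono divide_right_mono mult_left_mono hump_bounds)
    have "\<bar>hump'' ?t\<bar> / R \<le> \<bar>hump'' ?t\<bar> / 1" using R by (intro divide_left_mono) auto
    then show "\<bar>hump'' ?t\<bar> / R \<le> 30" using hump_bounds(3)[of ?t] by linarith
  qed (use assms in auto)
  finally show "cmod (packet_rest k c R x) \<le> (12 * \<bar>k\<bar> + 30) / R" by (simp add: add_divide_distrib)
qed

section \<open>Norms of product functions\<close>

definition sqint :: "(real \<Rightarrow> complex) \<Rightarrow> ennreal" where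
  "sqint f = (\<integral>\<^sup>+x. ennreal ((cmod (f x))\<^sup>2) \<partial>lborel)"

lemma sqint_le:
  assumes "\<And>x. cmod (f x) \<le> B" "\<And>x. x \<notin> {l..r} \<Longrightarrow> f x = 0" "l \<le> r"
  shows "sqint f \<le> ennreal (B\<^sup>2 * (r - l))"
proof -
  have "sqint f \<le> (\<integral>\<^sup>+x. ennreal (B\<^sup>2) * indicator {l..r} x \<partial>lborel)"
    unfolding sqint_def
  proof (rule nn_integral_mono)
    fix x
    show "ennreal ((cmod (f x))\<^sup>2) \<le> ennreal (B\<^sup>2) * indicator {l..r} x"
      using assms(1,2)[of x] by (cases "x \<in> {l..r}") (auto intro!: ennreal_leI power_mono)
  qed
  also have "\<dots> = ennreal (B\<^sup>2 * (r - l))" using assms(3) by (simp add: nn_integral_cmult_indicator ennreal_mult)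
  finally show ?thesis .
qed

lemma sqint_ge:
  assumes "\<And>x. x \<in> {l..r} \<Longrightarrow> b \<le> cmod (f x)" "b \<ge> 0" "l \<le> r"
  shows "ennreal (b\<^sup>2 * (r - l)) \<le> sqint f"
proof -
  have "ennreal (b\<^sup>2 * (r - l)) = (\<integral>\<^sup>+x. ennreal (b\<^sup>2) * indicator {l..r} x \<partial>lborel)"
    using assms(3) by (simp add: nn_integral_cmult_indicator ennreal_mult)
  also have "\<dots> \<le> sqint f" unfolding sqint_def
  proof (rule nn_integral_mono)
    fix x
    show "ennreal (b\<^sup>2) * indicator {l..r} x \<le> ennreal ((cmod (f x))\<^sup>2)"
      using assms(1)[of x] assms(2) by (cases "x \<in> {l..r}") (auto intro!: ennreal_leI power_mono)
  qed
  finally show ?thesis .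
qed

lemma ennreal_between:
  assumes "ennreal l \<le> x" "x \<le> ennreal r" "0 \<le> r" "0 \<le> l"
  obtains p where "x = ennreal p" "l \<le> p" "p \<le> r" "0 \<le> p"
  using assms by (cases x rule: ennreal_cases) (auto simp: top_unique)

lemma packet_sqint:
  assumes R: "R > 0"
  obtains p where "sqint (packet k c R) = ennreal p" "R / 16 \<le> p" "p \<le> 2 * R"
proof -
  \<comment> \<open>The envelope is at least \<open>1 / 4\<close> on an interval of length
    \<open>R\<close>.\<close>
  have "ennreal ((1 / 4)\<^sup>2 * ((c + R / 2) - (c - R / 2))) \<le> sqint (packet k c R)"
    using R by (intro sqint_ge packet_bounds) (auto simp: abs_if)
  then have "ennreal (R / 16) \<le> sqint (packet k c R)" by (simp add: power2_eq_square)
  moreover have "sqint (packet k c R) \<le> ennreal (1\<^sup>2 * ((c + R) - (c - R)))"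
    using R by (intro sqint_le packet_bounds packet_support) auto
  then have "sqint (packet k c R) \<le> ennreal (2 * R)" by simp
  ultimately show thesis using that R by (metis ennreal_between divide_nonneg_nonneg less_imp_le mult_nonneg_nonneg zero_le_numeral)
qed

lemma nn_integral_product3:
  assumes [measurable]: "f \<in> borel_measurable borel" "g \<in> borel_measurable borel" "h \<in> borel_measurable borel"
  shows "(\<integral>\<^sup>+p. f (fst (p :: pt)) * (g (fst (snd p)) * h (snd (snd p))) \<partial>lborel) = (\<integral>\<^sup>+x. f x \<partial>lborel) * ((\<integral>\<^sup>+x. g x \<partial>lborel) * (\<integral>\<^sup>+x. h x \<partial>lborel) :: ennreal)"
proof -
  have [measurable]: "(\<lambda>p :: pt. fst p) \<in> borel_measurable borel" "(\<lambda>p :: pt. fst (snd p)) \<in> borel_measurable borel" "(\<lambda>p :: pt. snd (snd p)) \<in> borel_measurable borel"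
    by (intro borel_measurable_continuous_onI continuous_intros)+
  have "(\<lambda>p :: pt. f (fst p) * (g (fst (snd p)) * h (snd (snd p)))) \<in> borel_measurable borel" by measurable
  from nn_integral_pt[OF this] show ?thesis by (simp add: nn_integral_cmult nn_integral_multc mult_ac)
qed

definition sqint_on :: "real \<Rightarrow> (real \<Rightarrow> complex) \<Rightarrow> ennreal" where
  "sqint_on d S = sqint (\<lambda>z. indicator {0..d} z * S z)"

lemma norm_gauged:
  assumes L: "L2 (slab_gauged d \<alpha> P Q S)" and c: "continuous_on UNIV P" "continuous_on UNIV Q" "continuous_on UNIV S"
  shows "ennreal ((norm (cls (slab_gauged d \<alpha> P Q S)))\<^sup>2) = sqint P * (sqint Q * sqint_on d S)"
proof -
  have [measurable]: "P \<in> borel_measurable borel" "Q \<in> borel_measurable borel" "S \<in> borel_measurable borel"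
    using c by (auto intro: borel_measurable_continuous_onI)
  have "ennreal ((norm (cls (slab_gauged d \<alpha> P Q S)))\<^sup>2)
      = (\<integral>\<^sup>+p. ennreal ((cmod (indicator (slab d) p * gauged \<alpha> P Q S p))\<^sup>2) \<partial>lborel)"
    by (rule nn_integral_cls[OF L, symmetric])
  also have "\<dots> = (\<integral>\<^sup>+p. ennreal ((cmod (P (fst p)))\<^sup>2) * (ennreal ((cmod (Q (fst (snd p))))\<^sup>2) * ennreal ((cmod (indicator {0..d} (snd (snd p)) * S (snd (snd p))))\<^sup>2)) \<partial>lborel)"
    by (intro nn_integral_cong) (auto simp: gauged_def norm_mult power_mult_distrib ennreal_mult slab_def indicator_def mult.assoc)
  also have "\<dots> = sqint P * (sqint Q * sqint_on d S)"
    unfolding sqint_def sqint_on_def by (rule nn_integral_product3) measurable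
  finally show ?thesis .
qed

lemma norm_gauged_real:
  assumes L: "L2 (slab_gauged d \<alpha> P Q S)" and c: "continuous_on UNIV P" "continuous_on UNIV Q" "continuous_on UNIV S"
  shows "sqint P \<le> ennreal p \<Longrightarrow> sqint Q \<le> ennreal q \<Longrightarrow> sqint_on d S \<le> ennreal s \<Longrightarrow> 0 \<le> p \<Longrightarrow> 0 \<le> q \<Longrightarrow> 0 \<le> s \<Longrightarrow>
      (norm (cls (slab_gauged d \<alpha> P Q S)))\<^sup>2 \<le> p * (q * s)"
    and "sqint P = ennreal p \<Longrightarrow> sqint Q = ennreal q \<Longrightarrow> sqint_on d S = ennreal s \<Longrightarrow> 0 \<le> p \<Longrightarrow> 0 \<le> q \<Longrightarrow> 0 \<le> s \<Longrightarrow>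
      (norm (cls (slab_gauged d \<alpha> P Q S)))\<^sup>2 = p * (q * s)"
proof -
  let ?n = "(norm (cls (slab_gauged d \<alpha> P Q S)))\<^sup>2"
  assume nn: "0 \<le> p" "0 \<le> q" "0 \<le> s"
  have e: "ennreal p * (ennreal q * ennreal s) = ennreal (p * (q * s))" using nn by (simp add: ennreal_mult)
  { assume "sqint P \<le> ennreal p" "sqint Q \<le> ennreal q" "sqint_on d S \<le> ennreal s"
    then have "ennreal ?n \<le> ennreal p * (ennreal q * ennreal s)" unfolding norm_gauged[OF assms] by (intro mult_mono) auto
    then show "?n \<le> p * (q * s)" unfolding e using nn by (subst (asm) ennreal_le_iff) auto }
  { assume "sqint P = ennreal p" "sqint Q = ennreal q" "sqint_on d S = ennreal s"
    then have "ennreal ?n = ennreal (p * (q * s))" unfolding norm_gauged[OF assms] e[symmetric] by simp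
    then show "?n = p * (q * s)" using nn by (subst (asm) ennreal_inj) auto }
qed

lemma packet_continuous:
  "continuous_on UNIV (packet k c R)" "continuous_on UNIV (packet' k c R)" "continuous_on UNIV (packet'' k c R)" "continuous_on UNIV (packet_rest k c R)"
proof -
  show *: "continuous_on UNIV (packet k c R)" "continuous_on UNIV (packet' k c R)" "continuous_on UNIV (packet'' k c R)"
    using C1_real_continuous[OF packet_C1] C1_real_continuous[OF packet'_C1] C1_real_continuous_derivative[OF packet'_C1] by auto
  have "packet_rest k c R = (\<lambda>x. packet'' k c R x + complex_of_real (k\<^sup>2) * packet k c R x)" by (simp add: fun_eq_iff packet''_def)
  then show "continuous_on UNIV (packet_rest k c R)" using * by (auto intro!: continuous_intros)
qed

lemma L2_slab_gauged:
  assumes "continuous_on UNIV P" "continuous_on UNIV Q" "continuous_on UNIV S" "R > 0"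
    "\<And>x. x \<notin> {R..M} \<Longrightarrow> P x = 0" "\<And>y. y \<notin> {- M..M} \<Longrightarrow> Q y = 0"
  shows "L2 (slab_gauged d \<alpha> P Q S)"
proof (rule L2_slab[of _ M])
  show "continuous_on UNIV (gauged \<alpha> P Q S)" by (rule continuous_gauged(1)[OF assms(1-4)]) (use assms(5) in auto)
  fix p :: pt assume "\<not> (\<bar>fst p\<bar> \<le> M \<and> \<bar>fst (snd p)\<bar> \<le> M)"
  then have "fst p \<notin> {R..M} \<or> fst (snd p) \<notin> {- M..M}" using assms(4) by (auto simp: abs_le_iff)
  then show "gauged \<alpha> P Q S p = 0" using assms(5,6) unfolding gauged_def by auto
qed

lemma sqint_on_linear:
  assumes "d > 0" shows "sqint_on d (\<lambda>z. complex_of_real (d - z)) = ennreal (d ^ 3 / 3)" "sqint_on d (\<lambda>z. - 1) = ennreal d"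
proof -
  have "sqint_on d (\<lambda>z. complex_of_real (d - z)) = (\<integral>\<^sup>+z. ennreal ((d - z)\<^sup>2) * indicator {0..d} z \<partial>lborel)"
    unfolding sqint_on_def sqint_def by (intro nn_integral_cong) (auto simp: indicator_def norm_mult simp del: of_real_diff)
  also have "\<dots> = ennreal (- ((d - d) ^ 3 / 3) - - ((d - 0) ^ 3 / 3))"
    by (rule nn_integral_FTC_Icc) (use assms in \<open>auto intro!: derivative_eq_intros simp: has_real_derivative_iff_has_vector_derivative[symmetric] power2_eq_square\<close>)
  finally show "sqint_on d (\<lambda>z. complex_of_real (d - z)) = ennreal (d ^ 3 / 3)" by simp
  have "sqint_on d (\<lambda>z. - 1) = (\<integral>\<^sup>+z. indicator {0..d} z \<partial>lborel)"
    unfolding sqint_on_def sqint_def by (intro nn_integral_cong) (auto simp: indicator_def)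
  then show "sqint_on d (\<lambda>z. - 1) = ennreal d" using assms by simp
qed

lemma norm_cls_i: "L2 f \<Longrightarrow> norm (cls (\<lambda>p. \<i> * f p)) = norm (cls f)"
  by (simp add: mult_i_cls[symmetric] norm_mult_i)

lemma norm_sq_mgrad_gauged:
  assumes L: "\<And>j. L2 (\<lambda>p. indicator (slab d) p * gauged_part \<alpha> P P' Q Q' S S' j p)"
  shows "(norm (snd (emb u (mgrad \<alpha> (slab_gauged d \<alpha> P Q S) (\<lambda>j p. indicator (slab d) p * gauged_grad \<alpha> P P' Q Q' S S' j p)))))\<^sup>2
    = (norm (cls (slab_gauged d \<alpha> P' Q S)))\<^sup>2 + (norm (cls (slab_gauged d \<alpha> P Q' S)))\<^sup>2
      + (norm (cls (slab_gauged d \<alpha> P Q S')))\<^sup>2"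
  unfolding mgrad_gauged[abs_def] emb_def using norm_cls_i[OF L[of 0]] norm_cls_i[OF L[of 1]] norm_cls_i[OF L[of 2]]
  by (simp add: norm_prod_def gauged_part_def)

text \<open>A product trial function. The vertical factor \<open>d - z\<close> vanishes on the upper
  face only and has Rayleigh quotient 3 / d^2. The horizontal envelopes have width proportional to
  \<open>a\<close> and add a relative energy of order 1 / a^2, small against 1 / d^2 when
  \<open>a / d\<close> is large.\<close>

theorem large_window_below_threshold:
  assumes d: "d > 0" and a: "a > 0" and big: "a / d > 500"
  shows "\<exists>u w. (u, w) \<in> form_dom d \<alpha> a \<and> (norm w)\<^sup>2 < (pi / d)\<^sup>2 * (norm u)\<^sup>2"
proof -
  \<comment> \<open>The support \<open>R \<le> x \<le> 3 * R\<close>,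
    \<open>\<bar>y\<bar> \<le> R\<close> avoids the axis and stays over the window, as
    \<open>9 * R^2 + R^2 \<le> 16 * R^2 = a^2\<close>.\<close>
  define R where "R = a / 4"
  have R: "R > 0" unfolding R_def using a by simp
  define P where "P = packet 0 (2 * R) R"
  define P' where "P' = packet' 0 (2 * R) R"
  define Q where "Q = packet 0 0 R"
  define Q' where "Q' = packet' 0 0 R"
  define S where "S = (\<lambda>z. complex_of_real (d - z))"
  define S' where "S' = (\<lambda>z :: real. - 1 :: complex)"
  have C: "C1_real P P'" "C1_real Q Q'" unfolding P_def P'_def Q_def Q'_def by (rule packet_C1)+
  have CS: "C1_real S S'" unfolding C1_real_def S_def S'_def by (auto intro!: derivative_eq_intros continuous_intros)
  have sP: "P x = 0" "P' x = 0" if "x \<notin> {R..3 * R}" for x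
    using packet_support(1,2)[OF R, of x "2 * R" 0] that unfolding P_def P'_def by auto
  have sQ': "Q x = 0" "Q' x = 0" if "x \<notin> {- R..R}" for x
    using packet_support(1,2)[OF R, of x 0 0] that unfolding Q_def Q'_def by auto
  have sQ: "Q x = 0" "Q' x = 0" if "x \<notin> {- (3 * R)..3 * R}" for x using sQ'[of x] that R by auto
  note cont = C1_real_continuous[OF C(1)] C1_real_continuous[OF C(2)] C1_real_continuous[OF CS]
    C1_real_continuous_derivative[OF C(1)] C1_real_continuous_derivative[OF C(2)] C1_real_continuous_derivative[OF CS]
  define u where "u = (slab_gauged d \<alpha> P Q S)"
  define g where "g = (\<lambda>j p. indicator (slab d) p * gauged_grad \<alpha> P P' Q Q' S S' j p)"
  have u: "core d a u g" unfolding u_def g_def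
  proof (rule gauged_core[OF C CS R d sP(1) sQ(1)])
    show "S d = 0" unfolding S_def by simp
    have "x\<^sup>2 + y\<^sup>2 \<le> a\<^sup>2" if "P x * Q y \<noteq> 0" for x y
    proof -
      have x: "x \<in> {R..3 * R}" and y: "y \<in> {- R..R}" using that sP(1)[of x] sQ'(1)[of y] by auto
      have "x\<^sup>2 \<le> (3 * R)\<^sup>2" using x R by (intro power_mono) auto
      moreover have "y\<^sup>2 \<le> R\<^sup>2" using y by (intro abs_le_square_iff[THEN iffD1]) auto
      moreover have "a\<^sup>2 = 16 * R\<^sup>2" unfolding R_def by (simp add: power_divide)
      moreover have "(3 * R)\<^sup>2 = 9 * R\<^sup>2" by (simp add: power_mult_distrib)
      ultimately show ?thesis using zero_le_power2[of R] by linarith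
    qed
    then show "S 0 = 0 \<or> (\<forall>x y. P x * Q y \<noteq> 0 \<longrightarrow> x\<^sup>2 + y\<^sup>2 \<le> a\<^sup>2)" by blast
  qed
  obtain p where p: "sqint P = ennreal p" "R / 16 \<le> p" "p \<le> 2 * R" unfolding P_def using packet_sqint[OF R] .
  obtain q where q: "sqint Q = ennreal q" "R / 16 \<le> q" "q \<le> 2 * R" unfolding Q_def using packet_sqint[OF R] .
  have pq0: "0 \<le> p" "0 \<le> q" using p q R by auto
  have P'le: "sqint P' \<le> ennreal (72 / R)"
  proof -
    have "sqint P' \<le> ennreal ((6 / R)\<^sup>2 * (3 * R - R))"
      using R sP(2) unfolding P'_def by (intro sqint_le packet_bounds) auto
    then show ?thesis using R by (simp add: power2_eq_square)
  qed
  have Q'le: "sqint Q' \<le> ennreal (72 / R)"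
  proof -
    have "sqint Q' \<le> ennreal ((6 / R)\<^sup>2 * (R - - R))"
      using R sQ'(2) unfolding Q'_def by (intro sqint_le packet_bounds) auto
    then show ?thesis using R by (simp add: power2_eq_square)
  qed
  have s: "sqint_on d S = ennreal (d ^ 3 / 3)" "sqint_on d S' = ennreal d"
    unfolding S_def S'_def by (rule sqint_on_linear[OF d])+
  have d3: "0 \<le> d ^ 3 / 3" "0 \<le> d" using d by auto
  have L: "L2 (slab_gauged d \<alpha> P' Q S)" "L2 (slab_gauged d \<alpha> P Q' S)"
    "L2 (slab_gauged d \<alpha> P Q S')"
    by (rule L2_slab_gauged[OF _ _ _ R, where M = "3 * R"]; use cont sP sQ in auto)+
  have "(norm (snd (emb u (mgrad \<alpha> u g))))\<^sup>2 = (norm (cls (slab_gauged d \<alpha> P' Q S)))\<^sup>2 + (norm (cls (slab_gauged d \<alpha> P Q' S)))\<^sup>2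
      + (norm (cls (slab_gauged d \<alpha> P Q S')))\<^sup>2"
    unfolding u_def g_def by (rule norm_sq_mgrad_gauged) (use L in \<open>auto simp: gauged_part_def\<close>)
  also have "\<dots> \<le> 72 / R * (2 * R * (d ^ 3 / 3)) + 2 * R * (72 / R * (d ^ 3 / 3)) + p * (q * d)"
  proof (intro add_mono)
    show "(norm (cls (slab_gauged d \<alpha> P' Q S)))\<^sup>2 \<le> 72 / R * (2 * R * (d ^ 3 / 3))"
      by (rule norm_gauged_real(1)[OF L(1) cont(4,2,3) P'le _ _ _ _ d3(1)]) (use q s R in \<open>auto intro!: ennreal_leI\<close>)
    show "(norm (cls (slab_gauged d \<alpha> P Q' S)))\<^sup>2 \<le> 2 * R * (72 / R * (d ^ 3 / 3))"
      by (rule norm_gauged_real(1)[OF L(2) cont(1,5,3) _ Q'le _ _ _ d3(1)]) (use p s R in \<open>auto intro!: ennreal_leI\<close>)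
    show "(norm (cls (slab_gauged d \<alpha> P Q S')))\<^sup>2 \<le> p * (q * d)"
      using norm_gauged_real(2)[OF L(3) cont(1,2,6) p(1) q(1) s(2) pq0 d3(2)] by simp
  qed
  also have "\<dots> = 96 * d ^ 3 + p * q * d" using R by (simp add: field_simps)
  also have "\<dots> < (pi / d)\<^sup>2 * (p * (q * (d ^ 3 / 3)))"
  proof -
    \<comment> \<open>The two horizontal terms sum to \<open>96 * d ^ 3\<close>, and
      \<open>pi^2 \<ge> 9\<close> leaves \<open>2 * p * q * d\<close> to absorb them, so
      \<open>48 * d^2 < p * q\<close> is what is needed. The packet bounds give
      \<open>p * q \<ge> a^2 / 4096\<close>, and 500^2 / 4096 exceeds 48.\<close>
    have "500 * d < a" using big d by (simp add: field_simps)
    then have "(500 * d)\<^sup>2 < a\<^sup>2" using d by (intro power_strict_mono) auto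
    then have "250000 * d\<^sup>2 < a\<^sup>2" by (simp add: power_mult_distrib)
    moreover have "R / 16 * (R / 16) \<le> p * q" using p q R pq0 by (intro mult_mono) auto
    then have "a\<^sup>2 \<le> 4096 * (p * q)" unfolding R_def by (simp add: power2_eq_square)
    ultimately have "48 * d\<^sup>2 < p * q" using zero_le_power2[of d] by linarith
    then have "96 * d\<^sup>2 + p * q < 3 * (p * q)" by simp
    also have "3 * (p * q) \<le> pi\<^sup>2 / 3 * (p * q)"
    proof (rule mult_right_mono)
      have "3\<^sup>2 \<le> pi\<^sup>2" using pi_gt3 by (intro power_mono) auto
      then show "3 \<le> pi\<^sup>2 / 3" by simp
      show "0 \<le> p * q" using pq0 by simp
    qed
    finally have "d * (96 * d\<^sup>2 + p * q) < d * (pi\<^sup>2 / 3 * (p * q))" using d by (rule mult_strict_left_mono)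
    moreover have "(pi / d)\<^sup>2 * (p * (q * (d ^ 3 / 3))) = d * (pi\<^sup>2 / 3 * (p * q))" using d by (simp add: power_divide power2_eq_square power3_eq_cube)
    moreover have "96 * d ^ 3 + p * q * d = d * (96 * d\<^sup>2 + p * q)" by (simp add: power2_eq_square power3_eq_cube algebra_simps)
    ultimately show ?thesis by (simp only:)
  qed
  also have "p * (q * (d ^ 3 / 3)) = (norm (fst (emb u (mgrad \<alpha> u g))))\<^sup>2"
    unfolding emb_def fst_conv u_def
    by (rule norm_gauged_real(2)[OF _ cont(1,2,3) p(1) q(1) s(1) pq0 d3(1), symmetric]) (use core_L2[OF u] u_def in simp)
  finally have "(norm (snd (emb u (mgrad \<alpha> u g))))\<^sup>2 < (pi / d)\<^sup>2 * (norm (fst (emb u (mgrad \<alpha> u g))))\<^sup>2" .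
  moreover have "emb u (mgrad \<alpha> u g) \<in> form_core d \<alpha> a"
    unfolding form_core_def by (intro CollectI exI[of _ u] exI[of _ g] conjI refl u)
  then have "emb u (mgrad \<alpha> u g) \<in> form_dom d \<alpha> a"
    unfolding form_dom_def by (rule closure_subset[THEN subsetD])
  ultimately show ?thesis by (metis prod.collapse)
qed

section \<open>Transverse mode and Weyl sequence\<close>

definition well :: "real \<Rightarrow> real \<Rightarrow> real" where "well d z = (max 0 (z - d)) ^ 3 + (max 0 (- z)) ^ 3"
definition well' :: "real \<Rightarrow> real \<Rightarrow> real" where "well' d z = 3 * (max 0 (z - d))\<^sup>2 - 3 * (max 0 (- z))\<^sup>2"
definition well'' :: "real \<Rightarrow> real \<Rightarrow> real" where "well'' d z = 6 * max 0 (z - d) + 6 * max 0 (- z)"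
text \<open>Equal to 1 on the slab, twice continuously differentiable, and zero at distance 1 from
  it. \<open>gauged_Hrel\<close> works with functions of \<open>z\<close> on the whole line, so the
  mode is cut off where the slab does not see it.\<close>

definition plateau :: "real \<Rightarrow> real \<Rightarrow> real" where "plateau d z = (max 0 (1 - well d z)) ^ 3"
definition plateau' :: "real \<Rightarrow> real \<Rightarrow> real" where "plateau' d z = - 3 * (max 0 (1 - well d z))\<^sup>2 * well' d z"
definition plateau'' :: "real \<Rightarrow> real \<Rightarrow> real" where
  "plateau'' d z = 6 * max 0 (1 - well d z) * (well' d z)\<^sup>2 - 3 * (max 0 (1 - well d z))\<^sup>2 * well'' d z"

lemma lin_derivative: "((\<lambda>z. z - d) has_real_derivative 1) (at z)" "((\<lambda>z. - z) has_real_derivative - 1) (at (z :: real))"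
  by (auto intro!: derivative_eq_intros)

lemma well_derivative: "(well d has_real_derivative well' d z) (at z)" "(well' d has_real_derivative well'' d z) (at z)"
proof -
  show "(well d has_real_derivative well' d z) (at z)" unfolding well_def[abs_def]
    by (rule DERIV_cong[OF DERIV_add[OF max0_cube_derivative[OF lin_derivative(1)] max0_cube_derivative[OF lin_derivative(2)]]]) (simp add: well'_def)
  show "(well' d has_real_derivative well'' d z) (at z)" unfolding well'_def[abs_def]
    by (rule DERIV_cong[OF DERIV_diff[OF DERIV_cmult[OF max0_square_derivative[OF lin_derivative(1)]] DERIV_cmult[OF max0_square_derivative[OF lin_derivative(2)]]]]) (simp add: well''_def)
qed

lemma plateau_derivative: "(plateau d has_real_derivative plateau' d z) (at z)" "(plateau' d has_real_derivative plateau'' d z) (at z)"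
proof -
  have 1: "((\<lambda>z. 1 - well d z) has_real_derivative - well' d z) (at z)"
    using DERIV_diff[OF DERIV_const well_derivative(1)] by simp
  show "(plateau d has_real_derivative plateau' d z) (at z)" unfolding plateau_def[abs_def]
    by (rule DERIV_cong[OF max0_cube_derivative[OF 1]]) (simp add: plateau'_def)
  show "(plateau' d has_real_derivative plateau'' d z) (at z)" unfolding plateau'_def[abs_def]
    by (rule DERIV_cong[OF DERIV_mult[OF DERIV_cmult[OF max0_square_derivative[OF 1]] well_derivative(2)]]) (simp add: plateau''_def power2_eq_square mult_ac)
qed

lemma plateau_eq: "z \<in> {0..d} \<Longrightarrow> plateau d z = 1 \<and> plateau' d z = 0 \<and> plateau'' d z = 0"
  unfolding plateau_def plateau'_def plateau''_def well_def well'_def well''_def by simp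

lemma plateau_support: "d \<ge> 0 \<Longrightarrow> z \<notin> {- (d + 1)..d + 1} \<Longrightarrow> plateau d z = 0"
proof -
  assume "d \<ge> 0" "z \<notin> {- (d + 1)..d + 1}"
  then have "1 \<le> max 0 (z - d) \<or> 1 \<le> max 0 (- z)" by auto
  then have "1 \<le> well d z" unfolding well_def
    using one_le_power[of "max 0 (z - d)" 3] one_le_power[of "max 0 (- z)" 3] by (auto intro: add_increasing add_increasing2)
  then show ?thesis unfolding plateau_def by simp
qed

text \<open>On the slab this is the lowest Dirichlet mode of the interval, with eigenvalue
  \<open>(pi / d)^2\<close>.\<close>

definition mode :: "real \<Rightarrow> real \<Rightarrow> real" where "mode d z = sin (pi / d * z) * plateau d z"
definition mode' :: "real \<Rightarrow> real \<Rightarrow> real" where "mode' d z = pi / d * cos (pi / d * z) * plateau d z + sin (pi / d * z) * plateau' d z"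
definition mode'' :: "real \<Rightarrow> real \<Rightarrow> real" where
  "mode'' d z = - (pi / d)\<^sup>2 * sin (pi / d * z) * plateau d z + 2 * (pi / d * cos (pi / d * z) * plateau' d z) + sin (pi / d * z) * plateau'' d z"

lemma mode_derivative: "(mode d has_real_derivative mode' d z) (at z)" "(mode' d has_real_derivative mode'' d z) (at z)"
proof -
  have sc: "((\<lambda>z. sin (w * z)) has_real_derivative w * cos (w * z)) (at z)"
     "((\<lambda>z. w * cos (w * z)) has_real_derivative - w\<^sup>2 * sin (w * z)) (at z)" for w
    by (auto intro!: derivative_eq_intros simp: power2_eq_square)
  have s: "((\<lambda>z. sin (pi / d * z)) has_real_derivative pi / d * cos (pi / d * z)) (at z)"
    and c: "((\<lambda>z. pi / d * cos (pi / d * z)) has_real_derivative - (pi / d)\<^sup>2 * sin (pi / d * z)) (at z)"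
    using sc[of "pi / d"] by auto
  show "(mode d has_real_derivative mode' d z) (at z)" unfolding mode_def[abs_def]
    by (rule DERIV_cong[OF DERIV_mult[OF s plateau_derivative(1)]]) (simp add: mode'_def algebra_simps)
  show "(mode' d has_real_derivative mode'' d z) (at z)" unfolding mode'_def[abs_def]
    by (rule DERIV_cong[OF DERIV_add[OF DERIV_mult[OF c plateau_derivative(1)] DERIV_mult[OF s plateau_derivative(2)]]]) (simp add: mode''_def algebra_simps)
qed

lemma mode''_continuous: "continuous_on UNIV (mode'' d)"
proof -
  have w: "continuous_on UNIV (well d)" "continuous_on UNIV (well' d)" "continuous_on UNIV (well'' d)"
    unfolding well_def well'_def well''_def by (intro continuous_intros)+
  then have "continuous_on UNIV (plateau d)" "continuous_on UNIV (plateau' d)" "continuous_on UNIV (plateau'' d)"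
    unfolding plateau_def plateau'_def plateau''_def by (auto intro!: continuous_intros)
  then show ?thesis unfolding mode''_def by (intro continuous_intros)
qed

lemma C1_real_of_real:
  assumes "\<And>x. (f has_real_derivative f' x) (at x)" "continuous_on UNIV f'"
  shows "C1_real (\<lambda>x. complex_of_real (f x)) (\<lambda>x. complex_of_real (f' x))"
  unfolding C1_real_def using assms by (auto intro!: has_vector_derivative_of_real continuous_intros)

lemma mode_C1: "C1_real (\<lambda>z. complex_of_real (mode d z)) (\<lambda>z. complex_of_real (mode' d z))"
    "C1_real (\<lambda>z. complex_of_real (mode' d z)) (\<lambda>z. complex_of_real (mode'' d z))"
proof -
  have "continuous_on UNIV (mode' d)" using DERIV_isCont[OF mode_derivative(2)] by (auto intro: continuous_at_imp_continuous_on)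
  then show "C1_real (\<lambda>z. complex_of_real (mode d z)) (\<lambda>z. complex_of_real (mode' d z))"
    "C1_real (\<lambda>z. complex_of_real (mode' d z)) (\<lambda>z. complex_of_real (mode'' d z))"
    using C1_real_of_real mode_derivative mode''_continuous by auto
qed

lemma mode_sqint:
  assumes d: "d > 0"
  obtains s where "sqint_on d (\<lambda>z. complex_of_real (mode d z)) = ennreal s" "s > 0"
proof -
  \<comment> \<open>For these \<open>z\<close> the argument of the sine runs from
    \<open>pi / 6\<close> to \<open>pi / 2\<close>.\<close>
  have b: "1 / 2 \<le> cmod (indicator {0..d} z * complex_of_real (mode d z))" if z: "z \<in> {d / 6..d / 2}" for z
  proof -
    have "pi / 6 \<le> pi / d * z" "pi / d * z \<le> pi / 2" using z d by (auto simp: field_simps)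
    then have "sin (pi / 6) \<le> sin (pi / d * z)" by (intro sin_monotone_2pi_le) (use pi_gt_zero in linarith)+
    moreover have "z \<in> {0..d}" using z d by auto
    ultimately show ?thesis using plateau_eq[of z d] by (simp add: mode_def sin_30)
  qed
  have "ennreal ((1 / 2)\<^sup>2 * (d / 2 - d / 6)) \<le> sqint_on d (\<lambda>z. complex_of_real (mode d z))"
    unfolding sqint_on_def by (rule sqint_ge[OF b]) (use d in auto)
  moreover have "cmod (indicator {0..d} z * complex_of_real (mode d z)) \<le> 1" for z
    using plateau_eq[of z d] by (auto simp: indicator_def mode_def)
  then have "sqint_on d (\<lambda>z. complex_of_real (mode d z)) \<le> ennreal (1\<^sup>2 * (d - 0))"
    unfolding sqint_on_def by (rule sqint_le) (use d in auto)
  ultimately obtain s where "sqint_on d (\<lambda>z. complex_of_real (mode d z)) = ennreal s" "(1 / 2)\<^sup>2 * (d / 2 - d / 6) \<le> s"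
    using d by (elim ennreal_between) auto
  then show thesis using that[of s] d by (simp add: power2_eq_square)
qed

text \<open>A Weyl sequence in quantitative form. The wave contributes \<open>k^2\<close> and the
  mode \<open>(pi / d)^2\<close>. Up to the fixed norm of the mode, a packet of size
  \<open>R\<close> has norm at least \<open>R / 16\<close>, whereas the norm of
  \<open>H u - l u\<close> stays bounded as \<open>R\<close> grows; so no resolvent bound can
  hold.\<close>

theorem essential_spectrum_subset:
  assumes d: "d > 0" and a: "a > 0"
  shows "complex_of_real (k\<^sup>2 + (pi / d)\<^sup>2) \<in> spectrum_H d \<alpha> a"
proof (rule ccontr)
  define l where "l = k\<^sup>2 + (pi / d)\<^sup>2"
  assume "complex_of_real (k\<^sup>2 + (pi / d)\<^sup>2) \<notin> spectrum_H d \<alpha> a"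
  then obtain C where C: "\<And>u h. Hrel d \<alpha> a u h \<Longrightarrow> L2norm u \<le> C * L2norm (\<lambda>p. h p - complex_of_real l * u p)"
    unfolding spectrum_H_def resolvent_set_def l_def by auto
  define B where "B = 12 * \<bar>k\<bar> + 30"
  have B: "B \<ge> 30" unfolding B_def by simp
  define R where "R = 1 + a + d + 64 * \<bar>C\<bar> * B"
  have R0: "0 \<le> 64 * \<bar>C\<bar> * B" using B by simp
  then have R: "R > 0" "R \<ge> 1" "R > a" "R \<ge> d + 1" "R > 64 * \<bar>C\<bar> * B" unfolding R_def using a d by linarith+
  define P where "P = packet k (2 * R) R"
  define Q where "Q = packet 0 0 R"
  define S where "S = (\<lambda>z. complex_of_real (mode d z))"
  define P2 where "P2 = packet'' k (2 * R) R"
  define Q2 where "Q2 = packet'' 0 0 R"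
  define S2 where "S2 = (\<lambda>z. complex_of_real (mode'' d z))"
  define E where "E = packet_rest k (2 * R) R"
  have sP: "P x = 0" "E x = 0" if "x \<notin> {R..3 * R}" for x
    using packet_support[OF R(1), of x "2 * R" k] that unfolding P_def E_def by auto
  have sQ': "Q x = 0" "Q2 x = 0" if "x \<notin> {- R..R}" for x
    using packet_support[OF R(1), of x 0 0] that unfolding Q_def Q2_def by auto
  have sQ: "Q x = 0" "Q2 x = 0" if "x \<notin> {- (3 * R)..3 * R}" for x using sQ'[of x] that R(1) by auto
  have sS: "S z = 0" if "z \<notin> {- (3 * R)..3 * R}" for z
    using plateau_support[of d z] that R d unfolding S_def mode_def by auto
  define u where "u = (slab_gauged d \<alpha> P Q S)"
  define h where "h = (\<lambda>p. - (indicator (slab d) p * (gauged \<alpha> P2 Q S p + gauged \<alpha> P Q2 S p + gauged \<alpha> P Q S2 p)))"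
  have H: "Hrel d \<alpha> a u h"
    unfolding u_def h_def P_def Q_def S_def P2_def Q2_def S2_def
    by (rule gauged_Hrel[OF packet_C1 packet'_C1 packet_C1 packet'_C1 mode_C1 a R(3) d, where M = "3 * R"])
      (use sP sQ sS d in \<open>auto simp: P_def Q_def S_def mode_def\<close>)
  define v1 where "v1 = (slab_gauged d \<alpha> E Q S)"
  define v2 where "v2 = (slab_gauged d \<alpha> P Q2 S)"
  have e: "h p - complex_of_real l * u p = - (v1 p + v2 p)" for p
  proof (cases "p \<in> slab d")
    case True
    then have hS: "S2 (snd (snd p)) = - complex_of_real ((pi / d)\<^sup>2) * S (snd (snd p))"
      unfolding S2_def S_def mode_def mode''_def using plateau_eq[of "snd (snd p)" d] by (simp add: slab_def)
    have hP: "P2 (fst p) = E (fst p) - complex_of_real (k\<^sup>2) * P (fst p)" unfolding P2_def E_def P_def packet''_def ..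
    have "gauged \<alpha> P Q S2 p = - complex_of_real ((pi / d)\<^sup>2) * gauged \<alpha> P Q S p" unfolding gauged_def hS by simp
    moreover have "gauged \<alpha> P2 Q S p = gauged \<alpha> E Q S p - complex_of_real (k\<^sup>2) * gauged \<alpha> P Q S p" unfolding gauged_def hP by (simp add: algebra_simps)
    ultimately show ?thesis using True unfolding h_def u_def v1_def v2_def l_def by (simp add: algebra_simps)
  next
    case False then show ?thesis unfolding h_def u_def v1_def v2_def by simp
  qed
  note cont = packet_continuous[of k "2 * R" R, folded P_def E_def] packet_continuous[of 0 0 R, folded Q_def Q2_def]
    C1_real_continuous[OF mode_C1(1)[of d], folded S_def]
  have L1: "L2 v1" and L2: "L2 v2" and Lu: "L2 u" unfolding v1_def v2_def u_def
    by (rule L2_slab_gauged[OF _ _ _ R(1), where M = "3 * R"]; use cont sP sQ in auto)+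
  obtain s where s: "sqint_on d S = ennreal s" "s > 0" unfolding S_def using mode_sqint[OF d] .
  obtain p where p: "sqint P = ennreal p" "R / 16 \<le> p" "p \<le> 2 * R" unfolding P_def using packet_sqint[OF R(1)] .
  obtain q where q: "sqint Q = ennreal q" "R / 16 \<le> q" "q \<le> 2 * R" unfolding Q_def using packet_sqint[OF R(1)] .
  have pq0: "0 \<le> p" "0 \<le> q" using p q R(1) by auto
  have "sqint E \<le> ennreal ((B / R)\<^sup>2 * (3 * R - R))"
    unfolding E_def B_def using R sP(2) by (intro sqint_le packet_bounds) (auto simp: E_def)
  then have El: "sqint E \<le> ennreal (2 * B\<^sup>2 / R)" using R by (simp add: power2_eq_square mult_ac)
  \<comment> \<open>The second horizontal factor carries no wave, so its second derivative is all
    remainder.\<close>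
  have Q2r: "Q2 = packet_rest 0 0 R" unfolding Q2_def packet''_def by simp
  have "cmod (Q2 x) \<le> B / R" for x
  proof -
    have "cmod (Q2 x) \<le> (12 * \<bar>0\<bar> + 30) / R" unfolding Q2r using R by (intro packet_bounds)
    also have "\<dots> \<le> B / R" using B R by (intro divide_right_mono) auto
    finally show ?thesis .
  qed
  then have "sqint Q2 \<le> ennreal ((B / R)\<^sup>2 * (R - - R))" using R sQ'(2) by (intro sqint_le) auto
  then have Q2l: "sqint Q2 \<le> ennreal (2 * B\<^sup>2 / R)" using R by (simp add: power2_eq_square mult_ac)
  have BR: "0 \<le> 2 * B\<^sup>2 / R" using R by simp
  have "(norm (cls v1))\<^sup>2 \<le> 2 * B\<^sup>2 / R * (2 * R * s)" unfolding v1_def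
    by (rule norm_gauged_real(1)[OF L1[unfolded v1_def] cont(4,5,9) El _ _ BR]) (use q s R in \<open>auto intro!: ennreal_leI\<close>)
  also have "\<dots> = (2 * B * sqrt s)\<^sup>2" using R s by (simp add: power_mult_distrib field_simps)
  finally have n1: "norm (cls v1) \<le> 2 * B * sqrt s" using B s by (auto elim!: power2_le_imp_le)
  have "(norm (cls v2))\<^sup>2 \<le> 2 * R * (2 * B\<^sup>2 / R * s)" unfolding v2_def
    by (rule norm_gauged_real(1)[OF L2[unfolded v2_def] cont(1,7,9) _ Q2l _ _ BR]) (use p s R in \<open>auto intro!: ennreal_leI\<close>)
  also have "\<dots> = (2 * B * sqrt s)\<^sup>2" using R s by (simp add: power_mult_distrib field_simps)
  finally have n2: "norm (cls v2) \<le> 2 * B * sqrt s" using B s by (auto elim!: power2_le_imp_le)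
  have "(R / 16 * sqrt s)\<^sup>2 = R / 16 * (R / 16 * s)" using s by (simp add: power_mult_distrib power2_eq_square)
  also have "\<dots> \<le> p * (q * s)" using p q R s pq0 by (intro mult_mono) auto
  also have "\<dots> = (norm (cls u))\<^sup>2" unfolding u_def
    by (rule norm_gauged_real(2)[OF Lu[unfolded u_def] cont(1,5,9) p(1) q(1) s(1) pq0, symmetric]) (use s in simp)
  finally have nu: "R / 16 * sqrt s \<le> norm (cls u)" by (rule power2_le_imp_le) simp
  have Lh: "L2 (\<lambda>p. h p - complex_of_real l * u p)" unfolding e by (intro L2_uminus L2_add L1 L2)
  have "norm (cls (\<lambda>p. h p - complex_of_real l * u p)) = norm (- (cls v1 + cls v2))"
    unfolding e using L1 L2 by (simp add: cls_add cls_uminus L2_add)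
  also have "\<dots> \<le> norm (cls v1) + norm (cls v2)" unfolding norm_minus_cancel by (rule norm_triangle_ineq)
  also have "\<dots> \<le> 4 * B * sqrt s" using n1 n2 by simp
  finally have nh: "norm (cls (\<lambda>p. h p - complex_of_real l * u p)) \<le> 4 * B * sqrt s" .
  have "R / 16 * sqrt s \<le> C * norm (cls (\<lambda>p. h p - complex_of_real l * u p))"
    using C[OF H] nu unfolding L2norm_cls[OF Lu] L2norm_cls[OF Lh] by simp
  also have "\<dots> \<le> \<bar>C\<bar> * norm (cls (\<lambda>p. h p - complex_of_real l * u p))" by (intro mult_right_mono) auto
  also have "\<dots> \<le> \<bar>C\<bar> * (4 * B * sqrt s)" by (intro mult_left_mono nh) auto
  finally have "R * sqrt s \<le> (64 * \<bar>C\<bar> * B) * sqrt s" by simp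
  then have "R \<le> 64 * \<bar>C\<bar> * B" using s(2) by (subst (asm) mult_le_cancel_right_pos) auto
  then show False using R(5) by simp
qed

section \<open>The discrete spectrum\<close>

lemma inner_mult_i_self: "inner (mult_i x) x = 0" "inner x (mult_i x) = 0"
  using inner_mult_i_right[of x x] by (simp_all add: inner_commute)

lemma inner_mult_i3_self: "inner W (mult_i3 W) = 0"
  unfolding mult_i3_def by (simp add: inner_prod_def inner_mult_i_self)

lemma cls_eq_0_iff: "L2 u \<Longrightarrow> cls u = 0 \<longleftrightarrow> (AE p in lborel. u p = 0)"
  using cls_eq_iff[OF _ L2_zero, of u] by (simp add: cls_zero)

lemma L2_Omega_cmult: "L2_Omega d u \<Longrightarrow> L2_Omega d (\<lambda>p. c * u p)"
  unfolding L2_Omega_def using L2_cmult by auto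

lemma L2_Omega_add: "L2_Omega d u \<Longrightarrow> L2_Omega d v \<Longrightarrow> L2_Omega d (\<lambda>p. u p + v p)"
  unfolding L2_Omega_def using L2_add by auto

lemma cls_sum: "finite B \<Longrightarrow> (\<And>b. b \<in> B \<Longrightarrow> L2 (f b)) \<Longrightarrow> cls (\<lambda>p. \<Sum>b\<in>B. f b p) = (\<Sum>b\<in>B. cls (f b))"
  by (induction B rule: finite_induct) (auto simp: cls_zero cls_add[symmetric] L2_sum)

text \<open>An eigenvalue is real and at least \<open>(pi / d)^2\<close>. Every point to the right
  of it then belongs to the spectrum, so it is not isolated.\<close>

theorem small_window_no_discrete_spectrum:
  assumes d: "d > 0" and \<alpha>: "\<alpha> \<notin> \<int>" and a: "a > 0" and small: "a / d < sqrt (hardy_const \<alpha>) / pi"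
  shows "disc_spectrum d \<alpha> a = {}"
proof (rule ccontr)
  assume "disc_spectrum d \<alpha> a \<noteq> {}"
  then obtain l \<epsilon> u where \<epsilon>: "\<epsilon> > 0" and iso: "\<And>\<mu>. \<mu> \<in> spectrum_H d \<alpha> a \<Longrightarrow> \<mu> \<noteq> l \<Longrightarrow> \<epsilon> \<le> cmod (\<mu> - l)"
    and H: "Hrel d \<alpha> a u (\<lambda>p. l * u p)" and nz: "\<not> (AE p in lborel. u p = 0)"
    unfolding disc_spectrum_def is_eigenvalue_def by blast
  obtain W where u: "L2 u" and W: "(cls u, W) \<in> form_dom d \<alpha> a"
    and eq: "\<And>z. z \<in> form_dom d \<alpha> a \<Longrightarrow> inner W (snd z) = inner (cls (\<lambda>p. l * u p)) (fst z)"
    using H unfolding Hrel_iff by blast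
  have n0: "(norm (cls u))\<^sup>2 > 0" using nz cls_eq_0_iff[OF u] by simp
  note lu = cls_complex_mult[OF u, of l]
  have re: "(norm W)\<^sup>2 = Re l * (norm (cls u))\<^sup>2"
    using eq[OF W] unfolding lu by (simp add: inner_add_left inner_mult_i_self power2_norm_eq_inner)
  \<comment> \<open>The weak equation tested with \<open>i u\<close>: the form of \<open>u\<close>
    against \<open>i u\<close> has no real part, and neither has the inner product of
    \<open>u\<close> with \<open>i u\<close>.\<close>
  have "0 = Im l * (norm (cls u))\<^sup>2"
    using eq[OF form_dom_mult_i[OF W]] unfolding lu
    by (simp add: inner_mult_i3_self inner_add_left inner_mult_i_self inner_mult_i power2_norm_eq_inner)
  then have im: "Im l = 0" using n0 by simp
  have "a / d * pi \<le> sqrt (hardy_const \<alpha>)" using small by (simp add: field_simps)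
  then have "(a / d * pi)\<^sup>2 \<le> (sqrt (hardy_const \<alpha>))\<^sup>2" using a d by (intro power_mono) auto
  then have "(pi / d)\<^sup>2 * a\<^sup>2 \<le> hardy_const \<alpha>" using hardy_const_pos[OF \<alpha>] by (simp add: power_mult_distrib power_divide mult_ac)
  from form_bound_small_window[OF d \<alpha> this W]
  have ge: "(pi / d)\<^sup>2 \<le> Re l" using n0 re by simp
  \<comment> \<open>Chosen so that a spectral point lies at distance \<open>\<epsilon> / 2\<close>
    to the right of the eigenvalue; the radicand is nonnegative by \<open>ge\<close>.\<close>
  define k where "k = sqrt (Re l + \<epsilon> / 2 - (pi / d)\<^sup>2)"
  have "k\<^sup>2 + (pi / d)\<^sup>2 = Re l + \<epsilon> / 2" unfolding k_def using ge \<epsilon> by simp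
  then have "complex_of_real (Re l + \<epsilon> / 2) \<in> spectrum_H d \<alpha> a" using essential_spectrum_subset[OF d a, of k \<alpha>] by simp
  moreover have diff: "complex_of_real (Re l + \<epsilon> / 2) - l = complex_of_real (\<epsilon> / 2)" using im by (simp add: complex_eq_iff)
  then have "complex_of_real (Re l + \<epsilon> / 2) \<noteq> l" using \<epsilon> by auto
  ultimately have "\<epsilon> \<le> cmod (complex_of_real (\<epsilon> / 2))" using iso[of "complex_of_real (Re l + \<epsilon> / 2)"] unfolding diff by simp
  then show False using \<epsilon> by simp
qed

text \<open>The eigenvalue, its finite multiplicity and its isolation come from the real theory of
  \<open>form_relation\<close>. What remains is translation, with a complex number
  \<open>\<mu>\<close> acting as \<open>Re \<mu>\<close> times the identity plus
  \<open>Im \<mu>\<close> times \<open>mult_i\<close>.\<close>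

theorem large_window_discrete_spectrum:
  assumes d: "d > 0" and \<alpha>: "\<alpha> \<notin> \<int>" and a: "a > 0" and big: "a / d > 500"
  shows "disc_spectrum d \<alpha> a \<noteq> {}"
proof -
  obtain I :: "((nat \<times> nat \<times> nat) \<times> bool) set" and b K where sb: "finite I" "K \<ge> 0"
    "\<And>z. z \<in> form_dom d \<alpha> a \<Longrightarrow> (pi / d)\<^sup>2 * (norm (fst z))\<^sup>2 \<le> (norm (snd z))\<^sup>2 + K * (\<Sum>i\<in>I. (inner (fst z) (b i))\<^sup>2)"
    by (rule semibound[OF d a \<alpha>]) (rule that)
  interpret F: form_relation "form_dom d \<alpha> a" mult_i mult_i3 "(pi / d)\<^sup>2" K I b
  proof
    show "(pi / d)\<^sup>2 * (norm u)\<^sup>2 \<le> (norm w)\<^sup>2 + K * (\<Sum>i\<in>I. (inner u (b i))\<^sup>2)" if "(u, w) \<in> form_dom d \<alpha> a" for u w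
      using sb(3)[OF that] by simp
    show "\<exists>u w. (u, w) \<in> form_dom d \<alpha> a \<and> (norm w)\<^sup>2 < (pi / d)\<^sup>2 * (norm u)\<^sup>2"
      by (rule large_window_below_threshold[OF d a big])
    show "mult_i (x + y) = mult_i x + mult_i y" "mult_i (r *\<^sub>R x) = r *\<^sub>R mult_i x" for x y r
      by (simp_all add: linear_add[OF linear_mult_i] linear_scale[OF linear_mult_i])
  qed (use sb closed_form_dom subspace_form_dom linear_mult_i mult_i_mult_i inner_mult_i norm_mult_i3 form_dom_mult_i in auto)
  define L where "L = complex_of_real F.lam"
  have cL: "cls (\<lambda>p. L * u p) = F.lam *\<^sub>R cls u" if "L2 u" for u
    using cls_complex_mult[OF that, of L] by (simp add: L_def)
  obtain z where z: "z \<in> form_dom d \<alpha> a" "fst z \<noteq> 0" "\<And>v. v \<in> form_dom d \<alpha> a \<Longrightarrow> inner (snd z) (snd v) = F.lam * inner (fst z) (fst v)"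
    using F.lowest_eigenvalue(1) by blast
  define u where "u = rp (fst z)"
  have u: "L2 u" "cls u = fst z" unfolding u_def by simp_all
  have H: "Hrel d \<alpha> a u (\<lambda>p. L * u p)"
    unfolding Hrel_iff
  proof (intro conjI exI[of _ "snd z"])
    show "L2_Omega d (\<lambda>p. L * u p)" unfolding u_def by (intro L2_Omega_cmult form_dom_Omega[OF z(1)])
    show "(cls u, snd z) \<in> form_dom d \<alpha> a" using z(1) u by simp
    show "\<forall>v\<in>form_dom d \<alpha> a. inner (snd z) (snd v) = inner (cls (\<lambda>p. L * u p)) (fst v)"
      using z(3) by (simp add: cL[OF u(1)] u(2))
  qed (rule u(1))
  have eig: "is_eigenvalue d \<alpha> a L"
    unfolding is_eigenvalue_def using H cls_eq_0_iff[OF u(1)] u(2) z(2) by (intro exI[of _ u] conjI) auto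
  \<comment> \<open>For an eigenfunction the residual is zero, so a resolvent bound would make its
    norm zero.\<close>
  have spec: "L \<in> spectrum_H d \<alpha> a"
  proof (rule ccontr)
    assume "L \<notin> spectrum_H d \<alpha> a"
    then obtain C where "\<And>u h. Hrel d \<alpha> a u h \<Longrightarrow> L2norm u \<le> C * L2norm (\<lambda>p. h p - L * u p)"
      unfolding spectrum_H_def resolvent_set_def by auto
    from this[OF H] have "L2norm u \<le> 0" by (simp add: L2norm_def)
    then show False using z(2) u by (simp add: L2norm_cls)
  qed
  have fin: "finite_mult d \<alpha> a L"
  proof -
    obtain B where B: "finite B"
      and span: "\<And>z. z \<in> form_dom d \<alpha> a \<Longrightarrow> (\<And>v. v \<in> form_dom d \<alpha> a \<Longrightarrow> inner (snd z) (snd v) = F.lam * inner (fst z) (fst v)) \<Longrightarrow> fst z \<in> span B"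
      using F.lowest_eigenvalue(2) by blast
    \<comment> \<open>\<open>finite_mult\<close> asks for functions, so the spanning classes are
      replaced by representatives. Distinct classes have distinct representatives, which allows the
      coefficients to be indexed by functions.\<close>
    have inj: "inj_on rp B" by (rule inj_on_inverseI[of _ cls]) simp
    show ?thesis unfolding finite_mult_def
    proof (intro exI[of _ "rp ` B"] conjI allI impI)
      show "finite (rp ` B)" "\<forall>b\<in>rp ` B. L2 b" using B by auto
      fix v assume "Hrel d \<alpha> a v (\<lambda>p. L * v p)"
      then obtain W where v: "L2 v" and W: "(cls v, W) \<in> form_dom d \<alpha> a"
        and eq: "\<And>z. z \<in> form_dom d \<alpha> a \<Longrightarrow> inner W (snd z) = inner (cls (\<lambda>p. L * v p)) (fst z)"
        unfolding Hrel_iff by blast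
      have "cls v \<in> span B" using span[OF W] eq by (simp add: cL[OF v])
      then obtain c where c: "cls v = (\<Sum>b\<in>B. c b *\<^sub>R b)" unfolding span_finite[OF B] by auto
      have "c b *\<^sub>R b = cls (\<lambda>p. complex_of_real (c b) * rp b p)" for b
        using cls_scaleR[of "rp b" "c b"] by simp
      then have "cls v = cls (\<lambda>p. \<Sum>b\<in>B. complex_of_real (c b) * rp b p)"
        unfolding c by (subst cls_sum[OF B]) (auto intro: L2_cmult)
      then have "AE p in lborel. v p = (\<Sum>b\<in>B. complex_of_real (c b) * rp b p)"
        by (subst (asm) cls_eq_iff[OF v L2_sum[OF B]]) (auto intro: L2_cmult)
      moreover have "(\<Sum>b\<in>B. complex_of_real (c b) * rp b p) = (\<Sum>f\<in>rp ` B. complex_of_real (c (cls f)) * f p)" for p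
        by (simp add: sum.reindex[OF inj])
      ultimately show "\<exists>c. AE p in lborel. v p = (\<Sum>f\<in>rp ` B. c f * f p)"
        by (intro exI[of _ "\<lambda>f. complex_of_real (c (cls f))"]) simp
    qed
  qed
  obtain \<epsilon> where \<epsilon>: "\<epsilon> > 0" and res: "\<And>s \<tau>. (s, \<tau>) \<noteq> (F.lam, 0) \<Longrightarrow> (s - F.lam)\<^sup>2 + \<tau>\<^sup>2 < \<epsilon>\<^sup>2 \<Longrightarrow>
     (\<forall>f. \<exists>z\<in>form_dom d \<alpha> a. \<forall>v\<in>form_dom d \<alpha> a. inner (snd z) (snd v) = inner (f + (s *\<^sub>R fst z + \<tau> *\<^sub>R mult_i (fst z))) (fst v)) \<and>
     (\<exists>C. \<forall>z\<in>form_dom d \<alpha> a. \<forall>h. (\<forall>v\<in>form_dom d \<alpha> a. inner (snd z) (snd v) = inner h (fst v)) \<longrightarrow>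
        norm (fst z) \<le> C * norm (h - (s *\<^sub>R fst z + \<tau> *\<^sub>R mult_i (fst z))))"
    using F.isolated by blast
  have iso: "\<epsilon> \<le> cmod (\<mu> - L)" if \<mu>: "\<mu> \<in> spectrum_H d \<alpha> a" "\<mu> \<noteq> L" for \<mu>
  proof (rule ccontr)
    assume "\<not> \<epsilon> \<le> cmod (\<mu> - L)"
    then have "(cmod (\<mu> - L))\<^sup>2 < \<epsilon>\<^sup>2" by (intro power_strict_mono) auto
    then have close: "(Re \<mu> - F.lam)\<^sup>2 + (Im \<mu>)\<^sup>2 < \<epsilon>\<^sup>2" by (simp add: cmod_power2 L_def)
    have ne: "(Re \<mu>, Im \<mu>) \<noteq> (F.lam, 0)" using \<mu>(2) by (auto simp: L_def complex_eq_iff)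
    have surj: "\<And>f. \<exists>z\<in>form_dom d \<alpha> a. \<forall>v\<in>form_dom d \<alpha> a. inner (snd z) (snd v) = inner (f + (Re \<mu> *\<^sub>R fst z + Im \<mu> *\<^sub>R mult_i (fst z))) (fst v)"
      using res[OF ne close] by blast
    obtain C where C: "\<And>z h. z \<in> form_dom d \<alpha> a \<Longrightarrow> (\<forall>v\<in>form_dom d \<alpha> a. inner (snd z) (snd v) = inner h (fst v)) \<Longrightarrow>
        norm (fst z) \<le> C * norm (h - (Re \<mu> *\<^sub>R fst z + Im \<mu> *\<^sub>R mult_i (fst z)))"
      using res[OF ne close] by blast
    have "\<mu> \<in> resolvent_set d \<alpha> a"
      unfolding resolvent_set_def
    proof (intro CollectI conjI allI impI exI[of _ C])
      fix f assume f: "L2_Omega d f"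
      then have fL: "L2 f" unfolding L2_Omega_def by simp
      obtain z where z: "z \<in> form_dom d \<alpha> a"
        and eq: "\<forall>v\<in>form_dom d \<alpha> a. inner (snd z) (snd v) = inner (cls f + (Re \<mu> *\<^sub>R fst z + Im \<mu> *\<^sub>R mult_i (fst z))) (fst v)"
        using surj by blast
      have "cls (\<lambda>p. f p + \<mu> * rp (fst z) p) = cls f + (Re \<mu> *\<^sub>R fst z + Im \<mu> *\<^sub>R mult_i (fst z))"
        using cls_complex_mult[of "rp (fst z)" \<mu>] by (simp add: cls_add[symmetric] fL L2_cmult)
      then have "Hrel d \<alpha> a (rp (fst z)) (\<lambda>p. f p + \<mu> * rp (fst z) p)"
        unfolding Hrel_iff using z eq by (auto intro!: exI[of _ "snd z"] L2_Omega_add[OF f] L2_Omega_cmult form_dom_Omega)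
      then show "\<exists>u. Hrel d \<alpha> a u (\<lambda>p. f p + \<mu> * u p)" by blast
    next
      fix v h assume "Hrel d \<alpha> a v h"
      then obtain W where v: "L2 v" and h: "L2_Omega d h" and W: "(cls v, W) \<in> form_dom d \<alpha> a"
        and eq: "\<forall>z\<in>form_dom d \<alpha> a. inner W (snd z) = inner (cls h) (fst z)"
        unfolding Hrel_iff by blast
      have hL: "L2 h" using h unfolding L2_Omega_def by simp
      have "cls (\<lambda>p. h p - \<mu> * v p) = cls h - (Re \<mu> *\<^sub>R cls v + Im \<mu> *\<^sub>R mult_i (cls v))"
        using cls_complex_mult[OF v, of \<mu>] by (simp add: cls_diff[symmetric] hL L2_cmult v)
      then show "L2norm v \<le> C * L2norm (\<lambda>p. h p - \<mu> * v p)"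
        using C[OF W, of "cls h"] eq by (simp add: L2norm_cls v L2_diff hL L2_cmult)
    qed
    then show False using \<mu>(1) unfolding spectrum_H_def by simp
  qed
  have "L \<in> disc_spectrum d \<alpha> a"
    unfolding disc_spectrum_def using spec eig fin iso \<epsilon> by blast
  then show ?thesis by blast
qed

theorem theorem3p1:
  fixes d \<alpha> :: real
  assumes "d > 0" and "\<alpha> \<notin> \<int>"
  shows "(\<exists>a0>0. \<forall>a>0. a / d < a0 \<longrightarrow> disc_spectrum d \<alpha> a = {}) \<and>
         (\<exists>a1>0. \<forall>a>0. a / d > a1 \<longrightarrow> disc_spectrum d \<alpha> a \<noteq> {})"
proof
  have "sqrt (hardy_const \<alpha>) / pi > 0" using hardy_const_pos[OF assms(2)] by simp
  then show "\<exists>a0>0. \<forall>a>0. a / d < a0 \<longrightarrow> disc_spectrum d \<alpha> a = {}"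
    using small_window_no_discrete_spectrum[OF assms] by blast
  show "\<exists>a1>0. \<forall>a>0. a / d > a1 \<longrightarrow> disc_spectrum d \<alpha> a \<noteq> {}"
    using large_window_discrete_spectrum[OF assms] by (intro exI[of _ 500]) auto
qed

end
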